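(* Suppose Assumptions 1 and 2 hold (and, for Algorithm 1, also Assumption 3), let $\alpha>1$ be a constant with $\Phi(c_2)\le\alpha$, where $\Phi(x)=(1+x)/(1-x)$, and let $w_\star$ be the unique minimizer of $P$. Assume that during the iterations $\widetilde\eta\in\{\eta_1,\eta_2\}$, and that $b,\gamma$ are chosen so that $$\left(2+4\eta_2^2\right)\frac{n-b}{b(n-1)}L^2\gamma^2m-\Big(\frac{2}{\eta_2}-L\gamma-3\Big)\leq 0 .$$ Set $$\xi=\frac{(2+4\eta_2^2)\alpha\hat{\beta}^2}{(m+1)\eta_1^2(1-\hat{\beta})^2(1+\hat{\beta})},\qquad C=\left(\frac{1-\hat{\beta}}{\alpha}\tau+\frac{(1-\hat{\beta})^2(1+\hat{\beta})}{2\alpha\hat{\beta}^2}\right)\sigma^2,$$ assume $\xi<1$, and define $$\delta_k=\frac{(1-\hat{\beta})^2(1+\hat{\beta})}{\gamma\alpha(1+2\eta_2^2)\hat{\beta}^2}\,\mathbb{E}\left[P(\widetilde{w}_k)-P(w_{\star})\right],\quad k=0,1,\dots,s-1,\qquad \delta=\max_{0\le k\le s-1}\delta_k .$$ (i) For Algorithm 1, with $\Delta=\frac{\xi(\delta+C)}{1-\xi}$, $$\mathbb{E}\left[\|\mathcal{G}_{\eta}(\widetilde{w}_s)\|^2\right]-\Delta\leq\xi^s\left(\|\nabla f(\widetilde{w}_0)\|^2-\Delta\right),$$ so that $\{\mathbb{E}[\|\mathcal{G}_{\eta}(\widetilde{w}_s)\|^2]\}$ converges linearly with rate $\xi$ to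 a $\Delta$-ball around zero. (ii) For Algorithm 2, with $\bar\Delta=\frac{\xi\delta}{1-\xi}$, $$\mathbb{E}\left[\|\mathcal{G}_{\eta}(\widetilde{w}_s)\|^2\right]-\bar\Delta\leq\xi^s\left(\|\nabla f(\widetilde{w}_0)\|^2-\bar\Delta\right),$$ so that $\{\mathbb{E}[\|\mathcal{G}_{\eta}(\widetilde{w}_s)\|^2]\}$ converges linearly with rate $\xi$ to a $\bar\Delta$-ball around zero.
   Context: Problem: minimize $P(w)=f(w)+\varphi(w)$ over $w\in\mathbb{R}^d$, where $f=\frac1n\sum_{i=1}^n f_i$ with smooth $f_i:\mathbb{R}^d\to\mathbb{R}$ (possibly nonconvex), and $\varphi:\mathbb{R}^d\to\mathbb{R}\cup\{+\infty\}$ is proper, closed and convex. $P$ is bounded from below and $\operatorname{dom}(f)\cap\operatorname{dom}(\varphi)\ne\emptyset$. $\operatorname{prox}_{\eta\varphi}(x)=\arg\min_u\{\varphi(u)+\frac1{2\eta}\|u-x\|^2\}$. Gradient mapping: $\mathcal{G}_\eta(w)=\frac1\eta\big(w-\operatorname{prox}_{\eta\varphi}(w-\eta\nabla f(w))\big)$; $\mathcal{G}_\eta(w_k^{(s)})$ is evaluated with $\eta$ the step size of iteration $k$ of epoch $s$. For $\mathcal{B}\subset\{1,\dots,n\}$ with $|\mathcal{B}|=b$: $f_{\mathcal{B}}=\frac1b\sum_{i\in\mathcal{B}}f_i$. Algorithm 1. Inputs: $\widetilde w_0\in\mathbb{R}^d$, epoch length $m$, batch size $b$, $\gamma\in(0,1]$,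 thresholds $\eta_2>0,\beta_o>0,\rho>0$, line-search constants $0<c_1<c_2<1$. Put $h^{(0)}=\nabla f(\widetilde w_0)$. For epochs $s=1,\dots,S$: set $w_0^{(s)}=\widetilde w_{s-1}$, $v_0^{(s)}=\nabla f(w_0^{(s)})$, $d_0^{(s)}=-h^{(s-1)}$. For $k=1,2,\dots$: pick $\mathcal{B}_k\subset\{1,\dots,n\}$ of size $b$ uniformly at random, and set $v_k^{(s)}=\nabla f_{\mathcal{B}_k}(w_k^{(s)})-\nabla f_{\mathcal{B}_k}(w_{k-1}^{(s)})+v_{k-1}^{(s)}$ and $d_k^{(s)}=-v_k^{(s)}+\beta_kd_{k-1}^{(s)}$. For $k\ge0$: a line search finds $\widetilde\eta$ with $f_{\mathcal{B}_k}(w_k^{(s)}+\widetilde\eta d_k^{(s)})\le f_{\mathcal{B}_k}(w_k^{(s)})+c_1\widetilde\eta\langle\nabla f_{\mathcal{B}_k}(w_k^{(s)}),d_k^{(s)}\rangle$ and $|\langle v_{k+1}^{(s)},d_k^{(s)}\rangle|\le-c_2\langle v_k^{(s)},d_k^{(s)}\rangle$; then $\eta=\min\{\widetilde\eta,\eta_2\}$, $y_k^{(s)}=\operatorname{prox}_{\eta\varphi}(w_k^{(s)}+\eta d_k^{(s)})$, $w_{k+1}^{(s)}=(1-\gamma)w_k^{(s)}+\gamma y_k^{(s)}$. The epoch ends with $\widetilde w_s=w_m^{(s)}$ and $h^{(s)}=v_m^{(s)}$ (quantities with index $m$ or $m+1$ are given by the same recursions). Algorithm 2 (deterministic restart) is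 identical except that $d_0^{(s)}=-v_0^{(s)}=-\nabla f(w_0^{(s)})$ in every epoch $s\ge1$. Conjugate parameter: let $\beta_k^{FR}=\|v_k^{(s)}\|^2/\|v_{k-1}^{(s)}\|^2$ and $\beta_k^{PR}=\langle v_k^{(s)},v_k^{(s)}-v_{k-1}^{(s)}\rangle/\|v_{k-1}^{(s)}\|^2$. Then $\beta_k$ is either $\min\{\beta_o,\rho\beta_k^{FR}\}$ or $\beta_k^{PR}$ truncated to $[-\beta_k^{FR},\beta_k^{FR}]$; the analysis is for any $\beta_k$ with $|\beta_k|\le\beta_k^{FR}$. Assumption 1: there is $L>0$ with $\frac1n\sum_{i=1}^n\|\nabla f_i(w)-\nabla f_i(w')\|^2\le L^2\|w-w'\|^2$ for all $w,w'\in\operatorname{dom}(f)$. Assumption 2: there is $\hat\beta<1$ with $\|v_{k+1}^{(s)}\|^2/\|v_k^{(s)}\|^2\le\hat\beta$ for all $k,s\ge0$. Assumption 3 (needed only for Algorithm 1): there is $\sigma>0$ with $\mathbb{E}[\|v_k^{(s)}-\nabla f(w_k^{(s)})\|^2]\le\sigma^2$ for all $k,s\ge0$. Constants: $0<\eta_1\le\eta_2$; $\tau>0$ is a constant with $\mathbb{E}\big[\big|\|v_k^{(s)}\|^2-\|\nabla f(w_k^{(s)})\|^2\big|\big]\le\tau\sigma^2$ for all $s,k\ge0$. *)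

theory Defs
  imports "HOL-Probability.Probability"
begin

definition gradient :: "('a::real_inner \<Rightarrow> real) \<Rightarrow> 'a \<Rightarrow> 'a" where
  "gradient h x = (THE D. GDERIV h x :> D)"

text \<open>The component functions \<open>f 1, \<dots>, f n\<close> are averaged over an index set: a minibatch, or
  \<open>{1..n}\<close> for the full smooth part.\<close>

definition avg_fun :: "(nat \<Rightarrow> 'a \<Rightarrow> real) \<Rightarrow> nat set \<Rightarrow> 'a \<Rightarrow> real" where
  "avg_fun f B w = (\<Sum>i\<in>B. f i w) / real (card B)"

definition objective :: "nat \<Rightarrow> (nat \<Rightarrow> 'a \<Rightarrow> real) \<Rightarrow> ('a \<Rightarrow> ereal) \<Rightarrow> 'a \<Rightarrow> ereal" where
  "objective n f \<phi> w = ereal (avg_fun f {1..n} w) + \<phi> w"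

definition proper_fun :: "('a \<Rightarrow> ereal) \<Rightarrow> bool" where
  "proper_fun \<phi> \<longleftrightarrow> (\<forall>x. \<phi> x \<noteq> -\<infinity>) \<and> (\<exists>x. \<phi> x \<noteq> \<infinity>)"

definition ereal_epigraph :: "('a \<Rightarrow> ereal) \<Rightarrow> ('a \<times> real) set" where
  "ereal_epigraph \<phi> = {(x, t). \<phi> x \<le> ereal t}"

definition prox :: "real \<Rightarrow> ('a::real_inner \<Rightarrow> ereal) \<Rightarrow> 'a \<Rightarrow> 'a" where
  "prox \<eta> \<phi> x = arg_min (\<lambda>u. \<phi> u + ereal ((norm (u - x))\<^sup>2 / (2 * \<eta>))) (\<lambda>_. True)"

definition gradient_mapping ::
  "nat \<Rightarrow> (nat \<Rightarrow> 'a::real_inner \<Rightarrow> real) \<Rightarrow> ('a \<Rightarrow> ereal) \<Rightarrow> real \<Rightarrow> 'a \<Rightarrow> 'a" where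
  "gradient_mapping n f \<phi> \<eta> w =
     (1 / \<eta>) *\<^sub>R (w - prox \<eta> \<phi> (w - \<eta> *\<^sub>R gradient (avg_fun f {1..n}) w))"

definition minibatches :: "nat \<Rightarrow> nat \<Rightarrow> nat set set" where
  "minibatches n b = {B. B \<subseteq> {1..n} \<and> card B = b}"

text \<open>Processes are indexed by the epoch \<open>s\<close>, the inner iteration \<open>k\<close> and the outcome \<open>\<omega>\<close>.
  \<open>outer_iterate\<close> is \<open>w~\<^sub>s\<close> and \<open>last_estimator\<close> is \<open>h\<^sup>(\<^sup>s\<^sup>)\<close>.\<close>

definition outer_iterate ::
  "'a \<Rightarrow> nat \<Rightarrow> (nat \<Rightarrow> nat \<Rightarrow> 'w \<Rightarrow> 'a) \<Rightarrow> nat \<Rightarrow> 'w \<Rightarrow> 'a" where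
  "outer_iterate w0 m w s \<omega> = (if s = 0 then w0 else w s m \<omega>)"

definition last_estimator ::
  "nat \<Rightarrow> (nat \<Rightarrow> 'a::real_inner \<Rightarrow> real) \<Rightarrow> 'a \<Rightarrow> nat \<Rightarrow> (nat \<Rightarrow> nat \<Rightarrow> 'w \<Rightarrow> 'a) \<Rightarrow> nat \<Rightarrow> 'w \<Rightarrow> 'a" where
  "last_estimator n f w0 m v s \<omega> = (if s = 0 then gradient (avg_fun f {1..n}) w0 else v s m \<omega>)"

text \<open>The steps common to both algorithms, i.e. everything except the choice of \<open>d s 0\<close>.

  The \<open>\<sigma>\<close>-algebra \<open>F s k\<close> is the information available at the end of iteration \<open>k\<close> of epoch
  \<open>s\<close>; it determines the batch \<open>B s k\<close>, the conjugate parameter \<open>\<beta> s k\<close> and the line-search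
  output \<open>\<theta> s k\<close>, hence also \<open>w s (Suc k)\<close>. The batch of iteration \<open>Suc k\<close> is picked uniformly
  conditionally on \<open>F s k\<close>, that is, after \<open>w s (Suc k)\<close> has been computed.

  No batch is drawn at \<open>k = 0\<close>, yet the decrease condition of the line search refers to
  one; \<open>B s 0\<close> is left as an arbitrary nonempty index set, which covers both the full index
  set (matching \<open>v s 0 = \<nabla>f\<close>) and a minibatch.

  The conjugate parameter is only required to satisfy \<open>\<bar>\<beta>\<bar> \<le> \<beta>\<^sup>F\<^sup>R\<close>, so the Fletcher--Reeves type and the
  truncated Polak--Ribiere choices are both instances.

  The estimator runs up to index \<open>m + 1\<close>, since the curvature condition at iteration \<open>m\<close>,
  which determines the step size at the last iterate \<open>w s m\<close>, refers to \<open>v s (m + 1)\<close>.\<close>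

locale prox_cg = prob_space M
  for M :: "'w measure" +
  fixes F :: "nat \<Rightarrow> nat \<Rightarrow> 'w measure"
    and n :: nat and f :: "nat \<Rightarrow> 'a::euclidean_space \<Rightarrow> real" and \<phi> :: "'a \<Rightarrow> ereal"
    and w0 :: 'a and m b S :: nat and \<gamma> \<eta>2 c1 c2 :: real
    and B :: "nat \<Rightarrow> nat \<Rightarrow> 'w \<Rightarrow> nat set"
    and \<theta> \<beta> :: "nat \<Rightarrow> nat \<Rightarrow> 'w \<Rightarrow> real"
    and w v d :: "nat \<Rightarrow> nat \<Rightarrow> 'w \<Rightarrow> 'a"
  assumes F_subalgebra: "\<lbrakk>s \<in> {1..S}; k \<le> Suc m\<rbrakk> \<Longrightarrow> subalgebra M (F s k)"
    and F_Suc: "\<lbrakk>s \<in> {1..S}; k \<le> m\<rbrakk> \<Longrightarrow> subalgebra (F s (Suc k)) (F s k)"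
    and F_next_epoch: "\<lbrakk>1 \<le> s; s < S\<rbrakk> \<Longrightarrow> subalgebra (F (Suc s) 0) (F s (Suc m))"
    and batch_measurable:
      "\<lbrakk>s \<in> {1..S}; k \<le> Suc m\<rbrakk> \<Longrightarrow> B s k \<in> measurable (F s k) (count_space UNIV)"
    and batch_0: "\<lbrakk>s \<in> {1..S}; \<omega> \<in> space M\<rbrakk> \<Longrightarrow> B s 0 \<omega> \<subseteq> {1..n} \<and> B s 0 \<omega> \<noteq> {}"
    and batch_size:
      "\<lbrakk>s \<in> {1..S}; k \<le> m; \<omega> \<in> space M\<rbrakk> \<Longrightarrow> B s (Suc k) \<omega> \<in> minibatches n b"
    and batch_uniform:
      "\<lbrakk>s \<in> {1..S}; k \<le> m; A \<in> sets (F s k); X \<in> minibatches n b\<rbrakk> \<Longrightarrow>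
         prob (A \<inter> {\<omega> \<in> space M. B s (Suc k) \<omega> = X}) = prob A / real (card (minibatches n b))"
    and step_measurable: "\<lbrakk>s \<in> {1..S}; k \<le> m\<rbrakk> \<Longrightarrow> \<theta> s k \<in> borel_measurable (F s k)"
    and beta_measurable: "\<lbrakk>s \<in> {1..S}; k \<in> {1..m}\<rbrakk> \<Longrightarrow> \<beta> s k \<in> borel_measurable (F s k)"
    and w_0: "\<lbrakk>s \<in> {1..S}; \<omega> \<in> space M\<rbrakk> \<Longrightarrow> w s 0 \<omega> = outer_iterate w0 m w (s - 1) \<omega>"
    and v_0: "\<lbrakk>s \<in> {1..S}; \<omega> \<in> space M\<rbrakk> \<Longrightarrow> v s 0 \<omega> = gradient (avg_fun f {1..n}) (w s 0 \<omega>)"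
    and v_Suc:
      "\<lbrakk>s \<in> {1..S}; k \<le> m; \<omega> \<in> space M\<rbrakk> \<Longrightarrow>
         v s (Suc k) \<omega> = gradient (avg_fun f (B s (Suc k) \<omega>)) (w s (Suc k) \<omega>)
           - gradient (avg_fun f (B s (Suc k) \<omega>)) (w s k \<omega>) + v s k \<omega>"
    and beta_bound:
      "\<lbrakk>s \<in> {1..S}; k < m; \<omega> \<in> space M\<rbrakk> \<Longrightarrow>
         \<bar>\<beta> s (Suc k) \<omega>\<bar> \<le> (norm (v s (Suc k) \<omega>))\<^sup>2 / (norm (v s k \<omega>))\<^sup>2"
    and d_Suc:
      "\<lbrakk>s \<in> {1..S}; k < m; \<omega> \<in> space M\<rbrakk> \<Longrightarrow>
         d s (Suc k) \<omega> = - v s (Suc k) \<omega> + \<beta> s (Suc k) \<omega> *\<^sub>R d s k \<omega>"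
    and line_search_decrease:
      "\<lbrakk>s \<in> {1..S}; k \<le> m; \<omega> \<in> space M\<rbrakk> \<Longrightarrow>
         avg_fun f (B s k \<omega>) (w s k \<omega> + \<theta> s k \<omega> *\<^sub>R d s k \<omega>)
           \<le> avg_fun f (B s k \<omega>) (w s k \<omega>)
             + c1 * \<theta> s k \<omega> * (gradient (avg_fun f (B s k \<omega>)) (w s k \<omega>) \<bullet> d s k \<omega>)"
    and line_search_curvature:
      "\<lbrakk>s \<in> {1..S}; k \<le> m; \<omega> \<in> space M\<rbrakk> \<Longrightarrow>
         \<bar>v s (Suc k) \<omega> \<bullet> d s k \<omega>\<bar> \<le> - c2 * (v s k \<omega> \<bullet> d s k \<omega>)"
    and w_Suc:
      "\<lbrakk>s \<in> {1..S}; k \<le> m; \<omega> \<in> space M\<rbrakk> \<Longrightarrow>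
         w s (Suc k) \<omega> = (1 - \<gamma>) *\<^sub>R w s k \<omega>
           + \<gamma> *\<^sub>R prox (min (\<theta> s k \<omega>) \<eta>2) \<phi> (w s k \<omega> + min (\<theta> s k \<omega>) \<eta>2 *\<^sub>R d s k \<omega>)"

locale prox_cg_algorithm1 = prox_cg +
  assumes d_0: "\<lbrakk>s \<in> {1..S}; \<omega> \<in> space M\<rbrakk> \<Longrightarrow> d s 0 \<omega> = - last_estimator n f w0 m v (s - 1) \<omega>"

locale prox_cg_algorithm2 = prox_cg +
  assumes d_0: "\<lbrakk>s \<in> {1..S}; \<omega> \<in> space M\<rbrakk> \<Longrightarrow> d s 0 \<omega> = - v s 0 \<omega>"

text \<open>The expected optimality gap \<open>E[P(w~\<^sub>k) - P(w\<^sub>\<star>)]\<close>. The integrand is nonnegative because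
  \<open>w\<^sub>\<star>\<close> minimizes \<open>P\<close>, and the value is \<open>\<infinity>\<close> if \<open>w~\<^sub>k\<close> leaves the domain of \<open>\<phi>\<close> with
  positive probability.\<close>

definition expected_gap ::
  "'w measure \<Rightarrow> ('a \<Rightarrow> ereal) \<Rightarrow> ('w \<Rightarrow> 'a) \<Rightarrow> 'a \<Rightarrow> ereal" where
  "expected_gap M P W wopt = enn2ereal (\<integral>\<^sup>+ \<omega>. e2ennreal (P (W \<omega>) - P wopt) \<partial>M)"

end

theory Submission
  imports Defs
begin

text \<open>
  The proof separates what holds along a single sample path of one epoch from what holds only in
  expectation.

  Fix an outcome and an epoch. Write \<open>Q k = \<parallel>w k - y k\<parallel>\<^sup>2\<close> for the squared proximal steps,
  \<open>e k\<close> for the error \<open>v k - \<nabla>f(w k)\<close> of the estimator and \<open>a = 2/\<eta>2 - L\<gamma> - 3\<close>, which the condition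
  on the batch size makes nonnegative. The descent lemma and convexity bound \<open>2/\<gamma>\<close> times the
  decrease of \<open>P\<close> in iteration \<open>k\<close> from below by a quantity \<open>R k\<close>. Telescoping, together with one
  further, fictitious proximal gradient step at \<open>w m\<close>, gives
  \<open>(\<Sum>k<m. R k) + 3 (\<eta>1 \<parallel>G\<parallel>)\<^sup>2 \<le> (2/\<gamma>) (P(w 0) - P(w\<^sub>\<star>))\<close> for the gradient mapping \<open>G\<close> at \<open>w m\<close>
  (\<open>total_descent\<close>).

  The theorem needs \<open>m + 1\<close> copies of \<open>(\<eta>1 \<parallel>G\<parallel>)\<^sup>2\<close> at the \<^emph>\<open>last\<close> iterate, although descent methods
  usually control only an average over the iterates. The missing \<open>m - 2\<close> copies come from the
  Moreau envelope. Let \<open>Z k\<close> be \<open>2 \<eta>1\<close> times the difference of \<open>\<phi>\<close> and its envelope with parameter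
  \<open>\<eta>2\<close>, at \<open>w k\<close>. Three facts carry the argument: \<open>\<eta>1 \<parallel>G\<parallel> \<le> \<surd>(Z m) + \<eta>1 \<parallel>\<nabla>f(w m)\<parallel>\<close>
  (\<open>mapping_le_envelope\<close>); each \<open>R k\<close> contains a multiple of \<open>Z k\<close> (\<open>R_late\<close>); and \<open>Z\<close> can grow in
  one iteration by at most \<open>\<eta>2\<^sup>2/2 \<parallel>d k\<parallel>\<^sup>2\<close> (\<open>Z_step\<close>). A nearly nonincreasing sequence has its last
  term below its average up to the accumulated growth, so that the sum of the \<open>R k\<close> pays for the
  copies of \<open>Z m\<close>.

  The price consists of squares of \<open>v k\<close>, \<open>d k\<close> and of the momentum terms \<open>\<beta> k *\<^sub>R d (k - 1)\<close>. The
  bound on \<open>\<beta>\<close>, the contraction \<open>\<parallel>v (k + 1)\<parallel>\<^sup>2 \<le> x \<parallel>v k\<parallel>\<^sup>2\<close> and the curvature condition of the line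
  search make them decay geometrically, so that they sum to multiples of \<open>\<parallel>v 0\<parallel>\<^sup>2\<close> and of the
  excess of \<open>\<parallel>d 0\<parallel>\<^sup>2\<close> over \<open>\<parallel>v 0\<parallel>\<^sup>2\<close>. The resulting constants are those of the theorem. Two choices of
  weights are needed, for \<open>x \<le> 2/3\<close> and for \<open>x > 2/3\<close>; in the second range \<open>\<xi> < 1\<close> forces the epoch to
  be long, and the first iterations are then not used for \<open>Z\<close> at all
  (\<open>mapping_bound_small_ratio\<close>, \<open>mapping_bound_large_ratio\<close>). The same bound holds for \<open>\<nabla>f(w m)\<close> in
  place of \<open>G\<close>.

  In expectation, sampling without replacement yields
  \<open>E \<parallel>e (k + 1)\<parallel>\<^sup>2 \<le> E \<parallel>e k\<parallel>\<^sup>2 + (n - b)/(b (n - 1)) L\<^sup>2 \<gamma>\<^sup>2 E (Q k)\<close>. Since \<open>e 0 = 0\<close>, the condition on the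
  batch size says that all error terms together cost at most the \<open>a (\<Sum>k<m. E (Q k))\<close> which
  the descent leaves over (\<open>total_noise_le\<close>). Hence both \<open>E \<parallel>G\<parallel>\<^sup>2\<close> and \<open>E \<parallel>\<nabla>f(w m)\<parallel>\<^sup>2\<close> are at most
  \<open>\<xi> (\<delta> + C + E \<parallel>\<nabla>f(w 0)\<parallel>\<^sup>2)\<close>. The bound on the gradient is iterated over the epochs
  \<open>1, \<dots>, s - 1\<close>, and the bound on the gradient mapping closes the last epoch. The two algorithms
  differ only in the residual \<open>v 0 + d 0\<close> and in the excess, both of which vanish for Algorithm 2 and
  are controlled by \<open>\<sigma>\<^sup>2\<close> and \<open>\<tau> \<sigma>\<^sup>2\<close> for Algorithm 1.
\<close>

section \<open>Proximal steps of a closed convex function\<close>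

locale closed_convex_fun =
  fixes \<phi> :: "'a::euclidean_space \<Rightarrow> ereal"
  assumes proper: "proper_fun \<phi>"
    and closed_epi: "closed (ereal_epigraph \<phi>)"
    and convex_epi: "convex (ereal_epigraph \<phi>)"
begin

definition dom :: "'a set" where "dom = {x. \<phi> x < \<infinity>}"

definition val :: "'a \<Rightarrow> real" where "val x = real_of_ereal (\<phi> x)"

lemma ereal_val: "x \<in> dom \<Longrightarrow> \<phi> x = ereal (val x)"
  using proper unfolding dom_def val_def proper_fun_def
  by (cases "\<phi> x") auto

lemma not_dom: "x \<notin> dom \<Longrightarrow> \<phi> x = \<infinity>"
  unfolding dom_def by (cases "\<phi> x") auto

lemma mem_epigraph: "(x, t) \<in> ereal_epigraph \<phi> \<longleftrightarrow> x \<in> dom \<and> val x \<le> t"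
proof (cases "x \<in> dom")
  case True
  then show ?thesis using ereal_val[OF True] by (auto simp: ereal_epigraph_def)
next
  case False
  then show ?thesis using not_dom[OF False] by (auto simp: ereal_epigraph_def)
qed

lemma dom_nonempty: obtains x where "x \<in> dom"
  using proper unfolding proper_fun_def dom_def by auto

lemma convex_combination:
  assumes "x \<in> dom" "y \<in> dom" "0 \<le> t" "t \<le> 1"
  shows "(1 - t) *\<^sub>R x + t *\<^sub>R y \<in> dom"
    and "val ((1 - t) *\<^sub>R x + t *\<^sub>R y) \<le> (1 - t) * val x + t * val y"
proof -
  have "(1 - t) *\<^sub>R (x, val x) + t *\<^sub>R (y, val y) \<in> ereal_epigraph \<phi>"
    using assms by (intro convexD[OF convex_epi]) (auto simp: mem_epigraph)
  then show "(1 - t) *\<^sub>R x + t *\<^sub>R y \<in> dom"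
    "val ((1 - t) *\<^sub>R x + t *\<^sub>R y) \<le> (1 - t) * val x + t * val y"
    by (auto simp: mem_epigraph)
qed

text \<open>If \<open>\<phi>\<close> were unbounded below on the compact ball, a cluster point of points with values below
  \<open>-1, -2, \<dots>\<close> would have the value \<open>-\<infinity>\<close>, because the epigraph is closed.\<close>

lemma bounded_below_on_cball: "\<exists>C. \<forall>x\<in>dom \<inter> cball x0 1. - C \<le> val x"
proof (rule ccontr)
  assume "\<not> ?thesis"
  then have "\<forall>C. \<exists>x\<in>dom \<inter> cball x0 1. val x < - C"
    by (meson not_le)
  then have "\<forall>k::nat. \<exists>x. x \<in> dom \<inter> cball x0 1 \<and> val x < - real k" by blast
  from choice[OF this] obtain z where
    z: "\<And>k::nat. z k \<in> dom \<inter> cball x0 1" "\<And>k::nat. val (z k) < - real k"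
    by blast
  obtain l r where l: "strict_mono (r :: nat \<Rightarrow> nat)" "(z \<circ> r) \<longlonglongrightarrow> l"
    using compact_cball[of x0 1] z(1) unfolding compact_def by (metis IntD2)
  have "(l, - real j) \<in> ereal_epigraph \<phi>" for j :: nat
  proof (rule Lim_in_closed_set[OF closed_epi])
    show "((\<lambda>k. ((z \<circ> r) k, - real j)) \<longlongrightarrow> (l, - real j)) sequentially"
      using l(2) by (intro tendsto_Pair tendsto_const)
    show "\<forall>\<^sub>F k in sequentially. ((z \<circ> r) k, - real j) \<in> ereal_epigraph \<phi>"
    proof (rule eventually_sequentiallyI[of j])
      fix k assume "j \<le> k"
      then have "j \<le> r k" using seq_suble[OF l(1), of k] by linarith
      then show "((z \<circ> r) k, - real j) \<in> ereal_epigraph \<phi>"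
        using z[of "r k"] by (auto simp: mem_epigraph)
    qed
  qed auto
  then have "\<And>j::nat. val l \<le> - real j" by (auto simp: mem_epigraph)
  moreover obtain j where "- val l < real j" using reals_Archimedean2 by blast
  ultimately show False by (metis less_minus_iff linorder_not_le minus_minus)
qed

text \<open>A convex function that dropped faster than linearly far from \<open>x0\<close> would, by convexity along the
  segment to \<open>x0\<close>, already be very negative on the unit ball around \<open>x0\<close>.\<close>

lemma linear_lower_bound:
  assumes "x0 \<in> dom"
  obtains C where "0 \<le> C" "\<And>x. x \<in> dom \<Longrightarrow> - C * (1 + norm (x - x0)) \<le> val x"
proof -
  obtain C where C: "\<And>x. x \<in> dom \<Longrightarrow> norm (x - x0) \<le> 1 \<Longrightarrow> - C \<le> val x"
    using bounded_below_on_cball[of x0] by (force simp: dist_norm norm_minus_commute)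
  define K where "K = \<bar>C\<bar> + \<bar>val x0\<bar>"
  show thesis
  proof (rule that[of K])
    show "0 \<le> K" by (simp add: K_def)
    fix x assume x: "x \<in> dom"
    show "- K * (1 + norm (x - x0)) \<le> val x"
    proof (cases "norm (x - x0) \<le> 1")
      case True
      then have "- C \<le> val x" using C x by auto
      moreover have "K \<le> K * (1 + norm (x - x0))" by (simp add: K_def algebra_simps)
      ultimately show ?thesis unfolding K_def by linarith
    next
      case False
      define t where "t = 1 / norm (x - x0)"
      have t: "0 < t" "t \<le> 1" "t * norm (x - x0) = 1"
        using False unfolding t_def not_le by (auto simp: divide_simps)
      have "norm (((1 - t) *\<^sub>R x0 + t *\<^sub>R x) - x0) = norm (t *\<^sub>R (x - x0))"
        by (simp add: algebra_simps)
      also have "\<dots> = 1" using t by simp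
      finally have "- C \<le> val ((1 - t) *\<^sub>R x0 + t *\<^sub>R x)"
        using C convex_combination(1)[OF assms x] t by auto
      also have "\<dots> \<le> (1 - t) * val x0 + t * val x"
        using convex_combination(2)[OF assms x] t by auto
      finally have *: "- C - (1 - t) * val x0 \<le> t * val x" by simp
      have "(1 - t) * val x0 \<le> \<bar>val x0\<bar>"
        using mult_left_mono[of "val x0" "\<bar>val x0\<bar>" "1 - t"] mult_right_mono[of "1 - t" 1 "\<bar>val x0\<bar>"] t
        by linarith
      then have "- K \<le> t * val x" using * unfolding K_def by linarith
      then have "- K * norm (x - x0) \<le> t * val x * norm (x - x0)"
        by (intro mult_right_mono) auto
      also have "\<dots> = val x" using t(3) by (simp add: mult.commute mult.left_commute)
      finally show ?thesis unfolding K_def by (simp add: algebra_simps)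
    qed
  qed
qed

text \<open>By the linear lower bound the quadratic term dominates at infinity, so minimizing sequences are
  bounded; closedness of the epigraph gives the minimizer.\<close>

lemma prox_minimizer_exists:
  assumes "0 < \<eta>"
  obtains y where "y \<in> dom"
    "\<And>u. u \<in> dom \<Longrightarrow> val y + (norm (y - x))\<^sup>2 / (2 * \<eta>) \<le> val u + (norm (u - x))\<^sup>2 / (2 * \<eta>)"
proof -
  obtain x0 where x0: "x0 \<in> dom" using dom_nonempty .
  obtain C where C: "0 \<le> C" "\<And>x. x \<in> dom \<Longrightarrow> - C * (1 + norm (x - x0)) \<le> val x"
    using linear_lower_bound[OF x0] by blast
  define g where "g = (\<lambda>p::'a \<times> real. snd p + (norm (fst p - x))\<^sup>2 / (2 * \<eta>))"
  define c where "c = val x0 + (norm (x0 - x))\<^sup>2 / (2 * \<eta>)"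
  define S where "S = ereal_epigraph \<phi> \<inter> {p. g p \<le> c}"
  have cont: "continuous_on UNIV g" unfolding g_def by (intro continuous_intros) (use assms in auto)
  have "closed {p. g p \<le> c}"
    using closed_Collect_le[OF cont continuous_on_const[of UNIV c]] by simp
  then have clS: "closed S" unfolding S_def using closed_epi by blast
  define R where "R = norm (x - x0)"
  define M where "M = 2 * \<eta> * C + 1 + 2 * \<eta> * (\<bar>c\<bar> + C * (1 + R))"
  have Mb: "norm (u - x) \<le> M \<and> \<bar>t\<bar> \<le> \<bar>c\<bar> + C * (1 + M + R)" if "(u, t) \<in> S" for u t
  proof -
    have u: "u \<in> dom" "val u \<le> t" "t + (norm (u - x))\<^sup>2 / (2 * \<eta>) \<le> c"
      using that by (auto simp: S_def mem_epigraph g_def)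
    define n where "n = norm (u - x)"
    have "norm (u - x0) \<le> n + R" unfolding n_def R_def using norm_triangle_ineq[of "u - x" "x - x0"] by simp
    then have "C * (1 + norm (u - x0)) \<le> C * (1 + n + R)" using C(1) by (intro mult_left_mono) auto
    then have lo: "- (C * (1 + n + R)) \<le> t" using C(2)[OF u(1)] u(2) by linarith
    have "n\<^sup>2 / (2 * \<eta>) \<le> \<bar>c\<bar> + C * (1 + n + R)" using lo u(3) unfolding n_def by linarith
    then have "n * n \<le> 2 * \<eta> * (\<bar>c\<bar> + C * (1 + n + R))" using assms
      by (simp add: field_simps power2_eq_square)
    then have nn: "n * n \<le> 2 * \<eta> * C * n + 2 * \<eta> * (\<bar>c\<bar> + C * (1 + R))" by (simp add: algebra_simps)
    have "n \<le> M"
    proof (rule ccontr)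
      assume "\<not> n \<le> M"
      then have nM: "n > M" by simp
      have b: "0 \<le> 2 * \<eta> * (\<bar>c\<bar> + C * (1 + R))" "0 \<le> 2 * \<eta> * C" using assms C(1) by (auto simp: R_def)
      then have n1: "n \<ge> 1" using nM unfolding M_def by linarith
      have "n * n > M * n" using nM n1 by (intro mult_strict_right_mono) auto
      moreover have "M * n = 2 * \<eta> * C * n + n + 2 * \<eta> * (\<bar>c\<bar> + C * (1 + R)) * n"
        unfolding M_def by (simp add: algebra_simps)
      moreover have "2 * \<eta> * (\<bar>c\<bar> + C * (1 + R)) * n \<ge> 2 * \<eta> * (\<bar>c\<bar> + C * (1 + R))"
        using mult_left_mono[OF n1 b(1)] by simp
      ultimately show False using nn n1 by linarith
    qed
    moreover have "t \<le> c" using u(3) assms by (smt (verit) divide_nonneg_pos zero_le_power2)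
    moreover have "C * (1 + n + R) \<le> C * (1 + M + R)" using \<open>n \<le> M\<close> C(1) by (intro mult_left_mono) auto
    ultimately show ?thesis using lo C(1) unfolding n_def R_def
      by (smt (verit) norm_ge_zero mult_nonneg_nonneg)
  qed
  have "bounded S"
  proof (rule bounded_subset)
    show "bounded (cball x M \<times> cball (0::real) (\<bar>c\<bar> + C * (1 + M + R)))"
      by (intro bounded_Times bounded_cball)
    show "S \<subseteq> cball x M \<times> cball 0 (\<bar>c\<bar> + C * (1 + M + R))"
      using Mb by (auto simp: dist_norm norm_minus_commute)
  qed
  then have "compact S" using clS by (simp add: compact_eq_bounded_closed)
  moreover have "(x0, val x0) \<in> S" using x0 by (auto simp: S_def mem_epigraph g_def c_def)
  ultimately obtain p where p: "p \<in> S" "\<And>p'. p' \<in> S \<Longrightarrow> g p \<le> g p'"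
    using continuous_attains_inf[of S g] continuous_on_subset[OF cont] by (metis empty_iff subset_UNIV)
  obtain y t where yt: "p = (y, t)" by (cases p)
  have y: "y \<in> dom" "val y \<le> t" "g (y, t) \<le> c" using p(1) by (auto simp: S_def mem_epigraph yt)
  show thesis
  proof (rule that[OF y(1)])
    fix u assume u: "u \<in> dom"
    show "val y + (norm (y - x))\<^sup>2 / (2 * \<eta>) \<le> val u + (norm (u - x))\<^sup>2 / (2 * \<eta>)"
    proof (cases "g (u, val u) \<le> c")
      case True
      then have "(u, val u) \<in> S" using u by (auto simp: S_def mem_epigraph)
      from p(2)[OF this] show ?thesis using y(2) by (auto simp: yt g_def)
    next
      case False
      then show ?thesis using y(2,3) by (auto simp: g_def)
    qed
  qed
qed

text \<open>First-order optimality of a proximal point: the objective cannot decrease when moving from \<open>y\<close>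
  a small fraction towards \<open>u\<close>.\<close>

lemma minimizer_subgradient:
  assumes "0 < \<eta>" and y: "y \<in> dom" and u: "u \<in> dom"
    and min: "\<And>u. u \<in> dom \<Longrightarrow> val y + (norm (y - x))\<^sup>2 / (2 * \<eta>) \<le> val u + (norm (u - x))\<^sup>2 / (2 * \<eta>)"
  shows "val y + ((x - y) \<bullet> (u - y)) / \<eta> \<le> val u"
proof (rule field_le_epsilon)
  fix e :: real assume e: "0 < e"
  define t where "t = min 1 (2 * \<eta> * e / ((norm (u - y))\<^sup>2 + 1))"
  have "0 < (norm (u - y))\<^sup>2 + 1" by (simp add: add_nonneg_pos)
  then have t: "0 < t" "t \<le> 1" using e assms(1) by (auto simp: t_def)
  have te: "t * (norm (u - y))\<^sup>2 / (2 * \<eta>) \<le> e"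
  proof -
    have "t * (norm (u - y))\<^sup>2 \<le> t * ((norm (u - y))\<^sup>2 + 1)" using t by (intro mult_left_mono) auto
    also have "\<dots> \<le> 2 * \<eta> * e / ((norm (u - y))\<^sup>2 + 1) * ((norm (u - y))\<^sup>2 + 1)"
      by (intro mult_right_mono) (auto simp: t_def)
    also have "\<dots> = 2 * \<eta> * e" using \<open>0 < (norm (u - y))\<^sup>2 + 1\<close> by simp
    finally show ?thesis using assms(1) by (simp add: field_simps)
  qed
  let ?z = "(1 - t) *\<^sub>R y + t *\<^sub>R u"
  have z: "?z - x = (y - x) + t *\<^sub>R (u - y)" by (simp add: algebra_simps)
  have nz: "(norm (?z - x))\<^sup>2 = (norm (y - x))\<^sup>2 + 2 * t * ((y - x) \<bullet> (u - y)) + t * t * (norm (u - y))\<^sup>2"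
    unfolding z by (simp add: power2_norm_eq_inner inner_add_left inner_add_right inner_commute algebra_simps)
  have "val y + (norm (y - x))\<^sup>2 / (2 * \<eta>) \<le> val ?z + (norm (?z - x))\<^sup>2 / (2 * \<eta>)"
    using min convex_combination(1)[OF y u] t by auto
  also have "\<dots> \<le> (1 - t) * val y + t * val u + (norm (?z - x))\<^sup>2 / (2 * \<eta>)"
    using convex_combination(2)[OF y u] t by auto
  finally have "val y + (norm (y - x))\<^sup>2 / (2 * \<eta>) \<le> (1 - t) * val y + t * val u + (norm (?z - x))\<^sup>2 / (2 * \<eta>)" .
  moreover have "(norm (?z - x))\<^sup>2 / (2 * \<eta>) = (norm (y - x))\<^sup>2 / (2 * \<eta>) +
      (2 * t * ((y - x) \<bullet> (u - y)) + t * t * (norm (u - y))\<^sup>2) / (2 * \<eta>)"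
    unfolding nz by (simp only: add_divide_distrib add.assoc)
  moreover have "(1 - t) * val y = val y - t * val y" by (simp add: algebra_simps)
  ultimately have "t * val y \<le> t * val u + (2 * t * ((y - x) \<bullet> (u - y)) + t * t * (norm (u - y))\<^sup>2) / (2 * \<eta>)"
    by linarith
  also have "\<dots> = t * (val u + ((y - x) \<bullet> (u - y)) / \<eta> + t * (norm (u - y))\<^sup>2 / (2 * \<eta>))"
    using assms(1) by (simp add: field_simps)
  finally have "val y \<le> val u + ((y - x) \<bullet> (u - y)) / \<eta> + t * (norm (u - y))\<^sup>2 / (2 * \<eta>)"
    using t by simp
  moreover have "((y - x) \<bullet> (u - y)) / \<eta> = - (((x - y) \<bullet> (u - y)) / \<eta>)"
    by (simp add: inner_diff_left minus_divide_left)
  ultimately show "val y + ((x - y) \<bullet> (u - y)) / \<eta> \<le> val u + e" using te by linarith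
qed

text \<open>The operator \<open>prox\<close> is an \<open>arg_min\<close> over all points with extended real values; any
  minimizer over the domain realises it.\<close>

lemma prox_minimizer:
  assumes "0 < \<eta>"
  shows "prox \<eta> \<phi> x \<in> dom"
    and "\<And>u. u \<in> dom \<Longrightarrow>
      val (prox \<eta> \<phi> x) + (norm (prox \<eta> \<phi> x - x))\<^sup>2 / (2 * \<eta>) \<le> val u + (norm (u - x))\<^sup>2 / (2 * \<eta>)"
proof -
  let ?F = "\<lambda>u. \<phi> u + ereal ((norm (u - x))\<^sup>2 / (2 * \<eta>))"
  obtain y where y: "y \<in> dom"
    "\<And>u. u \<in> dom \<Longrightarrow> val y + (norm (y - x))\<^sup>2 / (2 * \<eta>) \<le> val u + (norm (u - x))\<^sup>2 / (2 * \<eta>)"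
    using prox_minimizer_exists[OF assms, of x] by blast
  have "is_arg_min ?F (\<lambda>_. True) y"
    unfolding is_arg_min_linorder
  proof (intro conjI allI impI TrueI)
    fix u
    show "?F y \<le> ?F u"
      using y ereal_val[of u] ereal_val[of y] not_dom[of u] by (cases "u \<in> dom") auto
  qed
  then have am: "is_arg_min ?F (\<lambda>_. True) (prox \<eta> \<phi> x)"
    unfolding prox_def arg_min_def by (rule someI)
  then have le: "?F (prox \<eta> \<phi> x) \<le> ?F u" for u by (auto simp: is_arg_min_linorder)
  show d: "prox \<eta> \<phi> x \<in> dom"
    using le[of y] ereal_val[OF y(1)] not_dom[of "prox \<eta> \<phi> x"] by (cases "prox \<eta> \<phi> x \<in> dom") auto
  show "val (prox \<eta> \<phi> x) + (norm (prox \<eta> \<phi> x - x))\<^sup>2 / (2 * \<eta>) \<le> val u + (norm (u - x))\<^sup>2 / (2 * \<eta>)"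
    if "u \<in> dom" for u
    using le[of u] ereal_val[OF that] ereal_val[OF d] by auto
qed

lemma prox_subgradient:
  assumes "0 < \<eta>" "u \<in> dom"
  shows "val (prox \<eta> \<phi> x) + ((x - prox \<eta> \<phi> x) \<bullet> (u - prox \<eta> \<phi> x)) / \<eta> \<le> val u"
  by (rule minimizer_subgradient[OF assms(1) prox_minimizer(1)[OF assms(1)] assms(2) prox_minimizer(2)[OF assms(1)]])

lemma prox_nonexpansive:
  assumes "0 < \<eta>"
  shows "norm (prox \<eta> \<phi> x - prox \<eta> \<phi> y) \<le> norm (x - y)"
proof -
  let ?a = "prox \<eta> \<phi> x" and ?b = "prox \<eta> \<phi> y"
  have "((x - ?a) \<bullet> (?b - ?a)) / \<eta> + ((y - ?b) \<bullet> (?a - ?b)) / \<eta> \<le> 0"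
    using prox_subgradient[OF assms prox_minimizer(1)[OF assms], of x y]
      prox_subgradient[OF assms prox_minimizer(1)[OF assms], of y x] by linarith
  then have "(x - ?a) \<bullet> (?b - ?a) + (y - ?b) \<bullet> (?a - ?b) \<le> 0"
    using assms by (simp add: add_divide_distrib[symmetric] divide_le_0_iff)
  then have "(?a - ?b) \<bullet> (?a - ?b) \<le> (x - y) \<bullet> (?a - ?b)"
    by (simp add: inner_diff_left inner_diff_right inner_commute algebra_simps)
  also have "\<dots> \<le> norm (x - y) * norm (?a - ?b)" by (rule norm_cauchy_schwarz)
  finally have "norm (?a - ?b) * norm (?a - ?b) \<le> norm (x - y) * norm (?a - ?b)"
    by (simp add: norm_eq_sqrt_inner)
  then show ?thesis by (cases "norm (?a - ?b) = 0") auto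
qed

lemma continuous_on_prox: "0 < \<eta> \<Longrightarrow> continuous_on UNIV (prox \<eta> \<phi>)"
  unfolding continuous_on_iff dist_norm using prox_nonexpansive by (meson order_le_less_trans)

end

section \<open>The Moreau gap along proximal steps\<close>

lemma completed_square_nonneg:
  fixes x y :: "'a::real_inner"
  assumes "0 < t"
  shows "0 \<le> t * (x \<bullet> x) + x \<bullet> y + (1 / (4 * t)) * (y \<bullet> y)"
proof -
  have "0 \<le> (((2 * t) *\<^sub>R x + y) \<bullet> ((2 * t) *\<^sub>R x + y)) / (4 * t)" using assms by simp
  also have "\<dots> = t * (x \<bullet> x) + x \<bullet> y + (1 / (4 * t)) * (y \<bullet> y)"
    using assms by (simp add: inner_add_left inner_add_right inner_commute field_simps)
  finally show ?thesis .
qed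

context closed_convex_fun begin

text \<open>The Yosida approximation of the subdifferential, which is the gradient of the Moreau envelope.\<close>

definition yosida :: "real \<Rightarrow> 'a \<Rightarrow> 'a" where
  "yosida \<eta> x = (1 / \<eta>) *\<^sub>R (x - prox \<eta> \<phi> x)"

text \<open>The amount by which \<open>\<phi>\<close> exceeds its Moreau envelope. It serves as a potential: it vanishes
  exactly at the minimizers of \<open>\<phi>\<close> and it dominates the squared Yosida approximation.\<close>

definition moreau_gap :: "real \<Rightarrow> 'a \<Rightarrow> real" where
  "moreau_gap \<eta> x = val x - (val (prox \<eta> \<phi> x) + \<eta> / 2 * (norm (yosida \<eta> x))\<^sup>2)"

lemma prox_yosida: "0 < \<eta> \<Longrightarrow> prox \<eta> \<phi> x = x - \<eta> *\<^sub>R yosida \<eta> x"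
  by (simp add: yosida_def)

lemma yosida_subgradient:
  assumes "0 < \<eta>" "u \<in> dom"
  shows "val (prox \<eta> \<phi> x) + yosida \<eta> x \<bullet> (u - prox \<eta> \<phi> x) \<le> val u"
  using prox_subgradient[OF assms, of x] by (simp add: yosida_def)

text \<open>The resolvent complement \<open>x \<mapsto> x - prox \<eta> \<phi> x\<close> changes under a shift by \<open>\<eta> *\<^sub>R g\<close> by the shift
  itself minus the difference of two proximal points.\<close>

lemma yosida_nonexpansive:
  assumes "0 < \<eta>"
  shows "norm (\<eta> *\<^sub>R yosida \<eta> (w + \<eta> *\<^sub>R g) - \<eta> *\<^sub>R g - \<eta> *\<^sub>R yosida \<eta> w) \<le> \<eta> * norm g"
proof -
  have "\<eta> *\<^sub>R yosida \<eta> (w + \<eta> *\<^sub>R g) - \<eta> *\<^sub>R g - \<eta> *\<^sub>R yosida \<eta> w = prox \<eta> \<phi> w - prox \<eta> \<phi> (w + \<eta> *\<^sub>R g)"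
    using assms by (simp add: yosida_def)
  also have "norm \<dots> \<le> norm (w - (w + \<eta> *\<^sub>R g))" by (rule prox_nonexpansive[OF assms])
  finally show ?thesis using assms by simp
qed

lemma moreau_gap_ge:
  assumes "0 < \<eta>" "u \<in> dom"
  shows "val w - val u - (norm (u - w))\<^sup>2 / (2 * \<eta>) \<le> moreau_gap \<eta> w"
proof -
  have "(norm (prox \<eta> \<phi> w - w))\<^sup>2 / (2 * \<eta>) = \<eta> / 2 * (norm (yosida \<eta> w))\<^sup>2"
    using assms(1) by (simp add: prox_yosida power_mult_distrib power2_eq_square)
  then show ?thesis using prox_minimizer(2)[OF assms, of w] by (simp add: moreau_gap_def)
qed

lemma moreau_gap_nonneg: "0 < \<eta> \<Longrightarrow> w \<in> dom \<Longrightarrow> 0 \<le> moreau_gap \<eta> w"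
  using moreau_gap_ge[of \<eta> w w] by simp

lemma yosida_le_moreau_gap:
  assumes "0 < \<eta>" "\<eta> \<le> \<eta>2" "w \<in> dom"
  shows "\<eta> / 2 * (norm (yosida \<eta> w))\<^sup>2 \<le> moreau_gap \<eta>2 w"
proof -
  let ?A = "yosida \<eta> w" and ?u = "prox \<eta> \<phi> w"
  have u: "?u = w - \<eta> *\<^sub>R ?A" using prox_yosida[OF assms(1)] .
  have "val ?u + \<eta> * (norm ?A)\<^sup>2 \<le> val w"
    using yosida_subgradient[OF assms(1,3), of w]
    by (simp add: u power2_norm_eq_inner)
  moreover have "(norm (?u - w))\<^sup>2 / (2 * \<eta>2) \<le> \<eta> / 2 * (norm ?A)\<^sup>2"
  proof -
    have "(norm (?u - w))\<^sup>2 / (2 * \<eta>2) \<le> (norm (?u - w))\<^sup>2 / (2 * \<eta>)"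
      using assms by (intro divide_left_mono) auto
    also have "\<dots> = \<eta> / 2 * (norm ?A)\<^sup>2"
      using assms(1) by (simp add: u power_mult_distrib power2_eq_square)
    finally show ?thesis .
  qed
  ultimately show ?thesis
    using moreau_gap_ge[of \<eta>2 ?u w] prox_minimizer(1)[OF assms(1), of w] assms by linarith
qed

text \<open>Both Yosida approximations are subgradients, at two different proximal points of the same \<open>w\<close>;
  this is the monotonicity of the subdifferential at these points.\<close>

lemma yosida_monotone_step:
  assumes "0 < \<eta>" "\<eta> \<le> \<eta>2"
  shows "\<eta>2 * (norm (yosida \<eta> w - yosida \<eta>2 w))\<^sup>2
    \<le> (\<eta>2 - \<eta>) * ((yosida \<eta> w - yosida \<eta>2 w) \<bullet> yosida \<eta> w)"
proof -
  let ?A = "yosida \<eta> w" and ?p = "yosida \<eta>2 w"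
  have e2: "0 < \<eta>2" using assms by simp
  have "?A \<bullet> (prox \<eta>2 \<phi> w - prox \<eta> \<phi> w) + ?p \<bullet> (prox \<eta> \<phi> w - prox \<eta>2 \<phi> w) \<le> 0"
    using yosida_subgradient[OF assms(1) prox_minimizer(1)[OF e2], of w w]
      yosida_subgradient[OF e2 prox_minimizer(1)[OF assms(1)], of w w] by linarith
  then have "(?A - ?p) \<bullet> (\<eta> *\<^sub>R ?A - \<eta>2 *\<^sub>R ?p) \<le> 0"
    by (simp add: prox_yosida[OF assms(1)] prox_yosida[OF e2] inner_diff_left inner_diff_right inner_commute)
  then show ?thesis
    by (simp add: power2_norm_eq_inner inner_diff_left inner_diff_right inner_commute algebra_simps)
qed

text \<open>With \<open>q\<close> the scaled displacement, \<open>q + g\<close> is a subgradient of \<open>\<phi>\<close> at the new point \<open>y\<close>.\<close>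

lemma prox_step_decrease:
  fixes w g :: 'a
  assumes "0 < \<eta>" "w \<in> dom"
  defines "y \<equiv> prox \<eta> \<phi> (w + \<eta> *\<^sub>R g)"
  defines "q \<equiv> (1 / \<eta>) *\<^sub>R (w - y)"
  shows "val y + \<eta> * (norm q)\<^sup>2 + \<eta> * (q \<bullet> g) \<le> val w"
    and "\<And>u. u \<in> dom \<Longrightarrow> val y + (q + g) \<bullet> (u - y) \<le> val u"
proof -
  have Y: "yosida \<eta> (w + \<eta> *\<^sub>R g) = q + g"
    using assms(1) by (simp add: yosida_def q_def y_def algebra_simps)
  show *: "val y + (q + g) \<bullet> (u - y) \<le> val u" if "u \<in> dom" for u
    using yosida_subgradient[OF assms(1) that, of "w + \<eta> *\<^sub>R g"] unfolding Y y_def .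
  have "w - y = \<eta> *\<^sub>R q" using assms(1) by (simp add: q_def)
  then show "val y + \<eta> * (norm q)\<^sup>2 + \<eta> * (q \<bullet> g) \<le> val w"
    using *[OF assms(2)] by (simp add: power2_norm_eq_inner inner_add_left inner_commute algebra_simps)
qed

text \<open>The same subgradient inequality, compared with the proximal point for the envelope parameter
  \<open>\<eta>2\<close> in place of \<open>w\<close>: this makes the Moreau gap of \<open>w\<close> appear as part of the decrease.\<close>

lemma prox_step_decrease_moreau:
  fixes w g :: 'a
  assumes "0 < \<eta>" "0 < \<eta>2" "w \<in> dom"
  defines "y \<equiv> prox \<eta> \<phi> (w + \<eta> *\<^sub>R g)"
  defines "q \<equiv> (1 / \<eta>) *\<^sub>R (w - y)"
  shows "moreau_gap \<eta>2 w + (\<eta> - \<eta>2 / 2) * (norm q)\<^sup>2 - (\<eta>2 - \<eta>) * (q \<bullet> g) - \<eta>2 / 2 * (norm g)\<^sup>2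
    \<le> val w - val y"
proof -
  let ?p = "yosida \<eta>2 w" and ?u = "prox \<eta>2 \<phi> w"
  have "val y + (q + g) \<bullet> (?u - y) \<le> val ?u"
    using prox_step_decrease(2)[OF assms(1,3) prox_minimizer(1)[OF assms(2)]] unfolding y_def q_def .
  moreover have "?u - y = \<eta> *\<^sub>R q - \<eta>2 *\<^sub>R ?p"
    using assms(1) by (simp add: prox_yosida[OF assms(2)] q_def)
  ultimately have "val y + (q + g) \<bullet> (\<eta> *\<^sub>R q - \<eta>2 *\<^sub>R ?p) \<le> val ?u" by simp
  moreover have "0 \<le> \<eta>2 / 2 * (norm (q + g - ?p))\<^sup>2" using assms(2) by simp
  ultimately show ?thesis
    unfolding moreau_gap_def
    by (simp add: power2_norm_eq_inner inner_add_left inner_add_right inner_diff_left inner_diff_right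
        inner_commute algebra_simps)
qed

text \<open>Convexity of the envelope, whose gradient at \<open>w\<close> is the Yosida approximation.\<close>

lemma moreau_gap_gradient:
  assumes "0 < \<eta>2" "w \<in> dom"
  shows "moreau_gap \<eta>2 w' - val w' \<le> moreau_gap \<eta>2 w - val w - yosida \<eta>2 w \<bullet> (w' - w)"
proof -
  let ?p = "yosida \<eta>2 w" and ?p' = "yosida \<eta>2 w'"
  have "val (prox \<eta>2 \<phi> w) + ?p \<bullet> (prox \<eta>2 \<phi> w' - prox \<eta>2 \<phi> w) \<le> val (prox \<eta>2 \<phi> w')"
    by (rule yosida_subgradient[OF assms(1) prox_minimizer(1)[OF assms(1)]])
  moreover have "prox \<eta>2 \<phi> w' - prox \<eta>2 \<phi> w = (w' - w) - \<eta>2 *\<^sub>R (?p' - ?p)"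
    by (simp add: prox_yosida[OF assms(1)] algebra_simps)
  ultimately have *: "val (prox \<eta>2 \<phi> w) + ?p \<bullet> ((w' - w) - \<eta>2 *\<^sub>R (?p' - ?p)) \<le> val (prox \<eta>2 \<phi> w')"
    by simp
  have "0 \<le> \<eta>2 / 2 * (norm (?p' - ?p))\<^sup>2" using assms(1) by simp
  with * show ?thesis
    unfolding moreau_gap_def
    by (simp add: power2_norm_eq_inner inner_diff_left inner_diff_right inner_commute algebra_simps)
qed

text \<open>A relaxed proximal step with a \<^emph>\<open>shorter\<close> step size hardly increases the Moreau gap, whatever the
  direction \<open>g\<close>. By convexity of \<open>\<phi>\<close> and of the envelope the change of the gap is at most \<open>\<gamma>\<close> times
  \<open>val y - val w + \<eta> * (p \<bullet> q)\<close>, where \<open>p\<close> is the gradient of the envelope. Writing \<open>q\<close> as the Yosida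
  approximation for \<open>\<eta>\<close> plus a perturbation \<open>h\<close>, all terms free of \<open>g\<close> form a nonnegative quadratic
  form by \<open>yosida_monotone_step\<close>, and completing the square in \<open>h\<close> leaves only a multiple of \<open>\<parallel>g\<parallel>\<^sup>2\<close>.\<close>

lemma moreau_gap_step:
  fixes w g :: 'a
  assumes "0 < \<eta>" "\<eta> \<le> \<eta>2" "w \<in> dom" "0 \<le> \<gamma>" "\<gamma> \<le> 1"
  defines "y \<equiv> prox \<eta> \<phi> (w + \<eta> *\<^sub>R g)"
  defines "w' \<equiv> (1 - \<gamma>) *\<^sub>R w + \<gamma> *\<^sub>R y"
  shows "moreau_gap \<eta>2 w' \<le> moreau_gap \<eta>2 w + \<gamma> * (\<eta> * \<eta>2 / (3 * \<eta>2 + \<eta>)) * (norm g)\<^sup>2"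
proof -
  let ?A = "yosida \<eta> w" and ?p = "yosida \<eta>2 w"
  have e2: "0 < \<eta>2" using assms by simp
  define q where "q = (1 / \<eta>) *\<^sub>R (w - y)"
  define \<kappa> where "\<kappa> = \<eta>2 / (3 * \<eta>2 + \<eta>)"
  define h where "h = q - ?A"
  have wy: "w - y = \<eta> *\<^sub>R q" using assms(1) by (simp add: q_def)
  have ydom: "y \<in> dom" unfolding y_def by (rule prox_minimizer(1)[OF assms(1)])
  have A1: "val y + (q + g) \<bullet> (prox \<eta> \<phi> w - y) \<le> val (prox \<eta> \<phi> w)"
    using prox_step_decrease(2)[OF assms(1,3) prox_minimizer(1)[OF assms(1)]] unfolding y_def q_def .
  have A2: "prox \<eta> \<phi> w - y = \<eta> *\<^sub>R (q - ?A)"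
    using wy by (simp add: prox_yosida[OF assms(1)] algebra_simps)
  have A3: "val (prox \<eta> \<phi> w) + \<eta> * (?A \<bullet> ?A) \<le> val w"
    using yosida_subgradient[OF assms(1,3), of w] by (simp add: prox_yosida[OF assms(1)])
  have "\<eta> * (?A \<bullet> ?A + (q + g) \<bullet> (q - ?A)) \<le> val w - val y"
    using A1 A3 unfolding A2 by (simp add: algebra_simps)
  moreover have "?A \<bullet> ?A + (q + g) \<bullet> (q - ?A) - ?p \<bullet> q
      = (?A - ?p) \<bullet> ?A + (?A - ?p) \<bullet> h + h \<bullet> h + g \<bullet> h"
  proof -
    have "q = ?A + h" by (simp add: h_def)
    then show ?thesis
      by (simp add: inner_add_left inner_add_right inner_diff_left inner_diff_right inner_commute algebra_simps)
  qed
  moreover have "0 \<le> (?A - ?p) \<bullet> ?A + (?A - ?p) \<bullet> h + h \<bullet> h + g \<bullet> h + \<kappa> * (g \<bullet> g)"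
  proof (cases "\<eta> = \<eta>2")
    case True
    have "0 \<le> (h + (1/2) *\<^sub>R g) \<bullet> (h + (1/2) *\<^sub>R g)" by simp
    then show ?thesis using True assms(1)
      by (simp add: \<kappa>_def inner_add_left inner_add_right inner_commute)
  next
    case False
    then have lt: "\<eta> < \<eta>2" using assms by simp
    define r where "r = \<eta>2 / (\<eta>2 - \<eta>)"
    have r1: "1 \<le> r" using lt assms(1) by (simp add: r_def)
    have s0: "r * ((?A - ?p) \<bullet> (?A - ?p)) \<le> (?A - ?p) \<bullet> ?A"
      using yosida_monotone_step[OF assms(1,2), of w] lt
      by (simp add: r_def power2_norm_eq_inner field_simps)
    have k: "\<kappa> = r / (4 * r - 1)"
    proof -
      have "4 * r - 1 = (3 * \<eta>2 + \<eta>) / (\<eta>2 - \<eta>)" using lt by (simp add: r_def field_simps)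
      then show ?thesis using lt assms(1) by (simp add: \<kappa>_def r_def)
    qed
    (* h \<bullet> h is split: the part 1 / (4 r) completes the square with the Yosida difference, and the
       part t completes the square with g *)
    define t where "t = 1 - 1 / (4 * r)"
    have t: "0 < t" "\<kappa> = 1 / (4 * t)" using r1 by (auto simp: t_def k field_simps)
    have s1: "0 \<le> r * ((?A - ?p) \<bullet> (?A - ?p)) + (?A - ?p) \<bullet> h + (1 / (4 * r)) * (h \<bullet> h)"
      using r1 by (intro completed_square_nonneg) auto
    have s2: "0 \<le> t * (h \<bullet> h) + g \<bullet> h + \<kappa> * (g \<bullet> g)"
      using completed_square_nonneg[OF t(1), of h g] by (simp add: t(2) inner_commute)
    have "t * (h \<bullet> h) = h \<bullet> h - (1 / (4 * r)) * (h \<bullet> h)" by (simp add: t_def algebra_simps)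
    then show ?thesis using s0 s1 s2 by linarith
  qed
  ultimately have B: "- (\<eta> * \<kappa> * (g \<bullet> g)) \<le> val w - val y - \<eta> * (?p \<bullet> q)"
  proof -
    assume a: "\<eta> * (?A \<bullet> ?A + (q + g) \<bullet> (q - ?A)) \<le> val w - val y"
      and b: "?A \<bullet> ?A + (q + g) \<bullet> (q - ?A) - ?p \<bullet> q = (?A - ?p) \<bullet> ?A + (?A - ?p) \<bullet> h + h \<bullet> h + g \<bullet> h"
      and c: "0 \<le> (?A - ?p) \<bullet> ?A + (?A - ?p) \<bullet> h + h \<bullet> h + g \<bullet> h + \<kappa> * (g \<bullet> g)"
    have "0 \<le> \<eta> * (?A \<bullet> ?A + (q + g) \<bullet> (q - ?A) - ?p \<bullet> q + \<kappa> * (g \<bullet> g))"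
      using c assms(1) unfolding b by (intro mult_nonneg_nonneg) auto
    then show ?thesis using a by (simp add: algebra_simps)
  qed
  have D: "w' - w = - (\<gamma> * \<eta>) *\<^sub>R q"
  proof -
    have "w' - w = - (\<gamma> *\<^sub>R (w - y))" by (simp add: w'_def algebra_simps)
    then show ?thesis by (simp add: wy)
  qed
  have "val w' \<le> (1 - \<gamma>) * val w + \<gamma> * val y"
    unfolding w'_def by (rule convex_combination(2)[OF assms(3) ydom assms(4,5)])
  moreover have "moreau_gap \<eta>2 w' - val w' \<le> moreau_gap \<eta>2 w - val w - ?p \<bullet> (w' - w)"
    by (rule moreau_gap_gradient[OF e2 assms(3)])
  moreover have "\<gamma> * (- (\<eta> * \<kappa> * (g \<bullet> g))) \<le> \<gamma> * (val w - val y - \<eta> * (?p \<bullet> q))"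
    by (rule mult_left_mono[OF B assms(4)])
  ultimately show ?thesis
    unfolding D \<kappa>_def by (simp add: power2_norm_eq_inner algebra_simps)
qed

text \<open>Convex combination, with weight \<open>s * \<eta>\<close>, of the decrease that shows the Moreau gap and of the plain
  decrease. Scaling the weight with the step size makes the coefficient of \<open>q \<bullet> g\<close> the same for both
  admissible step sizes.\<close>

lemma prox_step_decrease_split:
  fixes w g :: 'a
  assumes "0 < \<eta>1" "\<eta>1 \<le> \<eta>2" "\<eta> \<in> {\<eta>1, \<eta>2}" "w \<in> dom" "0 \<le> s" "s * \<eta>2 \<le> 1"
  defines "y \<equiv> prox \<eta> \<phi> (w + \<eta> *\<^sub>R g)"
  defines "q \<equiv> (1 / \<eta>) *\<^sub>R (w - y)"
  shows "2 * s * \<eta>1 * moreau_gap \<eta>2 w + (2 / \<eta>2 - s) * (\<eta>\<^sup>2 * (norm q)\<^sup>2) - s * \<eta>2\<^sup>2 * (norm g)\<^sup>2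
      + 2 * \<eta> * ((1 - s * \<eta>2) * (q \<bullet> g)) \<le> 2 * (val w - val y)"
proof -
  have e: "0 < \<eta>" "\<eta> \<le> \<eta>2" "0 < \<eta>2" "\<eta>1 \<le> \<eta>" using assms by auto
  define l where "l = s * \<eta>"
  have l: "0 \<le> l" "l \<le> 1" using assms e mult_left_mono[of \<eta> \<eta>2 s] by (auto simp: l_def)
  have a: "moreau_gap \<eta>2 w + (\<eta> - \<eta>2 / 2) * (norm q)\<^sup>2 - (\<eta>2 - \<eta>) * (q \<bullet> g) - \<eta>2 / 2 * (norm g)\<^sup>2
      \<le> val w - val y"
    using prox_step_decrease_moreau[OF e(1,3) assms(4)] unfolding q_def y_def .
  have b: "\<eta> * (norm q)\<^sup>2 + \<eta> * (q \<bullet> g) \<le> val w - val y"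
    using prox_step_decrease(1)[OF e(1) assms(4), of g] unfolding q_def y_def by simp
  have c: "l * (moreau_gap \<eta>2 w + (\<eta> - \<eta>2 / 2) * (norm q)\<^sup>2 - (\<eta>2 - \<eta>) * (q \<bullet> g) - \<eta>2 / 2 * (norm g)\<^sup>2)
      + (1 - l) * (\<eta> * (norm q)\<^sup>2 + \<eta> * (q \<bullet> g)) \<le> val w - val y"
    using mult_left_mono[OF a l(1)] mult_left_mono[OF b, of "1 - l"] l by (simp add: algebra_simps)
  have s1: "s * \<eta>1 * moreau_gap \<eta>2 w \<le> l * moreau_gap \<eta>2 w"
    using moreau_gap_nonneg[OF e(3) assms(4)] e assms(5) unfolding l_def
    by (intro mult_right_mono mult_left_mono) auto
  have s2: "l * \<eta>2 * (norm g)\<^sup>2 \<le> s * \<eta>2\<^sup>2 * (norm g)\<^sup>2"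
    using e assms(5) unfolding l_def power2_eq_square
    by (intro mult_right_mono) (auto simp: mult.assoc intro!: mult_left_mono)
  have s3: "(2 / \<eta>2 - s) * (\<eta>\<^sup>2 * (norm q)\<^sup>2) \<le> 2 * (l * (\<eta> - \<eta>2 / 2) + (1 - l) * \<eta>) * (norm q)\<^sup>2"
  proof -
    have "0 \<le> \<eta> * (1 - \<eta> / \<eta>2) * (2 - s * \<eta>2)"
      using e assms(6) by (intro mult_nonneg_nonneg) auto
    also have "\<dots> = 2 * (l * (\<eta> - \<eta>2 / 2) + (1 - l) * \<eta>) - (2 / \<eta>2 - s) * \<eta>\<^sup>2"
      using e by (simp add: l_def field_simps power2_eq_square)
    finally have "(2 / \<eta>2 - s) * \<eta>\<^sup>2 \<le> 2 * (l * (\<eta> - \<eta>2 / 2) + (1 - l) * \<eta>)" by simp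
    from mult_right_mono[OF this, of "(norm q)\<^sup>2"] show ?thesis by (simp add: mult.assoc)
  qed
  have "l * (moreau_gap \<eta>2 w + (\<eta> - \<eta>2 / 2) * (norm q)\<^sup>2 - (\<eta>2 - \<eta>) * (q \<bullet> g) - \<eta>2 / 2 * (norm g)\<^sup>2)
      + (1 - l) * (\<eta> * (norm q)\<^sup>2 + \<eta> * (q \<bullet> g))
    = l * moreau_gap \<eta>2 w + (l * (\<eta> - \<eta>2 / 2) + (1 - l) * \<eta>) * (norm q)\<^sup>2
      + \<eta> * ((1 - s * \<eta>2) * (q \<bullet> g)) - l * \<eta>2 * (norm g)\<^sup>2 / 2"
    by (simp add: l_def algebra_simps)
  with c have c': "l * moreau_gap \<eta>2 w + (l * (\<eta> - \<eta>2 / 2) + (1 - l) * \<eta>) * (norm q)\<^sup>2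
      + \<eta> * ((1 - s * \<eta>2) * (q \<bullet> g)) - l * \<eta>2 * (norm g)\<^sup>2 / 2 \<le> val w - val y"
    by simp
  have arith: "M2 + P2 + C - N2 / 2 \<le> D \<Longrightarrow> M1 \<le> M2 \<Longrightarrow> N2 \<le> N1 \<Longrightarrow> P1 \<le> 2 * P2 \<Longrightarrow>
      2 * M1 + P1 - N1 + 2 * C \<le> 2 * D" for M1 M2 P1 P2 N1 N2 C D :: real by linarith
  show ?thesis using arith[OF c' s1 s2 s3[unfolded mult.assoc[of 2]]] by (simp only: mult.assoc)
qed

end

section \<open>Gradients and sampling without replacement\<close>

lemma has_gradient:
  fixes h :: "'a::euclidean_space \<Rightarrow> real"
  assumes "h differentiable (at x)"
  shows "GDERIV h x :> gradient h x"
proof -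
  obtain D where D: "(h has_derivative D) (at x)" using assms unfolding differentiable_def by blast
  then interpret D: bounded_linear D by (rule has_derivative_bounded_linear)
  define a where "a = (\<Sum>i\<in>Basis. D i *\<^sub>R i)"
  have "D y = y \<bullet> a" for y
  proof -
    have "D y = D (\<Sum>i\<in>Basis. (y \<bullet> i) *\<^sub>R i)" by (simp add: euclidean_representation)
    also have "\<dots> = (\<Sum>i\<in>Basis. (y \<bullet> i) * D i)" by (simp add: D.sum D.scaleR)
    also have "\<dots> = y \<bullet> a" by (simp add: a_def inner_sum_right mult.commute)
    finally show ?thesis .
  qed
  then have "D = (\<lambda>y. y \<bullet> a)" by auto
  then have a: "GDERIV h x :> a" using D by (simp add: gderiv_def)
  have "b = a" if "GDERIV h x :> b" for b
  proof -
    have "(\<lambda>y. y \<bullet> b) = (\<lambda>y. y \<bullet> a)"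
      using that a unfolding gderiv_def by (rule has_derivative_unique)
    then show ?thesis by (metis (no_types) inner_commute vector_eq_ldot)
  qed
  with a show ?thesis unfolding gradient_def by (rule theI)
qed

lemma gradient_eqI:
  fixes h :: "'a::euclidean_space \<Rightarrow> real"
  assumes "GDERIV h x :> a"
  shows "gradient h x = a"
proof -
  have "h differentiable (at x)" using assms unfolding gderiv_def differentiable_def by blast
  from has_gradient[OF this] assms have "(\<lambda>y. y \<bullet> gradient h x) = (\<lambda>y. y \<bullet> a)"
    unfolding gderiv_def by (rule has_derivative_unique)
  then show ?thesis by (metis (no_types) inner_commute vector_eq_ldot)
qed

lemma quadratic_upper_bound:
  fixes h :: "'a::euclidean_space \<Rightarrow> real"
  assumes G: "\<And>x. GDERIV h x :> G x"
    and lip: "\<And>x y. norm (G x - G y) \<le> L * norm (x - y)"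
  shows "h y \<le> h x + G x \<bullet> (y - x) + L / 2 * (norm (y - x))\<^sup>2"
proof -
  define D where "D = y - x"
  define g where "g = (\<lambda>t. h (x + t *\<^sub>R D) - t * (G x \<bullet> D) - L / 2 * (norm D)\<^sup>2 * t\<^sup>2)"
  have h': "((\<lambda>t. h (x + t *\<^sub>R D)) has_real_derivative (G (x + t *\<^sub>R D) \<bullet> D)) (at t)" for t
  proof -
    have "((\<lambda>t. x + t *\<^sub>R D) has_derivative (\<lambda>s. s *\<^sub>R D)) (at t)"
      by (auto intro!: derivative_eq_intros)
    moreover have "(h has_derivative (\<lambda>z. z \<bullet> G (x + t *\<^sub>R D))) (at (x + t *\<^sub>R D))"
      using G unfolding gderiv_def .
    ultimately have c1: "((\<lambda>t. h (x + t *\<^sub>R D)) has_derivative (\<lambda>s. (s *\<^sub>R D) \<bullet> G (x + t *\<^sub>R D))) (at t)"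
      by (rule has_derivative_compose)
    have c2: "(\<lambda>s. (s *\<^sub>R D) \<bullet> G (x + t *\<^sub>R D)) = (*) (G (x + t *\<^sub>R D) \<bullet> D)"
    proof
      fix s
      have "(s *\<^sub>R D) \<bullet> G (x + t *\<^sub>R D) = s * (D \<bullet> G (x + t *\<^sub>R D))" by (rule inner_scaleR_left)
      also have "D \<bullet> G (x + t *\<^sub>R D) = G (x + t *\<^sub>R D) \<bullet> D" by (rule inner_commute)
      finally show "(s *\<^sub>R D) \<bullet> G (x + t *\<^sub>R D) = G (x + t *\<^sub>R D) \<bullet> D * s" by (simp only: mult.commute)
    qed
    show ?thesis using c1 unfolding c2 has_field_derivative_def .
  qed
  have g': "\<exists>y. (g has_real_derivative y) (at t) \<and> y \<le> 0" if "0 \<le> t" "t \<le> 1" for t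
  proof (intro exI conjI)
    show "(g has_real_derivative (G (x + t *\<^sub>R D) \<bullet> D - G x \<bullet> D - L * (norm D)\<^sup>2 * t)) (at t)"
    proof -
      have d2: "((\<lambda>t. t * (G x \<bullet> D)) has_real_derivative (G x \<bullet> D)) (at t)"
        by (rule derivative_eq_intros | simp)+
      have d3: "((\<lambda>t. L / 2 * (norm D)\<^sup>2 * t\<^sup>2) has_real_derivative (L / 2 * (norm D)\<^sup>2 * (2 * t))) (at t)"
        by (rule derivative_eq_intros | simp)+
      show ?thesis using DERIV_diff[OF DERIV_diff[OF h' d2] d3] by (simp add: g_def mult.assoc)
    qed
    have "G (x + t *\<^sub>R D) \<bullet> D - G x \<bullet> D = (G (x + t *\<^sub>R D) - G x) \<bullet> D" by (simp add: inner_diff_left)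
    also have "\<dots> \<le> norm (G (x + t *\<^sub>R D) - G x) * norm D" by (rule norm_cauchy_schwarz)
    also have "\<dots> \<le> (L * norm (t *\<^sub>R D)) * norm D"
      using lip[of "x + t *\<^sub>R D" x] by (intro mult_right_mono) auto
    also have "\<dots> = L * (norm D)\<^sup>2 * t" using that by (simp add: power2_eq_square)
    finally show "G (x + t *\<^sub>R D) \<bullet> D - G x \<bullet> D - L * (norm D)\<^sup>2 * t \<le> 0" by simp
  qed
  have "g 1 \<le> g 0"
    by (rule DERIV_nonpos_imp_nonincreasing[of 0 1 g, OF _ g']) auto
  then show ?thesis by (simp add: g_def D_def)
qed

lemma sum_norm_sq_centered:
  fixes x :: "'i \<Rightarrow> 'a::real_inner"
  assumes "finite A" "A \<noteq> {}"
  defines "\<mu> \<equiv> (1 / real (card A)) *\<^sub>R (\<Sum>i\<in>A. x i)"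
  shows "(\<Sum>i\<in>A. (norm (x i - \<mu>))\<^sup>2) = (\<Sum>i\<in>A. (norm (x i))\<^sup>2) - real (card A) * (norm \<mu>)\<^sup>2"
proof -
  have c: "real (card A) > 0" using assms by (simp add: card_gt_0_iff)
  then have s: "(\<Sum>i\<in>A. x i) = real (card A) *\<^sub>R \<mu>" by (simp add: \<mu>_def)
  have "(\<Sum>i\<in>A. (norm (x i - \<mu>))\<^sup>2) = (\<Sum>i\<in>A. (norm (x i))\<^sup>2 - 2 * (x i \<bullet> \<mu>) + (norm \<mu>)\<^sup>2)"
    by (simp add: power2_norm_eq_inner inner_diff_left inner_diff_right inner_commute algebra_simps)
  also have "\<dots> = (\<Sum>i\<in>A. (norm (x i))\<^sup>2) - 2 * ((\<Sum>i\<in>A. x i) \<bullet> \<mu>) + real (card A) * (norm \<mu>)\<^sup>2"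
    by (simp add: sum.distrib sum_subtractf sum_distrib_left inner_sum_left)
  also have "\<dots> = (\<Sum>i\<in>A. (norm (x i))\<^sup>2) - real (card A) * (norm \<mu>)\<^sup>2"
    unfolding s by (simp add: power2_norm_eq_inner)
  finally show ?thesis .
qed

lemma norm_mean_sq_le:
  fixes x :: "'i \<Rightarrow> 'a::real_inner"
  assumes "finite A" "A \<noteq> {}"
  shows "(norm ((1 / real (card A)) *\<^sub>R (\<Sum>i\<in>A. x i)))\<^sup>2 \<le> (1 / real (card A)) * (\<Sum>i\<in>A. (norm (x i))\<^sup>2)"
proof -
  have "0 \<le> (\<Sum>i\<in>A. (norm (x i - (1 / real (card A)) *\<^sub>R (\<Sum>i\<in>A. x i)))\<^sup>2)" by (simp add: sum_nonneg)
  then have "real (card A) * (norm ((1 / real (card A)) *\<^sub>R (\<Sum>i\<in>A. x i)))\<^sup>2 \<le> (\<Sum>i\<in>A. (norm (x i))\<^sup>2)"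
    unfolding sum_norm_sq_centered[OF assms] by simp
  moreover have "real (card A) > 0" using assms by (simp add: card_gt_0_iff)
  ultimately show ?thesis by (simp add: field_simps)
qed

lemma card_subsets_separating:
  assumes "finite A" "I \<subseteq> A" "J \<subseteq> A" "I \<inter> J = {}" "card I \<le> b"
  shows "card {X. X \<subseteq> A \<and> card X = b \<and> I \<subseteq> X \<and> X \<inter> J = {}} = card (A - I - J) choose (b - card I)"
proof -
  have fI: "finite I" using assms finite_subset by blast
  have "bij_betw (\<lambda>Y. Y \<union> I) {Y. Y \<subseteq> A - I - J \<and> card Y = b - card I}
      {X. X \<subseteq> A \<and> card X = b \<and> I \<subseteq> X \<and> X \<inter> J = {}}"
  proof (rule bij_betw_byWitness[where f' = "\<lambda>X. X - I"])
    show "\<forall>Y\<in>{Y. Y \<subseteq> A - I - J \<and> card Y = b - card I}. Y \<union> I - I = Y" by auto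
    show "\<forall>X\<in>{X. X \<subseteq> A \<and> card X = b \<and> I \<subseteq> X \<and> X \<inter> J = {}}. X - I \<union> I = X" by auto
    show "(\<lambda>Y. Y \<union> I) ` {Y. Y \<subseteq> A - I - J \<and> card Y = b - card I}
        \<subseteq> {X. X \<subseteq> A \<and> card X = b \<and> I \<subseteq> X \<and> X \<inter> J = {}}"
    proof safe
      fix Y assume Y: "Y \<subseteq> A - I - J" "card Y = b - card I"
      then have "finite Y" using finite_subset[OF Y(1)] assms(1) by simp
      moreover have "Y \<inter> I = {}" using Y by auto
      ultimately show "card (Y \<union> I) = b" using Y assms(5) fI by (simp add: card_Un_disjoint)
    qed (use assms in auto)
    show "(\<lambda>X. X - I) ` {X. X \<subseteq> A \<and> card X = b \<and> I \<subseteq> X \<and> X \<inter> J = {}}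
        \<subseteq> {Y. Y \<subseteq> A - I - J \<and> card Y = b - card I}"
      using fI by (auto simp: card_Diff_subset)
  qed
  then show ?thesis using assms(1) by (simp add: bij_betw_same_card[symmetric] n_subsets)
qed

lemma sum_over_subsets:
  fixes g :: "'i \<Rightarrow> 'a::real_vector"
  assumes "finite A" "1 \<le> b"
  shows "(\<Sum>X | X \<subseteq> A \<and> card X = b. \<Sum>i\<in>X. g i) = real ((card A - 1) choose (b - 1)) *\<^sub>R (\<Sum>i\<in>A. g i)"
proof -
  let ?M = "{X. X \<subseteq> A \<and> card X = b}"
  have fM: "finite ?M" using assms(1) by simp
  have "(\<Sum>X\<in>?M. \<Sum>i\<in>X. g i) = (\<Sum>X\<in>?M. \<Sum>i\<in>A. if i \<in> X then g i else 0)"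
  proof (rule sum.cong[OF refl])
    fix X assume "X \<in> ?M"
    then have "A \<inter> X = X" by auto
    then show "(\<Sum>i\<in>X. g i) = (\<Sum>i\<in>A. if i \<in> X then g i else 0)"
      using sum.inter_restrict[OF assms(1), of g X] by (simp only:)
  qed
  also have "\<dots> = (\<Sum>i\<in>A. \<Sum>X\<in>?M. if i \<in> X then g i else 0)" by (rule sum.swap)
  also have "\<dots> = (\<Sum>i\<in>A. real ((card A - 1) choose (b - 1)) *\<^sub>R g i)"
  proof (intro sum.cong refl)
    fix i assume i: "i \<in> A"
    have "(\<Sum>X\<in>?M. if i \<in> X then g i else 0) = real (card {X \<in> ?M. i \<in> X}) *\<^sub>R g i"
      using fM by (simp add: sum.If_cases Int_def conj_ac sum_constant_scaleR)
    also have "{X \<in> ?M. i \<in> X} = {X. X \<subseteq> A \<and> card X = b \<and> {i} \<subseteq> X \<and> X \<inter> {} = {}}" by auto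
    also have "card \<dots> = (card A - 1) choose (b - 1)"
      using card_subsets_separating[of A "{i}" "{}" b] assms i by (simp add: card_Diff_subset)
    finally show "(\<Sum>X\<in>?M. if i \<in> X then g i else 0) = real ((card A - 1) choose (b - 1)) *\<^sub>R g i" .
  qed
  finally show ?thesis by (simp add: scaleR_sum_right)
qed

lemma mean_over_subsets:
  fixes g :: "'i \<Rightarrow> 'a::real_vector"
  assumes "finite A" "1 \<le> b" "b \<le> card A"
  defines "c \<equiv> real (card {X. X \<subseteq> A \<and> card X = b})"
  shows "0 < c"
    and "(1 / c) *\<^sub>R (\<Sum>X | X \<subseteq> A \<and> card X = b. (1 / real b) *\<^sub>R (\<Sum>i\<in>X. g i))
      = (1 / real (card A)) *\<^sub>R (\<Sum>i\<in>A. g i)"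
proof -
  have c: "c = real (card A choose b)" using assms(1) by (simp add: c_def n_subsets)
  show c0: "0 < c" unfolding c using assms by (simp add: zero_less_binomial_iff)
  have "b * (card A choose b) = card A * ((card A - 1) choose (b - 1))"
    using times_binomial_minus1_eq[of b "card A"] assms by simp
  then have k: "real b * c = real (card A) * real ((card A - 1) choose (b - 1))"
    unfolding c by (metis of_nat_mult)
  have "(1 / c) *\<^sub>R (\<Sum>X | X \<subseteq> A \<and> card X = b. (1 / real b) *\<^sub>R (\<Sum>i\<in>X. g i))
      = (real ((card A - 1) choose (b - 1)) / (real b * c)) *\<^sub>R (\<Sum>i\<in>A. g i)"
    unfolding scaleR_sum_right[symmetric] sum_over_subsets[OF assms(1,2)] by (simp add: field_simps)
  also have "real ((card A - 1) choose (b - 1)) / (real b * c) = 1 / real (card A)"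
  proof -
    have "real ((card A - 1) choose (b - 1)) \<noteq> 0" using assms by (simp add: zero_less_binomial_iff)
    then show ?thesis unfolding k by simp
  qed
  finally show "(1 / c) *\<^sub>R (\<Sum>X | X \<subseteq> A \<and> card X = b. (1 / real b) *\<^sub>R (\<Sum>i\<in>X. g i))
      = (1 / real (card A)) *\<^sub>R (\<Sum>i\<in>A. g i)" .
qed

text \<open>Expanding the square, every index occurs in \<open>card A - 1 choose (b - 1)\<close> subsets and every pair of
  distinct indices in \<open>card A - 2 choose (b - 2)\<close> of them. For centred vectors the mixed products sum to
  minus the squares, so Pascal's rule leaves the stated coefficient.\<close>

lemma sum_over_subsets_norm_sq:
  fixes x :: "'i \<Rightarrow> 'a::real_inner"
  assumes "finite A" "1 \<le> b" and centred: "(\<Sum>i\<in>A. x i) = 0"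
  shows "(\<Sum>X | X \<subseteq> A \<and> card X = b. (norm (\<Sum>i\<in>X. x i))\<^sup>2)
    = real ((card A - 2) choose (b - 1)) * (\<Sum>i\<in>A. (norm (x i))\<^sup>2)"
proof -
  let ?M = "{X. X \<subseteq> A \<and> card X = b}"
  let ?c = "real ((card A - 2) choose (b - 1))"
  have fM: "finite ?M" using assms(1) by simp
  have "(norm (\<Sum>i\<in>X. x i))\<^sup>2 = (\<Sum>i\<in>A. \<Sum>j\<in>A. if i \<in> X \<and> j \<notin> X then - (x i \<bullet> x j) else 0)" if X: "X \<in> ?M" for X
  proof -
    have fX: "finite X" "X \<subseteq> A" using X assms(1) finite_subset by auto
    have "(\<Sum>j\<in>X. x j) = - (\<Sum>j\<in>A - X. x j)"
      using sum.subset_diff[OF fX(2) assms(1), of x] centred by (simp add: eq_neg_iff_add_eq_0 add.commute)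
    then have "(norm (\<Sum>i\<in>X. x i))\<^sup>2 = (\<Sum>i\<in>X. x i) \<bullet> (- (\<Sum>j\<in>A - X. x j))"
      by (simp add: power2_norm_eq_inner)
    also have "\<dots> = (\<Sum>i\<in>X. \<Sum>j\<in>A - X. - (x i \<bullet> x j))"
      unfolding inner_sum_left by (intro sum.cong refl) (simp only: inner_minus_right inner_sum_right sum_negf)
    also have "\<dots> = (\<Sum>i\<in>A. if i \<in> X then (\<Sum>j\<in>A - X. - (x i \<bullet> x j)) else 0)"
      using fX assms(1) by (simp add: sum.If_cases Int_absorb1)
    also have "\<dots> = (\<Sum>i\<in>A. \<Sum>j\<in>A. if i \<in> X \<and> j \<notin> X then - (x i \<bullet> x j) else 0)"
      using assms(1) by (intro sum.cong refl) (auto simp: sum.If_cases set_diff_eq Int_def conj_ac)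
    finally show ?thesis .
  qed
  then have "(\<Sum>X\<in>?M. (norm (\<Sum>i\<in>X. x i))\<^sup>2)
      = (\<Sum>X\<in>?M. \<Sum>i\<in>A. \<Sum>j\<in>A. if i \<in> X \<and> j \<notin> X then - (x i \<bullet> x j) else 0)" by simp
  also have "\<dots> = (\<Sum>i\<in>A. \<Sum>X\<in>?M. \<Sum>j\<in>A. if i \<in> X \<and> j \<notin> X then - (x i \<bullet> x j) else 0)"
    by (rule sum.swap)
  also have "\<dots> = (\<Sum>i\<in>A. \<Sum>j\<in>A. \<Sum>X\<in>?M. if i \<in> X \<and> j \<notin> X then - (x i \<bullet> x j) else 0)"
    by (intro sum.cong refl sum.swap)
  also have "\<dots> = (\<Sum>i\<in>A. \<Sum>j\<in>A. if i = j then 0 else - ?c * (x i \<bullet> x j))"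
  proof (intro sum.cong refl)
    fix i j assume ij: "i \<in> A" "j \<in> A"
    show "(\<Sum>X\<in>?M. if i \<in> X \<and> j \<notin> X then - (x i \<bullet> x j) else 0) = (if i = j then 0 else - ?c * (x i \<bullet> x j))"
    proof (cases "i = j")
      case False
      have "(\<Sum>X\<in>?M. if i \<in> X \<and> j \<notin> X then - (x i \<bullet> x j) else 0)
          = real (card {X \<in> ?M. i \<in> X \<and> j \<notin> X}) * (- (x i \<bullet> x j))"
        using fM by (simp add: sum.If_cases Int_def conj_ac)
      also have "{X \<in> ?M. i \<in> X \<and> j \<notin> X} = {X. X \<subseteq> A \<and> card X = b \<and> {i} \<subseteq> X \<and> X \<inter> {j} = {}}" by auto
      also have "card \<dots> = (card A - 2) choose (b - 1)"
        using card_subsets_separating[of A "{i}" "{j}" b] assms ij False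
        by (simp add: card_Diff_subset numeral_2_eq_2)
      finally show ?thesis using False by simp
    qed simp
  qed
  also have "\<dots> = (\<Sum>i\<in>A. ?c * (norm (x i))\<^sup>2)"
  proof (intro sum.cong refl)
    fix i assume i: "i \<in> A"
    have "(\<Sum>j\<in>A. if i = j then 0 else - ?c * (x i \<bullet> x j))
        = (\<Sum>j\<in>A. - ?c * (x i \<bullet> x j) + (if j = i then ?c * (x i \<bullet> x i) else 0))"
      by (intro sum.cong) auto
    also have "\<dots> = - ?c * (x i \<bullet> (\<Sum>j\<in>A. x j)) + ?c * (x i \<bullet> x i)"
    proof -
      have "(\<Sum>j\<in>A. - ?c * (x i \<bullet> x j)) = - ?c * (x i \<bullet> (\<Sum>j\<in>A. x j))"
        by (simp only: sum_distrib_left inner_sum_right)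
      moreover have "(\<Sum>j\<in>A. if j = i then ?c * (x i \<bullet> x i) else 0) = ?c * (x i \<bullet> x i)"
        using assms(1) i by simp
      ultimately show ?thesis by (simp only: sum.distrib)
    qed
    finally show "(\<Sum>j\<in>A. if i = j then 0 else - ?c * (x i \<bullet> x j)) = ?c * (norm (x i))\<^sup>2"
      using centred by (simp add: power2_norm_eq_inner)
  qed
  finally show ?thesis by (simp add: sum_distrib_left)
qed

text \<open>The variance of the mean of a uniform \<open>b\<close>-subset carries the finite-population factor
  \<open>(N - b) / (b (N - 1))\<close>. The offset \<open>a\<close> is added here because the mean deviation is zero, so that it
  contributes just its own square; in the application it is the error accumulated before.\<close>

lemma sampling_variance:
  fixes x :: "'i \<Rightarrow> 'a::real_inner"
  assumes fA: "finite A" and b: "1 \<le> b" "b \<le> card A" and A2: "2 \<le> card A"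
  defines "c \<equiv> real (card {X. X \<subseteq> A \<and> card X = b})" and "N \<equiv> real (card A)"
  shows "(1 / c) * (\<Sum>X | X \<subseteq> A \<and> card X = b.
        (norm (a + ((1 / real b) *\<^sub>R (\<Sum>i\<in>X. x i) - (1 / N) *\<^sub>R (\<Sum>i\<in>A. x i))))\<^sup>2)
      \<le> (norm a)\<^sup>2 + (N - real b) / (real b * (N - 1)) * ((1 / N) * (\<Sum>i\<in>A. (norm (x i))\<^sup>2))"
proof -
  let ?M = "{X. X \<subseteq> A \<and> card X = b}"
  define \<mu> where "\<mu> = (1 / N) *\<^sub>R (\<Sum>i\<in>A. x i)"
  define z where "z = (\<lambda>i. x i - \<mu>)"
  have N: "0 < N" "N \<ge> 2" using A2 by (auto simp: N_def)
  have fM: "finite ?M" using fA by simp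
  have An: "A \<noteq> {}" using A2 by auto
  have c0: "0 < c" unfolding c_def by (rule mean_over_subsets(1)[OF fA b])
  have z0: "(\<Sum>i\<in>A. z i) = 0" using N by (simp add: z_def sum_subtractf \<mu>_def N_def sum_constant_scaleR)
  have zX: "(1 / real b) *\<^sub>R (\<Sum>i\<in>X. x i) - \<mu> = (1 / real b) *\<^sub>R (\<Sum>i\<in>X. z i)" if "X \<in> ?M" for X
    using that b by (auto simp: z_def sum_subtractf sum_constant_scaleR scaleR_diff_right)
  have "(\<Sum>X\<in>?M. (norm (a + ((1 / real b) *\<^sub>R (\<Sum>i\<in>X. x i) - \<mu>)))\<^sup>2)
      = (\<Sum>X\<in>?M. (norm a)\<^sup>2 + 2 * (a \<bullet> ((1 / real b) *\<^sub>R (\<Sum>i\<in>X. z i))) + (1 / real b)\<^sup>2 * (norm (\<Sum>i\<in>X. z i))\<^sup>2)"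
  proof (intro sum.cong refl)
    fix X assume X: "X \<in> ?M"
    define y where "y = (1 / real b) *\<^sub>R (\<Sum>i\<in>X. z i)"
    have "(norm (a + y))\<^sup>2 = (norm a)\<^sup>2 + 2 * (a \<bullet> y) + (norm y)\<^sup>2"
      by (simp add: power2_norm_eq_inner inner_add_left inner_add_right inner_commute)
    moreover have "(norm y)\<^sup>2 = (1 / real b)\<^sup>2 * (norm (\<Sum>i\<in>X. z i))\<^sup>2"
      by (simp add: y_def power_divide)
    ultimately show "(norm (a + ((1 / real b) *\<^sub>R (\<Sum>i\<in>X. x i) - \<mu>)))\<^sup>2
      = (norm a)\<^sup>2 + 2 * (a \<bullet> ((1 / real b) *\<^sub>R (\<Sum>i\<in>X. z i))) + (1 / real b)\<^sup>2 * (norm (\<Sum>i\<in>X. z i))\<^sup>2"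
      unfolding zX[OF X] y_def by simp
  qed
  also have "\<dots> = c * (norm a)\<^sup>2 + 2 * (a \<bullet> (\<Sum>X\<in>?M. (1 / real b) *\<^sub>R (\<Sum>i\<in>X. z i)))
      + (1 / real b)\<^sup>2 * (\<Sum>X\<in>?M. (norm (\<Sum>i\<in>X. z i))\<^sup>2)"
    by (simp add: sum.distrib sum_distrib_left inner_sum_right c_def)
  also have "(\<Sum>X\<in>?M. (1 / real b) *\<^sub>R (\<Sum>i\<in>X. z i)) = 0"
    unfolding scaleR_sum_right[symmetric] sum_over_subsets[OF fA b(1)] z0 by simp
  also have "(\<Sum>X\<in>?M. (norm (\<Sum>i\<in>X. z i))\<^sup>2) = real ((card A - 2) choose (b - 1)) * (\<Sum>i\<in>A. (norm (z i))\<^sup>2)"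
    by (rule sum_over_subsets_norm_sq[OF fA b(1) z0])
  finally have E: "(\<Sum>X\<in>?M. (norm (a + ((1 / real b) *\<^sub>R (\<Sum>i\<in>X. x i) - \<mu>)))\<^sup>2)
      = c * (norm a)\<^sup>2 + (1 / real b)\<^sup>2 * (real ((card A - 2) choose (b - 1)) * (\<Sum>i\<in>A. (norm (z i))\<^sup>2))" by simp
  have zle: "(\<Sum>i\<in>A. (norm (z i))\<^sup>2) \<le> (\<Sum>i\<in>A. (norm (x i))\<^sup>2)"
    using sum_norm_sq_centered[OF fA An, of x] unfolding z_def \<mu>_def N_def by simp
  have k: "(1 / real b)\<^sup>2 * real ((card A - 2) choose (b - 1)) = c * ((N - real b) / (real b * (N - 1)) * (1 / N))"
  proof -
    have c: "c = real (card A choose b)" using fA by (simp add: c_def n_subsets)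
    have "b * (card A choose b) = card A * ((card A - 1) choose (b - 1))"
      using times_binomial_minus1_eq[of b "card A"] b by simp
    then have 1: "real b * c = N * real ((card A - 1) choose (b - 1))"
      unfolding c N_def by (metis of_nat_mult)
    have "((card A - 1) - (b - 1)) * ((card A - 1) choose (b - 1)) = (card A - 1) * ((card A - 1 - 1) choose (b - 1))"
      using binomial_absorb_comp[of "card A - 1" "b - 1"] A2 by simp
    moreover have "card A - 1 - (b - 1) = card A - b" "card A - 1 - 1 = card A - 2" using b by auto
    ultimately have "(card A - b) * ((card A - 1) choose (b - 1)) = (card A - 1) * ((card A - 2) choose (b - 1))"
      by simp
    then have "real (card A - b) * real ((card A - 1) choose (b - 1)) = real (card A - 1) * real ((card A - 2) choose (b - 1))"
      unfolding of_nat_mult[symmetric] by (rule arg_cong)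
    then have 2: "(N - real b) * real ((card A - 1) choose (b - 1)) = (N - 1) * real ((card A - 2) choose (b - 1))"
      using b A2 by (simp add: N_def of_nat_diff)
    have 3: "real ((card A - 1) choose (b - 1)) = real b * c / N" using 1 N by (simp add: field_simps)
    have "real ((card A - 2) choose (b - 1)) = (N - real b) * (real b * c / N) / (N - 1)"
      using 2 N unfolding 3 by (simp add: field_simps)
    then show ?thesis using b N by (simp only:) (simp add: divide_simps power2_eq_square)
  qed
  have "(1 / c) * (\<Sum>X\<in>?M. (norm (a + ((1 / real b) *\<^sub>R (\<Sum>i\<in>X. x i) - \<mu>)))\<^sup>2)
      = (norm a)\<^sup>2 + (N - real b) / (real b * (N - 1)) * (1 / N) * (\<Sum>i\<in>A. (norm (z i))\<^sup>2)"
    unfolding E mult.assoc[symmetric] k using c0 by (simp add: field_simps)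
  also have "\<dots> \<le> (norm a)\<^sup>2 + (N - real b) / (real b * (N - 1)) * (1 / N) * (\<Sum>i\<in>A. (norm (x i))\<^sup>2)"
    using zle b N by (intro add_left_mono mult_left_mono) (auto simp: N_def)
  finally show ?thesis unfolding \<mu>_def by (simp add: mult.assoc)
qed

section \<open>Scalar inequalities behind the epoch budget\<close>

text \<open>Polynomial inequalities on \<open>[0, 2/3]\<close> and \<open>[2/3, 1]\<close>, each certified by nonnegative coefficients in
  the Bernstein basis of the interval. The first six are themselves the Bernstein coefficients, with
  respect to the step size \<open>h\<close> in \<open>[0, 2/3]\<close>, of two budgets that depend on both variables.\<close>

lemma small_ratio_gradient_poly_0:
  fixes x :: real
  assumes "0 \<le> x" "x \<le> 2/3"
  shows "0 \<le> 38/55 - 16/55 * x - 4/5 * x^3 + 2/5 * x^4"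
proof -
  have "38/55 - 16/55 * x - 4/5 * x^3 + 2/5 * x^4
      = 1539/440 * (2/3 - x)^4 + 1431/110 * (x * (2/3 - x)^3) + 3969/220 * (x^2 * (2/3 - x)^2) + 1083/110 * (x^3 * (2/3 - x)) + 151/88 * x^4"
    by (simp add: power_numeral_reduce field_simps)
  also have "0 \<le> \<dots>" using assms by (intro add_nonneg_nonneg mult_nonneg_nonneg zero_le_power) auto
  finally show ?thesis .
qed

lemma small_ratio_gradient_poly_1:
  fixes x :: real
  assumes "0 \<le> x" "x \<le> 2/3"
  shows "0 \<le> 38/55 - 16/55 * x + 14/33 * x^2 - 202/165 * x^3 + 2/5 * x^4"
proof -
  have "38/55 - 16/55 * x + 14/33 * x^2 - 202/165 * x^3 + 2/5 * x^4
      = 1539/440 * (2/3 - x)^4 + 1431/110 * (x * (2/3 - x)^3) + 4179/220 * (x^2 * (2/3 - x)^2) + 1223/110 * (x^3 * (2/3 - x)) + 179/88 * x^4"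
    by (simp add: power_numeral_reduce field_simps)
  also have "0 \<le> \<dots>" using assms by (intro add_nonneg_nonneg mult_nonneg_nonneg zero_le_power) auto
  finally show ?thesis .
qed

lemma small_ratio_gradient_poly_2:
  fixes x :: real
  assumes "0 \<le> x" "x \<le> 2/3"
  shows "0 \<le> 158/165 - 892/495 * x + 728/495 * x^2 - 272/165 * x^3 + 2/5 * x^4"
proof -
  have "158/165 - 892/495 * x + 728/495 * x^2 - 272/165 * x^3 + 2/5 * x^4
      = 2133/440 * (2/3 - x)^4 + 732/55 * (x * (2/3 - x)^3) + 283/20 * (x^2 * (2/3 - x)^2) + 291/55 * (x^3 * (2/3 - x)) + 1/440 * x^4"
    by (simp add: power_numeral_reduce field_simps)
  also have "0 \<le> \<dots>" using assms by (intro add_nonneg_nonneg mult_nonneg_nonneg zero_le_power) auto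
  finally show ?thesis .
qed

lemma small_ratio_deviation_poly_0:
  fixes x :: real
  assumes "0 \<le> x" "x \<le> 2/3"
  shows "0 \<le> 13/55 - 13/55 * x + 2/5 * x^2 - 2/5 * x^3"
proof -
  have "13/55 - 13/55 * x + 2/5 * x^2 - 2/5 * x^3
      = 1053/880 * (2/3 - x)^4 + 351/88 * (x * (2/3 - x)^3) + 1251/220 * (x^2 * (2/3 - x)^2) + 1581/440 * (x^3 * (2/3 - x)) + 123/176 * x^4"
    by (simp add: power_numeral_reduce field_simps)
  also have "0 \<le> \<dots>" using assms by (intro add_nonneg_nonneg mult_nonneg_nonneg zero_le_power) auto
  finally show ?thesis .
qed

lemma small_ratio_deviation_poly_1:
  fixes x :: real
  assumes "0 \<le> x" "x \<le> 2/3"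
  shows "0 \<le> 48/55 - 48/55 * x + 2/5 * x^2 - 2/5 * x^3"
proof -
  have "48/55 - 48/55 * x + 2/5 * x^2 - 2/5 * x^3
      = 243/55 * (2/3 - x)^4 + 162/11 * (x * (2/3 - x)^3) + 2043/110 * (x^2 * (2/3 - x)^2) + 552/55 * (x^3 * (2/3 - x)) + 39/22 * x^4"
    by (simp add: power_numeral_reduce field_simps)
  also have "0 \<le> \<dots>" using assms by (intro add_nonneg_nonneg mult_nonneg_nonneg zero_le_power) auto
  finally show ?thesis .
qed

lemma small_ratio_deviation_poly_2:
  fixes x :: real
  assumes "0 \<le> x" "x \<le> 2/3"
  shows "0 \<le> 1396/495 - 568/165 * x - 2/9 * x^2 - 32/45 * x^3 + 28/45 * x^4"
proof -
  have "1396/495 - 568/165 * x - 2/9 * x^2 - 32/45 * x^3 + 28/45 * x^4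
      = 3141/220 * (2/3 - x)^4 + 2502/55 * (x * (2/3 - x)^3) + 2767/55 * (x^2 * (2/3 - x)^2) + 3331/165 * (x^3 * (2/3 - x)) + 679/396 * x^4"
    by (simp add: power_numeral_reduce field_simps)
  also have "0 \<le> \<dots>" using assms by (intro add_nonneg_nonneg mult_nonneg_nonneg zero_le_power) auto
  finally show ?thesis .
qed

lemma large_ratio_direction_poly:
  fixes x :: real
  assumes "2/3 \<le> x" "x \<le> 1"
  shows "0 \<le> - 69/65 + 887/260 * x + 139/130 * x^2 - 1277/260 * x^3 + 3/2 * x^4"
proof -
  have "- 69/65 + 887/260 * x + 139/130 * x^2 - 1277/260 * x^3 + 3/2 * x^4
      = 5571/130 * (1 - x)^4 + 45033/260 * ((x - 2/3) * (1 - x)^3) + 57123/260 * ((x - 2/3)^2 * (1 - x)^2) + 5751/65 * ((x - 2/3)^3 * (1 - x)) + 81/130 * (x - 2/3)^4"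
    by (simp add: power_numeral_reduce field_simps)
  also have "0 \<le> \<dots>" using assms by (intro add_nonneg_nonneg mult_nonneg_nonneg zero_le_power) auto
  finally show ?thesis .
qed

lemma large_ratio_growth_poly:
  fixes x :: real
  assumes "2/3 \<le> x" "x \<le> 1"
  shows "0 \<le> - 3 - 17/3 * x + 23/2 * x^2 + 17/3 * x^3"
proof -
  have "- 3 - 17/3 * x + 23/2 * x^2 + 17/3 * x^3
      = 1/3 * (1 - x)^3 + 156 * ((x - 2/3) * (1 - x)^2) + 759/2 * ((x - 2/3)^2 * (1 - x)) + 459/2 * (x - 2/3)^3"
    by (simp add: power_numeral_reduce field_simps)
  also have "0 \<le> \<dots>" using assms by (intro add_nonneg_nonneg mult_nonneg_nonneg zero_le_power) auto
  finally show ?thesis .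
qed

lemma large_ratio_length_poly:
  fixes x :: real
  assumes "2/3 \<le> x" "x \<le> 1"
  shows "0 \<le> - 20 + 20 * x + 1535/54 * x^2 - 20 * x^3"
proof -
  have "- 20 + 20 * x + 1535/54 * x^2 - 20 * x^3
      = 10/9 * (1 - x)^3 + 2560/9 * ((x - 2/3) * (1 - x)^2) + 3185/6 * ((x - 2/3)^2 * (1 - x)) + 455/2 * (x - 2/3)^3"
    by (simp add: power_numeral_reduce field_simps)
  also have "0 \<le> \<dots>" using assms by (intro add_nonneg_nonneg mult_nonneg_nonneg zero_le_power) auto
  finally show ?thesis .
qed

lemma quarter_bound: "x * (1 - x) \<le> (1/4 :: real)"
proof -
  have "0 \<le> (x - 1/2)\<^sup>2" by simp
  then show ?thesis by (simp add: power2_eq_square algebra_simps)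
qed

text \<open>Bernstein form of a quadratic on \<open>[0, 2/3]\<close>; the factor \<open>9/4\<close> normalises the interval length.\<close>

lemma bernstein_quadratic_nonneg:
  fixes h :: real
  assumes "0 \<le> p0" "0 \<le> p1" "0 \<le> p2" "0 \<le> h" "h \<le> 2/3"
  shows "0 \<le> 9/4 * (p0 * (2/3 - h)^2 + 2 * p1 * (h * (2/3 - h)) + p2 * h^2)"
proof -
  have "0 \<le> p0 * (2/3 - h)^2" "0 \<le> 2 * p1 * (h * (2/3 - h))" "0 \<le> p2 * h^2"
    using assms by simp_all
  then show ?thesis by simp
qed

text \<open>For ratios up to \<open>2/3\<close>: the total coefficient of \<open>\<parallel>v 0\<parallel>\<^sup>2\<close> collected over an epoch stays within
  \<open>2 + 4 h\<^sup>2\<close>. The numbers \<open>7/5\<close>, \<open>10/11\<close> and \<open>2/5\<close> come from the weights chosen in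
  \<open>mapping_bound_small_ratio\<close>.\<close>

lemma small_ratio_budget_gradient:
  fixes x h :: real
  assumes x: "0 \<le> x" "x \<le> 2/3" and h: "0 \<le> h" "h \<le> 2/3"
  defines "z \<equiv> 7/5 * h"
  shows "(1 - z) * (10/11) + 2/5 * ((1 - x)\<^sup>2 * (1 + x)) + z * (10/11) * (1 - x\<^sup>2)
    + 7/5 * h\<^sup>2 * ((1 + x) * (1 + 1 / (2 * (1 - x)))) + 13/10 * h\<^sup>2 \<le> 2 + 4 * h\<^sup>2"
proof -
  define r where "r = 1 + 1 / (2 * (1 - x))"
  have u: "0 < 1 - x" using x by simp
  have ur: "(1 - x) * r = 3/2 - x" using u by (simp add: r_def field_simps)
  define D where "D = 2 + 4 * h\<^sup>2 - ((1 - z) * (10/11) + 2/5 * ((1 - x)\<^sup>2 * (1 + x)) + z * (10/11) * (1 - x\<^sup>2)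
    + 7/5 * h\<^sup>2 * ((1 + x) * r) + 13/10 * h\<^sup>2)"
  have "(1 - x) * D = (1 - x) * (2 + 4 * h\<^sup>2 - ((1 - z) * (10/11) + 2/5 * ((1 - x)\<^sup>2 * (1 + x)) + z * (10/11) * (1 - x\<^sup>2)
    + 13/10 * h\<^sup>2)) - 7/5 * h\<^sup>2 * (1 + x) * ((1 - x) * r)"
    unfolding D_def by algebra
  also have "\<dots> = 9/4 * ((38/55 - 16/55 * x - 4/5 * x^3 + 2/5 * x^4) * (2/3 - h)^2 + 2 * (38/55 - 16/55 * x + 14/33 * x^2 - 202/165 * x^3 + 2/5 * x^4) * (h * (2/3 - h)) + (158/165 - 892/495 * x + 728/495 * x^2 - 272/165 * x^3 + 2/5 * x^4) * h^2)"
    unfolding ur z_def by (simp add: power_numeral_reduce field_simps)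
  also have "0 \<le> \<dots>"
    by (rule bernstein_quadratic_nonneg[OF small_ratio_gradient_poly_0[OF x] small_ratio_gradient_poly_1[OF x] small_ratio_gradient_poly_2[OF x] h])
  finally have "0 \<le> D" using u by (simp add: zero_le_mult_iff)
  then show ?thesis by (simp add: D_def r_def)
qed

text \<open>The companion of \<open>small_ratio_budget_gradient\<close> for the coefficient of the excess of \<open>\<parallel>d 0\<parallel>\<^sup>2\<close>.\<close>

lemma small_ratio_budget_deviation:
  fixes x h :: real
  assumes x: "0 \<le> x" "x \<le> 2/3" and h: "0 \<le> h" "h \<le> 2/3"
  defines "z \<equiv> 7/5 * h"
  shows "3/2 * ((1 - z) * (10/11)) + 2/5 * (1 - x\<^sup>2)
    + 7/5 * h\<^sup>2 * ((1 + x) * (1 + 1 / (2 * (1 - x))) * (1/2 + x\<^sup>2)) \<le> 2 + 4 * h\<^sup>2"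
proof -
  define r where "r = 1 + 1 / (2 * (1 - x))"
  have u: "0 < 1 - x" using x by simp
  have ur: "(1 - x) * r = 3/2 - x" using u by (simp add: r_def field_simps)
  define D where "D = 2 + 4 * h\<^sup>2 - (3/2 * ((1 - z) * (10/11)) + 2/5 * (1 - x\<^sup>2)
    + 7/5 * h\<^sup>2 * ((1 + x) * r * (1/2 + x\<^sup>2)))"
  have "(1 - x) * D = (1 - x) * (2 + 4 * h\<^sup>2 - (3/2 * ((1 - z) * (10/11)) + 2/5 * (1 - x\<^sup>2)))
      - 7/5 * h\<^sup>2 * (1 + x) * (1/2 + x\<^sup>2) * ((1 - x) * r)"
    unfolding D_def by algebra
  also have "\<dots> = 9/4 * ((13/55 - 13/55 * x + 2/5 * x^2 - 2/5 * x^3) * (2/3 - h)^2 + 2 * (48/55 - 48/55 * x + 2/5 * x^2 - 2/5 * x^3) * (h * (2/3 - h)) + (1396/495 - 568/165 * x - 2/9 * x^2 - 32/45 * x^3 + 28/45 * x^4) * h^2)"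
    unfolding ur z_def by (simp add: power_numeral_reduce field_simps)
  also have "0 \<le> \<dots>"
    by (rule bernstein_quadratic_nonneg[OF small_ratio_deviation_poly_0[OF x] small_ratio_deviation_poly_1[OF x] small_ratio_deviation_poly_2[OF x] h])
  finally have "0 \<le> D" using u by (simp add: zero_le_mult_iff)
  then show ?thesis by (simp add: D_def r_def)
qed

text \<open>The last estimator is weighted by a factor of order \<open>N\<close>, which the power of \<open>x\<close> compensates:
  passing from \<open>N\<close> to \<open>N + 1\<close> multiplies the left-hand side by at most one from \<open>N = 3\<close> on, and the
  smaller cases follow from \<open>x (1 - x) \<le> 1/4\<close>.\<close>

lemma small_ratio_budget_last:
  fixes x :: real
  assumes x: "0 \<le> x" "x \<le> 2/3" and N: "1 \<le> N"
  shows "28 * real N * (real N + 3) / (real N + 24) * (x ^ N * ((1 - x)\<^sup>2 * (1 + x))) \<le> 13/10"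
proof -
  let ?c = "\<lambda>N. 28 * real N * (real N + 3) / (real N + 24)"
  let ?P = "(1 - x)\<^sup>2 * (1 + x)"
  have P0: "0 \<le> ?P" using x by simp
  have q: "x * (1 - x) \<le> 1/4" "0 \<le> x * (1 - x)" using quarter_bound[of x] x by auto
  have s1: "(1 - x) * (1 + x) \<le> 1" using x by (simp add: algebra_simps)
  have s2: "(x * (1 - x)) * (x * (1 - x)) \<le> 1/16" using mult_mono[OF q(1) q(1)] q(2) by simp
  have one: "x * ?P \<le> 1/4"
  proof -
    have "x * ?P = (x * (1 - x)) * ((1 - x) * (1 + x))" by (simp add: power2_eq_square)
    also have "\<dots> \<le> 1/4 * 1" using q s1 x by (intro mult_mono) auto
    finally show ?thesis by simp
  qed
  have two: "x ^ 2 * ?P \<le> 1/16 * (5/3)"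
  proof -
    have "x ^ 2 * ?P = ((x * (1 - x)) * (x * (1 - x))) * (1 + x)" by (simp add: power2_eq_square)
    also have "\<dots> \<le> 1/16 * (5/3)" using s2 x by (intro mult_mono) auto
    finally show ?thesis .
  qed
  have three: "x ^ 3 * ?P \<le> 1/16 * (5/3) * (2/3)"
  proof -
    have "x ^ 3 * ?P = (x ^ 2 * ?P) * x" by (simp add: power_numeral_reduce)
    also have "\<dots> \<le> 1/16 * (5/3) * (2/3)" using two x P0 by - (rule mult_mono, auto)
    finally show ?thesis .
  qed
  have large: "?c N * (x ^ N * ?P) \<le> 13/10" if "3 \<le> N" for N
    using that
  proof (induction N rule: dec_induct)
    case base
    show ?case using three by simp
  next
    case (step k)
    have "?c (Suc k) * x \<le> ?c (Suc k) * (2/3)" using x by (intro mult_left_mono) auto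
    also have "\<dots> \<le> ?c k"
    proof -
      define y where "y = real k - 3"
      have y: "0 \<le> y" "real k = y + 3" using step.hyps by (auto simp: y_def)
      have "2 * (real k + 1) * (real k + 4) * (real k + 24) \<le> 3 * real k * (real k + 3) * (real k + 25)"
        unfolding y(2) using y(1) by (simp add: algebra_simps add_nonneg_nonneg)
      then show ?thesis using y by (simp add: divide_simps) (simp add: algebra_simps)
    qed
    finally have "?c (Suc k) * x * (x ^ k * ?P) \<le> ?c k * (x ^ k * ?P)"
      using x P0 by (intro mult_right_mono) auto
    moreover have "?c (Suc k) * (x ^ Suc k * ?P) = ?c (Suc k) * x * (x ^ k * ?P)" by (simp only: power_Suc mult_ac)
    ultimately show ?case using step.IH by linarith
  qed
  consider "N = 1" | "N = 2" | "3 \<le> N" using N by linarith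
  then show ?thesis
  proof cases
    case 1
    have "28 * real N * (real N + 3) / (real N + 24) * (x ^ N * ?P) = 112/25 * (x * ?P)" by (simp add: 1)
    then show ?thesis using one by linarith
  next
    case 2
    then show ?thesis using two by simp
  next
    case 3
    then show ?thesis by (rule large)
  qed
qed

text \<open>For a ratio above \<open>2/3\<close> the contraction condition forces an epoch of length at least about twenty,
  and longer epochs as \<open>x\<close> tends to one. Bernoulli's inequality for \<open>1 / x\<close> then bounds the power
  \<open>x ^ (N div 9)\<close> by \<open>1 / (1 + y)\<close> with \<open>y = (N div 9) (1 - x) / x\<close>, and the length condition bounds \<open>y\<close>
  from below, so that discarding the first ninth of the epoch gains a factor \<open>3/5\<close>.\<close>

lemma large_ratio_geometry:
  fixes x :: real
  assumes x: "2/3 < x" "x < 1"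
    and N: "17/2 * (x\<^sup>2 / ((1 - x)\<^sup>2 * (1 + x))) \<le> real N + 3"
  defines "\<zeta> \<equiv> x ^ (N div 9)"
  shows "18 \<le> N" and "\<zeta> \<le> 3/5"
    and "3/2 * (\<zeta> * ((1 + x) * (1 + 1 / (2 * (1 - x))))) \<le> 23/5"
    and "20 * real N * (x ^ N * ((1 - x)\<^sup>2 * (1 + x))) \<le> 81/50"
proof -
  define u where "u = 1 - x"
  have u: "0 < u" "u \<le> 1/3" "x = 1 - u" using x by (auto simp: u_def)
  have xx: "2/3 \<le> x" "x \<le> 1" using x by auto
  have N': "17/2 * x\<^sup>2 \<le> (real N + 3) * (u\<^sup>2 * (1 + x))"
  proof -
    define p where "p = u\<^sup>2 * (1 + x)"
    have p: "0 < p" using u x by (simp add: p_def)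
    have "17/2 * (x\<^sup>2 / p) \<le> real N + 3" using N by (simp only: p_def u_def)
    then have "17/2 * (x\<^sup>2 / p) * p \<le> (real N + 3) * p" using p by (intro mult_right_mono) auto
    moreover have "17/2 * (x\<^sup>2 / p) * p = 17/2 * x\<^sup>2" using p by simp
    ultimately show ?thesis by (simp only: p_def)
  qed
  have "20 * (u\<^sup>2 * (1 + x)) < 17/2 * x\<^sup>2"
  proof -
    have "2/27 * x ^ 2 \<le> 17/2 * x\<^sup>2 - 20 * (u\<^sup>2 * (1 + x))"
      using large_ratio_length_poly[OF xx] by (simp add: u_def power_numeral_reduce algebra_simps)
    moreover have "0 < 2/27 * x ^ 2" using x by simp
    ultimately show ?thesis by linarith
  qed
  with N' have "20 * (u\<^sup>2 * (1 + x)) < (real N + 3) * (u\<^sup>2 * (1 + x))" by linarith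
  then have "20 < real N + 3" using u x by (simp add: mult_less_cancel_right)
  then show N18: "18 \<le> N" by linarith
  define K where "K = N div 9"
  have "N mod 9 < 9" "N = 9 * K + N mod 9" unfolding K_def by simp_all
  moreover have K2: "2 \<le> K" using N18 unfolding K_def by linarith
  ultimately have NK: "9 * K \<le> N" "N \<le> 13 * K" by linarith+
  define y where "y = real K * u / x"
  have xK: "\<zeta> * (1 + y) \<le> 1"
  proof -
    have "1 + real K * (u / x) \<le> (1 + u / x) ^ K"
      using u x by (intro Bernoulli_inequality) (auto intro: order_trans[of _ 0])
    moreover have "1 + u / x = 1 / x" using x by (simp add: u_def field_simps)
    ultimately have "1 + y \<le> (1 / x) ^ K" by (simp add: y_def)
    then have "x ^ K * (1 + y) \<le> x ^ K * (1 / x) ^ K" using x by (intro mult_left_mono) auto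
    also have "\<dots> = 1" using x by (simp add: power_mult_distrib[symmetric])
    finally show ?thesis by (simp add: \<zeta>_def K_def)
  qed
  have \<zeta>0: "0 < \<zeta>" using x by (simp add: \<zeta>_def)
  have y0: "0 < y" using K2 u x by (simp add: y_def)
  have Ny: "real N \<le> 13 * real K" using NK(2) by linarith
  have yl: "17/2 * x\<^sup>2 - 3 * (u\<^sup>2 * (1 + x)) \<le> 13 * y * (x * u * (1 + x))"
  proof -
    have "13 * y * (x * u * (1 + x)) = 13 * real K * (u\<^sup>2 * (1 + x))"
      using x by (simp add: y_def power2_eq_square)
    moreover have "real N * (u\<^sup>2 * (1 + x)) \<le> 13 * real K * (u\<^sup>2 * (1 + x))"
      using Ny u x by (intro mult_right_mono) auto
    ultimately show ?thesis using N' by (simp add: algebra_simps)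
  qed
  have y23: "2/3 \<le> y"
  proof -
    have "26/3 * (x * u * (1 + x)) \<le> 17/2 * x\<^sup>2 - 3 * (u\<^sup>2 * (1 + x))"
    proof -
      have "17/2 * x\<^sup>2 - 3 * (u\<^sup>2 * (1 + x)) - 26/3 * (x * u * (1 + x)) = - 3 - 17/3 * x + 23/2 * x^2 + 17/3 * x^3"
        by (simp add: u_def power_numeral_reduce field_simps)
      then show ?thesis using large_ratio_growth_poly[OF xx] by linarith
    qed
    with yl have "26/3 * (x * u * (1 + x)) \<le> 13 * y * (x * u * (1 + x))" by linarith
    moreover have "0 < x * u * (1 + x)" using u(1) x by simp
    ultimately have "26/3 \<le> 13 * y" by (rule mult_right_le_imp_le)
    then show ?thesis by simp
  qed
  show \<zeta>35: "\<zeta> \<le> 3/5"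
  proof -
    have "\<zeta> * (5/3) \<le> \<zeta> * (1 + y)" using y23 \<zeta>0 by (intro mult_left_mono) auto
    then show ?thesis using xK by linarith
  qed
  have inv: "\<zeta> \<le> 1 / (1 + y)" using xK y0 by (simp add: field_simps)
  show "3/2 * (\<zeta> * ((1 + x) * (1 + 1 / (2 * (1 - x))))) \<le> 23/5"
  proof -
    have "3/2 * ((1 + x) * (u + 1/2)) \<le> 23/5 * (u * (1 + y))"
    proof -
      have "3/2 * ((1 + x) * (u + 1/2)) * (x * (1 + x)) \<le> 23/5 * (u * (x * (1 + x))) + 23/65 * (17/2 * x\<^sup>2 - 3 * (u\<^sup>2 * (1 + x)))"
      proof -
        have "23/5 * (u * (x * (1 + x))) + 23/65 * (17/2 * x\<^sup>2 - 3 * (u\<^sup>2 * (1 + x)))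
            - 3/2 * ((1 + x) * (u + 1/2)) * (x * (1 + x)) = - 69/65 + 887/260 * x + 139/130 * x^2 - 1277/260 * x^3 + 3/2 * x^4"
          by (simp add: u_def power_numeral_reduce field_simps)
        then show ?thesis using large_ratio_direction_poly[OF xx] by linarith
      qed
      also have "\<dots> \<le> 23/5 * (u * (x * (1 + x))) + 23/65 * (13 * y * (x * u * (1 + x)))"
        using mult_left_mono[OF yl, of "23/65"] by linarith
      also have "\<dots> = 23/5 * (u * (1 + y)) * (x * (1 + x))" by (simp add: algebra_simps)
      finally show ?thesis by (rule mult_right_le_imp_le) (use x in auto)
    qed
    moreover have "(1 + 1 / (2 * u)) * u = u + 1/2" using u(1) by (simp add: field_simps)
    then have "3/2 * ((1 + x) * (1 + 1 / (2 * u))) * u = 3/2 * ((1 + x) * (u + 1/2))"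
      by (simp only: mult.assoc)
    ultimately have "3/2 * ((1 + x) * (1 + 1 / (2 * u))) * u \<le> 23/5 * (1 + y) * u"
      by (simp only: mult_ac)
    then have "3/2 * ((1 + x) * (1 + 1 / (2 * u))) \<le> 23/5 * (1 + y)"
      using u(1) by (rule mult_right_le_imp_le)
    then have "\<zeta> * (3/2 * ((1 + x) * (1 + 1 / (2 * u)))) \<le> \<zeta> * (23/5 * (1 + y))"
      using \<zeta>0 by (intro mult_left_mono) auto
    also have "\<dots> = 23/5 * (\<zeta> * (1 + y))" by (simp only: mult_ac)
    also have "\<dots> \<le> 23/5" using mult_left_mono[OF xK, of "23/5"] by simp
    finally show ?thesis by (simp add: u_def mult_ac)
  qed
  show "20 * real N * (x ^ N * ((1 - x)\<^sup>2 * (1 + x))) \<le> 81/50"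
  proof -
    have "x ^ N \<le> x ^ (9 * K)" using x NK by (intro power_decreasing) auto
    also have "\<dots> = \<zeta> ^ 9" 
      unfolding \<zeta>_def K_def[symmetric] power_mult[symmetric] by (simp only: mult.commute)
    also have "\<dots> = \<zeta> * \<zeta> ^ 8" by (simp add: power_numeral_reduce)
    finally have xN: "x ^ N \<le> \<zeta> * \<zeta> ^ 8" .
    have "\<zeta> * y \<le> 1" using xK \<zeta>0 by (simp add: algebra_simps)
    then have Kx: "real K * \<zeta> * u \<le> x" using x by (simp add: y_def field_simps)
    have "real N * x ^ N \<le> (13 * real K) * (\<zeta> * \<zeta> ^ 8)"
      using Ny xN x by (intro mult_mono) auto
    then have "real N * x ^ N * (u\<^sup>2 * (1 + x)) \<le> (13 * real K) * (\<zeta> * \<zeta> ^ 8) * (u\<^sup>2 * (1 + x))"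
      using x by (intro mult_right_mono) auto
    also have "\<dots> = 13 * (real K * \<zeta> * u) * (\<zeta> ^ 8 * (u * (1 + x)))" by (simp add: power2_eq_square)
    also have "\<dots> \<le> 13 * x * (\<zeta> ^ 8 * (u * (1 + x)))"
      using Kx u x \<zeta>0 by (intro mult_right_mono) auto
    also have "\<dots> = 13 * \<zeta> ^ 8 * (x * (u * (1 + x)))" by simp
    also have "\<dots> \<le> 13 * (3/5) ^ 8 * (10/27)"
    proof (intro mult_mono)
      show "\<zeta> ^ 8 \<le> (3/5) ^ 8" using \<zeta>35 \<zeta>0 by (intro power_mono) auto
      have "0 \<le> (x - 2/3) * (x * x + 2/3 * x - 5/9)"
      proof (intro mult_nonneg_nonneg)
        have "2/3 * (2/3) \<le> x * x" using xx by (intro mult_mono) auto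
        then show "0 \<le> x * x + 2/3 * x - 5/9" using xx by linarith
      qed (use xx in simp)
      also have "(x - 2/3) * (x * x + 2/3 * x - 5/9) = 10/27 - x * (u * (1 + x))"
        by (simp add: u_def field_simps)
      finally show "x * (u * (1 + x)) \<le> 10/27" by simp
    qed (use u x \<zeta>0 in auto)
    finally have A: "real N * x ^ N * (u\<^sup>2 * (1 + x)) \<le> 13 * (3/5) ^ 8 * (10/27)" .
    have "20 * real N * (x ^ N * (u\<^sup>2 * (1 + x))) = 20 * (real N * x ^ N * (u\<^sup>2 * (1 + x)))"
      by (simp only: mult.assoc)
    also have "\<dots> \<le> 20 * (13 * (3/5) ^ 8 * (10/27))" by (rule mult_left_mono[OF A]) simp
    also have "\<dots> \<le> 81/50" by (simp add: power_numeral_reduce)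
    finally show ?thesis by (simp only: u_def)
  qed
qed

text \<open>The two budgets for ratios above \<open>2/3\<close>. They are affine in the quantities estimated by
  \<open>large_ratio_geometry\<close>, and \<open>h\<^sup>2 \<le> 2/3 * h\<close> makes the remaining inequality in \<open>h\<close> linear.\<close>

lemma large_ratio_budget_gradient:
  fixes x h \<zeta> :: real
  assumes x: "2/3 \<le> x" "x \<le> 1" and h: "0 \<le> h" "h \<le> 2/3" and \<zeta>: "0 \<le> \<zeta>" "\<zeta> \<le> 3/5"
    and F: "3/2 * (\<zeta> * Y) \<le> 23/5" and W: "W \<le> 81/50"
  defines "z \<equiv> 3/2 * h"
  shows "5/4 - 163/200 * z + 5/4 * z * (\<zeta> * (1 - x\<^sup>2)) + 3/2 * h\<^sup>2 * (\<zeta> * Y) + h\<^sup>2 * W \<le> 2 + 4 * h\<^sup>2"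
proof -
  have "1 - x\<^sup>2 \<le> 5/9" using mult_mono[OF x(1) x(1)] x by (simp add: power2_eq_square)
  moreover have "0 \<le> 1 - x\<^sup>2" using x by (simp add: power_le_one)
  ultimately have "\<zeta> * (1 - x\<^sup>2) \<le> 3/5 * (5/9)" using \<zeta> by (intro mult_mono) auto
  then have "5/4 * z * (\<zeta> * (1 - x\<^sup>2)) \<le> 5/4 * z * (1/3)" using h by (intro mult_left_mono) (auto simp: z_def)
  moreover have "h\<^sup>2 * (3/2 * (\<zeta> * Y)) \<le> h\<^sup>2 * (23/5)" by (intro mult_left_mono F) simp
  moreover have "h\<^sup>2 * W \<le> h\<^sup>2 * (81/50)" by (intro mult_left_mono W) simp
  moreover have "h\<^sup>2 \<le> 2/3 * h" using mult_right_mono[OF h(2,1)] by (simp add: power2_eq_square)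
  moreover have "3/2 * h\<^sup>2 * (\<zeta> * Y) = h\<^sup>2 * (3/2 * (\<zeta> * Y))" by simp
  moreover have "z = 3/2 * h" by (simp add: z_def)
  ultimately show ?thesis using h by linarith
qed

lemma large_ratio_budget_deviation:
  fixes x h \<zeta> :: real
  assumes x: "2/3 \<le> x" "x \<le> 1" and h: "0 \<le> h" "h \<le> 2/3" and \<zeta>: "0 \<le> \<zeta>" "\<zeta> \<le> 3/5"
    and F: "3/2 * (\<zeta> * Y) \<le> 23/5"  "0 \<le> Y"
  defines "z \<equiv> 3/2 * h"
  shows "3/2 * (5/4 - 163/200 * z) + 3/2 * h\<^sup>2 * (\<zeta> * Y * (1/2 + \<zeta> * x\<^sup>2)) \<le> 2 + 4 * h\<^sup>2"
proof -
  have "\<zeta> * x\<^sup>2 \<le> 3/5 * 1" using \<zeta> x by (intro mult_mono) (auto simp: power_le_one)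
  then have "3/2 * (\<zeta> * Y) * (1/2 + \<zeta> * x\<^sup>2) \<le> 23/5 * (11/10)"
    using F(1) \<zeta> F(2) by (intro mult_mono) auto
  then have "h\<^sup>2 * (3/2 * (\<zeta> * Y) * (1/2 + \<zeta> * x\<^sup>2)) \<le> h\<^sup>2 * (253/50)" by (intro mult_left_mono) auto
  moreover have "h\<^sup>2 \<le> 2/3 * h" using mult_right_mono[OF h(2,1)] by (simp add: power2_eq_square)
  ultimately show ?thesis unfolding z_def using h by (simp add: algebra_simps)
qed

lemma power_times_exponent_le:
  fixes x :: real
  assumes "0 \<le> x" "x < 1"
  shows "real (Suc k) * x ^ k * (1 - x) \<le> 1"
proof -
  have "real (Suc k) * x ^ k = (\<Sum>i<Suc k. x ^ k)" by simp
  also have "\<dots> \<le> (\<Sum>i<Suc k. x ^ i)" using assms by (intro sum_mono power_decreasing) auto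
  finally have "real (Suc k) * x ^ k * (1 - x) \<le> (\<Sum>i<Suc k. x ^ i) * (1 - x)"
    using assms by (intro mult_right_mono) auto
  also have "\<dots> = 1 - x ^ Suc k" by (metis mult.commute one_diff_power_eq)
  finally show ?thesis using assms by (smt (verit) zero_le_power)
qed

lemma final_gradient_budget:
  fixes x :: real
  assumes "0 \<le> x" "x < 1" "2 \<le> m"
  shows "(real m + 1) * (x ^ (m - 2) * ((1 - x)\<^sup>2 * (1 + x))) \<le> 3"
proof -
  define k where "k = m - 2"
  have m: "m = k + 2" using assms(3) by (simp add: k_def)
  have "(real m + 1) * (x ^ k * ((1 - x)\<^sup>2 * (1 + x))) \<le> (3 * real (Suc k)) * (x ^ k * ((1 - x)\<^sup>2 * (1 + x)))"
    using assms m by (intro mult_right_mono) auto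
  also have "\<dots> = 3 * (real (Suc k) * x ^ k * (1 - x)) * ((1 - x) * (1 + x))" by (simp only: power2_eq_square mult_ac)
  also have "\<dots> \<le> 3 * 1 * 1"
  proof (rule mult_mono)
    show "3 * (real (Suc k) * x ^ k * (1 - x)) \<le> 3 * 1"
      using power_times_exponent_le[OF assms(1,2), of k] by simp
    show "(1 - x) * (1 + x) \<le> 1" using zero_le_square[of x] by (simp add: algebra_simps)
  qed (use assms in auto)
  finally show ?thesis by (simp add: k_def)
qed

lemma geometric_tail:
  fixes x :: real
  assumes "0 \<le> x" "x < 1"
  shows "(\<Sum>k=a..<n. x ^ k) \<le> x ^ a / (1 - x)"
    and "(\<Sum>k=a..<n. real (k + 1 - a) * x ^ k) \<le> x ^ a / (1 - x)\<^sup>2"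
proof -
  have 1: "(1 - x) * (\<Sum>k<n. x ^ k) \<le> 1" for n
    using one_diff_power_eq[of x n] zero_le_power[OF assms(1), of n] by linarith
  have 2: "(1 - x)\<^sup>2 * (\<Sum>k<n. real (k + 1) * x ^ k) = 1 - real (n + 1) * x ^ n + real n * x ^ Suc n" for n
    by (induction n) (simp_all add: power2_eq_square algebra_simps)
  have 3: "(1 - x)\<^sup>2 * (\<Sum>k<n. real (k + 1) * x ^ k) \<le> 1" for n
  proof -
    have "real n * x ^ Suc n \<le> real n * x ^ n" using assms by (intro mult_left_mono power_decreasing) auto
    moreover have "0 \<le> x ^ n" using assms by simp
    ultimately show ?thesis unfolding 2 by (simp add: algebra_simps)
  qed
  have s: "(\<Sum>k=a..<n. g (k - a) * x ^ k) = x ^ a * (\<Sum>k<n - a. g k * x ^ k)" for g :: "nat \<Rightarrow> real"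
  proof (cases "a \<le> n")
    case True
    have "(\<Sum>k=a..<n. g (k - a) * x ^ k) = (\<Sum>k=0 + a..<(n - a) + a. g (k - a) * x ^ k)" using True by simp
    also have "\<dots> = (\<Sum>k=0..<n - a. g k * x ^ (k + a))"
      unfolding sum.shift_bounds_nat_ivl by simp
    finally show ?thesis by (simp add: power_add sum_distrib_left atLeast0LessThan mult_ac)
  qed simp
  show "(\<Sum>k=a..<n. x ^ k) \<le> x ^ a / (1 - x)"
    using s[of "\<lambda>_. 1"] mult_left_mono[OF 1[of "n - a"], of "x ^ a"] assms by (simp add: field_simps)
  have "(\<Sum>k=a..<n. real (k + 1 - a) * x ^ k) = (\<Sum>k=a..<n. real (k - a + 1) * x ^ k)"
    by (intro sum.cong) (auto simp: Suc_diff_le)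
  also have "\<dots> = x ^ a * (\<Sum>k<n - a. real (k + 1) * x ^ k)" using s[of "\<lambda>k. real (k + 1)"] by simp
  also have "\<dots> \<le> x ^ a / (1 - x)\<^sup>2"
    using mult_left_mono[OF 3[of "n - a"], of "x ^ a"] assms by (simp add: field_simps)
  finally show "(\<Sum>k=a..<n. real (k + 1 - a) * x ^ k) \<le> x ^ a / (1 - x)\<^sup>2" .
qed

text \<open>A sequence that grows by at most \<open>\<delta> k\<close> in step \<open>k\<close> ends below its average, up to the growth that each
  of the earlier terms has missed.\<close>

lemma nearly_monotone_average:
  fixes Z \<delta> :: "nat \<Rightarrow> real"
  assumes "a \<le> n" "\<And>k. a \<le> k \<Longrightarrow> k < n \<Longrightarrow> Z (Suc k) \<le> Z k + \<delta> k"
  shows "real (n - a) * Z n \<le> (\<Sum>k=a..<n. Z k) + (\<Sum>k=a..<n. real (k + 1 - a) * \<delta> k)"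
  using assms
proof (induction n rule: dec_induct)
  case (step n)
  have IH: "real (n - a) * Z n \<le> (\<Sum>k=a..<n. Z k) + (\<Sum>k=a..<n. real (k + 1 - a) * \<delta> k)"
    using step by auto
  have e: "real (Suc n - a) = real (n - a) + 1" using step.hyps by (simp add: Suc_diff_le)
  have "real (Suc n - a) * Z (Suc n) \<le> real (Suc n - a) * (Z n + \<delta> n)"
    using step by (intro mult_left_mono) auto
  also have "\<dots> = real (n - a) * Z n + Z n + real (n + 1 - a) * \<delta> n" unfolding Suc_eq_plus1[symmetric] e
    by (simp add: algebra_simps)
  finally show ?case using IH step.hyps by simp
qed simp

section \<open>Conjugate directions under the curvature condition\<close>

text \<open>One epoch of the direction recursion along a sample path, detached from the optimization problem:
  \<open>v\<close> is the gradient estimator, which contracts with ratio \<open>x\<close>, and \<open>d\<close> the search direction.\<close>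

locale conjugate_recursion =
  fixes v d :: "nat \<Rightarrow> 'a::real_inner" and bt :: "nat \<Rightarrow> real" and m :: nat and c \<alpha> x :: real
  assumes c: "0 < c" "c < 1" and \<alpha>: "(1 + c) / (1 - c) \<le> \<alpha>"
    and x: "0 < x" "x < 1"
    and v_nz: "\<And>k. k \<le> m \<Longrightarrow> v k \<noteq> 0"
    and v_decay: "\<And>k. k \<le> m \<Longrightarrow> (norm (v (Suc k)))\<^sup>2 \<le> x * (norm (v k))\<^sup>2"
    and bt_le: "\<And>k. k < m \<Longrightarrow> \<bar>bt (Suc k)\<bar> \<le> (norm (v (Suc k)))\<^sup>2 / (norm (v k))\<^sup>2"
    and d_step: "\<And>k. k < m \<Longrightarrow> d (Suc k) = - v (Suc k) + bt (Suc k) *\<^sub>R d k"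
    and curvature: "\<And>k. k \<le> m \<Longrightarrow> \<bar>v (Suc k) \<bullet> d k\<bar> \<le> - c * (v k \<bullet> d k)"
begin

text \<open>\<open>\<Delta>\<close> measures how far the initial direction is longer than the initial estimator, and \<open>\<kappa>\<close> is the
  relative descent of a direction; \<open>\<kappa> k = 1\<close> for steepest descent.\<close>
definition "V0 = (norm (v 0))\<^sup>2"
definition "\<Delta> = max 0 ((norm (d 0))\<^sup>2 - (norm (v 0))\<^sup>2)"
definition "\<mu> = (1 - c) / (1 + c)"
definition "\<kappa> k = - (v k \<bullet> d k) / (norm (v k))\<^sup>2"

lemma V0_nonneg: "0 \<le> V0" and \<Delta>_nonneg: "0 \<le> \<Delta>" and \<mu>_nonneg: "0 \<le> \<mu>"
  using c by (auto simp: V0_def \<Delta>_def \<mu>_def)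

lemma \<alpha>_ge_1: "1 \<le> \<alpha>"
proof -
  have "1 \<le> (1 + c) / (1 - c)" using c by (simp add: field_simps)
  then show ?thesis using \<alpha> by linarith
qed

lemma v_le: "k \<le> Suc m \<Longrightarrow> (norm (v k))\<^sup>2 \<le> x ^ k * V0"
proof (induction k)
  case (Suc k)
  have "(norm (v (Suc k)))\<^sup>2 \<le> x * (norm (v k))\<^sup>2" using v_decay Suc.prems by simp
  also have "\<dots> \<le> x * (x ^ k * V0)" using Suc x by (intro mult_left_mono) auto
  finally show ?case by simp
qed (simp add: V0_def)

lemma \<kappa>_nonneg: "k \<le> m \<Longrightarrow> 0 \<le> \<kappa> k"
proof -
  assume k: "k \<le> m"
  have "0 \<le> c * - (v k \<bullet> d k)" using curvature[OF k] by (simp add: order_trans[OF abs_ge_zero])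
  then have "0 \<le> - (v k \<bullet> d k)" using c by (simp add: zero_le_mult_iff mult_le_0_iff)
  then show "0 \<le> \<kappa> k" unfolding \<kappa>_def by (intro divide_nonneg_nonneg) auto
qed

lemma cross_term: "k < m \<Longrightarrow> \<bar>bt (Suc k) * (v (Suc k) \<bullet> d k)\<bar> \<le> (norm (v (Suc k)))\<^sup>2 * (c * \<kappa> k)"
proof -
  assume k: "k < m"
  have nz: "(norm (v k))\<^sup>2 > 0" using v_nz[of k] k by simp
  have "\<bar>v (Suc k) \<bullet> d k\<bar> \<le> c * (\<kappa> k * (norm (v k))\<^sup>2)"
    using curvature[of k] k nz by (simp add: \<kappa>_def)
  then have "\<bar>bt (Suc k)\<bar> * \<bar>v (Suc k) \<bullet> d k\<bar> \<le> (norm (v (Suc k)))\<^sup>2 / (norm (v k))\<^sup>2 * (c * (\<kappa> k * (norm (v k))\<^sup>2))"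
    using bt_le[OF k] by (intro mult_mono) auto
  also have "\<dots> = (norm (v (Suc k)))\<^sup>2 * (c * \<kappa> k)" using nz by simp
  finally show ?thesis by (simp add: abs_mult)
qed

text \<open>The classical induction for Fletcher--Reeves methods: the mixed term contributes at most \<open>c\<close> times the
  previous relative descent, so \<open>\<kappa>\<close> approaches the fixed point \<open>1 / (1 - c)\<close> geometrically.\<close>

lemma \<kappa>_step: "k < m \<Longrightarrow> \<kappa> (Suc k) \<le> 1 + c * \<kappa> k"
proof -
  assume k: "k < m"
  have nz: "(norm (v (Suc k)))\<^sup>2 > 0" using v_nz[of "Suc k"] k by simp
  have "- (v (Suc k) \<bullet> d (Suc k)) = (norm (v (Suc k)))\<^sup>2 - bt (Suc k) * (v (Suc k) \<bullet> d k)"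
    using d_step[OF k] by (simp add: inner_diff_right power2_norm_eq_inner)
  also have "\<dots> \<le> (norm (v (Suc k)))\<^sup>2 * (1 + c * \<kappa> k)"
    using cross_term[OF k] by (simp add: algebra_simps abs_le_iff)
  finally have "- (v (Suc k) \<bullet> d (Suc k)) \<le> (1 + c * \<kappa> k) * (norm (v (Suc k)))\<^sup>2" by (simp only: mult.commute)
  then show "\<kappa> (Suc k) \<le> 1 + c * \<kappa> k"
    unfolding \<kappa>_def[of "Suc k"] pos_divide_le_eq[OF nz] .
qed

lemma \<kappa>_le: "k \<le> m \<Longrightarrow> \<kappa> k \<le> 1 / (1 - c) + c ^ k * max 0 (\<kappa> 0 - 1 / (1 - c))"
proof (induction k)
  case (Suc k)
  have "\<kappa> (Suc k) \<le> 1 + c * \<kappa> k" using \<kappa>_step Suc.prems by simp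
  also have "\<dots> \<le> 1 + c * (1 / (1 - c) + c ^ k * max 0 (\<kappa> 0 - 1 / (1 - c)))"
    using Suc c by (intro add_left_mono mult_left_mono) auto
  also have "\<dots> = (1 + c * (1 / (1 - c))) + c ^ Suc k * max 0 (\<kappa> 0 - 1 / (1 - c))"
    by (simp add: distrib_left)
  also have "1 + c * (1 / (1 - c)) = 1 / (1 - c)" using c by (simp add: field_simps)
  finally show ?case .
qed (simp add: max_def)

text \<open>A relative descent of \<open>d 0\<close> above the fixed point requires a direction longer than \<open>v 0\<close>. After the
  Cauchy--Schwarz inequality this is the nonnegativity of a square in \<open>\<parallel>v 0\<parallel>\<close> and \<open>\<parallel>d 0\<parallel>\<close>, and the factor
  \<open>\<mu> = (1 - c) / (1 + c)\<close> is what makes \<open>\<mu> * (c + c\<^sup>2 + \<dots>)\<close> at most \<open>1/2\<close> later on.\<close>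

lemma initial_excess: "2 * (max 0 (\<kappa> 0 - 1 / (1 - c)) * V0) \<le> \<mu> * \<Delta>"
proof -
  have nz: "V0 > 0" using v_nz[of 0] by (simp add: V0_def)
  define p where "p = norm (v 0)"
  define q where "q = norm (d 0)"
  have "- (v 0 \<bullet> d 0) \<le> p * q" unfolding p_def q_def
    using Cauchy_Schwarz_ineq2[of "v 0" "d 0"] by linarith
  moreover have "\<kappa> 0 * V0 = - (v 0 \<bullet> d 0)" using nz by (simp add: \<kappa>_def V0_def)
  ultimately have k: "\<kappa> 0 * V0 \<le> p * q" by simp
  have "2 * (p * q - p\<^sup>2 / (1 - c)) \<le> \<mu> * (q\<^sup>2 - p\<^sup>2)"
  proof -
    have i: "0 \<le> ((1 - c) * q - (1 + c) * p)\<^sup>2 / ((1 - c) * (1 + c))" using c by simp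
    have "((1 - c) * q - (1 + c) * p)\<^sup>2 / ((1 - c) * (1 + c)) = \<mu> * q\<^sup>2 - 2 * (p * q) + (1 + c) / (1 - c) * p\<^sup>2"
      using c by (simp add: \<mu>_def field_simps power2_eq_square)
    moreover have "(1 + c) / (1 - c) + \<mu> \<le> 2 / (1 - c)"
    proof -
      have "\<mu> \<le> 1" using c by (simp add: \<mu>_def)
      moreover have "(1 + c) / (1 - c) + 1 = 2 / (1 - c)" using c by (simp add: field_simps)
      ultimately show ?thesis by linarith
    qed
    then have "((1 + c) / (1 - c) + \<mu>) * p\<^sup>2 \<le> 2 / (1 - c) * p\<^sup>2" by (intro mult_right_mono) auto
    ultimately show ?thesis using i by (simp add: algebra_simps)
  qed
  moreover have "\<mu> * (q\<^sup>2 - p\<^sup>2) \<le> \<mu> * \<Delta>" using \<mu>_nonneg by (intro mult_left_mono) (auto simp: \<Delta>_def p_def q_def)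
  moreover have "(\<kappa> 0 - 1 / (1 - c)) * V0 \<le> p * q - p\<^sup>2 / (1 - c)"
    using k by (simp add: left_diff_distrib V0_def p_def)
  then have "2 * ((\<kappa> 0 - 1 / (1 - c)) * V0) \<le> 2 * (p * q - p\<^sup>2 / (1 - c))" by (intro mult_left_mono) auto
  ultimately have "2 * ((\<kappa> 0 - 1 / (1 - c)) * V0) \<le> \<mu> * \<Delta>" by (meson order_trans)
  moreover have "0 \<le> \<mu> * \<Delta>" using \<mu>_nonneg \<Delta>_nonneg by simp
  ultimately show ?thesis by (simp add: max_def)
qed

lemma momentum_le: "k < m \<Longrightarrow> (norm (bt (Suc k) *\<^sub>R d k))\<^sup>2 \<le> x\<^sup>2 * (norm (d k))\<^sup>2"
proof -
  assume k: "k < m"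
  have "(norm (v (Suc k)))\<^sup>2 / (norm (v k))\<^sup>2 \<le> x"
    using v_decay[of k] v_nz[of k] k by (simp add: pos_divide_le_eq)
  then have "\<bar>bt (Suc k)\<bar> \<le> x" using bt_le[OF k] by linarith
  then have "(bt (Suc k))\<^sup>2 \<le> x\<^sup>2" using x by (simp add: abs_le_square_iff[symmetric])
  then have "(bt (Suc k))\<^sup>2 * (norm (d k))\<^sup>2 \<le> x\<^sup>2 * (norm (d k))\<^sup>2" by (intro mult_right_mono) auto
  then show ?thesis by (simp add: power_mult_distrib)
qed

text \<open>Expanding \<open>\<parallel>- v (Suc k) + \<beta> *\<^sub>R d k\<parallel>\<^sup>2\<close>: the mixed term is controlled by \<open>\<kappa>\<close> at its fixed point, where
  \<open>1 + 2 c / (1 - c) = (1 + c) / (1 - c)\<close> is at most \<open>\<alpha>\<close>, and the momentum term contracts by \<open>x\<^sup>2\<close>.\<close>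

lemma direction_step:
  assumes k: "k < m"
  shows "(norm (d (Suc k)))\<^sup>2 \<le> x\<^sup>2 * (norm (d k))\<^sup>2 + x ^ Suc k * (\<alpha> * V0 + c ^ Suc k * (\<mu> * \<Delta>))"
proof -
  let ?K = "max 0 (\<kappa> 0 - 1 / (1 - c))"
  have "(norm (d (Suc k)))\<^sup>2 = (norm (v (Suc k)))\<^sup>2 - 2 * (bt (Suc k) * (v (Suc k) \<bullet> d k)) + (norm (bt (Suc k) *\<^sub>R d k))\<^sup>2"
  proof -
    define y where "y = bt (Suc k) *\<^sub>R d k"
    have "v (Suc k) \<bullet> y = bt (Suc k) * (v (Suc k) \<bullet> d k)" by (simp add: y_def)
    moreover have "(norm (- v (Suc k) + y))\<^sup>2 = (norm (v (Suc k)))\<^sup>2 - 2 * (v (Suc k) \<bullet> y) + (norm y)\<^sup>2"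
      by (simp add: power2_norm_eq_inner inner_diff_left inner_diff_right inner_commute)
    ultimately show ?thesis unfolding d_step[OF k] y_def[symmetric] by simp
  qed
  also have "\<dots> \<le> (norm (v (Suc k)))\<^sup>2 + 2 * ((norm (v (Suc k)))\<^sup>2 * (c * \<kappa> k)) + x\<^sup>2 * (norm (d k))\<^sup>2"
    using cross_term[OF k] momentum_le[OF k] by (simp add: abs_le_iff)
  also have "(norm (v (Suc k)))\<^sup>2 + 2 * ((norm (v (Suc k)))\<^sup>2 * (c * \<kappa> k)) = (norm (v (Suc k)))\<^sup>2 * (1 + 2 * c * \<kappa> k)"
    by (simp add: algebra_simps)
  also have "\<dots> \<le> (x ^ Suc k * V0) * (\<alpha> + 2 * c ^ Suc k * ?K)"
  proof (rule mult_mono)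
    show "(norm (v (Suc k)))\<^sup>2 \<le> x ^ Suc k * V0" using v_le[of "Suc k"] k by simp
    have "2 * c * \<kappa> k \<le> 2 * c * (1 / (1 - c) + c ^ k * ?K)" using \<kappa>_le[of k] k c by (intro mult_left_mono) auto
    moreover have "1 + 2 * c * (1 / (1 - c)) \<le> \<alpha>"
    proof -
      have "1 + 2 * c * (1 / (1 - c)) = (1 + c) / (1 - c)" using c by (simp add: field_simps)
      then show ?thesis using \<alpha> by simp
    qed
    ultimately show "1 + 2 * c * \<kappa> k \<le> \<alpha> + 2 * c ^ Suc k * ?K" by (simp add: algebra_simps)
    show "0 \<le> 1 + 2 * c * \<kappa> k" using \<kappa>_nonneg[of k] k c by simp
  qed (use x V0_nonneg in simp)
  also have "\<dots> = x ^ Suc k * (\<alpha> * V0 + c ^ Suc k * (2 * (?K * V0)))" by (simp add: algebra_simps)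
  also have "\<dots> \<le> x ^ Suc k * (\<alpha> * V0 + c ^ Suc k * (\<mu> * \<Delta>))"
    using initial_excess x c by (intro mult_left_mono add_left_mono) auto
  finally show ?thesis by simp
qed

lemma initial_direction_le: "(norm (d 0))\<^sup>2 \<le> \<alpha> * V0 + \<Delta>"
proof -
  have "(norm (d 0))\<^sup>2 \<le> V0 + \<Delta>" by (simp add: V0_def \<Delta>_def)
  moreover have "1 * V0 \<le> \<alpha> * V0" using \<alpha>_ge_1 V0_nonneg by (intro mult_right_mono) auto
  ultimately show ?thesis by simp
qed

lemma excess_sum_le: "\<mu> * (\<Sum>j\<in>{1..k}. c ^ j) \<le> 1/2"
proof -
  have "(\<Sum>j\<in>{1..k}. c ^ j) = (\<Sum>j=1..<Suc k. c ^ j)" by (simp add: atLeastLessThanSuc_atLeastAtMost)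
  also have "\<dots> \<le> c ^ 1 / (1 - c)" using geometric_tail(1)[of c 1 "Suc k"] c by simp
  finally have "\<mu> * (\<Sum>j\<in>{1..k}. c ^ j) \<le> \<mu> * (c / (1 - c))" using \<mu>_nonneg by (intro mult_left_mono) auto
  also have "\<dots> = c / (1 + c)" using c by (simp add: \<mu>_def)
  also have "\<dots> \<le> 1/2" using c by (simp add: field_simps)
  finally show ?thesis .
qed

lemma direction_le:
  assumes "k \<le> m"
  shows "(norm (d k))\<^sup>2 \<le> x ^ k * (\<alpha> * V0 / (1 - x) + \<Delta> * (x ^ k + 1/2))"
proof -
  let ?\<sigma> = "\<lambda>k. \<mu> * (\<Sum>j\<in>{1..k}. c ^ j)"
  have "(norm (d k))\<^sup>2 \<le> x ^ k * (\<alpha> * V0 / (1 - x) + \<Delta> * (x ^ k + ?\<sigma> k))" using assms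
  proof (induction k)
    case 0
    have "0 \<le> \<alpha> * V0" using \<alpha>_ge_1 V0_nonneg by simp
    then have "\<alpha> * V0 \<le> \<alpha> * V0 / (1 - x)" using x by (simp add: pos_le_divide_eq mult_left_le)
    then show ?case using initial_direction_le by simp
  next
    case (Suc k)
    have aV: "0 \<le> \<alpha> * V0 / (1 - x)" using \<alpha>_ge_1 V0_nonneg x by simp
    have \<sigma>0: "0 \<le> ?\<sigma> k" using \<mu>_nonneg c by (intro mult_nonneg_nonneg sum_nonneg) auto
    have "x\<^sup>2 * (norm (d k))\<^sup>2 \<le> x\<^sup>2 * (x ^ k * (\<alpha> * V0 / (1 - x) + \<Delta> * (x ^ k + ?\<sigma> k)))"
      using Suc by (intro mult_left_mono) auto
    also have "\<dots> = x ^ Suc k * (x * (\<alpha> * V0 / (1 - x)) + \<Delta> * (x ^ Suc k + x * ?\<sigma> k))"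
      by (simp add: power2_eq_square algebra_simps)
    also have "\<dots> \<le> x ^ Suc k * (x * (\<alpha> * V0 / (1 - x)) + \<Delta> * (x ^ Suc k + ?\<sigma> k))"
      using x \<sigma>0 \<Delta>_nonneg by (intro mult_left_mono add_left_mono) (auto simp: mult_left_le_one_le)
    finally have "(norm (d (Suc k)))\<^sup>2 \<le> x ^ Suc k * (x * (\<alpha> * V0 / (1 - x)) + \<Delta> * (x ^ Suc k + ?\<sigma> k))
        + x ^ Suc k * (\<alpha> * V0 + c ^ Suc k * (\<mu> * \<Delta>))"
      using direction_step[of k] Suc.prems by simp
    also have "\<dots> = x ^ Suc k * ((x * (\<alpha> * V0 / (1 - x)) + \<alpha> * V0) + \<Delta> * (x ^ Suc k + ?\<sigma> (Suc k)))"
      by (simp add: algebra_simps)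
    also have "x * (\<alpha> * V0 / (1 - x)) + \<alpha> * V0 = \<alpha> * V0 / (1 - x)" using x by (simp add: field_simps)
    finally show ?case .
  qed
  also have "\<dots> \<le> x ^ k * (\<alpha> * V0 / (1 - x) + \<Delta> * (x ^ k + 1/2))"
    using excess_sum_le[of k] x \<Delta>_nonneg by (intro mult_left_mono add_left_mono) auto
  finally show ?thesis .
qed

lemma direction_sum_le:
  assumes "n \<le> Suc m"
  shows "(1 - x\<^sup>2) * (\<Sum>k<n. (norm (d k))\<^sup>2) \<le> \<alpha> * V0 / (1 - x) + 3/2 * \<Delta>"
proof (cases n)
  case 0
  then show ?thesis using \<alpha>_ge_1 V0_nonneg \<Delta>_nonneg x by simp
next
  case (Suc M)
  have "(1 - x\<^sup>2) * (\<Sum>k\<le>M. (norm (d k))\<^sup>2) + x\<^sup>2 * (norm (d M))\<^sup>2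
      \<le> \<alpha> * V0 * (\<Sum>k\<le>M. x ^ k) + \<Delta> * (1 + \<mu> * (\<Sum>j\<in>{1..M}. c ^ j))" if "M \<le> m" for M
    using that
  proof (induction M)
    case 0
    then show ?case using initial_direction_le by (simp add: algebra_simps)
  next
    case (Suc M)
    have "x ^ Suc M * (c ^ Suc M * (\<mu> * \<Delta>)) \<le> 1 * (c ^ Suc M * (\<mu> * \<Delta>))"
      using x c \<mu>_nonneg \<Delta>_nonneg by (intro mult_right_mono power_le_one) auto
    then have "(norm (d (Suc M)))\<^sup>2 - x\<^sup>2 * (norm (d M))\<^sup>2 \<le> \<alpha> * V0 * x ^ Suc M + \<Delta> * (\<mu> * c ^ Suc M)"
      using direction_step[of M] Suc.prems by (simp add: algebra_simps)
    then show ?case using Suc by (simp add: algebra_simps)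
  qed
  from this[of M] assms Suc have 1: "(1 - x\<^sup>2) * (\<Sum>k\<le>M. (norm (d k))\<^sup>2) + x\<^sup>2 * (norm (d M))\<^sup>2
      \<le> \<alpha> * V0 * (\<Sum>k\<le>M. x ^ k) + \<Delta> * (1 + \<mu> * (\<Sum>j\<in>{1..M}. c ^ j))" by simp
  have 2: "\<alpha> * V0 * (\<Sum>k\<le>M. x ^ k) \<le> \<alpha> * V0 * (1 / (1 - x))"
    using geometric_tail(1)[of x 0 "Suc M"] x \<alpha>_ge_1 V0_nonneg
    by (intro mult_left_mono) (auto simp: lessThan_Suc_atMost atLeast0LessThan)
  have 3: "\<Delta> * (1 + \<mu> * (\<Sum>j\<in>{1..M}. c ^ j)) \<le> \<Delta> * (1 + 1/2)"
    using excess_sum_le \<Delta>_nonneg by (intro mult_left_mono) auto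
  have 4: "0 \<le> x\<^sup>2 * (norm (d M))\<^sup>2" by simp
  have arith: "A + B \<le> C + D \<Longrightarrow> C \<le> E \<Longrightarrow> D \<le> G * (1 + 1/2) \<Longrightarrow> 0 \<le> B \<Longrightarrow> A \<le> E + 3/2 * G"
    for A B C D E G :: real by simp
  show ?thesis using arith[OF 1 2 3 4] by (simp add: Suc lessThan_Suc_atMost)
qed

text \<open>This is where the factor \<open>x\<^sup>2 / ((1 - x)\<^sup>2 (1 + x))\<close> of the contraction rate \<open>\<xi>\<close> originates.\<close>

lemma momentum_sum_le:
  "(\<Sum>k=1..<m. (norm (bt k *\<^sub>R d (k - 1)))\<^sup>2)
    \<le> x\<^sup>2 / ((1 - x)\<^sup>2 * (1 + x)) * (\<alpha> * V0) + 3/2 * (x\<^sup>2 / (1 - x\<^sup>2) * \<Delta>)"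
proof -
  have "(\<Sum>k=1..<m. (norm (bt k *\<^sub>R d (k - 1)))\<^sup>2) \<le> (\<Sum>k<m - 1. x\<^sup>2 * (norm (d k))\<^sup>2)"
  proof -
    have "(\<Sum>k=1..<m. (norm (bt k *\<^sub>R d (k - 1)))\<^sup>2) = (\<Sum>k<m - 1. (norm (bt (Suc k) *\<^sub>R d k))\<^sup>2)"
      by (rule sum.reindex_bij_witness[where i = Suc and j = "\<lambda>k. k - 1"]) auto
    also have "\<dots> \<le> (\<Sum>k<m - 1. x\<^sup>2 * (norm (d k))\<^sup>2)" by (intro sum_mono momentum_le) auto
    finally show ?thesis .
  qed
  also have "\<dots> = x\<^sup>2 / (1 - x\<^sup>2) * ((1 - x\<^sup>2) * (\<Sum>k<m - 1. (norm (d k))\<^sup>2))"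
  proof -
    have "1 - x\<^sup>2 \<noteq> 0" using x by (simp add: power2_eq_1_iff)
    then show ?thesis by (simp add: sum_distrib_left)
  qed
  also have "\<dots> \<le> x\<^sup>2 / (1 - x\<^sup>2) * (\<alpha> * V0 / (1 - x) + 3/2 * \<Delta>)"
    using x by (intro mult_left_mono direction_sum_le) (auto simp: power_le_one)
  also have "\<dots> = x\<^sup>2 / (1 - x\<^sup>2) * (1 / (1 - x)) * (\<alpha> * V0) + 3/2 * (x\<^sup>2 / (1 - x\<^sup>2) * \<Delta>)"
    by (simp add: algebra_simps)
  also have "x\<^sup>2 / (1 - x\<^sup>2) * (1 / (1 - x)) = x\<^sup>2 / ((1 - x)\<^sup>2 * (1 + x))"
  proof -
    have "1 - x\<^sup>2 = (1 - x) * (1 + x)" by (simp add: power2_eq_square algebra_simps)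
    then show ?thesis by (simp add: power2_eq_square mult_ac)
  qed
  finally show ?thesis .
qed

end

section \<open>One epoch along a sample path\<close>

lemma young_inner:
  fixes p r :: "'a::real_inner"
  assumes "0 < t"
  shows "- (t * (norm p)\<^sup>2 + (norm r)\<^sup>2 / t) \<le> 2 * (p \<bullet> r)"
proof -
  have "0 \<le> t * (p \<bullet> p) + p \<bullet> (2 *\<^sub>R r) + (1 / (4 * t)) * ((2 *\<^sub>R r) \<bullet> (2 *\<^sub>R r))"
    by (rule completed_square_nonneg[OF assms])
  then show ?thesis using assms by (simp add: power2_norm_eq_inner)
qed

lemma norm_convex_combination_sq:
  fixes p r :: "'a::real_inner"
  assumes "0 \<le> z" "z \<le> 1"
  shows "(norm (z *\<^sub>R p + (1 - z) *\<^sub>R r))\<^sup>2 \<le> z * (norm p)\<^sup>2 + (1 - z) * (norm r)\<^sup>2"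
proof -
  have "z * (norm p)\<^sup>2 + (1 - z) * (norm r)\<^sup>2 - (norm (z *\<^sub>R p + (1 - z) *\<^sub>R r))\<^sup>2
      = z * (1 - z) * (norm (p - r))\<^sup>2"
    by (simp add: power2_norm_eq_inner inner_add_left inner_add_right inner_diff_left inner_diff_right inner_commute)
      (simp add: algebra_simps)
  moreover have "0 \<le> z * (1 - z) * (norm (p - r))\<^sup>2" using assms by simp
  ultimately show ?thesis by linarith
qed

lemma three_term_square:
  fixes X A B C p q r :: real
  assumes "X \<le> A + B + C" "0 \<le> X" "0 < p" "0 < q" "0 < r" "p + q + r \<le> 1"
  shows "X\<^sup>2 \<le> A\<^sup>2 / p + B\<^sup>2 / q + C\<^sup>2 / r"
proof -
  have titu: "(a + b)\<^sup>2 / (s + t) \<le> a\<^sup>2 / s + b\<^sup>2 / t" if "0 < s" "0 < t" for a b s t :: real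
  proof -
    have "0 \<le> (a * t - b * s)\<^sup>2 / (s * t * (s + t))" using that by simp
    also have "\<dots> = a\<^sup>2 / s + b\<^sup>2 / t - (a + b)\<^sup>2 / (s + t)"
      using that by (simp add: divide_simps) (simp add: power2_eq_square algebra_simps)
    finally show ?thesis by simp
  qed
  have "X\<^sup>2 \<le> (A + B + C)\<^sup>2" using assms by (intro power_mono) auto
  also have "\<dots> \<le> (A + B + C)\<^sup>2 / (p + q + r)"
    using assms by (simp add: pos_le_divide_eq mult_left_le)
  also have "\<dots> \<le> (A + B)\<^sup>2 / (p + q) + C\<^sup>2 / r" using assms titu[of "p + q" r "A + B" C] by simp
  also have "\<dots> \<le> A\<^sup>2 / p + B\<^sup>2 / q + C\<^sup>2 / r" using assms titu[of p q A B] by simp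
  finally show ?thesis .
qed

text \<open>The deterministic content of one epoch: \<open>fr\<close> with gradient \<open>G\<close> is the smooth part, \<open>x\<close> the contraction
  ratio of the estimators, and \<open>Pmin\<close> a lower bound of the objective.\<close>

locale prox_cg_epoch = closed_convex_fun \<phi> + conjugate_recursion v d bt m c \<alpha> x
  for \<phi> :: "'a::euclidean_space \<Rightarrow> ereal" and v d :: "nat \<Rightarrow> 'a" and bt :: "nat \<Rightarrow> real"
    and m :: nat and c \<alpha> x :: real +
  fixes fr :: "'a \<Rightarrow> real" and G :: "'a \<Rightarrow> 'a" and L \<gamma> \<eta>1 \<eta>2 Pmin :: real
    and \<eta> :: "nat \<Rightarrow> real" and w :: "nat \<Rightarrow> 'a"
  assumes descent: "\<And>y z. fr z \<le> fr y + G y \<bullet> (z - y) + L / 2 * (norm (z - y))\<^sup>2"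
    and Pmin: "\<And>y. \<phi> y < \<infinity> \<Longrightarrow> Pmin \<le> fr y + real_of_ereal (\<phi> y)"
    and etas: "0 < \<eta>1" "\<eta>1 \<le> \<eta>2" and eta_k: "\<And>k. k \<le> m \<Longrightarrow> \<eta> k \<in> {\<eta>1, \<eta>2}"
    and gam: "0 < \<gamma>" "\<gamma> \<le> 1" and L: "0 < L"
    and slack: "0 \<le> 2 / \<eta>2 - L * \<gamma> - 3"
    and w_step: "\<And>k. k < m \<Longrightarrow> w (Suc k) = (1 - \<gamma>) *\<^sub>R w k + \<gamma> *\<^sub>R prox (\<eta> k) \<phi> (w k + \<eta> k *\<^sub>R d k)"
    and w0: "\<phi> (w 0) < \<infinity>"
    and v0: "v 0 = G (w 0)"
begin

text \<open>\<open>R k\<close> is the guaranteed decrease of the objective in iteration \<open>k\<close>, scaled by \<open>2 / \<gamma>\<close>, and \<open>Z k\<close> the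
  potential that transports information to the last iterate. The scaling of \<open>Z\<close> makes
  \<open>(\<eta>1 \<parallel>yosida (\<eta> m) (w m)\<parallel>)\<^sup>2 \<le> Z m\<close>.\<close>
definition "y k = prox (\<eta> k) \<phi> (w k + \<eta> k *\<^sub>R d k)"
definition "q k = (1 / \<eta> k) *\<^sub>R (w k - y k)"
definition "Q k = (norm (w k - y k))\<^sup>2"
definition "e k = v k - G (w k)"
definition "a = 2 / \<eta>2 - L * \<gamma> - 3"
definition "gap = 2 / \<gamma> * (fr (w 0) + val (w 0) - Pmin)"
definition "R k = 2 * (val (w k) - val (y k)) + 2 * \<eta> k * (q k \<bullet> G (w k)) - L * \<gamma> * Q k"
definition "Z k = 2 * \<eta>1 * moreau_gap \<eta>2 (w k)"
definition "momentum_sq k = (norm (bt k *\<^sub>R d (k - 1)))\<^sup>2"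
definition "final_mapping = (1 / \<eta> m) *\<^sub>R (w m - prox (\<eta> m) \<phi> (w m - \<eta> m *\<^sub>R G (w m)))"

lemma eta_pos: "k \<le> m \<Longrightarrow> 0 < \<eta> k" "k \<le> m \<Longrightarrow> \<eta>1 \<le> \<eta> k" "k \<le> m \<Longrightarrow> \<eta> k \<le> \<eta>2"
  using eta_k[of k] etas by auto

lemma eta2_pos: "0 < \<eta>2" using etas by simp

lemma eta2_bound: "\<eta>2 \<le> 2/3"
proof -
  have "3 \<le> 2 / \<eta>2" using slack L gam by (smt (verit) mult_pos_pos)
  then show ?thesis using eta2_pos by (simp add: field_simps)
qed

lemma w_dom: "k \<le> m \<Longrightarrow> w k \<in> dom"
proof (induction k)
  case 0
  then show ?case using w0 by (simp add: dom_def)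
next
  case (Suc k)
  then have "w k \<in> dom" "prox (\<eta> k) \<phi> (w k + \<eta> k *\<^sub>R d k) \<in> dom"
    using prox_minimizer(1)[OF eta_pos(1)[of k]] by simp_all
  then show ?case
    using w_step[of k] Suc.prems convex_combination(1)[of "w k" "prox (\<eta> k) \<phi> (w k + \<eta> k *\<^sub>R d k)" \<gamma>] gam by simp
qed

text \<open>The descent lemma along \<open>p + \<gamma> *\<^sub>R (p' - p)\<close>, with convexity of \<open>\<phi>\<close> on the segment.\<close>

lemma relaxed_step_descent:
  fixes p g :: 'a
  assumes "0 < s" "p \<in> dom"
  defines "p' \<equiv> prox s \<phi> (p + s *\<^sub>R g)"
  shows "2 * (val p - val p') + 2 * ((p - p') \<bullet> G p) - L * \<gamma> * (norm (p - p'))\<^sup>2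
    \<le> 2 / \<gamma> * ((fr p + val p) - (fr ((1 - \<gamma>) *\<^sub>R p + \<gamma> *\<^sub>R p') + val ((1 - \<gamma>) *\<^sub>R p + \<gamma> *\<^sub>R p')))"
proof -
  let ?n = "(1 - \<gamma>) *\<^sub>R p + \<gamma> *\<^sub>R p'"
  have n: "?n - p = - (\<gamma> *\<^sub>R (p - p'))" by (simp add: algebra_simps)
  have "fr ?n \<le> fr p - \<gamma> * (G p \<bullet> (p - p')) + L / 2 * (\<gamma>\<^sup>2 * (norm (p - p'))\<^sup>2)"
    using descent[of ?n p] unfolding n by (simp add: power_mult_distrib)
  moreover have "val ?n \<le> (1 - \<gamma>) * val p + \<gamma> * val p'"
    using convex_combination(2)[OF assms(2) prox_minimizer(1)[OF assms(1)]] gam unfolding p'_def by auto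
  ultimately have "\<gamma> / 2 * (2 * (val p - val p') + 2 * ((p - p') \<bullet> G p) - L * \<gamma> * (norm (p - p'))\<^sup>2)
      \<le> (fr p + val p) - (fr ?n + val ?n)"
    by (simp add: algebra_simps power2_eq_square inner_commute)
  then have "2 / \<gamma> * (\<gamma> / 2 * (2 * (val p - val p') + 2 * ((p - p') \<bullet> G p) - L * \<gamma> * (norm (p - p'))\<^sup>2))
      \<le> 2 / \<gamma> * ((fr p + val p) - (fr ?n + val ?n))"
    using gam by (intro mult_left_mono) auto
  moreover have "2 / \<gamma> * (\<gamma> / 2 * t) = t" for t :: real using gam by simp
  ultimately show ?thesis by (simp only:)
qed

lemma eta_q: "k \<le> m \<Longrightarrow> \<eta> k *\<^sub>R q k = w k - y k" "k \<le> m \<Longrightarrow> (\<eta> k)\<^sup>2 * (norm (q k))\<^sup>2 = Q k"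
proof -
  assume k: "k \<le> m"
  show *: "\<eta> k *\<^sub>R q k = w k - y k" using eta_pos(1)[OF k] by (simp add: q_def)
  show "(\<eta> k)\<^sup>2 * (norm (q k))\<^sup>2 = Q k"
    unfolding Q_def *[symmetric] by (simp add: power_mult_distrib)
qed

lemma step_descent:
  assumes "k < m"
  shows "R k \<le> 2 / \<gamma> * ((fr (w k) + val (w k)) - (fr (w (Suc k)) + val (w (Suc k))))"
proof -
  have k: "k \<le> m" using assms by simp
  have "2 * \<eta> k * (q k \<bullet> G (w k)) = 2 * ((w k - y k) \<bullet> G (w k))"
    unfolding eta_q(1)[OF k, symmetric] by simp
  then show ?thesis
    using relaxed_step_descent[OF eta_pos(1)[OF k] w_dom[OF k], of "d k"] w_step[OF assms]
    unfolding R_def Q_def y_def[symmetric] by simp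
qed

text \<open>A relaxed proximal gradient step at \<open>w m\<close> cannot go below \<open>Pmin\<close>, hence its guaranteed decrease bounds
  the gradient mapping there; the number three is the one in \<open>2 / \<eta>2 - L * \<gamma> - 3\<close>.\<close>

lemma final_descent: "3 * (\<eta>1 * norm final_mapping)\<^sup>2 \<le> 2 / \<gamma> * (fr (w m) + val (w m) - Pmin)"
proof -
  define s where "s = \<eta> m"
  define p where "p = w m"
  define p' where "p' = prox s \<phi> (p + s *\<^sub>R (- G p))"
  have s: "0 < s" "\<eta>1 \<le> s" "s \<le> \<eta>2" and p: "p \<in> dom" using eta_pos[of m] w_dom[of m] by (auto simp: s_def p_def)
  let ?n = "(1 - \<gamma>) *\<^sub>R p + \<gamma> *\<^sub>R p'"
  have ndom: "?n \<in> dom"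
    using convex_combination(1)[OF p prox_minimizer(1)[OF s(1)]] gam unfolding p'_def by auto
  then have "Pmin \<le> fr ?n + val ?n" using Pmin[of ?n] by (simp add: dom_def val_def)
  then have 1: "2 / \<gamma> * ((fr p + val p) - (fr ?n + val ?n)) \<le> 2 / \<gamma> * (fr p + val p - Pmin)"
    using gam by (intro mult_left_mono) auto
  define t where "t = (1 / s) *\<^sub>R (p - p')"
  have st: "p - p' = s *\<^sub>R t" using s by (simp add: t_def)
  have "s * (norm t)\<^sup>2 + s * (t \<bullet> - G p) \<le> val p - val p'"
    using prox_step_decrease(1)[OF s(1) p, of "- G p"] unfolding p'_def[symmetric] t_def[symmetric] by simp
  then have "2 * (s * (norm t)\<^sup>2) - L * \<gamma> * (norm (p - p'))\<^sup>2
      \<le> 2 * (val p - val p') + 2 * ((p - p') \<bullet> G p) - L * \<gamma> * (norm (p - p'))\<^sup>2"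
    unfolding st by simp
  also have "\<dots> \<le> 2 / \<gamma> * ((fr p + val p) - (fr ?n + val ?n))"
    unfolding p'_def by (rule relaxed_step_descent[OF s(1) p])
  finally have 2: "2 * (s * (norm t)\<^sup>2) - L * \<gamma> * (s\<^sup>2 * (norm t)\<^sup>2) \<le> 2 / \<gamma> * (fr p + val p - Pmin)"
    using 1 unfolding st by (simp add: power_mult_distrib)
  have "3 + L * \<gamma> \<le> 2 / s"
  proof -
    have "2 / \<eta>2 \<le> 2 / s" using s by (intro divide_left_mono) auto
    then show ?thesis using slack by simp
  qed
  then have "(3 + L * \<gamma>) * (s\<^sup>2 * (norm t)\<^sup>2) \<le> 2 / s * (s\<^sup>2 * (norm t)\<^sup>2)" by (intro mult_right_mono) auto
  also have "\<dots> = 2 * (s * (norm t)\<^sup>2)" using s by (simp add: power2_eq_square)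
  finally have "3 * (s\<^sup>2 * (norm t)\<^sup>2) \<le> 2 / \<gamma> * (fr p + val p - Pmin)" using 2 by (simp add: algebra_simps)
  moreover have "(\<eta>1 * norm t)\<^sup>2 \<le> (s * norm t)\<^sup>2" using s etas by (intro power_mono mult_right_mono) auto
  moreover have "t = final_mapping" by (simp add: t_def final_mapping_def s_def p_def p'_def)
  ultimately show ?thesis by (simp add: p_def power_mult_distrib)
qed

lemma total_descent: "(\<Sum>k<m. R k) + 3 * (\<eta>1 * norm final_mapping)\<^sup>2 \<le> gap"
proof -
  have "(\<Sum>k<m. R k) \<le> (\<Sum>k<m. 2 / \<gamma> * ((fr (w k) + val (w k)) - (fr (w (Suc k)) + val (w (Suc k)))))"
    by (intro sum_mono step_descent) auto
  also have "\<dots> = 2 / \<gamma> * ((fr (w 0) + val (w 0)) - (fr (w m) + val (w m)))"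
    unfolding sum_distrib_left[symmetric]
    using sum_lessThan_telescope'[of "\<lambda>k. fr (w k) + val (w k)" m] by simp
  finally show ?thesis using final_descent unfolding gap_def by (simp add: right_diff_distrib)
qed

text \<open>The error in using \<open>- d k\<close> for the gradient enters only through the inner product with the step. Of
  the coefficient \<open>3 + a\<close> of \<open>Q k\<close> the three units are spent on absorbing such products by Young's
  inequality, and \<open>a\<close> is kept to pay for the sampling noise.\<close>

lemma R_basic:
  assumes "k < m"
  shows "(3 + a) * Q k + 2 * ((w k - y k) \<bullet> (G (w k) + d k)) \<le> R k"
proof -
  have k: "k \<le> m" using assms by simp
  have "\<eta> k * (norm (q k))\<^sup>2 + \<eta> k * (q k \<bullet> d k) \<le> val (w k) - val (y k)"
    using prox_step_decrease(1)[OF eta_pos(1)[OF k] w_dom[OF k], of "d k"]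
    unfolding y_def[symmetric] q_def[symmetric] by simp
  moreover have "(3 + a + L * \<gamma>) * Q k \<le> 2 * (\<eta> k * (norm (q k))\<^sup>2)"
  proof -
    have "3 + a + L * \<gamma> \<le> 2 / \<eta> k" using eta_pos[OF k] eta2_pos by (auto simp: a_def intro!: divide_left_mono)
    then have "(3 + a + L * \<gamma>) * Q k \<le> 2 / \<eta> k * Q k" by (intro mult_right_mono) (auto simp: Q_def)
    then show ?thesis using eta_pos(1)[OF k] unfolding eta_q(2)[OF k, symmetric] by (simp add: power2_eq_square)
  qed
  ultimately show ?thesis
    unfolding R_def eta_q(1)[OF k, symmetric] by (simp add: inner_add_right algebra_simps)
qed

lemma direction_error: "k < m \<Longrightarrow> 0 < k \<Longrightarrow> d k = - v k + bt k *\<^sub>R d (k - 1)"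
  using d_step[of "k - 1"] by simp

lemma R_initial: "0 < m \<Longrightarrow> a * Q 0 - (norm (v 0 + d 0))\<^sup>2 / 3 \<le> R 0"
  using R_basic[of 0] young_inner[of 3 "w 0 - y 0" "v 0 + d 0"] by (simp add: v0 Q_def algebra_simps)

lemma R_early:
  assumes "0 < k" "k < m" "0 < \<rho>" "\<rho> < 3"
  shows "a * Q k - momentum_sq k / (3 - \<rho>) - (norm (e k))\<^sup>2 / \<rho> \<le> R k"
proof -
  let ?Y = "w k - y k"
  have "G (w k) + d k = bt k *\<^sub>R d (k - 1) + - e k"
    using direction_error[OF assms(2,1)] by (simp add: e_def)
  then have "2 * (?Y \<bullet> (G (w k) + d k)) = 2 * (?Y \<bullet> (bt k *\<^sub>R d (k - 1))) + 2 * (?Y \<bullet> - e k)"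
    by (simp only: inner_add_right distrib_left)
  moreover have "- ((3 - \<rho>) * Q k + momentum_sq k / (3 - \<rho>)) \<le> 2 * (?Y \<bullet> (bt k *\<^sub>R d (k - 1)))"
    using young_inner[of "3 - \<rho>" ?Y "bt k *\<^sub>R d (k - 1)"] assms by (simp only: Q_def momentum_sq_def)
  moreover have "- (\<rho> * Q k + (norm (e k))\<^sup>2 / \<rho>) \<le> 2 * (?Y \<bullet> - e k)"
    using young_inner[OF assms(3), of ?Y "- e k"] by (simp only: Q_def norm_minus_cancel)
  ultimately show ?thesis using R_basic[OF assms(2)] by (simp add: algebra_simps)
qed

text \<open>Here \<open>s\<close> of the three units are traded for \<open>s\<close> copies of the potential \<open>Z k\<close>. The direction is then
  reduced by the factor \<open>1 - z\<close>, so the discrepancy to the gradient is a convex combination of the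
  estimator and of the momentum term, apart from the estimation error.\<close>

lemma R_late:
  assumes k: "0 < k" "k < m" and s: "0 \<le> s" "s * \<eta>2 \<le> 1" and \<rho>: "0 < \<rho>" "0 < \<rho>'" "s + \<rho>' + \<rho> = 3"
  defines "z \<equiv> s * \<eta>2"
  shows "s * Z k + a * Q k - s * \<eta>2\<^sup>2 * (norm (d k))\<^sup>2 - (z * (norm (v k))\<^sup>2 + (1 - z) * momentum_sq k) / \<rho>'
    - (norm (e k))\<^sup>2 / \<rho> \<le> R k"
proof -
  let ?Y = "w k - y k"
  have km: "k \<le> m" using k by simp
  have z: "0 \<le> z" "z \<le> 1" using s eta2_pos by (auto simp: z_def)
  have "2 * s * \<eta>1 * moreau_gap \<eta>2 (w k) + (2 / \<eta>2 - s) * ((\<eta> k)\<^sup>2 * (norm (q k))\<^sup>2) - s * \<eta>2\<^sup>2 * (norm (d k))\<^sup>2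
      + 2 * \<eta> k * ((1 - s * \<eta>2) * (q k \<bullet> d k)) \<le> 2 * (val (w k) - val (y k))"
    using prox_step_decrease_split[OF etas eta_k[OF km] w_dom[OF km] s, of "d k"]
    unfolding y_def[symmetric] q_def[symmetric] .
  then have 1: "s * Z k + (2 / \<eta>2 - s) * Q k - s * \<eta>2\<^sup>2 * (norm (d k))\<^sup>2
      + 2 * (?Y \<bullet> ((1 - z) *\<^sub>R d k)) \<le> 2 * (val (w k) - val (y k))"
    unfolding eta_q(2)[OF km] eta_q(1)[OF km, symmetric] Z_def z_def by (simp add: mult_ac)
  have 2: "2 * \<eta> k * (q k \<bullet> G (w k)) = 2 * (?Y \<bullet> G (w k))"
    unfolding eta_q(1)[OF km, symmetric] by simp
  define b where "b = z *\<^sub>R v k + (1 - z) *\<^sub>R (bt k *\<^sub>R d (k - 1))"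
  have "(1 - z) *\<^sub>R d k + G (w k) = b + - e k"
  proof -
    define b' where "b' = bt k *\<^sub>R d (k - 1)"
    have vb: "v k = b' - d k" using direction_error[OF k(2,1)] by (simp add: b'_def)
    have "(1 - z) *\<^sub>R d k + v k = z *\<^sub>R v k + (1 - z) *\<^sub>R b'" unfolding vb by (simp add: algebra_simps)
    then have "(1 - z) *\<^sub>R d k = b - v k" unfolding b_def b'_def by (metis add_diff_cancel_right')
    then show ?thesis by (simp add: e_def)
  qed
  then have "2 * (?Y \<bullet> ((1 - z) *\<^sub>R d k)) + 2 * (?Y \<bullet> G (w k)) = 2 * (?Y \<bullet> b) + 2 * (?Y \<bullet> - e k)"
    by (simp only: inner_add_right[symmetric] distrib_left[symmetric])
  moreover have "- (\<rho>' * Q k + (norm b)\<^sup>2 / \<rho>') \<le> 2 * (?Y \<bullet> b)"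
    using young_inner[OF \<rho>(2), of ?Y b] by (simp only: Q_def)
  moreover have "(norm b)\<^sup>2 / \<rho>' \<le> (z * (norm (v k))\<^sup>2 + (1 - z) * momentum_sq k) / \<rho>'"
    using norm_convex_combination_sq[OF z, of "v k" "bt k *\<^sub>R d (k - 1)"] \<rho>
    unfolding b_def momentum_sq_def by (intro divide_right_mono) auto
  moreover have "- (\<rho> * Q k + (norm (e k))\<^sup>2 / \<rho>) \<le> 2 * (?Y \<bullet> - e k)"
    using young_inner[OF \<rho>(1), of ?Y "- e k"] by (simp only: Q_def norm_minus_cancel)
  moreover have "(2 / \<eta>2 - s) * Q k - L * \<gamma> * Q k = a * Q k + \<rho>' * Q k + \<rho> * Q k"
  proof -
    have "2 / \<eta>2 - s - L * \<gamma> = a + \<rho>' + \<rho>" using \<rho>(3) by (simp add: a_def)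
    then have "(2 / \<eta>2 - s - L * \<gamma>) * Q k = (a + \<rho>' + \<rho>) * Q k" by simp
    then show ?thesis by (simp add: algebra_simps)
  qed
  ultimately show ?thesis using 1 2 unfolding R_def by linarith
qed

lemma Z_nonneg: "k \<le> m \<Longrightarrow> 0 \<le> Z k"
  using moreau_gap_nonneg[OF eta2_pos w_dom] etas by (simp add: Z_def)

lemma Z_step:
  assumes "k < m"
  shows "Z (Suc k) \<le> Z k + \<eta>2\<^sup>2 / 2 * (norm (d k))\<^sup>2"
proof -
  have k: "k \<le> m" using assms by simp
  let ?c = "\<eta> k * \<eta>2 / (3 * \<eta>2 + \<eta> k)"
  have c0: "0 \<le> ?c" using eta_pos[OF k] eta2_pos by simp
  have "moreau_gap \<eta>2 (w (Suc k)) \<le> moreau_gap \<eta>2 (w k) + \<gamma> * ?c * (norm (d k))\<^sup>2"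
    using moreau_gap_step[OF eta_pos(1)[OF k] eta_pos(3)[OF k] w_dom[OF k], of \<gamma> "d k"] gam
    unfolding w_step[OF assms] by simp
  also have "\<dots> \<le> moreau_gap \<eta>2 (w k) + 1 * ?c * (norm (d k))\<^sup>2"
    using gam c0 by (intro add_left_mono mult_right_mono) auto
  finally have "2 * \<eta>1 * moreau_gap \<eta>2 (w (Suc k)) \<le> 2 * \<eta>1 * (moreau_gap \<eta>2 (w k) + 1 * ?c * (norm (d k))\<^sup>2)"
    using etas by (intro mult_left_mono) auto
  moreover have "2 * \<eta>1 * ?c * (norm (d k))\<^sup>2 \<le> \<eta>2\<^sup>2 / 2 * (norm (d k))\<^sup>2"
  proof (intro mult_right_mono)
    have "4 * \<eta>1 * \<eta> k \<le> \<eta>2 * (3 * \<eta>2 + \<eta> k)"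
    proof -
      have "\<eta>1 * \<eta> k \<le> \<eta>2 * \<eta> k" "\<eta>1 * \<eta> k \<le> \<eta>2 * \<eta>2"
        using eta_pos[OF k] eta2_pos etas by (auto intro: mult_mono)
      then show ?thesis by (simp add: algebra_simps)
    qed
    then have "4 * \<eta>1 * \<eta> k * \<eta>2 \<le> \<eta>2 * (3 * \<eta>2 + \<eta> k) * \<eta>2" using eta2_pos by (intro mult_right_mono) auto
    then show "2 * \<eta>1 * ?c \<le> \<eta>2\<^sup>2 / 2"
      using eta_pos[OF k] eta2_pos by (simp add: pos_divide_le_eq add_pos_pos power2_eq_square algebra_simps)
  qed simp
  moreover have "2 * \<eta>1 * (moreau_gap \<eta>2 (w k) + 1 * ?c * (norm (d k))\<^sup>2)
      = 2 * \<eta>1 * moreau_gap \<eta>2 (w k) + 2 * \<eta>1 * ?c * (norm (d k))\<^sup>2"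
    by (simp only: distrib_left mult_1 mult.assoc)
  ultimately show ?thesis unfolding Z_def by linarith
qed

text \<open>The Yosida approximation at \<open>w m\<close> is the gradient mapping with the smooth part switched off, and
  switching it on changes the mapping by at most the norm of the gradient.\<close>

lemma mapping_le_envelope: "\<eta>1 * norm final_mapping \<le> sqrt (Z m) + \<eta>1 * norm (G (w m))"
proof -
  define s where "s = \<eta> m"
  have s: "0 < s" "\<eta>1 \<le> s" "s \<le> \<eta>2" using eta_pos[of m] by (auto simp: s_def)
  let ?A = "yosida s (w m)"
  have "s *\<^sub>R yosida s (w m + s *\<^sub>R (- G (w m))) - s *\<^sub>R (- G (w m)) = s *\<^sub>R final_mapping"
    using s by (simp add: yosida_def final_mapping_def s_def)
  then have "norm (s *\<^sub>R final_mapping - s *\<^sub>R ?A) \<le> s * norm (G (w m))"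
    using yosida_nonexpansive[OF s(1), of "w m" "- G (w m)"] by simp
  then have "s * norm (final_mapping - ?A) \<le> s * norm (G (w m))"
    using s by (simp add: scaleR_diff_right[symmetric])
  then have "norm (final_mapping - ?A) \<le> norm (G (w m))" using s by simp
  then have 1: "norm final_mapping \<le> norm ?A + norm (G (w m))" using norm_triangle_sub[of final_mapping ?A] by simp
  have "s / 2 * (norm ?A)\<^sup>2 \<le> moreau_gap \<eta>2 (w m)"
    by (rule yosida_le_moreau_gap[OF s(1,3)]) (rule w_dom, simp)
  moreover have "\<eta>1 / 2 * (norm ?A)\<^sup>2 \<le> s / 2 * (norm ?A)\<^sup>2" using s by (intro mult_right_mono) auto
  ultimately have "2 * \<eta>1 * (\<eta>1 / 2 * (norm ?A)\<^sup>2) \<le> Z m"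
    unfolding Z_def using etas by (intro mult_left_mono) auto
  then have "(\<eta>1 * norm ?A)\<^sup>2 \<le> Z m" by (simp add: power2_eq_square mult_ac)
  then have "\<eta>1 * norm ?A \<le> sqrt (Z m)" by (rule real_le_rsqrt)
  moreover have "\<eta>1 * norm final_mapping \<le> \<eta>1 * norm ?A + \<eta>1 * norm (G (w m))"
    using mult_left_mono[OF 1, of \<eta>1] etas by (simp add: distrib_left)
  ultimately show ?thesis by linarith
qed

lemma mapping_square_split:
  assumes "0 < p" "0 < r" "0 < t" "p + r + t \<le> 1"
  shows "(\<eta>1 * norm final_mapping)\<^sup>2 \<le> Z m / p + \<eta>1\<^sup>2 * (norm (e m))\<^sup>2 / r + \<eta>1\<^sup>2 * (norm (v m))\<^sup>2 / t"
proof -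
  have "norm (G (w m)) \<le> norm (e m) + norm (v m)"
    using norm_triangle_ineq4[of "v m" "e m"] by (simp add: e_def)
  then have "\<eta>1 * norm (G (w m)) \<le> \<eta>1 * norm (e m) + \<eta>1 * norm (v m)"
    using etas by (metis distrib_left mult_le_cancel_left_pos)
  then have "\<eta>1 * norm final_mapping \<le> sqrt (Z m) + \<eta>1 * norm (e m) + \<eta>1 * norm (v m)"
    using mapping_le_envelope by linarith
  from three_term_square[OF this _ assms] etas Z_nonneg[of m] show ?thesis by (simp add: power_mult_distrib)
qed

lemma gradient_square_split:
  "(\<eta>1 * norm (G (w m)))\<^sup>2 \<le> 4/3 * (\<eta>1\<^sup>2 * (norm (v m))\<^sup>2) + 4 * (\<eta>1\<^sup>2 * (norm (e m))\<^sup>2)"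
proof -
  have "(norm (v m + - e m))\<^sup>2 \<le> 4/3 * (norm (v m))\<^sup>2 + 4 * (norm (e m))\<^sup>2"
    using young_inner[of "1/3" "v m" "e m"]
    by (simp add: power2_norm_eq_inner inner_diff_left inner_diff_right inner_commute)
  then have "\<eta>1\<^sup>2 * (norm (G (w m)))\<^sup>2 \<le> \<eta>1\<^sup>2 * (4/3 * (norm (v m))\<^sup>2 + 4 * (norm (e m))\<^sup>2)"
    by (intro mult_left_mono) (auto simp: e_def)
  then show ?thesis by (simp add: power_mult_distrib algebra_simps)
qed

text \<open>The three parts of the budget of an epoch: \<open>T\<close> stems from the initial estimator, \<open>D\<close> from the excess
  length of the initial direction, and \<open>v 0 + d 0\<close> is the residual of the initial direction.\<close>
definition "T = x\<^sup>2 / ((1 - x)\<^sup>2 * (1 + x)) * (\<alpha> * V0)"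
definition "D = x\<^sup>2 / (1 - x\<^sup>2) * \<Delta>"
definition "budget = (2 + 4 * \<eta>2\<^sup>2) * T + (1 + 2 * \<eta>2\<^sup>2) * (norm (v 0 + d 0))\<^sup>2 + (2 + 4 * \<eta>2\<^sup>2) * D"

lemma one_minus_sq: "1 - x\<^sup>2 = (1 - x) * (1 + x)" "0 < 1 - x\<^sup>2"
proof -
  show *: "1 - x\<^sup>2 = (1 - x) * (1 + x)" by (simp add: power2_eq_square algebra_simps)
  show "0 < 1 - x\<^sup>2" unfolding * using x by simp
qed

lemma T_nonneg: "0 \<le> T" and D_nonneg: "0 \<le> D"
  using x V0_nonneg \<alpha>_ge_1 \<Delta>_nonneg one_minus_sq(2) by (auto simp: T_def D_def)

lemma V0_le_\<alpha>: "V0 \<le> \<alpha> * V0"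
  using \<alpha>_ge_1 V0_nonneg mult_right_mono[of 1 \<alpha> V0] by simp

lemma square_V0_eq: "x\<^sup>2 * (\<alpha> * V0) = (1 - x)\<^sup>2 * (1 + x) * T"
  using x by (simp add: T_def)

lemma momentum_sum: "(\<Sum>k=1..<m. momentum_sq k) \<le> T + 3/2 * D"
  using momentum_sum_le unfolding momentum_sq_def T_def D_def .

lemma momentum_first: "1 < m \<Longrightarrow> momentum_sq 1 \<le> (1 - x)\<^sup>2 * (1 + x) * T + (1 - x\<^sup>2) * D"
proof -
  assume m: "1 < m"
  have "momentum_sq 1 \<le> x\<^sup>2 * (norm (d 0))\<^sup>2" using momentum_le[of 0] m by (simp add: momentum_sq_def)
  also have "\<dots> \<le> x\<^sup>2 * (\<alpha> * V0 + \<Delta>)" by (intro mult_left_mono initial_direction_le) auto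
  also have "\<dots> = (1 - x)\<^sup>2 * (1 + x) * T + (1 - x\<^sup>2) * D"
    unfolding distrib_left square_V0_eq using one_minus_sq(2) by (simp add: D_def)
  finally show ?thesis .
qed

lemma estimator_tail: "(\<Sum>k=K+2..<m. (norm (v k))\<^sup>2) \<le> x ^ K * ((1 - x\<^sup>2) * T)"
proof -
  have "(\<Sum>k=K+2..<m. (norm (v k))\<^sup>2) \<le> (\<Sum>k=K+2..<m. x ^ k * V0)" by (intro sum_mono v_le) auto
  also have "\<dots> = (\<Sum>k=K+2..<m. x ^ k) * V0" by (simp add: sum_distrib_right)
  also have "\<dots> \<le> x ^ (K + 2) / (1 - x) * V0" using x V0_nonneg by (intro mult_right_mono geometric_tail) auto
  also have "\<dots> \<le> x ^ (K + 2) / (1 - x) * (\<alpha> * V0)" using x V0_le_\<alpha> by (intro mult_left_mono) auto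
  also have "\<dots> = x ^ K * (x\<^sup>2 * (\<alpha> * V0)) / (1 - x)" by (simp add: power_add power2_eq_square)
  also have "\<dots> = x ^ K * ((1 - x\<^sup>2) * T)"
    unfolding square_V0_eq one_minus_sq(1) using x by (simp add: power2_eq_square)
  finally show ?thesis .
qed

lemma direction_tail:
  "(\<Sum>k=K+2..<m. (1 + real (k + 1 - (K + 2)) / 2) * (norm (d k))\<^sup>2)
    \<le> x ^ K * ((1 + x) * (1 + 1 / (2 * (1 - x)))) * (T + (1/2 + x ^ K * x\<^sup>2) * D)"
proof -
  define E where "E = \<alpha> * V0 / (1 - x) + \<Delta> * (x ^ (K + 2) + 1/2)"
  have E0: "0 \<le> E" using x V0_nonneg \<alpha>_ge_1 \<Delta>_nonneg by (auto simp: E_def)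
  have "(norm (d k))\<^sup>2 \<le> x ^ k * E" if "k \<in> {K+2..<m}" for k
  proof -
    have "(norm (d k))\<^sup>2 \<le> x ^ k * (\<alpha> * V0 / (1 - x) + \<Delta> * (x ^ k + 1/2))" using direction_le that by simp
    also have "\<dots> \<le> x ^ k * E"
      unfolding E_def using that x \<Delta>_nonneg
      by (intro mult_left_mono add_left_mono add_right_mono power_decreasing) auto
    finally show ?thesis .
  qed
  then have "(\<Sum>k=K+2..<m. (1 + real (k + 1 - (K + 2)) / 2) * (norm (d k))\<^sup>2)
      \<le> (\<Sum>k=K+2..<m. (1 + real (k + 1 - (K + 2)) / 2) * (x ^ k * E))"
    by (intro sum_mono mult_left_mono) auto
  also have "\<dots> = ((\<Sum>k=K+2..<m. x ^ k) + (\<Sum>k=K+2..<m. real (k + 1 - (K + 2)) * x ^ k) / 2) * E"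
  proof -
    have "(\<Sum>k=K+2..<m. (1 + real (k + 1 - (K + 2)) / 2) * (x ^ k * E))
        = (\<Sum>k=K+2..<m. (x ^ k + real (k + 1 - (K + 2)) * x ^ k / 2) * E)"
      by (intro sum.cong refl) (simp only: distrib_right mult_1 times_divide_eq_left mult.assoc)
    then show ?thesis by (simp only: sum_distrib_right[symmetric] sum.distrib sum_divide_distrib[symmetric])
  qed
  also have "\<dots> \<le> (x ^ (K + 2) / (1 - x) + x ^ (K + 2) / (1 - x)\<^sup>2 / 2) * E"
    using geometric_tail[of x "K + 2" m] x E0
    by (intro mult_right_mono add_mono divide_right_mono) auto
  also have "\<dots> = x ^ K * ((1 + x) * (1 + 1 / (2 * (1 - x)))) * (x\<^sup>2 / ((1 - x) * (1 + x)) * E)"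
    using x by (simp add: power_add divide_simps) (simp add: power2_eq_square algebra_simps)
  also have "x\<^sup>2 / ((1 - x) * (1 + x)) * E = T + (1/2 + x ^ K * x\<^sup>2) * D"
    using x unfolding E_def T_def D_def one_minus_sq(1)
    by (simp add: power_add divide_simps) (simp add: power2_eq_square algebra_simps)
  finally show ?thesis .
qed

lemma final_estimator: "2 \<le> m \<Longrightarrow> (norm (v m))\<^sup>2 \<le> x ^ (m - 2) * ((1 - x)\<^sup>2 * (1 + x)) * T"
proof -
  assume m: "2 \<le> m"
  have "(norm (v m))\<^sup>2 \<le> x ^ m * V0" using v_le[of m] by simp
  also have "\<dots> \<le> x ^ m * (\<alpha> * V0)" using V0_le_\<alpha> x by (intro mult_left_mono) auto
  also have "x ^ m = x ^ (m - 2) * x\<^sup>2" using m by (metis le_add_diff_inverse2 power_add)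
  finally show ?thesis using square_V0_eq by (simp add: mult.assoc)
qed

lemma simple_decrease:
  assumes "0 < m"
  shows "a * (\<Sum>k<m. Q k) \<le> (\<Sum>k<m. R k) + 2 * (\<Sum>k<m. (norm (e k))\<^sup>2)
    + (norm (v 0 + d 0))\<^sup>2 / 3 + 2/5 * (\<Sum>k=1..<m. momentum_sq k)"
proof -
  have s: "(\<Sum>k<m. g k) = g 0 + (\<Sum>k=1..<m. g k)" for g :: "nat \<Rightarrow> real"
    using assms by (simp add: atLeast0LessThan[symmetric] sum.atLeast_Suc_lessThan)
  have "a * Q k \<le> R k + 2 * (norm (e k))\<^sup>2 + 2/5 * momentum_sq k" if "k \<in> {1..<m}" for k
    using R_early[of k "1/2"] that by simp
  then have "(\<Sum>k=1..<m. a * Q k) \<le> (\<Sum>k=1..<m. R k + 2 * (norm (e k))\<^sup>2 + 2/5 * momentum_sq k)" by (rule sum_mono)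
  then have "a * (\<Sum>k=1..<m. Q k) \<le> (\<Sum>k=1..<m. R k) + 2 * (\<Sum>k=1..<m. (norm (e k))\<^sup>2) + 2/5 * (\<Sum>k=1..<m. momentum_sq k)"
    by (simp only: sum.distrib sum_distrib_left)
  moreover have "0 \<le> 2 * (norm (e 0))\<^sup>2" by simp
  ultimately show ?thesis using R_initial[OF assms] unfolding s[of Q] s[of R] s[of "\<lambda>k. (norm (e k))\<^sup>2"] distrib_left
    by linarith
qed

lemma simple_budget:
  "(norm (v 0 + d 0))\<^sup>2 / 3 + 2/5 * (\<Sum>k=1..<m. momentum_sq k) + (8/5 + 4 * \<eta>2\<^sup>2) * T \<le> budget"
proof -
  have "0 \<le> \<eta>2\<^sup>2 * (norm (v 0 + d 0))\<^sup>2" "0 \<le> \<eta>2\<^sup>2 * D" using D_nonneg by auto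
  moreover have "0 \<le> (norm (v 0 + d 0))\<^sup>2" by simp
  ultimately show ?thesis using momentum_sum D_nonneg unfolding budget_def distrib_right mult_1 mult.assoc by linarith
qed

text \<open>For at most two iterations the factor \<open>m + 1\<close> does not exceed the three copies from \<open>final_descent\<close>.\<close>

lemma mapping_bound_short:
  assumes "0 < m" "m \<le> 2"
  shows "(real m + 1) * (\<eta>1 * norm final_mapping)\<^sup>2 + a * (\<Sum>k<m. Q k) \<le> gap + 2 * (\<Sum>k<m. (norm (e k))\<^sup>2) + budget"
proof -
  have "(real m + 1) * (\<eta>1 * norm final_mapping)\<^sup>2 \<le> 3 * (\<eta>1 * norm final_mapping)\<^sup>2" using assms by (intro mult_right_mono) auto
  moreover have "0 \<le> (8/5 + 4 * \<eta>2\<^sup>2) * T" using T_nonneg by simp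
  ultimately show ?thesis using total_descent simple_decrease[OF assms(1)] simple_budget by linarith
qed

text \<open>The gradient at \<open>w m\<close> is compared with the last estimator, whose decay \<open>x ^ m\<close> outweighs the factor
  \<open>m + 1\<close>.\<close>

lemma gradient_bound:
  assumes "2 \<le> m"
  shows "(real m + 1) * (\<eta>1 * norm (G (w m)))\<^sup>2 + a * (\<Sum>k<m. Q k)
    \<le> gap + 2 * (\<Sum>k<m. (norm (e k))\<^sup>2) + 4 * (real m + 1) * \<eta>2\<^sup>2 * (norm (e m))\<^sup>2 + budget"
proof -
  have e: "\<eta>1\<^sup>2 \<le> \<eta>2\<^sup>2" using etas by (intro power_mono) auto
  have "(real m + 1) * (4/3 * (\<eta>1\<^sup>2 * (norm (v m))\<^sup>2)) \<le> 4 * \<eta>2\<^sup>2 * T"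
  proof -
    have "(real m + 1) * (norm (v m))\<^sup>2 \<le> (real m + 1) * (x ^ (m - 2) * ((1 - x)\<^sup>2 * (1 + x)) * T)"
      using final_estimator[OF assms] by (intro mult_left_mono) auto
    also have "\<dots> \<le> 3 * T" using mult_right_mono[OF final_gradient_budget[of x m] T_nonneg] x assms
      by (simp add: mult.assoc)
    finally have "\<eta>1\<^sup>2 * ((real m + 1) * (norm (v m))\<^sup>2) \<le> \<eta>2\<^sup>2 * (3 * T)"
      using e T_nonneg by - (rule mult_mono, auto)
    then show ?thesis by (simp add: algebra_simps)
  qed
  moreover have "(real m + 1) * (4 * (\<eta>1\<^sup>2 * (norm (e m))\<^sup>2)) \<le> (real m + 1) * (4 * (\<eta>2\<^sup>2 * (norm (e m))\<^sup>2))"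
    using e by (intro mult_left_mono mult_right_mono) auto
  moreover have "(real m + 1) * (\<eta>1 * norm (G (w m)))\<^sup>2
      \<le> (real m + 1) * (4/3 * (\<eta>1\<^sup>2 * (norm (v m))\<^sup>2)) + (real m + 1) * (4 * (\<eta>1\<^sup>2 * (norm (e m))\<^sup>2))"
    using mult_left_mono[OF gradient_square_split, of "real m + 1"] by (simp add: distrib_left)
  moreover have "(\<Sum>k<m. R k) \<le> gap" using total_descent by (smt (verit) zero_le_power2)
  moreover have "(8/5 + 4 * \<eta>2\<^sup>2) * T = 8/5 * T + 4 * \<eta>2\<^sup>2 * T" by (simp add: distrib_right)
  moreover have "0 \<le> 8/5 * T" using T_nonneg by simp
  moreover have "(real m + 1) * (4 * (\<eta>2\<^sup>2 * (norm (e m))\<^sup>2)) = 4 * (real m + 1) * \<eta>2\<^sup>2 * (norm (e m))\<^sup>2" by simp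
  moreover have "a * (\<Sum>k<m. Q k) \<le> (\<Sum>k<m. R k) + 2 * (\<Sum>k<m. (norm (e k))\<^sup>2)
      + (norm (v 0 + d 0))\<^sup>2 / 3 + 2/5 * (\<Sum>k=1..<m. momentum_sq k)"
    using assms by (intro simple_decrease) simp
  ultimately show ?thesis using simple_budget by linarith
qed

text \<open>With a single iteration there is no decay to exploit. Two of the three units of \<open>Q 0\<close> are kept instead;
  they compensate the change of the gradient in expectation.\<close>

lemma first_step_bound:
  assumes "m = 1"
  shows "2 * Q 0 + a * (\<Sum>k<m. Q k) \<le> gap + (norm (v 0 + d 0))\<^sup>2"
proof -
  have "(3 + a) * Q 0 + 2 * ((w 0 - y 0) \<bullet> (v 0 + d 0)) \<le> R 0" using R_basic[of 0] assms by (simp add: v0)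
  moreover have "- (1 * Q 0 + (norm (v 0 + d 0))\<^sup>2 / 1) \<le> 2 * ((w 0 - y 0) \<bullet> (v 0 + d 0))"
    unfolding Q_def by (rule young_inner) simp
  moreover have "R 0 \<le> gap" using total_descent assms by (smt (verit) One_nat_def lessThan_0 lessThan_Suc sum.empty
        sum.insert finite.emptyI empty_iff add_0_right zero_le_power2)
  ultimately show ?thesis using assms by (simp add: algebra_simps)
qed

section \<open>The gradient mapping at the end of an epoch\<close>

text \<open>The iterations \<open>1, \<dots>, K + 1\<close> only have to be nonnegative up to their error terms, while the later ones
  contribute \<open>s * Z k\<close>, which \<open>nearly_monotone_average\<close> converts into copies of \<open>Z m\<close>. The growth
  \<open>\<eta>2\<^sup>2/2 \<parallel>d k\<parallel>\<^sup>2\<close> of \<open>Z\<close> accounts for the half in the weights of the last sum.\<close>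

lemma weighted_decrease:
  assumes m: "K + 2 \<le> m" and s: "0 \<le> s" "s * \<eta>2 \<le> 1" and \<rho>: "0 < \<rho>" "\<rho> < 3" "0 < \<rho>'" "s + \<rho>' + \<rho> = 3"
  defines "z \<equiv> s * \<eta>2"
  shows "a * (\<Sum>k<m. Q k) + s * (real (m - (K + 2)) * Z m) \<le> (\<Sum>k<m. R k) + (\<Sum>k<m. (norm (e k))\<^sup>2) / \<rho>
    + (norm (v 0 + d 0))\<^sup>2 / 3 + (\<Sum>k=1..<K+2. momentum_sq k) / (3 - \<rho>)
    + (z * (\<Sum>k=K+2..<m. (norm (v k))\<^sup>2) + (1 - z) * (\<Sum>k=K+2..<m. momentum_sq k)) / \<rho>'
    + s * \<eta>2\<^sup>2 * (\<Sum>k=K+2..<m. (1 + real (k + 1 - (K + 2)) / 2) * (norm (d k))\<^sup>2)"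
proof -
  have sp: "(\<Sum>k<m. g k) = g 0 + (\<Sum>k=1..<K+2. g k) + (\<Sum>k=K+2..<m. g k)" for g :: "nat \<Rightarrow> real"
  proof -
    have "(\<Sum>k<m. g k) = (\<Sum>k=0..<K+2. g k) + (\<Sum>k=K+2..<m. g k)"
      using m sum.atLeastLessThan_concat[of 0 "K + 2" m g] by (simp add: atLeast0LessThan)
    then show ?thesis by (simp add: sum.atLeast_Suc_lessThan)
  qed
  have "a * Q k \<le> R k + (norm (e k))\<^sup>2 / \<rho> + momentum_sq k / (3 - \<rho>)" if "k \<in> {1..<K+2}" for k
    using R_early[of k \<rho>] that m \<rho> by simp
  then have "(\<Sum>k=1..<K+2. a * Q k) \<le> (\<Sum>k=1..<K+2. R k + (norm (e k))\<^sup>2 / \<rho> + momentum_sq k / (3 - \<rho>))" by (rule sum_mono)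
  then have 1: "a * (\<Sum>k=1..<K+2. Q k)
      \<le> (\<Sum>k=1..<K+2. R k) + (\<Sum>k=1..<K+2. (norm (e k))\<^sup>2) / \<rho> + (\<Sum>k=1..<K+2. momentum_sq k) / (3 - \<rho>)"
    by (simp only: sum.distrib sum_distrib_left sum_divide_distrib)
  have "s * Z k + a * Q k \<le> R k + (norm (e k))\<^sup>2 / \<rho> + s * \<eta>2\<^sup>2 * (norm (d k))\<^sup>2
      + (z * (norm (v k))\<^sup>2 + (1 - z) * momentum_sq k) / \<rho>'" if "k \<in> {K+2..<m}" for k
    using R_late[of k s \<rho> \<rho>'] that s \<rho> unfolding z_def by simp
  then have "(\<Sum>k=K+2..<m. s * Z k + a * Q k) \<le> (\<Sum>k=K+2..<m. R k + (norm (e k))\<^sup>2 / \<rho> + s * \<eta>2\<^sup>2 * (norm (d k))\<^sup>2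
      + (z * (norm (v k))\<^sup>2 + (1 - z) * momentum_sq k) / \<rho>')" by (rule sum_mono)
  then have 2: "s * (\<Sum>k=K+2..<m. Z k) + a * (\<Sum>k=K+2..<m. Q k)
      \<le> (\<Sum>k=K+2..<m. R k) + (\<Sum>k=K+2..<m. (norm (e k))\<^sup>2) / \<rho> + s * \<eta>2\<^sup>2 * (\<Sum>k=K+2..<m. (norm (d k))\<^sup>2)
      + (z * (\<Sum>k=K+2..<m. (norm (v k))\<^sup>2) + (1 - z) * (\<Sum>k=K+2..<m. momentum_sq k)) / \<rho>'"
    by (simp only: sum.distrib sum_distrib_left sum_divide_distrib add_divide_distrib)
  have "real (m - (K + 2)) * Z m \<le> (\<Sum>k=K+2..<m. Z k) + (\<Sum>k=K+2..<m. real (k + 1 - (K + 2)) * (\<eta>2\<^sup>2 / 2 * (norm (d k))\<^sup>2))"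
    by (rule nearly_monotone_average[OF m]) (rule Z_step)
  also have "(\<Sum>k=K+2..<m. real (k + 1 - (K + 2)) * (\<eta>2\<^sup>2 / 2 * (norm (d k))\<^sup>2))
      = \<eta>2\<^sup>2 * (\<Sum>k=K+2..<m. real (k + 1 - (K + 2)) / 2 * (norm (d k))\<^sup>2)"
    by (simp add: sum_distrib_left mult_ac)
  finally have "s * (real (m - (K + 2)) * Z m)
      \<le> s * ((\<Sum>k=K+2..<m. Z k) + \<eta>2\<^sup>2 * (\<Sum>k=K+2..<m. real (k + 1 - (K + 2)) / 2 * (norm (d k))\<^sup>2))"
    using s by (intro mult_left_mono) auto
  then have 3: "s * (real (m - (K + 2)) * Z m)
      \<le> s * (\<Sum>k=K+2..<m. Z k) + s * \<eta>2\<^sup>2 * (\<Sum>k=K+2..<m. real (k + 1 - (K + 2)) / 2 * (norm (d k))\<^sup>2)"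
    by (simp only: distrib_left mult.assoc)
  have 4: "s * \<eta>2\<^sup>2 * (\<Sum>k=K+2..<m. (1 + real (k + 1 - (K + 2)) / 2) * (norm (d k))\<^sup>2)
      = s * \<eta>2\<^sup>2 * (\<Sum>k=K+2..<m. (norm (d k))\<^sup>2) + s * \<eta>2\<^sup>2 * (\<Sum>k=K+2..<m. real (k + 1 - (K + 2)) / 2 * (norm (d k))\<^sup>2)"
    by (simp only: distrib_right sum.distrib distrib_left mult_1)
  have 5: "a * Q 0 \<le> R 0 + (norm (v 0 + d 0))\<^sup>2 / 3" using R_initial m by simp
  have 6: "0 \<le> (norm (e 0))\<^sup>2 / \<rho>" using \<rho> by simp
  show ?thesis using 1 2 3 5 6
    unfolding 4 sp[of Q] sp[of R] sp[of "\<lambda>k. (norm (e k))\<^sup>2"] distrib_left add_divide_distrib by linarith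
qed

text \<open>Of the \<open>m + 1\<close> copies three come from \<open>final_descent\<close> and \<open>m - 2\<close> from \<open>Z m\<close>. The parameters \<open>p\<close>, \<open>r\<close>, \<open>t\<close>
  distribute the square of \<open>\<surd>(Z m) + \<eta>1 \<parallel>e m\<parallel> + \<eta>1 \<parallel>v m\<parallel>\<close> over its terms.\<close>

lemma mapping_bound_from_weights:
  assumes m: "K + 2 < m" and s: "0 \<le> s" "s * \<eta>2 \<le> 1"
    and \<rho>: "0 < \<rho>" "\<rho> < 3" "0 < \<rho>'" "s + \<rho>' + \<rho> = 3"
    and p: "0 < p" "0 < r" "0 < t" "p + r + t \<le> 1"
    and N: "real (m - 2) \<le> p * (s * real (m - (K + 2)))"
  defines "z \<equiv> s * \<eta>2"
  shows "(real m + 1) * (\<eta>1 * norm final_mapping)\<^sup>2 + a * (\<Sum>k<m. Q k) \<le> gap + (\<Sum>k<m. (norm (e k))\<^sup>2) / \<rho>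
    + real (m - 2) / r * (\<eta>1\<^sup>2 * (norm (e m))\<^sup>2)
    + ((norm (v 0 + d 0))\<^sup>2 / 3 + (\<Sum>k=1..<K+2. momentum_sq k) / (3 - \<rho>)
    + (z * (\<Sum>k=K+2..<m. (norm (v k))\<^sup>2) + (1 - z) * (\<Sum>k=K+2..<m. momentum_sq k)) / \<rho>'
    + s * \<eta>2\<^sup>2 * (\<Sum>k=K+2..<m. (1 + real (k + 1 - (K + 2)) / 2) * (norm (d k))\<^sup>2)
    + real (m - 2) / t * (\<eta>1\<^sup>2 * (norm (v m))\<^sup>2))"
proof -
  have "real (m - 2) * (Z m / p) \<le> p * (s * real (m - (K + 2))) * (Z m / p)"
    using N Z_nonneg[of m] p by (intro mult_right_mono) auto
  also have "\<dots> = s * (real (m - (K + 2)) * Z m)" using p by simp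
  finally have 1: "real (m - 2) * (Z m / p) \<le> s * (real (m - (K + 2)) * Z m)" .
  have "real (m - 2) * (\<eta>1 * norm final_mapping)\<^sup>2
      \<le> real (m - 2) * (Z m / p + \<eta>1\<^sup>2 * (norm (e m))\<^sup>2 / r + \<eta>1\<^sup>2 * (norm (v m))\<^sup>2 / t)"
    by (intro mult_left_mono mapping_square_split p) auto
  then have 2: "real (m - 2) * (\<eta>1 * norm final_mapping)\<^sup>2 \<le> real (m - 2) * (Z m / p)
      + real (m - 2) / r * (\<eta>1\<^sup>2 * (norm (e m))\<^sup>2) + real (m - 2) / t * (\<eta>1\<^sup>2 * (norm (v m))\<^sup>2)"
    by (simp only: distrib_left times_divide_eq_left times_divide_eq_right)
  have 3: "(real m + 1) * (\<eta>1 * norm final_mapping)\<^sup>2 = 3 * (\<eta>1 * norm final_mapping)\<^sup>2 + real (m - 2) * (\<eta>1 * norm final_mapping)\<^sup>2"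
  proof -
    have "real m + 1 = 3 + real (m - 2)" using m by (simp add: of_nat_diff)
    then show ?thesis by (simp only: distrib_right)
  qed
  show ?thesis
    using weighted_decrease[of K s \<rho> \<rho>'] m s \<rho> total_descent 1 2 unfolding 3 z_def by simp
qed

lemma sum_split:
  fixes g :: "nat \<Rightarrow> real"
  assumes "K + 2 \<le> m"
  shows "(\<Sum>k=1..<K+2. g k) + (\<Sum>k=K+2..<m. g k) = (\<Sum>k=1..<m. g k)"
  using assms by (intro sum.atLeastLessThan_concat) auto

lemma momentum_sq_nonneg: "0 \<le> momentum_sq k" by (simp add: momentum_sq_def)

lemma initial_error_in_budget: "(norm (v 0 + d 0))\<^sup>2 / 3 \<le> (1 + 2 * \<eta>2\<^sup>2) * (norm (v 0 + d 0))\<^sup>2"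
proof -
  have "1/3 \<le> 1 + 2 * \<eta>2\<^sup>2" using zero_le_power2[of \<eta>2] by linarith
  from mult_right_mono[OF this, of "(norm (v 0 + d 0))\<^sup>2"] show ?thesis by simp
qed

text \<open>For small ratios all iterations from the second on are used for the potential (\<open>K = 0\<close>). The weights
  \<open>r\<close> and \<open>t\<close> depend on the epoch length so that the final error costs just \<open>4 (m + 1)\<close> units.\<close>

lemma mapping_bound_small_ratio:
  assumes m: "3 \<le> m" and x23: "x \<le> 2/3"
  shows "(real m + 1) * (\<eta>1 * norm final_mapping)\<^sup>2 + a * (\<Sum>k<m. Q k)
    \<le> gap + 2 * (\<Sum>k<m. (norm (e k))\<^sup>2) + 4 * (real m + 1) * \<eta>2\<^sup>2 * (norm (e m))\<^sup>2 + budget"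
proof -
  define N where "N = m - 2"
  have N: "1 \<le> N" "m = N + 2" using m by (auto simp: N_def)
  define n where "n = real N"
  have n: "1 \<le> n" using N by (simp add: n_def)
  define z where "z = 7/5 * \<eta>2"
  have h: "0 \<le> \<eta>2" "\<eta>2 \<le> 2/3" using eta2_pos eta2_bound by auto
  have z: "0 \<le> z" "z \<le> 1" using h by (auto simp: z_def)
  have x0: "0 \<le> x" "x < 1" using x by auto
  (* r makes n / r = 4 (m + 1), and t uses up what p = 5/7 and r leave of the unit *)
  define r where "r = n / (4 * (n + 3))"
  define t where "t = (n + 24) / (28 * (n + 3))"
  have rt: "0 < r" "0 < t" "5/7 + r + t \<le> 1"
    using n by (auto simp: r_def t_def divide_simps)
  let ?V = "(\<Sum>k=0+2..<m. (norm (v k))\<^sup>2)" and ?B2 = "(\<Sum>k=0+2..<m. momentum_sq k)"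
  let ?S = "(\<Sum>k=0+2..<m. (1 + real (k + 1 - (0 + 2)) / 2) * (norm (d k))\<^sup>2)"
  let ?Y = "(1 + x) * (1 + 1 / (2 * (1 - x)))"
  have main: "(real m + 1) * (\<eta>1 * norm final_mapping)\<^sup>2 + a * (\<Sum>k<m. Q k) \<le> gap + (\<Sum>k<m. (norm (e k))\<^sup>2) / (1/2)
    + n / r * (\<eta>1\<^sup>2 * (norm (e m))\<^sup>2)
    + ((norm (v 0 + d 0))\<^sup>2 / 3 + (\<Sum>k=1..<0+2. momentum_sq k) / (3 - 1/2)
    + (z * ?V + (1 - z) * ?B2) / (11/10) + 7/5 * \<eta>2\<^sup>2 * ?S + n / t * (\<eta>1\<^sup>2 * (norm (v m))\<^sup>2))"
    unfolding n_def N_def z_def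
    by (rule mapping_bound_from_weights[where K = 0 and s = "7/5" and \<rho> = "1/2" and \<rho>' = "11/10"
        and p = "5/7" and r = r and t = t]) (use m h rt in auto)
  have e12: "\<eta>1\<^sup>2 \<le> \<eta>2\<^sup>2" using etas by (intro power_mono) auto
  have E: "n / r * (\<eta>1\<^sup>2 * (norm (e m))\<^sup>2) \<le> 4 * (real m + 1) * \<eta>2\<^sup>2 * (norm (e m))\<^sup>2"
  proof -
    have "n / r = 4 * (real m + 1)" using n N by (simp add: r_def n_def)
    then have "n / r * (\<eta>1\<^sup>2 * (norm (e m))\<^sup>2) \<le> 4 * (real m + 1) * (\<eta>2\<^sup>2 * (norm (e m))\<^sup>2)"
      using mult_right_mono[OF e12, of "(norm (e m))\<^sup>2"]
      by (simp only:) (rule mult_left_mono, auto)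
    then show ?thesis by (simp only: mult.assoc)
  qed
  have B1: "(\<Sum>k=1..<0+2. momentum_sq k) / (3 - 1/2) \<le> 2/5 * ((1 - x)\<^sup>2 * (1 + x) * T) + 2/5 * ((1 - x\<^sup>2) * D)"
  proof -
    have "(\<Sum>k=1..<0+2. momentum_sq k) = momentum_sq 1" by (simp add: numeral_2_eq_2)
    then have "(\<Sum>k=1..<0+2. momentum_sq k) / (3 - 1/2) = 2/5 * momentum_sq 1" by simp
    also have "\<dots> \<le> 2/5 * ((1 - x)\<^sup>2 * (1 + x) * T + (1 - x\<^sup>2) * D)"
      using momentum_first m by (intro mult_left_mono) auto
    finally show ?thesis by (simp only: distrib_left)
  qed
  have B2: "?B2 \<le> T + 3/2 * D"
  proof -
    have "(\<Sum>k=1..<0+2. momentum_sq k) + ?B2 = (\<Sum>k=1..<m. momentum_sq k)"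
      by (rule sum_split) (use m momentum_sq_nonneg in auto)
    moreover have "0 \<le> (\<Sum>k=1..<0+2. momentum_sq k)" by (rule sum_nonneg, rule momentum_sq_nonneg)
    ultimately show ?thesis using momentum_sum by linarith
  qed
  have V: "?V \<le> (1 - x\<^sup>2) * T" using estimator_tail[of 0] by simp
  have S: "?S \<le> ?Y * (T + (1/2 + x\<^sup>2) * D)" using direction_tail[of 0] by simp
  have last: "n / t * (\<eta>1\<^sup>2 * (norm (v m))\<^sup>2) \<le> 13/10 * \<eta>2\<^sup>2 * T"
  proof -
    have c: "n / t = 28 * real N * (real N + 3) / (real N + 24)" using n by (simp add: t_def n_def)
    have c0: "0 \<le> n / t" using n rt by simp
    have "(norm (v m))\<^sup>2 \<le> x ^ N * ((1 - x)\<^sup>2 * (1 + x)) * T" using final_estimator m by (simp add: N_def)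
    then have "n / t * (norm (v m))\<^sup>2 \<le> n / t * (x ^ N * ((1 - x)\<^sup>2 * (1 + x)) * T)"
      using c0 by (intro mult_left_mono) auto
    also have "\<dots> = 28 * real N * (real N + 3) / (real N + 24) * (x ^ N * ((1 - x)\<^sup>2 * (1 + x))) * T"
      unfolding c by (simp only: mult.assoc)
    also have "\<dots> \<le> 13/10 * T"
      by (intro mult_right_mono small_ratio_budget_last x0 x23 N T_nonneg)
    finally have "\<eta>1\<^sup>2 * (n / t * (norm (v m))\<^sup>2) \<le> \<eta>2\<^sup>2 * (13/10 * T)"
    proof (rule mult_mono[OF e12])
      show "0 \<le> n / t * (norm (v m))\<^sup>2" using c0 by (rule mult_nonneg_nonneg) simp
    qed simp
    then show ?thesis by (simp add: mult_ac)
  qed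
  have PT: "((1 - z) * (10/11) + 2/5 * ((1 - x)\<^sup>2 * (1 + x)) + z * (10/11) * (1 - x\<^sup>2)
    + 7/5 * \<eta>2\<^sup>2 * ?Y + 13/10 * \<eta>2\<^sup>2) * T \<le> (2 + 4 * \<eta>2\<^sup>2) * T"
    unfolding z_def by (intro mult_right_mono small_ratio_budget_gradient x0 x23 h T_nonneg)
  have PD: "(3/2 * ((1 - z) * (10/11)) + 2/5 * (1 - x\<^sup>2) + 7/5 * \<eta>2\<^sup>2 * (?Y * (1/2 + x\<^sup>2))) * D \<le> (2 + 4 * \<eta>2\<^sup>2) * D"
    unfolding z_def by (intro mult_right_mono small_ratio_budget_deviation x0 x23 h D_nonneg)
  have vB: "(z * ?V + (1 - z) * ?B2) / (11/10) \<le> z * (10/11) * ((1 - x\<^sup>2) * T) + (1 - z) * (10/11) * (T + 3/2 * D)"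
  proof -
    have "z * ?V \<le> z * ((1 - x\<^sup>2) * T)" "(1 - z) * ?B2 \<le> (1 - z) * (T + 3/2 * D)"
      using V B2 z by (auto intro!: mult_left_mono)
    then have "(z * ?V + (1 - z) * ?B2) / (11/10) \<le> (z * ((1 - x\<^sup>2) * T) + (1 - z) * (T + 3/2 * D)) / (11/10)"
      by (intro divide_right_mono add_mono) auto
    also have "\<dots> = z * (10/11) * ((1 - x\<^sup>2) * T) + (1 - z) * (10/11) * (T + 3/2 * D)" by (simp add: field_simps)
    finally show ?thesis .
  qed
  have Sh: "7/5 * \<eta>2\<^sup>2 * ?S \<le> 7/5 * \<eta>2\<^sup>2 * (?Y * (T + (1/2 + x\<^sup>2) * D))"
    using S by (intro mult_left_mono) auto
  note eps = initial_error_in_budget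
  have "(norm (v 0 + d 0))\<^sup>2 / 3 + (\<Sum>k=1..<0+2. momentum_sq k) / (3 - 1/2)
    + (z * ?V + (1 - z) * ?B2) / (11/10) + 7/5 * \<eta>2\<^sup>2 * ?S + n / t * (\<eta>1\<^sup>2 * (norm (v m))\<^sup>2)
    \<le> (1 + 2 * \<eta>2\<^sup>2) * (norm (v 0 + d 0))\<^sup>2 + (2/5 * ((1 - x)\<^sup>2 * (1 + x) * T) + 2/5 * ((1 - x\<^sup>2) * D))
    + (z * (10/11) * ((1 - x\<^sup>2) * T) + (1 - z) * (10/11) * (T + 3/2 * D))
    + 7/5 * \<eta>2\<^sup>2 * (?Y * (T + (1/2 + x\<^sup>2) * D)) + 13/10 * \<eta>2\<^sup>2 * T"
    by (intro add_mono eps B1 vB Sh last)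
  also have "\<dots> = (1 + 2 * \<eta>2\<^sup>2) * (norm (v 0 + d 0))\<^sup>2
    + ((1 - z) * (10/11) + 2/5 * ((1 - x)\<^sup>2 * (1 + x)) + z * (10/11) * (1 - x\<^sup>2)
    + 7/5 * \<eta>2\<^sup>2 * ?Y + 13/10 * \<eta>2\<^sup>2) * T
    + (3/2 * ((1 - z) * (10/11)) + 2/5 * (1 - x\<^sup>2) + 7/5 * \<eta>2\<^sup>2 * (?Y * (1/2 + x\<^sup>2))) * D"
    by algebra
  also have "\<dots> \<le> budget" using PT PD unfolding budget_def by linarith
  finally show ?thesis using main E by simp
qed

text \<open>For large ratios the squared directions decay slowly, and the first ninth of the epoch is left out, in
  which they lose the factor \<open>\<zeta> \<le> 3/5\<close>.\<close>

lemma mapping_bound_large_ratio: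
  assumes m: "3 \<le> m" and x23: "2/3 < x" and long: "17/2 * (x\<^sup>2 / ((1 - x)\<^sup>2 * (1 + x))) \<le> real m + 1"
  shows "(real m + 1) * (\<eta>1 * norm final_mapping)\<^sup>2 + a * (\<Sum>k<m. Q k)
    \<le> gap + 10/7 * (\<Sum>k<m. (norm (e k))\<^sup>2) + 5 * real m * \<eta>2\<^sup>2 * (norm (e m))\<^sup>2 + budget"
proof -
  define N where "N = m - 2"
  have N: "1 \<le> N" "m = N + 2" using m by (auto simp: N_def)
  define n where "n = real N"
  (* the number of iterations left out of the potential *)
  define K where "K = N div 9"
  define \<zeta> where "\<zeta> = x ^ K"
  have x0: "0 \<le> x" "x < 1" "2/3 \<le> x" "x \<le> 1" using x x23 by auto
  have long': "17/2 * (x\<^sup>2 / ((1 - x)\<^sup>2 * (1 + x))) \<le> real N + 3" using long N by simp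
  note geo = large_ratio_geometry[OF x23 x0(2) long', folded K_def \<zeta>_def]
  have n: "18 \<le> n" using geo(1) by (simp add: n_def)
  define z where "z = 3/2 * \<eta>2"
  have h: "0 \<le> \<eta>2" "\<eta>2 \<le> 2/3" using eta2_pos eta2_bound by auto
  have z: "0 \<le> z" "z \<le> 1" using h by (auto simp: z_def)
  have K9: "9 * K \<le> N" "K + 2 < m" using geo(1) N unfolding K_def by linarith+
  have \<zeta>0: "0 \<le> \<zeta>" using x0 by (simp add: \<zeta>_def)
  let ?V = "(\<Sum>k=K+2..<m. (norm (v k))\<^sup>2)" and ?B1 = "(\<Sum>k=1..<K+2. momentum_sq k)" and ?B2 = "(\<Sum>k=K+2..<m. momentum_sq k)"
  let ?S = "(\<Sum>k=K+2..<m. (1 + real (k + 1 - (K + 2)) / 2) * (norm (d k))\<^sup>2)"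
  let ?Y = "(1 + x) * (1 + 1 / (2 * (1 - x)))"
  have Y0: "0 \<le> ?Y" using x0 by (intro mult_nonneg_nonneg) auto
  have nK: "real (m - (K + 2)) = n - real K" using K9 N by (simp add: n_def)
  have main: "(real m + 1) * (\<eta>1 * norm final_mapping)\<^sup>2 + a * (\<Sum>k<m. Q k) \<le> gap + (\<Sum>k<m. (norm (e k))\<^sup>2) / (7/10)
    + n / (1/5) * (\<eta>1\<^sup>2 * (norm (e m))\<^sup>2)
    + ((norm (v 0 + d 0))\<^sup>2 / 3 + ?B1 / (3 - 7/10)
    + (z * ?V + (1 - z) * ?B2) / (4/5) + 3/2 * \<eta>2\<^sup>2 * ?S + n / (1/20) * (\<eta>1\<^sup>2 * (norm (v m))\<^sup>2))"
    unfolding n_def N_def z_def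
  proof (rule mapping_bound_from_weights[where K = K and s = "3/2" and \<rho> = "7/10" and \<rho>' = "4/5"
        and p = "3/4" and r = "1/5" and t = "1/20"])
    have "9 * real K \<le> n" using K9(1) unfolding n_def by linarith
    then show "real (m - 2) \<le> 3 / 4 * (3 / 2 * real (m - (K + 2)))" unfolding nK by (simp add: n_def N_def)
  qed (use K9 h in auto)
  have e12: "\<eta>1\<^sup>2 \<le> \<eta>2\<^sup>2" using etas by (intro power_mono) auto
  have E: "n / (1/5) * (\<eta>1\<^sup>2 * (norm (e m))\<^sup>2) \<le> 5 * real m * \<eta>2\<^sup>2 * (norm (e m))\<^sup>2"
  proof -
    have "n / (1/5) * (\<eta>1\<^sup>2 * (norm (e m))\<^sup>2) \<le> (5 * real m) * (\<eta>2\<^sup>2 * (norm (e m))\<^sup>2)"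
      using mult_right_mono[OF e12, of "(norm (e m))\<^sup>2"] N n
      by - (rule mult_mono, auto simp: n_def)
    then show ?thesis by (simp only: mult.assoc)
  qed
  (* an upper bound, for all z in [0, 1], of both weights 10/23 and 5/4 (1 - z) of the momentum terms *)
  define cB where "cB = 5/4 - 163/200 * z"
  have BB: "?B1 / (3 - 7/10) + (1 - z) * ?B2 / (4/5) \<le> cB * (T + 3/2 * D)"
  proof -
    have nn: "0 \<le> ?B1" "0 \<le> ?B2" by (rule sum_nonneg, rule momentum_sq_nonneg)+
    have "?B1 / (3 - 7/10) \<le> cB * ?B1"
    proof -
      have "10/23 * ?B1 \<le> cB * ?B1" using z nn by (intro mult_right_mono) (auto simp: cB_def)
      then show ?thesis by simp
    qed
    moreover have "(1 - z) * ?B2 / (4/5) \<le> cB * ?B2"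
    proof -
      have "(5/4 * (1 - z)) * ?B2 \<le> cB * ?B2" using z nn by (intro mult_right_mono) (auto simp: cB_def)
      moreover have "(1 - z) * ?B2 / (4/5) = (5/4 * (1 - z)) * ?B2" by simp
      ultimately show ?thesis by (simp only:)
    qed
    moreover have "cB * ?B1 + cB * ?B2 \<le> cB * (T + 3/2 * D)"
      unfolding distrib_left[symmetric] using z momentum_sum sum_split[where g = momentum_sq and K = K] momentum_sq_nonneg K9
      by (intro mult_left_mono) (auto simp: cB_def)
    ultimately show ?thesis by linarith
  qed
  have V: "z * ?V / (4/5) \<le> 5/4 * z * (\<zeta> * (1 - x\<^sup>2)) * T"
  proof -
    have "z * ?V \<le> z * (\<zeta> * ((1 - x\<^sup>2) * T))" using estimator_tail[of K] z by (intro mult_left_mono) (auto simp: \<zeta>_def)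
    then have "5/4 * (z * ?V) \<le> 5/4 * (z * (\<zeta> * ((1 - x\<^sup>2) * T)))" by (rule mult_left_mono) simp
    moreover have "z * ?V / (4/5) = 5/4 * (z * ?V)" by simp
    moreover have "5/4 * (z * (\<zeta> * ((1 - x\<^sup>2) * T))) = 5/4 * z * (\<zeta> * (1 - x\<^sup>2)) * T" by (simp only: mult.assoc)
    ultimately show ?thesis by (simp only:)
  qed
  have Sh: "3/2 * \<eta>2\<^sup>2 * ?S \<le> 3/2 * \<eta>2\<^sup>2 * (\<zeta> * ?Y * (T + (1/2 + \<zeta> * x\<^sup>2) * D))"
    using direction_tail[of K] by (intro mult_left_mono) (auto simp: \<zeta>_def)
  define W where "W = 20 * real N * (x ^ N * ((1 - x)\<^sup>2 * (1 + x)))"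
  have last: "n / (1/20) * (\<eta>1\<^sup>2 * (norm (v m))\<^sup>2) \<le> \<eta>2\<^sup>2 * W * T"
  proof -
    have "(norm (v m))\<^sup>2 \<le> x ^ N * ((1 - x)\<^sup>2 * (1 + x)) * T" using final_estimator m by (simp add: N_def)
    then have "20 * real N * (norm (v m))\<^sup>2 \<le> 20 * real N * (x ^ N * ((1 - x)\<^sup>2 * (1 + x)) * T)"
      by (intro mult_left_mono) auto
    also have "\<dots> = W * T" by (simp only: W_def mult.assoc)
    finally have "\<eta>1\<^sup>2 * (20 * real N * (norm (v m))\<^sup>2) \<le> \<eta>2\<^sup>2 * (W * T)"
      using e12 by - (rule mult_mono, auto)
    then show ?thesis by (simp add: n_def mult_ac)
  qed
  have PT: "(cB + 5/4 * z * (\<zeta> * (1 - x\<^sup>2)) + 3/2 * \<eta>2\<^sup>2 * (\<zeta> * ?Y) + \<eta>2\<^sup>2 * W) * T \<le> (2 + 4 * \<eta>2\<^sup>2) * T"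
    unfolding cB_def z_def
    by (intro mult_right_mono large_ratio_budget_gradient x0 h \<zeta>0 geo T_nonneg) (use geo(4) in \<open>simp add: W_def\<close>)
  have PD: "(3/2 * cB + 3/2 * \<eta>2\<^sup>2 * (\<zeta> * ?Y * (1/2 + \<zeta> * x\<^sup>2))) * D \<le> (2 + 4 * \<eta>2\<^sup>2) * D"
    unfolding cB_def z_def
    by (intro mult_right_mono large_ratio_budget_deviation x0 h \<zeta>0 geo D_nonneg Y0)
  note eps = initial_error_in_budget
  have "(norm (v 0 + d 0))\<^sup>2 / 3 + ?B1 / (3 - 7/10)
    + (z * ?V + (1 - z) * ?B2) / (4/5) + 3/2 * \<eta>2\<^sup>2 * ?S + n / (1/20) * (\<eta>1\<^sup>2 * (norm (v m))\<^sup>2)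
    \<le> (1 + 2 * \<eta>2\<^sup>2) * (norm (v 0 + d 0))\<^sup>2 + cB * (T + 3/2 * D) + 5/4 * z * (\<zeta> * (1 - x\<^sup>2)) * T
    + 3/2 * \<eta>2\<^sup>2 * (\<zeta> * ?Y * (T + (1/2 + \<zeta> * x\<^sup>2) * D)) + \<eta>2\<^sup>2 * W * T"
    using eps BB V Sh last unfolding add_divide_distrib by linarith
  also have "\<dots> = (1 + 2 * \<eta>2\<^sup>2) * (norm (v 0 + d 0))\<^sup>2
    + (cB + 5/4 * z * (\<zeta> * (1 - x\<^sup>2)) + 3/2 * \<eta>2\<^sup>2 * (\<zeta> * ?Y) + \<eta>2\<^sup>2 * W) * T
    + (3/2 * cB + 3/2 * \<eta>2\<^sup>2 * (\<zeta> * ?Y * (1/2 + \<zeta> * x\<^sup>2))) * D"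
    by algebra
  also have "\<dots> \<le> budget" using PT PD unfolding budget_def by linarith
  finally show ?thesis using main E by simp
qed

end

section \<open>Measurability and boundedness of the process\<close>

text \<open>Almost sure boundedness, unlike integrability, is preserved by every operation of the algorithm.\<close>

definition ae_bounded :: "'w measure \<Rightarrow> ('w \<Rightarrow> 'a::real_normed_vector) \<Rightarrow> bool" where
  "ae_bounded M X \<longleftrightarrow> (\<exists>C. AE \<omega> in M. norm (X \<omega>) \<le> C)"

lemma ae_bounded_const: "ae_bounded M (\<lambda>_. c)"
  unfolding ae_bounded_def by (rule exI[of _ "norm c"]) simp

lemma ae_bounded_add:
  assumes "ae_bounded M X" "ae_bounded M Y"
  shows "ae_bounded M (\<lambda>\<omega>. X \<omega> + Y \<omega>)"
proof -
  obtain C D where "AE \<omega> in M. norm (X \<omega>) \<le> C" "AE \<omega> in M. norm (Y \<omega>) \<le> D"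
    using assms unfolding ae_bounded_def by auto
  then have "AE \<omega> in M. norm (X \<omega> + Y \<omega>) \<le> C + D"
    by eventually_elim (rule order_trans[OF norm_triangle_ineq], simp)
  then show ?thesis unfolding ae_bounded_def by blast
qed

lemma ae_bounded_scaleR: "ae_bounded M X \<Longrightarrow> ae_bounded M (\<lambda>\<omega>. c *\<^sub>R X \<omega>)"
proof -
  assume "ae_bounded M X"
  then obtain C where "AE \<omega> in M. norm (X \<omega>) \<le> C" unfolding ae_bounded_def by auto
  then have "AE \<omega> in M. norm (c *\<^sub>R X \<omega>) \<le> \<bar>c\<bar> * C" by eventually_elim (simp add: mult_left_mono)
  then show ?thesis unfolding ae_bounded_def by blast
qed

lemma ae_bounded_minus: "ae_bounded M X \<Longrightarrow> ae_bounded M Y \<Longrightarrow> ae_bounded M (\<lambda>\<omega>. X \<omega> - Y \<omega>)"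
  using ae_bounded_add[OF _ ae_bounded_scaleR[of M Y "-1"]] by simp

lemma ae_bounded_mono:
  assumes "ae_bounded M X" "AE \<omega> in M. norm (Y \<omega>) \<le> norm (X \<omega>)"
  shows "ae_bounded M Y"
proof -
  obtain C where "AE \<omega> in M. norm (X \<omega>) \<le> C" using assms(1) unfolding ae_bounded_def by auto
  with assms(2) have "AE \<omega> in M. norm (Y \<omega>) \<le> C" by eventually_elim simp
  then show ?thesis unfolding ae_bounded_def by blast
qed

lemma ae_bounded_norm_sq: "ae_bounded M X \<Longrightarrow> ae_bounded M (\<lambda>\<omega>. (norm (X \<omega>))\<^sup>2)"
proof -
  assume "ae_bounded M X"
  then obtain C where "AE \<omega> in M. norm (X \<omega>) \<le> C" unfolding ae_bounded_def by auto
  then have "AE \<omega> in M. norm ((norm (X \<omega>))\<^sup>2) \<le> C\<^sup>2" by eventually_elim (simp add: power_mono)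
  then show ?thesis unfolding ae_bounded_def by blast
qed

lemma ae_bounded_lipschitz:
  assumes "ae_bounded M X" "\<And>x y. norm (G x - G y) \<le> K * norm (x - y)" "0 \<le> K"
  shows "ae_bounded M (\<lambda>\<omega>. G (X \<omega>))"
proof -
  obtain C where "AE \<omega> in M. norm (X \<omega>) \<le> C" using assms(1) unfolding ae_bounded_def by auto
  then have "AE \<omega> in M. norm (G (X \<omega>)) \<le> norm (G 0) + K * C"
  proof eventually_elim
    case (elim \<omega>)
    have "norm (G (X \<omega>)) \<le> norm (G 0) + norm (G (X \<omega>) - G 0)" using norm_triangle_sub by blast
    also have "norm (G (X \<omega>) - G 0) \<le> K * norm (X \<omega>)" using assms(2)[of "X \<omega>" 0] by simp
    also have "K * norm (X \<omega>) \<le> K * C" using elim assms(3) by (intro mult_left_mono) auto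
    finally show ?case by simp
  qed
  then show ?thesis unfolding ae_bounded_def by blast
qed

lemma (in finite_measure) integrable_ae_bounded:
  fixes X :: "'a \<Rightarrow> real"
  assumes "ae_bounded M X" "X \<in> borel_measurable M"
  shows "integrable M X"
  using assms integrable_const_bound unfolding ae_bounded_def by blast

text \<open>This handles the dependence of the estimators on the random batch, which takes finitely many values.\<close>

lemma measurable_choice:
  assumes g: "g \<in> measurable N (count_space UNIV)" "\<And>x. x \<in> space N \<Longrightarrow> g x \<in> I" "finite I"
    and h: "\<And>i. i \<in> I \<Longrightarrow> h i \<in> measurable N P"
  shows "(\<lambda>x. h (g x) x) \<in> measurable N P"
proof (rule measurable_compose_countable'[where I = I and f = h and g = g])
  show "g \<in> measurable N (count_space I)"
    unfolding measurable_count_space_eq_countable[OF countable_finite[OF g(3)]]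
    using g(2) measurable_sets[OF g(1)] by auto
  show "h i \<in> measurable N P" if "i \<in> I" for i using h[OF that] .
  show "countable I" using g(3) by (rule countable_finite)
qed

text \<open>The hypotheses shared by both algorithms, with \<open>r\<close> for the contraction constant of the estimators. Each
  epoch may start from either of the two initial directions.\<close>

locale prox_cg_analysis = prox_cg M F n f \<phi> w0 m b S \<gamma> \<eta>2 c1 c2 B \<theta> \<beta> w v d
  for M :: "'w measure" and F and n :: nat and f :: "nat \<Rightarrow> 'a::euclidean_space \<Rightarrow> real"
    and \<phi> :: "'a \<Rightarrow> ereal" and w0 :: 'a and m b S :: nat and \<gamma> \<eta>2 c1 c2 :: real
    and B and \<theta> \<beta> :: "nat \<Rightarrow> nat \<Rightarrow> 'w \<Rightarrow> real" and w v d :: "nat \<Rightarrow> nat \<Rightarrow> 'w \<Rightarrow> 'a" +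
  fixes wopt :: 'a and \<eta>1 L r \<alpha> :: real
  assumes f_diff: "\<And>i x. i \<in> {1..n} \<Longrightarrow> f i differentiable (at x)"
    and \<phi>_proper: "proper_fun \<phi>" and \<phi>_closed: "closed (ereal_epigraph \<phi>)" and \<phi>_convex: "convex (ereal_epigraph \<phi>)"
    and wopt_min: "is_arg_min (objective n f \<phi>) (\<lambda>_. True) wopt"
    and n2: "2 \<le> n" and b: "1 \<le> b" "b \<le> n" and m1: "1 \<le> m" and \<gamma>: "0 < \<gamma>" "\<gamma> \<le> 1"
    and c2: "0 < c2" "c2 < 1" and etas: "0 < \<eta>1" "\<eta>1 \<le> \<eta>2"
    and L: "0 < L"
    and mean_lipschitz: "\<And>x y. (1 / real n) * (\<Sum>i\<in>{1..n}. (norm (gradient (f i) x - gradient (f i) y))\<^sup>2)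
               \<le> L\<^sup>2 * (norm (x - y))\<^sup>2"
    and r1: "r < 1"
    and contraction: "AE \<omega> in M. \<forall>t\<in>{1..S}. \<forall>k\<le>m.
         v t k \<omega> \<noteq> 0 \<and> (norm (v t (Suc k) \<omega>))\<^sup>2 / (norm (v t k \<omega>))\<^sup>2 \<le> r"
    and \<alpha>: "(1 + c2) / (1 - c2) \<le> \<alpha>"
    and step_values: "\<And>t k \<omega>. \<lbrakk>t \<in> {1..S}; k \<le> m; \<omega> \<in> space M\<rbrakk> \<Longrightarrow> \<theta> t k \<omega> \<in> {\<eta>1, \<eta>2}"
    and batch_condition: "(2 + 4 * \<eta>2\<^sup>2) * ((real n - real b) / (real b * (real n - 1))) * L\<^sup>2 * \<gamma>\<^sup>2 * real m
           - (2 / \<eta>2 - L * \<gamma> - 3) \<le> 0"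
    and S1: "1 \<le> S"
    and d_init: "\<And>t. t \<in> {1..S} \<Longrightarrow> (\<forall>\<omega>\<in>space M. d t 0 \<omega> = - v t 0 \<omega>)
        \<or> (\<forall>\<omega>\<in>space M. d t 0 \<omega> = - last_estimator n f w0 m v (t - 1) \<omega>)"
begin

sublocale closed_convex_fun \<phi>
  using \<phi>_proper \<phi>_closed \<phi>_convex by unfold_locales

definition "fbar = avg_fun f {1..n}"
definition "g = gradient fbar"
definition "batch_grad X = gradient (avg_fun f X)"
definition "eta t k \<omega> = min (\<theta> t k \<omega>) \<eta>2"

lemma gderiv_avg:
  assumes "X \<subseteq> {1..n}"
  shows "GDERIV (avg_fun f X) x :> (1 / real (card X)) *\<^sub>R (\<Sum>i\<in>X. gradient (f i) x)"
proof -
  have D: "((\<lambda>y. f i y) has_derivative (\<lambda>h. h \<bullet> gradient (f i) x)) (at x)" if "i \<in> X" for i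
  proof -
    have "f i differentiable (at x)" using that assms f_diff by blast
    from has_gradient[OF this] show ?thesis unfolding gderiv_def by (simp add: inner_commute)
  qed
  have 1: "((\<lambda>y. \<Sum>i\<in>X. f i y) has_derivative (\<lambda>h. \<Sum>i\<in>X. h \<bullet> gradient (f i) x)) (at x)"
    by (rule has_derivative_sum) (rule D)
  have "((\<lambda>y. (\<Sum>i\<in>X. f i y) / real (card X)) has_derivative
      (\<lambda>h. (\<Sum>i\<in>X. h \<bullet> gradient (f i) x) / real (card X))) (at x)"
    by (rule bounded_linear.has_derivative[OF bounded_linear_divide 1])
  then show ?thesis
    unfolding gderiv_def avg_fun_def[abs_def] by (simp add: inner_sum_left inner_sum_right inner_commute)
qed

lemma batch_grad_eq: "X \<subseteq> {1..n} \<Longrightarrow> batch_grad X x = (1 / real (card X)) *\<^sub>R (\<Sum>i\<in>X. gradient (f i) x)"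
  unfolding batch_grad_def by (rule gradient_eqI[OF gderiv_avg])

lemma g_eq: "g x = (1 / real n) *\<^sub>R (\<Sum>i\<in>{1..n}. gradient (f i) x)"
  using batch_grad_eq[of "{1..n}" x] by (simp add: g_def batch_grad_def fbar_def)

text \<open>Only a crude Lipschitz constant of single components follows from the mean-square condition. It is
  enough for measurability; the constant \<open>L\<close> itself enters through means over all components.\<close>

lemma component_lipschitz:
  assumes "i \<in> {1..n}"
  shows "norm (gradient (f i) x - gradient (f i) y) \<le> (real n * L) * norm (x - y)"
proof -
  define K where "K = L\<^sup>2 * (norm (x - y))\<^sup>2"
  have n1: "1 \<le> real n" using n2 by simp
  have K0: "0 \<le> K" by (simp add: K_def)
  have "(norm (gradient (f i) x - gradient (f i) y))\<^sup>2 \<le> (\<Sum>j\<in>{1..n}. (norm (gradient (f j) x - gradient (f j) y))\<^sup>2)"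
    by (rule member_le_sum[OF assms]) auto
  also have "\<dots> \<le> real n * K"
    using mean_lipschitz[of x y] n1 unfolding K_def[symmetric]
    by (simp add: divide_le_eq mult.commute)
  also have "\<dots> \<le> (real n)\<^sup>2 * K" using n1 K0 self_le_power[of "real n" 2] by (intro mult_right_mono) auto
  also have "\<dots> = ((real n * L) * norm (x - y))\<^sup>2" unfolding K_def by (simp only: power_mult_distrib mult.assoc)
  finally show ?thesis by (rule power2_le_imp_le) (use n1 L in auto)
qed

lemma batch_lipschitz:
  assumes "X \<subseteq> {1..n}" "X \<noteq> {}"
  shows "norm (batch_grad X x - batch_grad X y) \<le> (real n * L) * norm (x - y)"
proof -
  have fX: "finite X" using assms(1) finite_subset by blast
  have c: "0 < real (card X)" using assms fX by (simp add: card_gt_0_iff)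
  have "batch_grad X x - batch_grad X y = (1 / real (card X)) *\<^sub>R (\<Sum>i\<in>X. gradient (f i) x - gradient (f i) y)"
    unfolding batch_grad_eq[OF assms(1)] by (simp only: sum_subtractf scaleR_diff_right)
  then have "norm (batch_grad X x - batch_grad X y) = (1 / real (card X)) * norm (\<Sum>i\<in>X. gradient (f i) x - gradient (f i) y)" using c by simp
  also have "norm (\<Sum>i\<in>X. gradient (f i) x - gradient (f i) y) \<le> (\<Sum>i\<in>X. norm (gradient (f i) x - gradient (f i) y))"
    by (rule norm_sum)
  also have "\<dots> \<le> (\<Sum>i\<in>X. (real n * L) * norm (x - y))"
    by (rule sum_mono, rule component_lipschitz) (use assms in auto)
  also have "\<dots> = real (card X) * ((real n * L) * norm (x - y))" by simp
  also have "(1 / real (card X)) * \<dots> = (real n * L) * norm (x - y)" using c by simp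
  finally show ?thesis using c by (simp add: mult_left_mono divide_right_mono)
qed

lemma g_lipschitz: "norm (g x - g y) \<le> L * norm (x - y)"
proof -
  have ne: "finite {1..n}" "{1..n} \<noteq> {}" using n2 by auto
  have "g x - g y = (1 / real (card {1..n})) *\<^sub>R (\<Sum>i\<in>{1..n}. gradient (f i) x - gradient (f i) y)"
    unfolding g_eq by (simp only: sum_subtractf scaleR_diff_right card_atLeastAtMost diff_Suc_1)
  then have "(norm (g x - g y))\<^sup>2 \<le> (1 / real n) * (\<Sum>i\<in>{1..n}. (norm (gradient (f i) x - gradient (f i) y))\<^sup>2)"
    using norm_mean_sq_le[of "{1..n}" "\<lambda>i. gradient (f i) x - gradient (f i) y"] ne by simp
  also have "\<dots> \<le> (L * norm (x - y))\<^sup>2" using mean_lipschitz[of x y] by (simp only: power_mult_distrib)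
  finally show ?thesis by (rule power2_le_imp_le) (use L in auto)
qed

lemma lipschitz_measurable:
  fixes h :: "'a \<Rightarrow> 'a"
  assumes "\<And>x y. norm (h x - h y) \<le> K * norm (x - y)"
  shows "h \<in> borel_measurable borel"
proof -
  have "continuous_on UNIV h"
    unfolding continuous_on_iff dist_norm
  proof (intro ballI allI impI)
    fix x :: 'a and e :: real assume e: "0 < e"
    show "\<exists>d>0. \<forall>x'\<in>UNIV. norm (x' - x) < d \<longrightarrow> norm (h x' - h x) < e"
    proof (intro exI[of _ "e / (\<bar>K\<bar> + 1)"] conjI ballI impI)
      fix x' assume "norm (x' - x) < e / (\<bar>K\<bar> + 1)"
      then have "(\<bar>K\<bar> + 1) * norm (x' - x) < e" by (simp add: field_simps)
      moreover have "K * norm (x' - x) \<le> (\<bar>K\<bar> + 1) * norm (x' - x)" by (intro mult_right_mono) auto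
      ultimately show "norm (h x' - h x) < e" using assms[of x' x] by linarith
    qed (use e in auto)
  qed
  then show ?thesis by (rule borel_measurable_continuous_onI)
qed

lemma g_measurable [measurable]: "g \<in> borel_measurable borel"
  using g_lipschitz by (rule lipschitz_measurable)

lemma minibatch: "X \<in> minibatches n b \<Longrightarrow> X \<subseteq> {1..n}" "X \<in> minibatches n b \<Longrightarrow> X \<noteq> {}"
    "X \<in> minibatches n b \<Longrightarrow> card X = b" "finite (minibatches n b)"
  using b by (auto simp: minibatches_def)

lemma batch_grad_measurable: "X \<in> minibatches n b \<Longrightarrow> batch_grad X \<in> borel_measurable borel"
  using batch_lipschitz[OF minibatch(1,2)] by (intro lipschitz_measurable)

lemma prox_measurable: "0 < s \<Longrightarrow> prox s \<phi> \<in> borel_measurable borel"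
  using continuous_on_prox by (intro borel_measurable_continuous_onI)

lemma eta_values: "t \<in> {1..S} \<Longrightarrow> k \<le> m \<Longrightarrow> \<omega> \<in> space M \<Longrightarrow> eta t k \<omega> = \<theta> t k \<omega> \<and> eta t k \<omega> \<in> {\<eta>1, \<eta>2}"
  using step_values[of t k \<omega>] etas by (auto simp: eta_def)

lemma space_F: "t \<in> {1..S} \<Longrightarrow> k \<le> Suc m \<Longrightarrow> space (F t k) = space M"
  using F_subalgebra unfolding subalgebra_def by blast

lemma measurable_F_Suc: "t \<in> {1..S} \<Longrightarrow> k \<le> m \<Longrightarrow> X \<in> measurable (F t k) N \<Longrightarrow> X \<in> measurable (F t (Suc k)) N"
  using F_Suc measurable_from_subalg by blast

lemma measurable_F_M: "t \<in> {1..S} \<Longrightarrow> k \<le> Suc m \<Longrightarrow> X \<in> measurable (F t k) N \<Longrightarrow> X \<in> measurable M N"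
  using F_subalgebra measurable_from_subalg by blast

text \<open>The step size takes two values only, so continuity of the two proximal maps suffices.\<close>

lemma prox_eta_measurable:
  assumes t: "t \<in> {1..S}" "k \<le> m" and X: "X \<in> borel_measurable (F t k)" and Y: "Y \<in> borel_measurable (F t k)"
  shows "(\<lambda>\<omega>. prox (eta t k \<omega>) \<phi> (X \<omega> + eta t k \<omega> *\<^sub>R Y \<omega>)) \<in> borel_measurable (F t k)"
proof -
  have e2: "0 < \<eta>2" using etas by simp
  have [measurable]: "X \<in> borel_measurable (F t k)" "Y \<in> borel_measurable (F t k)" "\<theta> t k \<in> borel_measurable (F t k)"
    "prox \<eta>1 \<phi> \<in> borel_measurable borel" "prox \<eta>2 \<phi> \<in> borel_measurable borel"
    using X Y step_measurable t prox_measurable etas e2 by auto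
  have "(\<lambda>\<omega>. if \<theta> t k \<omega> = \<eta>1 then prox \<eta>1 \<phi> (X \<omega> + \<eta>1 *\<^sub>R Y \<omega>) else prox \<eta>2 \<phi> (X \<omega> + \<eta>2 *\<^sub>R Y \<omega>))
      \<in> borel_measurable (F t k)" by measurable
  also have "?this \<longleftrightarrow> ?thesis"
  proof (rule measurable_cong)
    fix \<omega> assume "\<omega> \<in> space (F t k)"
    then have "\<omega> \<in> space M" using space_F[of t k] t by simp
    from eta_values[OF t this] show "(if \<theta> t k \<omega> = \<eta>1 then prox \<eta>1 \<phi> (X \<omega> + \<eta>1 *\<^sub>R Y \<omega>)
        else prox \<eta>2 \<phi> (X \<omega> + \<eta>2 *\<^sub>R Y \<omega>)) = prox (eta t k \<omega>) \<phi> (X \<omega> + eta t k \<omega> *\<^sub>R Y \<omega>)"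
      by (cases "\<theta> t k \<omega> = \<eta>1") auto
  qed
  finally show ?thesis .
qed

lemma w_step_measurable:
  assumes t: "t \<in> {1..S}" "k \<le> m" and X: "w t k \<in> borel_measurable (F t k)" "d t k \<in> borel_measurable (F t k)"
  shows "w t (Suc k) \<in> borel_measurable (F t k)"
proof -
  note [measurable] = X prox_eta_measurable[OF t X]
  have "(\<lambda>\<omega>. (1 - \<gamma>) *\<^sub>R w t k \<omega> + \<gamma> *\<^sub>R prox (eta t k \<omega>) \<phi> (w t k \<omega> + eta t k \<omega> *\<^sub>R d t k \<omega>))
      \<in> borel_measurable (F t k)" by measurable
  also have "?this \<longleftrightarrow> ?thesis"
    using w_Suc[OF t] t space_F by (intro measurable_cong) (auto simp: eta_def)
  finally show ?thesis .
qed

lemma v_step_measurable: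
  assumes t: "t \<in> {1..S}" "k \<le> m" and X: "w t k \<in> borel_measurable (F t k)" "d t k \<in> borel_measurable (F t k)"
    "v t k \<in> borel_measurable (F t k)"
  shows "v t (Suc k) \<in> borel_measurable (F t (Suc k))"
proof -
  have X': "w t (Suc k) \<in> borel_measurable (F t (Suc k))" "w t k \<in> borel_measurable (F t (Suc k))"
    "v t k \<in> borel_measurable (F t (Suc k))"
    using measurable_F_Suc[OF t] w_step_measurable[OF t X(1,2)] X by auto
  have "(\<lambda>\<omega>. batch_grad (B t (Suc k) \<omega>) (w t (Suc k) \<omega>) - batch_grad (B t (Suc k) \<omega>) (w t k \<omega>)) \<in> borel_measurable (F t (Suc k))"
  proof (rule measurable_choice[where g = "B t (Suc k)" and I = "minibatches n b"
        and h = "\<lambda>X \<omega>. batch_grad X (w t (Suc k) \<omega>) - batch_grad X (w t k \<omega>)"])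
    show "B t (Suc k) \<in> measurable (F t (Suc k)) (count_space UNIV)" using t by (intro batch_measurable) auto
    show "B t (Suc k) x \<in> minibatches n b" if "x \<in> space (F t (Suc k))" for x
      using that t space_F[of t "Suc k"] by (intro batch_size) auto
    fix X assume "X \<in> minibatches n b"
    note [measurable] = batch_grad_measurable[OF this] X'
    show "(\<lambda>\<omega>. batch_grad X (w t (Suc k) \<omega>) - batch_grad X (w t k \<omega>)) \<in> borel_measurable (F t (Suc k))" by measurable
  qed (rule minibatch)
  note [measurable] = this X'(3)
  have "(\<lambda>\<omega>. batch_grad (B t (Suc k) \<omega>) (w t (Suc k) \<omega>) - batch_grad (B t (Suc k) \<omega>) (w t k \<omega>) + v t k \<omega>)
      \<in> borel_measurable (F t (Suc k))" by measurable
  also have "?this \<longleftrightarrow> ?thesis"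
    using v_Suc[OF t] t space_F by (intro measurable_cong) (auto simp: batch_grad_def)
  finally show ?thesis .
qed

lemma epoch_measurable:
  assumes t: "t \<in> {1..S}" and init: "w t 0 \<in> borel_measurable (F t 0)" "d t 0 \<in> borel_measurable (F t 0)"
  shows "k \<le> m \<Longrightarrow> w t k \<in> borel_measurable (F t k) \<and> v t k \<in> borel_measurable (F t k) \<and> d t k \<in> borel_measurable (F t k)"
proof (induction k)
  case 0
  note [measurable] = init(1)
  have "(\<lambda>\<omega>. g (w t 0 \<omega>)) \<in> borel_measurable (F t 0)" by measurable
  also have "?this \<longleftrightarrow> v t 0 \<in> borel_measurable (F t 0)"
    using v_0[OF t] space_F[OF t, of 0] by (intro measurable_cong) (auto simp: g_def fbar_def)
  finally show ?case using init by blast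
next
  case (Suc k)
  then have k: "k \<le> m" "k < m" by auto
  have IH: "w t k \<in> borel_measurable (F t k)" "v t k \<in> borel_measurable (F t k)" "d t k \<in> borel_measurable (F t k)"
    using Suc by auto
  have 1: "w t (Suc k) \<in> borel_measurable (F t (Suc k))"
    using measurable_F_Suc[OF t k(1) w_step_measurable[OF t k(1) IH(1,3)]] .
  have 2: "v t (Suc k) \<in> borel_measurable (F t (Suc k))" using v_step_measurable[OF t k(1) IH(1,3,2)] .
  have "\<beta> t (Suc k) \<in> borel_measurable (F t (Suc k))" using Suc.prems t by (intro beta_measurable) auto
  note [measurable] = this 2 measurable_F_Suc[OF t k(1) IH(3)]
  have "(\<lambda>\<omega>. - v t (Suc k) \<omega> + \<beta> t (Suc k) \<omega> *\<^sub>R d t k \<omega>) \<in> borel_measurable (F t (Suc k))" by measurable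
  also have "?this \<longleftrightarrow> d t (Suc k) \<in> borel_measurable (F t (Suc k))"
    using d_Suc[OF t k(2)] space_F[OF t, of "Suc k"] k by (intro measurable_cong) auto
  finally show ?case using 1 2 by blast
qed

lemma measurable_next_epoch:
  assumes "1 \<le> t" "t < S" "k \<le> Suc m" "X \<in> measurable (F t k) N"
  shows "X \<in> measurable (F (Suc t) 0) N"
proof -
  have t: "t \<in> {1..S}" using assms by auto
  have "k + j \<le> Suc m \<Longrightarrow> X \<in> measurable (F t (k + j)) N" for j
  proof (induction j)
    case 0 then show ?case using assms(4) by simp
  next
    case (Suc j) then show ?case using measurable_F_Suc[OF t, of "k + j"] by simp
  qed
  from this[of "Suc m - k"] assms(3) have "X \<in> measurable (F t (Suc m)) N" by simp
  then show ?thesis using F_next_epoch[OF assms(1,2)] measurable_from_subalg by blast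
qed

lemma previous_measurable:
  assumes "Suc j \<in> {1..S}"
    and IH: "1 \<le> j \<Longrightarrow> w j 0 \<in> borel_measurable (F j 0) \<and> d j 0 \<in> borel_measurable (F j 0)"
  shows "outer_iterate w0 m w j \<in> borel_measurable (F (Suc j) 0)"
    and "last_estimator n f w0 m v j \<in> borel_measurable (F (Suc j) 0)"
proof -
  show "outer_iterate w0 m w j \<in> borel_measurable (F (Suc j) 0)"
  proof (cases "j = 0")
    case True
    then have "outer_iterate w0 m w j = (\<lambda>_. w0)" by (simp add: outer_iterate_def fun_eq_iff)
    then show ?thesis by simp
  next
    case False
    then have j: "1 \<le> j" "j < S" "j \<in> {1..S}" using assms(1) by auto
    have "outer_iterate w0 m w j = w j m" using False by (simp add: outer_iterate_def fun_eq_iff)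
    moreover have "w j m \<in> borel_measurable (F j m)"
      using epoch_measurable[OF j(3), of m] IH[OF j(1)] by blast
    ultimately show ?thesis using measurable_next_epoch[OF j(1,2), of m] by simp
  qed
  show "last_estimator n f w0 m v j \<in> borel_measurable (F (Suc j) 0)"
  proof (cases "j = 0")
    case True
    then have "last_estimator n f w0 m v j = (\<lambda>_. g w0)"
      by (simp add: last_estimator_def fun_eq_iff g_def fbar_def)
    then show ?thesis by simp
  next
    case False
    then have j: "1 \<le> j" "j < S" "j \<in> {1..S}" using assms(1) by auto
    have "last_estimator n f w0 m v j = v j m" using False by (simp add: last_estimator_def fun_eq_iff)
    moreover have "v j m \<in> borel_measurable (F j m)"
      using epoch_measurable[OF j(3), of m] IH[OF j(1)] by blast
    ultimately show ?thesis using measurable_next_epoch[OF j(1,2), of m] by simp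
  qed
qed

lemma v_start: "t \<in> {1..S} \<Longrightarrow> \<omega> \<in> space M \<Longrightarrow> v t 0 \<omega> = g (w t 0 \<omega>)"
  using v_0 by (simp add: g_def fbar_def)

lemma start_measurable:
  "t \<in> {1..S} \<Longrightarrow> w t 0 \<in> borel_measurable (F t 0) \<and> d t 0 \<in> borel_measurable (F t 0)"
proof (induction t)
  case (Suc j)
  note t = Suc.prems
  have "1 \<le> j \<Longrightarrow> w j 0 \<in> borel_measurable (F j 0) \<and> d j 0 \<in> borel_measurable (F j 0)"
    using Suc by simp
  note [measurable] = previous_measurable[OF t this]
  have sp: "space (F (Suc j) 0) = space M" using space_F[OF t] by simp
  have "outer_iterate w0 m w j \<in> borel_measurable (F (Suc j) 0) \<longleftrightarrow> w (Suc j) 0 \<in> borel_measurable (F (Suc j) 0)"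
    using w_0[OF t] sp by (intro measurable_cong) simp
  then have w: "w (Suc j) 0 \<in> borel_measurable (F (Suc j) 0)" by simp
  note [measurable] = w
  have "(\<lambda>\<omega>. - g (w (Suc j) 0 \<omega>)) \<in> borel_measurable (F (Suc j) 0)"
    "(\<lambda>\<omega>. - last_estimator n f w0 m v j \<omega>) \<in> borel_measurable (F (Suc j) 0)" by measurable
  note meas = this
  have "d (Suc j) 0 \<in> borel_measurable (F (Suc j) 0)"
    using d_init[OF t]
  proof
    assume A: "\<forall>\<omega>\<in>space M. d (Suc j) 0 \<omega> = - v (Suc j) 0 \<omega>"
    have "d (Suc j) 0 \<in> borel_measurable (F (Suc j) 0)
      \<longleftrightarrow> (\<lambda>\<omega>. - g (w (Suc j) 0 \<omega>)) \<in> borel_measurable (F (Suc j) 0)"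
      using A v_start[OF t] sp by (intro measurable_cong) simp
    then show ?thesis using meas by blast
  next
    assume A: "\<forall>\<omega>\<in>space M. d (Suc j) 0 \<omega> = - last_estimator n f w0 m v (Suc j - 1) \<omega>"
    have "d (Suc j) 0 \<in> borel_measurable (F (Suc j) 0)
      \<longleftrightarrow> (\<lambda>\<omega>. - last_estimator n f w0 m v j \<omega>) \<in> borel_measurable (F (Suc j) 0)"
      using A sp by (intro measurable_cong) simp
    then show ?thesis using meas by blast
  qed
  then show ?case using w by blast
qed simp

lemma adapted:
  assumes "t \<in> {1..S}" "k \<le> m"
  shows "w t k \<in> borel_measurable (F t k)" "v t k \<in> borel_measurable (F t k)" "d t k \<in> borel_measurable (F t k)"
    "w t (Suc k) \<in> borel_measurable (F t k)" "v t (Suc k) \<in> borel_measurable (F t (Suc k))"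
  using epoch_measurable[OF assms(1), of k] start_measurable[OF assms(1)] assms
    w_step_measurable[OF assms] v_step_measurable[OF assms] by blast+

lemma process_measurable:
  assumes "t \<in> {1..S}" "k \<le> m"
  shows "w t k \<in> borel_measurable M" "v t k \<in> borel_measurable M" "d t k \<in> borel_measurable M"
    "w t (Suc k) \<in> borel_measurable M" "v t (Suc k) \<in> borel_measurable M"
  using adapted[OF assms] measurable_F_M[OF assms(1)] assms(2) by (meson le_SucI not_less_eq_eq)+

text \<open>The almost sure event on which the estimators contract in every epoch.\<close>
definition "regular \<omega> \<longleftrightarrow> \<omega> \<in> space M \<and>
  (\<forall>t\<in>{1..S}. \<forall>k\<le>m. v t k \<omega> \<noteq> 0 \<and> (norm (v t (Suc k) \<omega>))\<^sup>2 \<le> r * (norm (v t k \<omega>))\<^sup>2)"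

lemma AE_regular: "AE \<omega> in M. regular \<omega>"
  using contraction AE_space
proof eventually_elim
  case (elim \<omega>)
  show ?case unfolding regular_def
  proof (intro conjI ballI allI impI)
    fix t k assume "t \<in> {1..S}" "k \<le> m"
    with elim have A: "v t k \<omega> \<noteq> 0" "(norm (v t (Suc k) \<omega>))\<^sup>2 / (norm (v t k \<omega>))\<^sup>2 \<le> r" by auto
    then show "v t k \<omega> \<noteq> 0" "(norm (v t (Suc k) \<omega>))\<^sup>2 \<le> r * (norm (v t k \<omega>))\<^sup>2"
      by (auto simp: divide_le_eq)
  qed (use elim in auto)
qed

text \<open>The estimators do not vanish, so that their ratios are positive.\<close>

lemma r_pos: "0 < r"
proof (rule ccontr)
  assume r: "\<not> 0 < r"
  have "AE \<omega> in M. False"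
    using AE_regular
  proof eventually_elim
    case (elim \<omega>)
    have 1: "1 \<in> {1..S}" using S1 by simp
    have "v 1 (Suc 0) \<omega> \<noteq> 0" "(norm (v 1 (Suc 0) \<omega>))\<^sup>2 \<le> r * (norm (v 1 0 \<omega>))\<^sup>2"
      using elim 1 m1 unfolding regular_def by auto
    moreover have "r * (norm (v 1 0 \<omega>))\<^sup>2 \<le> 0" using r by (intro mult_nonpos_nonneg) auto
    ultimately show False by (metis norm_eq_zero order_trans power2_less_eq_zero_iff)
  qed
  then show False by simp
qed

lemma beta_le_1:
  assumes "regular \<omega>" "t \<in> {1..S}" "k < m"
  shows "\<bar>\<beta> t (Suc k) \<omega>\<bar> \<le> 1"
proof -
  have A: "v t k \<omega> \<noteq> 0" "(norm (v t (Suc k) \<omega>))\<^sup>2 \<le> r * (norm (v t k \<omega>))\<^sup>2" "\<omega> \<in> space M"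
    using assms by (auto simp: regular_def)
  then have "(norm (v t (Suc k) \<omega>))\<^sup>2 / (norm (v t k \<omega>))\<^sup>2 \<le> r" by (simp add: divide_le_eq)
  then show ?thesis using beta_bound[OF assms(2,3) A(3)] r1 by linarith
qed

text \<open>Boundedness replaces any integrability hypothesis: the first epoch starts at a fixed point, the norms of
  the estimators decrease, \<open>\<bar>\<beta>\<bar> \<le> 1\<close> bounds the directions, and proximal maps are nonexpansive.\<close>

lemma v_step_bounded:
  assumes "t \<in> {1..S}" "k \<le> m" "ae_bounded M (v t k)"
  shows "ae_bounded M (v t (Suc k))"
proof (rule ae_bounded_mono[OF assms(3)])
  show "AE \<omega> in M. norm (v t (Suc k) \<omega>) \<le> norm (v t k \<omega>)"
    using AE_regular
  proof eventually_elim
    case (elim \<omega>)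
    have "(norm (v t (Suc k) \<omega>))\<^sup>2 \<le> r * (norm (v t k \<omega>))\<^sup>2" using elim assms by (auto simp: regular_def)
    also have "\<dots> \<le> 1 * (norm (v t k \<omega>))\<^sup>2" using r1 by (intro mult_right_mono) auto
    finally show ?case by simp
  qed
qed

lemma norm_prox_le:
  assumes "t \<in> {1..S}" "k \<le> m" "\<omega> \<in> space M"
  shows "norm (prox (eta t k \<omega>) \<phi> x) \<le> norm (prox \<eta>1 \<phi> 0) + norm (prox \<eta>2 \<phi> 0) + norm x"
proof -
  have e: "eta t k \<omega> \<in> {\<eta>1, \<eta>2}" "0 < eta t k \<omega>" using eta_values[OF assms] etas by auto
  have "norm (prox (eta t k \<omega>) \<phi> x - prox (eta t k \<omega>) \<phi> 0) \<le> norm x"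
    using prox_nonexpansive[OF e(2), of x 0] by simp
  moreover have "norm (prox (eta t k \<omega>) \<phi> 0) \<le> norm (prox \<eta>1 \<phi> 0) + norm (prox \<eta>2 \<phi> 0)"
    using e(1) by auto
  ultimately show ?thesis using norm_triangle_sub[of "prox (eta t k \<omega>) \<phi> x" "prox (eta t k \<omega>) \<phi> 0"] by linarith
qed

lemma prox_bounded:
  assumes t: "t \<in> {1..S}" "k \<le> m" and X: "ae_bounded M X" and Y: "ae_bounded M Y"
  shows "ae_bounded M (\<lambda>\<omega>. prox (eta t k \<omega>) \<phi> (X \<omega> + eta t k \<omega> *\<^sub>R Y \<omega>))"
proof -
  define K where "K = norm (prox \<eta>1 \<phi> 0) + norm (prox \<eta>2 \<phi> 0)"
  obtain C D where "AE \<omega> in M. norm (X \<omega>) \<le> C" "AE \<omega> in M. norm (Y \<omega>) \<le> D"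
    using X Y unfolding ae_bounded_def by blast
  then have "AE \<omega> in M. norm (prox (eta t k \<omega>) \<phi> (X \<omega> + eta t k \<omega> *\<^sub>R Y \<omega>)) \<le> K + (C + \<eta>2 * D)"
    using AE_space
  proof eventually_elim
    case (elim \<omega>)
    have e: "0 \<le> eta t k \<omega>" "eta t k \<omega> \<le> \<eta>2" using eta_values[OF t elim(3)] etas by auto
    have "eta t k \<omega> * norm (Y \<omega>) \<le> \<eta>2 * D" using e elim etas by (intro mult_mono) auto
    then have "norm (X \<omega> + eta t k \<omega> *\<^sub>R Y \<omega>) \<le> C + \<eta>2 * D"
      using norm_triangle_ineq[of "X \<omega>" "eta t k \<omega> *\<^sub>R Y \<omega>"] e elim by simp
    then show ?case using norm_prox_le[OF t elim(3), of "X \<omega> + eta t k \<omega> *\<^sub>R Y \<omega>"] unfolding K_def by linarith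
  qed
  then show ?thesis unfolding ae_bounded_def by blast
qed

lemma w_step_bounded:
  assumes t: "t \<in> {1..S}" "k \<le> m" and b: "ae_bounded M (w t k)" "ae_bounded M (d t k)"
  shows "ae_bounded M (w t (Suc k))"
proof (rule ae_bounded_mono)
  show "ae_bounded M (\<lambda>\<omega>. (1 - \<gamma>) *\<^sub>R w t k \<omega> + \<gamma> *\<^sub>R prox (eta t k \<omega>) \<phi> (w t k \<omega> + eta t k \<omega> *\<^sub>R d t k \<omega>))"
    by (intro ae_bounded_add ae_bounded_scaleR prox_bounded t b)
  show "AE \<omega> in M. norm (w t (Suc k) \<omega>)
      \<le> norm ((1 - \<gamma>) *\<^sub>R w t k \<omega> + \<gamma> *\<^sub>R prox (eta t k \<omega>) \<phi> (w t k \<omega> + eta t k \<omega> *\<^sub>R d t k \<omega>))"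
    using w_Suc[OF t] by (intro AE_I2) (simp add: eta_def)
qed

lemma g_bounded: "ae_bounded M X \<Longrightarrow> ae_bounded M (\<lambda>\<omega>. g (X \<omega>))"
  by (rule ae_bounded_lipschitz[where K = L]) (use g_lipschitz L in auto)

lemma epoch_bounded:
  assumes t: "t \<in> {1..S}" and b: "ae_bounded M (w t 0)" "ae_bounded M (d t 0)"
  shows "k \<le> m \<Longrightarrow> ae_bounded M (w t k) \<and> ae_bounded M (v t k) \<and> ae_bounded M (d t k)"
proof (induction k)
  case 0
  have "ae_bounded M (v t 0)"
  proof (rule ae_bounded_mono)
    show "ae_bounded M (\<lambda>\<omega>. g (w t 0 \<omega>))" using b(1) by (rule g_bounded)
    show "AE \<omega> in M. norm (v t 0 \<omega>) \<le> norm (g (w t 0 \<omega>))" using v_start[OF t] by (intro AE_I2) simp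
  qed
  then show ?case using b by blast
next
  case (Suc k)
  then have k: "k \<le> m" "k < m" by auto
  have IH: "ae_bounded M (w t k)" "ae_bounded M (v t k)" "ae_bounded M (d t k)" using Suc by auto
  have v': "ae_bounded M (v t (Suc k))" using v_step_bounded[OF t k(1) IH(2)] .
  obtain C D where "AE \<omega> in M. norm (v t (Suc k) \<omega>) \<le> C" "AE \<omega> in M. norm (d t k \<omega>) \<le> D"
    using v' IH(3) unfolding ae_bounded_def by blast
  then have "AE \<omega> in M. norm (d t (Suc k) \<omega>) \<le> C + D"
    using AE_regular
  proof eventually_elim
    case (elim \<omega>)
    then have "\<omega> \<in> space M" by (simp add: regular_def)
    then have "norm (d t (Suc k) \<omega>) \<le> norm (v t (Suc k) \<omega>) + \<bar>\<beta> t (Suc k) \<omega>\<bar> * norm (d t k \<omega>)"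
      using d_Suc[OF t k(2)] norm_triangle_ineq[of "- v t (Suc k) \<omega>" "\<beta> t (Suc k) \<omega> *\<^sub>R d t k \<omega>"] by simp
    also have "\<bar>\<beta> t (Suc k) \<omega>\<bar> * norm (d t k \<omega>) \<le> 1 * norm (d t k \<omega>)"
      using beta_le_1[OF elim(3) t k(2)] by (rule mult_right_mono) simp
    finally show ?case using elim by linarith
  qed
  then have "ae_bounded M (d t (Suc k))" unfolding ae_bounded_def by blast
  then show ?case using w_step_bounded[OF t k(1) IH(1,3)] v' by blast
qed

lemma start_bounded:
  "t \<in> {1..S} \<Longrightarrow> ae_bounded M (w t 0) \<and> ae_bounded M (d t 0)"
proof (induction t)
  case (Suc j)
  note t = Suc.prems
  have "1 \<le> j \<Longrightarrow> ae_bounded M (w j m) \<and> ae_bounded M (v j m)"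
    using Suc epoch_bounded[of j m] by simp
  then have prev: "ae_bounded M (outer_iterate w0 m w j)" "ae_bounded M (last_estimator n f w0 m v j)"
  proof -
    assume IH: "1 \<le> j \<Longrightarrow> ae_bounded M (w j m) \<and> ae_bounded M (v j m)"
    show "ae_bounded M (outer_iterate w0 m w j)"
    proof (cases "j = 0")
      case True
      then have "outer_iterate w0 m w j = (\<lambda>_. w0)" by (simp add: outer_iterate_def fun_eq_iff)
      then show ?thesis by (simp add: ae_bounded_const)
    next
      case False
      then have "outer_iterate w0 m w j = w j m" by (simp add: outer_iterate_def fun_eq_iff)
      then show ?thesis using IH False by simp
    qed
    show "ae_bounded M (last_estimator n f w0 m v j)"
    proof (cases "j = 0")
      case True
      then have "last_estimator n f w0 m v j = (\<lambda>_. gradient (avg_fun f {1..n}) w0)"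
        by (simp add: last_estimator_def fun_eq_iff)
      then show ?thesis by (simp add: ae_bounded_const)
    next
      case False
      then have "last_estimator n f w0 m v j = v j m" by (simp add: last_estimator_def fun_eq_iff)
      then show ?thesis using IH False by simp
    qed
  qed
  have w: "ae_bounded M (w (Suc j) 0)"
    by (rule ae_bounded_mono[OF prev(1)], rule AE_I2) (simp add: w_0[OF t])
  have gw: "ae_bounded M (\<lambda>\<omega>. g (w (Suc j) 0 \<omega>))" using w by (rule g_bounded)
  have "ae_bounded M (d (Suc j) 0)"
    using d_init[OF t]
  proof
    assume "\<forall>\<omega>\<in>space M. d (Suc j) 0 \<omega> = - v (Suc j) 0 \<omega>"
    then show ?thesis by (intro ae_bounded_mono[OF gw] AE_I2) (simp add: v_start[OF t])
  next
    assume "\<forall>\<omega>\<in>space M. d (Suc j) 0 \<omega> = - last_estimator n f w0 m v (Suc j - 1) \<omega>"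
    then show ?thesis by (intro ae_bounded_mono[OF prev(2)] AE_I2) simp
  qed
  then show ?case using w by blast
qed simp

lemma process_bounded:
  assumes "t \<in> {1..S}" "k \<le> m"
  shows "ae_bounded M (w t k)" "ae_bounded M (v t k)" "ae_bounded M (d t k)"
    "ae_bounded M (w t (Suc k))" "ae_bounded M (v t (Suc k))"
  using epoch_bounded[OF assms(1), of k] start_bounded[OF assms(1)] assms(2)
    w_step_bounded[OF assms] v_step_bounded[OF assms] by blast+

lemma integrable_norm_sq:
  fixes X :: "'w \<Rightarrow> 'a"
  assumes "ae_bounded M X" "X \<in> borel_measurable M"
  shows "integrable M (\<lambda>\<omega>. (norm (X \<omega>))\<^sup>2)"
  using assms by (intro integrable_ae_bounded ae_bounded_norm_sq) measurable

definition "err t k \<omega> = v t k \<omega> - g (w t k \<omega>)"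
definition "step t k \<omega> = w t k \<omega> - prox (eta t k \<omega>) \<phi> (w t k \<omega> + eta t k \<omega> *\<^sub>R d t k \<omega>)"
definition "mapping t \<omega> = (1 / eta t m \<omega>) *\<^sub>R (w t m \<omega> - prox (eta t m \<omega>) \<phi> (w t m \<omega> - eta t m \<omega> *\<^sub>R g (w t m \<omega>)))"

lemma integrable_err: "t \<in> {1..S} \<Longrightarrow> k \<le> m \<Longrightarrow> integrable M (\<lambda>\<omega>. (norm (err t k \<omega>))\<^sup>2)"
proof (rule integrable_norm_sq)
  assume t: "t \<in> {1..S}" "k \<le> m"
  note [measurable] = process_measurable[OF t]
  show "ae_bounded M (err t k)" unfolding err_def[abs_def] by (intro ae_bounded_minus g_bounded process_bounded t)
  show "err t k \<in> borel_measurable M" unfolding err_def[abs_def] by measurable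
qed

lemma integrable_step: "t \<in> {1..S} \<Longrightarrow> k \<le> m \<Longrightarrow> integrable M (\<lambda>\<omega>. (norm (step t k \<omega>))\<^sup>2)"
proof (rule integrable_norm_sq)
  assume t: "t \<in> {1..S}" "k \<le> m"
  have "k \<le> Suc m" using t by simp
  note [measurable] = process_measurable[OF t]
    measurable_F_M[OF t(1) \<open>k \<le> Suc m\<close> prox_eta_measurable[OF t adapted(1,3)[OF t]]]
  show "ae_bounded M (step t k)" unfolding step_def[abs_def] by (intro ae_bounded_minus prox_bounded process_bounded t)
  show "step t k \<in> borel_measurable M" unfolding step_def[abs_def] by measurable
qed

lemma integrable_gradient: "t \<in> {1..S} \<Longrightarrow> k \<le> m \<Longrightarrow> integrable M (\<lambda>\<omega>. (norm (g (w t k \<omega>)))\<^sup>2)"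
proof (rule integrable_norm_sq)
  assume t: "t \<in> {1..S}" "k \<le> m"
  note [measurable] = process_measurable[OF t]
  show "ae_bounded M (\<lambda>\<omega>. g (w t k \<omega>))" by (intro g_bounded process_bounded t)
  show "(\<lambda>\<omega>. g (w t k \<omega>)) \<in> borel_measurable M" by measurable
qed

lemma integrable_mapping: "t \<in> {1..S} \<Longrightarrow> integrable M (\<lambda>\<omega>. (norm (mapping t \<omega>))\<^sup>2)"
proof (rule integrable_norm_sq)
  assume t: "t \<in> {1..S}"
  have m': "m \<le> Suc m" "m \<le> m" by auto
  note A = adapted[OF t m'(2)]
  have gm: "(\<lambda>\<omega>. - g (w t m \<omega>)) \<in> borel_measurable (F t m)" using A(1) by measurable
  have th: "\<theta> t m \<in> borel_measurable M" using measurable_F_M[OF t m'(1) step_measurable[OF t m'(2)]] .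
  note [measurable] = process_measurable[OF t m'(2)] th
    measurable_F_M[OF t m'(1) prox_eta_measurable[OF t m'(2) A(1) gm]]
  let ?X = "\<lambda>\<omega>. w t m \<omega> - prox (eta t m \<omega>) \<phi> (w t m \<omega> + eta t m \<omega> *\<^sub>R (- g (w t m \<omega>)))"
  have eq: "mapping t = (\<lambda>\<omega>. (1 / eta t m \<omega>) *\<^sub>R ?X \<omega>)" by (simp add: mapping_def fun_eq_iff)
  have "ae_bounded M (\<lambda>\<omega>. - g (w t m \<omega>))"
    using ae_bounded_scaleR[OF g_bounded[OF process_bounded(1)[OF t m'(2)]], of "-1"] by simp
  then have "ae_bounded M ?X" by (intro ae_bounded_minus prox_bounded process_bounded t m'(2))
  then have "ae_bounded M (\<lambda>\<omega>. (1 / \<eta>1) *\<^sub>R ?X \<omega>)" by (rule ae_bounded_scaleR)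
  then show "ae_bounded M (mapping t)"
  proof (rule ae_bounded_mono)
    show "AE \<omega> in M. norm (mapping t \<omega>) \<le> norm ((1 / \<eta>1) *\<^sub>R ?X \<omega>)"
    proof (rule AE_I2)
      fix \<omega> assume "\<omega> \<in> space M"
      then have e: "\<eta>1 \<le> eta t m \<omega>" using eta_values[OF t m'(2), of \<omega>] etas by auto
      have "norm (mapping t \<omega>) = (1 / eta t m \<omega>) * norm (?X \<omega>)" unfolding eq using e etas by simp
      also have "\<dots> \<le> (1 / \<eta>1) * norm (?X \<omega>)"
        using e etas by (intro mult_right_mono divide_left_mono mult_pos_pos) auto
      also have "\<dots> = norm ((1 / \<eta>1) *\<^sub>R ?X \<omega>)" using etas by simp
      finally show "norm (mapping t \<omega>) \<le> norm ((1 / \<eta>1) *\<^sub>R ?X \<omega>)" .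
    qed
  qed
  have [measurable]: "eta t m \<in> borel_measurable M" unfolding eta_def[abs_def] by measurable
  show "mapping t \<in> borel_measurable M" unfolding eq by measurable
qed

definition "Pmin = fbar wopt + val wopt"
definition "start_gap t \<omega> = 2 / \<gamma> * (fbar (w t 0 \<omega>) + val (w t 0 \<omega>) - Pmin)"
definition "ratio = r\<^sup>2 / ((1 - r)\<^sup>2 * (1 + r))"
definition "excess t \<omega> = max 0 ((norm (d t 0 \<omega>))\<^sup>2 - (norm (v t 0 \<omega>))\<^sup>2)"
definition "epoch_budget t \<omega> = (2 + 4 * \<eta>2\<^sup>2) * (ratio * (\<alpha> * (norm (v t 0 \<omega>))\<^sup>2))
  + (1 + 2 * \<eta>2\<^sup>2) * (norm (v t 0 \<omega> + d t 0 \<omega>))\<^sup>2 + (2 + 4 * \<eta>2\<^sup>2) * (r\<^sup>2 / (1 - r\<^sup>2) * excess t \<omega>)"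
definition "slack_term = 2 / \<eta>2 - L * \<gamma> - 3"

lemma wopt_dom: "wopt \<in> dom"
proof -
  obtain x where x: "x \<in> dom" by (rule dom_nonempty)
  have "\<not> objective n f \<phi> x < objective n f \<phi> wopt" using wopt_min by (auto simp: is_arg_min_def)
  then have "objective n f \<phi> wopt \<le> ereal (avg_fun f {1..n} x + val x)"
    using ereal_val[OF x] by (simp add: objective_def not_less)
  then show ?thesis unfolding objective_def dom_def by (cases "\<phi> wopt") auto
qed

lemma objective_eq: "x \<in> dom \<Longrightarrow> objective n f \<phi> x = ereal (fbar x + val x)"
  using ereal_val by (simp add: objective_def fbar_def)

lemma Pmin_le: "x \<in> dom \<Longrightarrow> Pmin \<le> fbar x + val x"
proof -
  assume x: "x \<in> dom"
  have "\<not> objective n f \<phi> x < objective n f \<phi> wopt" using wopt_min by (auto simp: is_arg_min_def)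
  then show ?thesis using objective_eq[OF x] objective_eq[OF wopt_dom] by (simp add: Pmin_def)
qed

lemma sample_factor_nonneg: "0 \<le> (real n - real b) / (real b * (real n - 1)) * L\<^sup>2 * \<gamma>\<^sup>2"
  using b n2 by (intro mult_nonneg_nonneg divide_nonneg_nonneg) auto

lemma slack_term_bound: "real m * (2 + 4 * \<eta>2\<^sup>2) * ((real n - real b) / (real b * (real n - 1)) * L\<^sup>2 * \<gamma>\<^sup>2) \<le> slack_term"
  using batch_condition unfolding slack_term_def by (simp add: mult_ac)

lemma slack_term_nonneg: "0 \<le> slack_term"
proof -
  have "0 \<le> real m * (2 + 4 * \<eta>2\<^sup>2) * ((real n - real b) / (real b * (real n - 1)) * L\<^sup>2 * \<gamma>\<^sup>2)"
    using sample_factor_nonneg by (rule mult_nonneg_nonneg[rotated]) (simp add: add_nonneg_nonneg)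
  then show ?thesis using slack_term_bound by linarith
qed

lemma epoch_at:
  assumes t: "t \<in> {1..S}" and reg: "regular \<omega>" and w0: "w t 0 \<omega> \<in> dom"
  shows "prox_cg_epoch \<phi> (\<lambda>k. v t k \<omega>) (\<lambda>k. d t k \<omega>) (\<lambda>k. \<beta> t k \<omega>) m c2 \<alpha> r fbar g L \<gamma> \<eta>1 \<eta>2 Pmin
    (\<lambda>k. eta t k \<omega>) (\<lambda>k. w t k \<omega>)"
proof unfold_locales
  have \<omega>: "\<omega> \<in> space M" using reg by (simp add: regular_def)
  show "0 < c2" "c2 < 1" "(1 + c2) / (1 - c2) \<le> \<alpha>" "0 < r" "r < 1" "0 < \<eta>1" "\<eta>1 \<le> \<eta>2" "0 < \<gamma>" "\<gamma> \<le> 1" "0 < L"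
    using c2 \<alpha> r_pos r1 etas \<gamma> L by auto
  show "v t k \<omega> \<noteq> 0" "(norm (v t (Suc k) \<omega>))\<^sup>2 \<le> r * (norm (v t k \<omega>))\<^sup>2" if "k \<le> m" for k
    using reg t that by (auto simp: regular_def)
  show "\<bar>\<beta> t (Suc k) \<omega>\<bar> \<le> (norm (v t (Suc k) \<omega>))\<^sup>2 / (norm (v t k \<omega>))\<^sup>2" if "k < m" for k
    using beta_bound[OF t that \<omega>] .
  show "d t (Suc k) \<omega> = - v t (Suc k) \<omega> + \<beta> t (Suc k) \<omega> *\<^sub>R d t k \<omega>" if "k < m" for k
    using d_Suc[OF t that \<omega>] .
  show "\<bar>v t (Suc k) \<omega> \<bullet> d t k \<omega>\<bar> \<le> - c2 * (v t k \<omega> \<bullet> d t k \<omega>)" if "k \<le> m" for k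
    using line_search_curvature[OF t that \<omega>] .
  show "fbar z \<le> fbar y + g y \<bullet> (z - y) + L / 2 * (norm (z - y))\<^sup>2" for y z
  proof (rule quadratic_upper_bound[where h = fbar and G = g and L = L])
    show "GDERIV fbar x :> g x" for x
      using gderiv_avg[of "{1..n}" x] g_eq[of x] by (simp add: fbar_def)
  qed (rule g_lipschitz)
  show "Pmin \<le> fbar y + real_of_ereal (\<phi> y)" if "\<phi> y < \<infinity>" for y
    using Pmin_le[of y] that by (simp add: dom_def val_def)
  show "eta t k \<omega> \<in> {\<eta>1, \<eta>2}" if "k \<le> m" for k using eta_values[OF t that \<omega>] by blast
  show "0 \<le> 2 / \<eta>2 - L * \<gamma> - 3" using slack_term_nonneg by (simp add: slack_term_def)
  show "w t (Suc k) \<omega> = (1 - \<gamma>) *\<^sub>R w t k \<omega> + \<gamma> *\<^sub>R prox (eta t k \<omega>) \<phi> (w t k \<omega> + eta t k \<omega> *\<^sub>R d t k \<omega>)" if "k < m" for k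
    using w_Suc[OF t _ \<omega>, of k] that by (simp add: eta_def)
  show "\<phi> (w t 0 \<omega>) < \<infinity>" using w0 by (simp add: dom_def)
  show "v t 0 \<omega> = g (w t 0 \<omega>)" using v_start[OF t \<omega>] .
qed

lemma pathwise_facts:
  assumes t: "t \<in> {1..S}" and reg: "regular \<omega>" and w0: "w t 0 \<omega> \<in> dom"
  shows "0 < m \<Longrightarrow> m \<le> 2 \<Longrightarrow> (real m + 1) * (\<eta>1 * norm (mapping t \<omega>))\<^sup>2 + slack_term * (\<Sum>k<m. (norm (step t k \<omega>))\<^sup>2)
      \<le> start_gap t \<omega> + 2 * (\<Sum>k<m. (norm (err t k \<omega>))\<^sup>2) + epoch_budget t \<omega>"
    and "3 \<le> m \<Longrightarrow> r \<le> 2/3 \<Longrightarrow> (real m + 1) * (\<eta>1 * norm (mapping t \<omega>))\<^sup>2 + slack_term * (\<Sum>k<m. (norm (step t k \<omega>))\<^sup>2)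
      \<le> start_gap t \<omega> + 2 * (\<Sum>k<m. (norm (err t k \<omega>))\<^sup>2) + 4 * (real m + 1) * \<eta>2\<^sup>2 * (norm (err t m \<omega>))\<^sup>2 + epoch_budget t \<omega>"
    and "3 \<le> m \<Longrightarrow> 2/3 < r \<Longrightarrow> 17/2 * ratio \<le> real m + 1 \<Longrightarrow>
      (real m + 1) * (\<eta>1 * norm (mapping t \<omega>))\<^sup>2 + slack_term * (\<Sum>k<m. (norm (step t k \<omega>))\<^sup>2)
      \<le> start_gap t \<omega> + 10/7 * (\<Sum>k<m. (norm (err t k \<omega>))\<^sup>2) + 5 * real m * \<eta>2\<^sup>2 * (norm (err t m \<omega>))\<^sup>2 + epoch_budget t \<omega>"
    and "2 \<le> m \<Longrightarrow> (real m + 1) * (\<eta>1 * norm (g (w t m \<omega>)))\<^sup>2 + slack_term * (\<Sum>k<m. (norm (step t k \<omega>))\<^sup>2)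
      \<le> start_gap t \<omega> + 2 * (\<Sum>k<m. (norm (err t k \<omega>))\<^sup>2) + 4 * (real m + 1) * \<eta>2\<^sup>2 * (norm (err t m \<omega>))\<^sup>2 + epoch_budget t \<omega>"
    and "m = 1 \<Longrightarrow> 2 * (norm (step t 0 \<omega>))\<^sup>2 + slack_term * (\<Sum>k<m. (norm (step t k \<omega>))\<^sup>2)
      \<le> start_gap t \<omega> + (norm (v t 0 \<omega> + d t 0 \<omega>))\<^sup>2"
proof -
  interpret E: prox_cg_epoch \<phi> "\<lambda>k. v t k \<omega>" "\<lambda>k. d t k \<omega>" "\<lambda>k. \<beta> t k \<omega>" m c2 \<alpha> r fbar g L \<gamma> \<eta>1 \<eta>2 Pmin
    "\<lambda>k. eta t k \<omega>" "\<lambda>k. w t k \<omega>"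
    by (rule epoch_at[OF t reg w0])
  have eqs: "E.final_mapping = mapping t \<omega>" "E.a = slack_term" "E.gap = start_gap t \<omega>"
      "\<And>k. E.Q k = (norm (step t k \<omega>))\<^sup>2" "\<And>k. E.e k = err t k \<omega>" "E.budget = epoch_budget t \<omega>"
    by (simp_all add: E.final_mapping_def mapping_def E.a_def slack_term_def E.gap_def start_gap_def E.Q_def E.y_def step_def
        E.e_def err_def E.budget_def epoch_budget_def E.T_def E.D_def E.V0_def E.\<Delta>_def excess_def ratio_def)
  show "0 < m \<Longrightarrow> m \<le> 2 \<Longrightarrow> (real m + 1) * (\<eta>1 * norm (mapping t \<omega>))\<^sup>2 + slack_term * (\<Sum>k<m. (norm (step t k \<omega>))\<^sup>2)
      \<le> start_gap t \<omega> + 2 * (\<Sum>k<m. (norm (err t k \<omega>))\<^sup>2) + epoch_budget t \<omega>"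
    using E.mapping_bound_short unfolding eqs .
  show "3 \<le> m \<Longrightarrow> r \<le> 2/3 \<Longrightarrow> (real m + 1) * (\<eta>1 * norm (mapping t \<omega>))\<^sup>2 + slack_term * (\<Sum>k<m. (norm (step t k \<omega>))\<^sup>2)
      \<le> start_gap t \<omega> + 2 * (\<Sum>k<m. (norm (err t k \<omega>))\<^sup>2) + 4 * (real m + 1) * \<eta>2\<^sup>2 * (norm (err t m \<omega>))\<^sup>2 + epoch_budget t \<omega>"
    using E.mapping_bound_small_ratio unfolding eqs .
  show "3 \<le> m \<Longrightarrow> 2/3 < r \<Longrightarrow> 17/2 * ratio \<le> real m + 1 \<Longrightarrow>
      (real m + 1) * (\<eta>1 * norm (mapping t \<omega>))\<^sup>2 + slack_term * (\<Sum>k<m. (norm (step t k \<omega>))\<^sup>2)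
      \<le> start_gap t \<omega> + 10/7 * (\<Sum>k<m. (norm (err t k \<omega>))\<^sup>2) + 5 * real m * \<eta>2\<^sup>2 * (norm (err t m \<omega>))\<^sup>2 + epoch_budget t \<omega>"
    using E.mapping_bound_large_ratio unfolding eqs ratio_def .
  show "2 \<le> m \<Longrightarrow> (real m + 1) * (\<eta>1 * norm (g (w t m \<omega>)))\<^sup>2 + slack_term * (\<Sum>k<m. (norm (step t k \<omega>))\<^sup>2)
      \<le> start_gap t \<omega> + 2 * (\<Sum>k<m. (norm (err t k \<omega>))\<^sup>2) + 4 * (real m + 1) * \<eta>2\<^sup>2 * (norm (err t m \<omega>))\<^sup>2 + epoch_budget t \<omega>"
    using E.gradient_bound unfolding eqs .
  show "m = 1 \<Longrightarrow> 2 * (norm (step t 0 \<omega>))\<^sup>2 + slack_term * (\<Sum>k<m. (norm (step t k \<omega>))\<^sup>2)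
      \<le> start_gap t \<omega> + (norm (v t 0 \<omega> + d t 0 \<omega>))\<^sup>2"
    using E.first_step_bound unfolding eqs .
qed

section \<open>Uniform batches and the noise of the estimator\<close>

text \<open>Uniformity of the next batch conditionally on the past says that the indicator density of the event
  \<open>B = X\<close> and the constant density \<open>1 / c\<close> define the same measure on the past \<open>\<sigma>\<close>-algebra; integrals of
  past-measurable functions therefore agree.\<close>

lemma nn_integral_batch:
  fixes Y :: "'w \<Rightarrow> ennreal"
  assumes t: "t \<in> {1..S}" "k \<le> m" and X: "X \<in> minibatches n b" and Y: "Y \<in> borel_measurable (F t k)"
  shows "(\<integral>\<^sup>+\<omega>. indicator {\<omega>\<in>space M. B t (Suc k) \<omega> = X} \<omega> * Y \<omega> \<partial>M)
    = ennreal (1 / real (card (minibatches n b))) * (\<integral>\<^sup>+\<omega>. Y \<omega> \<partial>M)"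
proof -
  define E where "E = {\<omega>\<in>space M. B t (Suc k) \<omega> = X}"
  define c where "c = real (card (minibatches n b))"
  have sub: "subalgebra M (F t k)" using t by (intro F_subalgebra) auto
  have E: "E \<in> sets M"
  proof -
    have "Suc k \<le> Suc m" using t by simp
    then have "B t (Suc k) \<in> measurable M (count_space UNIV)"
      using measurable_F_M[OF t(1) _ batch_measurable[OF t(1)]] by blast
    from measurable_sets[OF this, of "{X}"] show ?thesis
      by (auto simp: E_def vimage_def Int_def conj_commute)
  qed
  have YM: "Y \<in> borel_measurable M" using measurable_from_subalg[OF sub Y] .
  have eq: "restr_to_subalg (density M (indicator E)) (F t k) = restr_to_subalg (density M (\<lambda>_. ennreal (1 / c))) (F t k)"
  proof (rule measure_eqI)
    have s1: "subalgebra (density M (indicator E)) (F t k)" and s2: "subalgebra (density M (\<lambda>_. ennreal (1 / c))) (F t k)"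
      using sub by (simp_all add: subalgebra_def)
    show "sets (restr_to_subalg (density M (indicator E)) (F t k)) = sets (restr_to_subalg (density M (\<lambda>_. ennreal (1 / c))) (F t k))"
      by (simp add: sets_restr_to_subalg[OF s1] sets_restr_to_subalg[OF s2])
    fix A assume "A \<in> sets (restr_to_subalg (density M (indicator E)) (F t k))"
    then have A: "A \<in> sets (F t k)" by (simp add: sets_restr_to_subalg[OF s1])
    then have AM: "A \<in> sets M" using sub by (auto simp: subalgebra_def)
    have "emeasure (restr_to_subalg (density M (indicator E)) (F t k)) A = emeasure M (E \<inter> A)"
      using E AM by (simp add: emeasure_restr_to_subalg[OF s1 A] emeasure_density nn_integral_set_ennreal[symmetric]
          indicator_inter_arith[symmetric])
    also have "\<dots> = ennreal (prob A / c)"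
      using batch_uniform[OF t A X] by (simp add: emeasure_eq_measure E_def c_def Int_commute)
    also have "\<dots> = ennreal (1 / c) * emeasure M A"
      by (simp add: emeasure_eq_measure ennreal_mult'[symmetric] c_def)
    also have "\<dots> = emeasure (restr_to_subalg (density M (\<lambda>_. ennreal (1 / c))) (F t k)) A"
      using AM by (simp add: emeasure_restr_to_subalg[OF s2 A] emeasure_density nn_integral_cmult_indicator)
    finally show "emeasure (restr_to_subalg (density M (indicator E)) (F t k)) A
      = emeasure (restr_to_subalg (density M (\<lambda>_. ennreal (1 / c))) (F t k)) A" .
  qed
  have "(\<integral>\<^sup>+\<omega>. indicator E \<omega> * Y \<omega> \<partial>M) = (\<integral>\<^sup>+\<omega>. Y \<omega> \<partial>density M (indicator E))"
    using E YM by (subst nn_integral_density) auto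
  also have "\<dots> = (\<integral>\<^sup>+\<omega>. Y \<omega> \<partial>restr_to_subalg (density M (indicator E)) (F t k))"
    using sub Y by (intro nn_integral_subalgebra2[symmetric]) (simp_all add: subalgebra_def)
  also have "\<dots> = (\<integral>\<^sup>+\<omega>. Y \<omega> \<partial>density M (\<lambda>_. ennreal (1 / c)))"
    unfolding eq using sub Y by (intro nn_integral_subalgebra2) (simp_all add: subalgebra_def)
  also have "\<dots> = ennreal (1 / c) * (\<integral>\<^sup>+\<omega>. Y \<omega> \<partial>M)"
    using YM by (subst nn_integral_density) (auto simp: nn_integral_cmult)
  finally show ?thesis unfolding E_def c_def .
qed

lemma nn_integral_batch_mean:
  fixes h :: "nat set \<Rightarrow> 'w \<Rightarrow> real"
  assumes t: "t \<in> {1..S}" "k \<le> m" and h: "\<And>X. X \<in> minibatches n b \<Longrightarrow> h X \<in> borel_measurable (F t k)"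
    and h0: "\<And>X \<omega>. 0 \<le> h X \<omega>"
  shows "(\<integral>\<^sup>+\<omega>. ennreal (h (B t (Suc k) \<omega>) \<omega>) \<partial>M)
    = (\<integral>\<^sup>+\<omega>. ennreal (1 / real (card (minibatches n b)) * (\<Sum>X\<in>minibatches n b. h X \<omega>)) \<partial>M)"
proof -
  define c where "c = real (card (minibatches n b))"
  have fin: "finite (minibatches n b)" by (rule minibatch)
  have sub: "subalgebra M (F t k)" using t by (intro F_subalgebra) auto
  have hM: "h X \<in> borel_measurable M" if "X \<in> minibatches n b" for X using measurable_from_subalg[OF sub h[OF that]] .
  have E: "{\<omega>\<in>space M. B t (Suc k) \<omega> = X} \<in> sets M" for X
  proof -
    have "Suc k \<le> Suc m" using t by simp
    then have "B t (Suc k) \<in> measurable M (count_space UNIV)"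
      using measurable_F_M[OF t(1) _ batch_measurable[OF t(1)]] by blast
    from measurable_sets[OF this, of "{X}"] show ?thesis
      by (auto simp: vimage_def Int_def conj_commute)
  qed
  have "(\<integral>\<^sup>+\<omega>. ennreal (h (B t (Suc k) \<omega>) \<omega>) \<partial>M)
      = (\<integral>\<^sup>+\<omega>. (\<Sum>X\<in>minibatches n b. indicator {\<omega>\<in>space M. B t (Suc k) \<omega> = X} \<omega> * ennreal (h X \<omega>)) \<partial>M)"
  proof (rule nn_integral_cong)
    fix \<omega> assume \<omega>: "\<omega> \<in> space M"
    have "(\<Sum>X\<in>minibatches n b. indicator {\<omega>\<in>space M. B t (Suc k) \<omega> = X} \<omega> * ennreal (h X \<omega>))
        = (\<Sum>X\<in>minibatches n b. if X = B t (Suc k) \<omega> then ennreal (h X \<omega>) else 0)"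
      using \<omega> by (intro sum.cong) (auto simp: indicator_def)
    also have "\<dots> = ennreal (h (B t (Suc k) \<omega>) \<omega>)"
      using batch_size[OF t \<omega>] fin by (simp add: sum.delta)
    finally show "ennreal (h (B t (Suc k) \<omega>) \<omega>)
      = (\<Sum>X\<in>minibatches n b. indicator {\<omega>\<in>space M. B t (Suc k) \<omega> = X} \<omega> * ennreal (h X \<omega>))" by simp
  qed
  also have "\<dots> = (\<Sum>X\<in>minibatches n b. \<integral>\<^sup>+\<omega>. indicator {\<omega>\<in>space M. B t (Suc k) \<omega> = X} \<omega> * ennreal (h X \<omega>) \<partial>M)"
    using E hM by (intro nn_integral_sum) (auto intro!: borel_measurable_times_ennreal borel_measurable_indicator)
  also have "\<dots> = (\<Sum>X\<in>minibatches n b. \<integral>\<^sup>+\<omega>. ennreal (1 / c) * ennreal (h X \<omega>) \<partial>M)"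
  proof (rule sum.cong)
    fix X assume X: "X \<in> minibatches n b"
    have "(\<lambda>\<omega>. ennreal (h X \<omega>)) \<in> borel_measurable (F t k)" using h[OF X] by measurable
    from nn_integral_batch[OF t X this] hM[OF X]
    show "(\<integral>\<^sup>+\<omega>. indicator {\<omega>\<in>space M. B t (Suc k) \<omega> = X} \<omega> * ennreal (h X \<omega>) \<partial>M)
      = (\<integral>\<^sup>+\<omega>. ennreal (1 / c) * ennreal (h X \<omega>) \<partial>M)"
      unfolding c_def by (subst nn_integral_cmult) auto
  qed simp
  also have "\<dots> = (\<integral>\<^sup>+\<omega>. (\<Sum>X\<in>minibatches n b. ennreal (1 / c) * ennreal (h X \<omega>)) \<partial>M)"
    using hM by (intro nn_integral_sum[symmetric]) auto
  also have "\<dots> = (\<integral>\<^sup>+\<omega>. ennreal (1 / c * (\<Sum>X\<in>minibatches n b. h X \<omega>)) \<partial>M)"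
    using h0 by (simp add: sum_distrib_left ennreal_mult'[symmetric] c_def sum_ennreal sum_nonneg)
  finally show ?thesis unfolding c_def .
qed

lemma batch_expectation_le:
  fixes h :: "nat set \<Rightarrow> 'w \<Rightarrow> real"
  assumes t: "t \<in> {1..S}" "k \<le> m" and h: "\<And>X. X \<in> minibatches n b \<Longrightarrow> h X \<in> borel_measurable (F t k)"
    and h0: "\<And>X \<omega>. 0 \<le> h X \<omega>"
    and Z: "integrable M Z" "\<And>\<omega>. \<omega> \<in> space M \<Longrightarrow> Z \<omega> = h (B t (Suc k) \<omega>) \<omega>"
    and U: "integrable M U" "\<And>\<omega>. \<omega> \<in> space M \<Longrightarrow> 0 \<le> U \<omega>"
  shows "(\<And>\<omega>. \<omega> \<in> space M \<Longrightarrow> 1 / real (card (minibatches n b)) * (\<Sum>X\<in>minibatches n b. h X \<omega>) \<le> U \<omega>)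
      \<Longrightarrow> (\<integral>\<omega>. Z \<omega> \<partial>M) \<le> (\<integral>\<omega>. U \<omega> \<partial>M)"
    and "(\<And>\<omega>. \<omega> \<in> space M \<Longrightarrow> U \<omega> \<le> 1 / real (card (minibatches n b)) * (\<Sum>X\<in>minibatches n b. h X \<omega>))
      \<Longrightarrow> (\<integral>\<omega>. U \<omega> \<partial>M) \<le> (\<integral>\<omega>. Z \<omega> \<partial>M)"
proof -
  have Z0: "0 \<le> Z \<omega>" if "\<omega> \<in> space M" for \<omega> using Z(2)[OF that] h0 by simp
  have IZ: "ennreal (\<integral>\<omega>. Z \<omega> \<partial>M) = (\<integral>\<^sup>+\<omega>. ennreal (Z \<omega>) \<partial>M)"
    using Z(1) Z0 by (intro nn_integral_eq_integral[symmetric]) auto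
  have IU: "ennreal (\<integral>\<omega>. U \<omega> \<partial>M) = (\<integral>\<^sup>+\<omega>. ennreal (U \<omega>) \<partial>M)"
    using U by (intro nn_integral_eq_integral[symmetric]) auto
  have "(\<integral>\<^sup>+\<omega>. ennreal (Z \<omega>) \<partial>M) = (\<integral>\<^sup>+\<omega>. ennreal (h (B t (Suc k) \<omega>) \<omega>) \<partial>M)"
    using Z(2) by (intro nn_integral_cong) simp
  also have "\<dots> = (\<integral>\<^sup>+\<omega>. ennreal (1 / real (card (minibatches n b)) * (\<Sum>X\<in>minibatches n b. h X \<omega>)) \<partial>M)"
    by (rule nn_integral_batch_mean[OF t h h0])
  finally have IM: "(\<integral>\<^sup>+\<omega>. ennreal (Z \<omega>) \<partial>M)
      = (\<integral>\<^sup>+\<omega>. ennreal (1 / real (card (minibatches n b)) * (\<Sum>X\<in>minibatches n b. h X \<omega>)) \<partial>M)" .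
  have nn: "0 \<le> (\<integral>\<omega>. Z \<omega> \<partial>M)" "0 \<le> (\<integral>\<omega>. U \<omega> \<partial>M)"
    using Z0 U(2) by (auto intro!: integral_nonneg_AE AE_I2)
  show "(\<integral>\<omega>. Z \<omega> \<partial>M) \<le> (\<integral>\<omega>. U \<omega> \<partial>M)"
    if A: "\<And>\<omega>. \<omega> \<in> space M \<Longrightarrow> 1 / real (card (minibatches n b)) * (\<Sum>X\<in>minibatches n b. h X \<omega>) \<le> U \<omega>"
  proof -
    have "ennreal (\<integral>\<omega>. Z \<omega> \<partial>M) \<le> ennreal (\<integral>\<omega>. U \<omega> \<partial>M)"
      unfolding IZ IM IU by (rule nn_integral_mono) (rule ennreal_leI, rule A)
    then show ?thesis using nn by (simp add: ennreal_le_iff)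
  qed
  show "(\<integral>\<omega>. U \<omega> \<partial>M) \<le> (\<integral>\<omega>. Z \<omega> \<partial>M)"
    if A: "\<And>\<omega>. \<omega> \<in> space M \<Longrightarrow> U \<omega> \<le> 1 / real (card (minibatches n b)) * (\<Sum>X\<in>minibatches n b. h X \<omega>)"
  proof -
    have "ennreal (\<integral>\<omega>. U \<omega> \<partial>M) \<le> ennreal (\<integral>\<omega>. Z \<omega> \<partial>M)"
      unfolding IZ IM IU by (rule nn_integral_mono) (rule ennreal_leI, rule A)
    then show ?thesis using nn by (simp add: ennreal_le_iff)
  qed
qed

lemma move_eq:
  assumes "t \<in> {1..S}" "k \<le> m" "\<omega> \<in> space M"
  shows "(norm (w t (Suc k) \<omega> - w t k \<omega>))\<^sup>2 = \<gamma>\<^sup>2 * (norm (step t k \<omega>))\<^sup>2"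
proof -
  have "w t (Suc k) \<omega> - w t k \<omega> = - (\<gamma> *\<^sub>R step t k \<omega>)"
    using w_Suc[OF assms] by (simp add: step_def eta_def algebra_simps)
  then show ?thesis using \<gamma> by (simp add: power_mult_distrib)
qed

lemma gradient_increments_le:
  assumes "t \<in> {1..S}" "k \<le> m" "\<omega> \<in> space M"
  shows "(1 / real n) * (\<Sum>i\<in>{1..n}. (norm (gradient (f i) (w t (Suc k) \<omega>) - gradient (f i) (w t k \<omega>)))\<^sup>2)
    \<le> L\<^sup>2 * \<gamma>\<^sup>2 * (norm (step t k \<omega>))\<^sup>2"
  using mean_lipschitz[of "w t (Suc k) \<omega>" "w t k \<omega>"] unfolding move_eq[OF assms] by (simp add: mult.assoc)

lemma batch_grad_diff:
  assumes "X \<in> minibatches n b"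
  shows "batch_grad X y - batch_grad X x = (1 / real b) *\<^sub>R (\<Sum>i\<in>X. gradient (f i) y - gradient (f i) x)"
  using minibatch(1,3)[OF assms] by (simp add: batch_grad_eq sum_subtractf scaleR_diff_right)

lemma g_diff: "g y - g x = (1 / real n) *\<^sub>R (\<Sum>i\<in>{1..n}. gradient (f i) y - gradient (f i) x)"
  unfolding g_eq by (simp only: sum_subtractf scaleR_diff_right)

lemma v_step: "t \<in> {1..S} \<Longrightarrow> k \<le> m \<Longrightarrow> \<omega> \<in> space M \<Longrightarrow>
    v t (Suc k) \<omega> = batch_grad (B t (Suc k) \<omega>) (w t (Suc k) \<omega>) - batch_grad (B t (Suc k) \<omega>) (w t k \<omega>) + v t k \<omega>"
  using v_Suc by (simp add: batch_grad_def)

definition "noise_rate = (real n - real b) / (real b * (real n - 1)) * L\<^sup>2 * \<gamma>\<^sup>2"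

text \<open>The new error is the old one plus the centred sampling error of the gradient increments. Their
  mean square is at most \<open>L\<^sup>2\<close> times the squared displacement \<open>\<gamma>\<^sup>2 \<parallel>step\<parallel>\<^sup>2\<close>.\<close>

lemma noise_step:
  assumes t: "t \<in> {1..S}" "Suc k \<le> m"
  shows "(\<integral>\<omega>. (norm (err t (Suc k) \<omega>))\<^sup>2 \<partial>M)
    \<le> (\<integral>\<omega>. (norm (err t k \<omega>))\<^sup>2 \<partial>M) + noise_rate * (\<integral>\<omega>. (norm (step t k \<omega>))\<^sup>2 \<partial>M)"
proof -
  have k: "k \<le> m" using t by simp
  let ?h = "\<lambda>X \<omega>. (norm (err t k \<omega> + ((batch_grad X (w t (Suc k) \<omega>) - batch_grad X (w t k \<omega>)) - (g (w t (Suc k) \<omega>) - g (w t k \<omega>)))))\<^sup>2"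
  let ?U = "\<lambda>\<omega>. (norm (err t k \<omega>))\<^sup>2 + noise_rate * (norm (step t k \<omega>))\<^sup>2"
  have r0: "0 \<le> noise_rate" using sample_factor_nonneg by (simp add: noise_rate_def)
  have "(\<integral>\<omega>. (norm (err t (Suc k) \<omega>))\<^sup>2 \<partial>M) \<le> (\<integral>\<omega>. ?U \<omega> \<partial>M)"
  proof (rule batch_expectation_le(1)[OF t(1) k, where h = ?h])
    fix X assume X: "X \<in> minibatches n b"
    note [measurable] = adapted(1,2,4)[OF t(1) k] batch_grad_measurable[OF X]
    show "?h X \<in> borel_measurable (F t k)" unfolding err_def by measurable
  next
    show "integrable M (\<lambda>\<omega>. (norm (err t (Suc k) \<omega>))\<^sup>2)" using integrable_err[OF t] .
    show "integrable M ?U" using integrable_err[OF t(1) k] integrable_step[OF t(1) k] by simp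
  next
    fix \<omega> assume \<omega>: "\<omega> \<in> space M"
    have "err t (Suc k) \<omega> = err t k \<omega> + ((batch_grad (B t (Suc k) \<omega>) (w t (Suc k) \<omega>) - batch_grad (B t (Suc k) \<omega>) (w t k \<omega>))
        - (g (w t (Suc k) \<omega>) - g (w t k \<omega>)))"
      using v_step[OF t(1) k \<omega>] by (simp add: err_def)
    then show "(norm (err t (Suc k) \<omega>))\<^sup>2 = ?h (B t (Suc k) \<omega>) \<omega>" by simp
    show "0 \<le> ?U \<omega>" using r0 by simp
    let ?x = "\<lambda>i. gradient (f i) (w t (Suc k) \<omega>) - gradient (f i) (w t k \<omega>)"
    have "1 / real (card (minibatches n b)) * (\<Sum>X\<in>minibatches n b. ?h X \<omega>)
      = 1 / real (card (minibatches n b)) * (\<Sum>X\<in>minibatches n b.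
          (norm (err t k \<omega> + ((1 / real b) *\<^sub>R (\<Sum>i\<in>X. ?x i) - (1 / real n) *\<^sub>R (\<Sum>i\<in>{1..n}. ?x i))))\<^sup>2)"
      by (simp only: batch_grad_diff g_diff cong: sum.cong)
    also have "\<dots> \<le> (norm (err t k \<omega>))\<^sup>2 + (real n - real b) / (real b * (real n - 1)) * ((1 / real n) * (\<Sum>i\<in>{1..n}. (norm (?x i))\<^sup>2))"
      using sampling_variance[of "{1..n}" b "err t k \<omega>" ?x] b n2 unfolding minibatches_def by simp
    also have "\<dots> \<le> (norm (err t k \<omega>))\<^sup>2 + (real n - real b) / (real b * (real n - 1)) * (L\<^sup>2 * \<gamma>\<^sup>2 * (norm (step t k \<omega>))\<^sup>2)"
      using b n2 gradient_increments_le[OF t(1) k \<omega>] by (intro add_left_mono mult_left_mono) auto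
    also have "\<dots> = ?U \<omega>" by (simp add: noise_rate_def)
    finally show "1 / real (card (minibatches n b)) * (\<Sum>X\<in>minibatches n b. ?h X \<omega>) \<le> ?U \<omega>" .
  qed simp
  also have "\<dots> = (\<integral>\<omega>. (norm (err t k \<omega>))\<^sup>2 \<partial>M) + noise_rate * (\<integral>\<omega>. (norm (step t k \<omega>))\<^sup>2 \<partial>M)"
    using integrable_err[OF t(1) k] integrable_step[OF t(1) k] by simp
  finally show ?thesis .
qed

lemma noise_le:
  assumes t: "t \<in> {1..S}"
  shows "k \<le> m \<Longrightarrow> (\<integral>\<omega>. (norm (err t k \<omega>))\<^sup>2 \<partial>M) \<le> noise_rate * (\<Sum>j<k. \<integral>\<omega>. (norm (step t j \<omega>))\<^sup>2 \<partial>M)"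
proof (induction k)
  case 0
  have "(\<integral>\<omega>. (norm (err t 0 \<omega>))\<^sup>2 \<partial>M) = (\<integral>\<omega>. 0 \<partial>M)"
    by (rule Bochner_Integration.integral_cong) (auto simp: err_def v_start[OF t])
  then show ?case by simp
next
  case (Suc k)
  then show ?case using noise_step[OF t Suc.prems] by (simp add: algebra_simps)
qed

text \<open>No error is made at \<open>k = 0\<close>, where the full gradient is computed; therefore only \<open>m - 1\<close> of the \<open>m\<close>
  errors with weight \<open>cE\<close> count, which leaves room for the larger weight \<open>cL\<close> of the final one.\<close>

lemma total_noise_le:
  assumes t: "t \<in> {1..S}" and c: "0 \<le> cE" "0 \<le> cL" "cE * (real m - 1) + cL \<le> real m * (2 + 4 * \<eta>2\<^sup>2)"
  shows "cE * (\<Sum>k<m. \<integral>\<omega>. (norm (err t k \<omega>))\<^sup>2 \<partial>M) + cL * (\<integral>\<omega>. (norm (err t m \<omega>))\<^sup>2 \<partial>M)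
    \<le> slack_term * (\<Sum>k<m. \<integral>\<omega>. (norm (step t k \<omega>))\<^sup>2 \<partial>M)"
proof -
  define Sg where "Sg = (\<Sum>k<m. \<integral>\<omega>. (norm (step t k \<omega>))\<^sup>2 \<partial>M)"
  have r0: "0 \<le> noise_rate" using sample_factor_nonneg by (simp add: noise_rate_def)
  have S0: "0 \<le> Sg" unfolding Sg_def by (intro sum_nonneg integral_nonneg_AE AE_I2) simp
  have each: "(\<integral>\<omega>. (norm (err t k \<omega>))\<^sup>2 \<partial>M) \<le> noise_rate * Sg" if "k \<le> m" for k
  proof -
    have "(\<Sum>j<k. \<integral>\<omega>. (norm (step t j \<omega>))\<^sup>2 \<partial>M) \<le> Sg"
      unfolding Sg_def using that by (intro sum_mono2 integral_nonneg_AE AE_I2) auto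
    then show ?thesis using noise_le[OF t that] mult_left_mono[OF _ r0] by (meson order_trans)
  qed
  have e0: "(\<integral>\<omega>. (norm (err t 0 \<omega>))\<^sup>2 \<partial>M) \<le> 0" using noise_le[OF t, of 0] by simp
  obtain N where N: "m = Suc N" using m1 by (cases m) auto
  have "(\<Sum>k<m. \<integral>\<omega>. (norm (err t k \<omega>))\<^sup>2 \<partial>M)
      = (\<integral>\<omega>. (norm (err t 0 \<omega>))\<^sup>2 \<partial>M) + (\<Sum>k<N. \<integral>\<omega>. (norm (err t (Suc k) \<omega>))\<^sup>2 \<partial>M)"
    unfolding N by (rule sum.lessThan_Suc_shift)
  also have "\<dots> \<le> 0 + (\<Sum>k<N. noise_rate * Sg)"
    using e0 each N by (intro add_mono sum_mono) auto
  finally have s: "(\<Sum>k<m. \<integral>\<omega>. (norm (err t k \<omega>))\<^sup>2 \<partial>M) \<le> (real m - 1) * (noise_rate * Sg)" using N by simp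
  have "cE * (\<Sum>k<m. \<integral>\<omega>. (norm (err t k \<omega>))\<^sup>2 \<partial>M) + cL * (\<integral>\<omega>. (norm (err t m \<omega>))\<^sup>2 \<partial>M)
      \<le> cE * ((real m - 1) * (noise_rate * Sg)) + cL * (noise_rate * Sg)"
    using s each[of m] c by (intro add_mono mult_left_mono) auto
  also have "\<dots> = (cE * (real m - 1) + cL) * (noise_rate * Sg)" by (simp add: algebra_simps)
  also have "\<dots> \<le> (real m * (2 + 4 * \<eta>2\<^sup>2)) * (noise_rate * Sg)"
    using c r0 S0 by (intro mult_right_mono mult_nonneg_nonneg) auto
  also have "\<dots> = (real m * (2 + 4 * \<eta>2\<^sup>2) * noise_rate) * Sg" by simp
  also have "\<dots> \<le> slack_term * Sg"
    using slack_term_bound S0 unfolding noise_rate_def by (intro mult_right_mono)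
  finally show ?thesis unfolding Sg_def .
qed

text \<open>Jensen's inequality: conditionally on the past, the gradient at \<open>w 1\<close> is the mean of \<open>v 1\<close> over the
  batches.\<close>

lemma gradient_le_estimator:
  assumes t: "t \<in> {1..S}"
  shows "(\<integral>\<omega>. (norm (g (w t 1 \<omega>)))\<^sup>2 \<partial>M) \<le> (\<integral>\<omega>. (norm (v t 1 \<omega>))\<^sup>2 \<partial>M)"
proof -
  let ?h = "\<lambda>X \<omega>. (norm ((batch_grad X (w t (Suc 0) \<omega>) - batch_grad X (w t 0 \<omega>)) + g (w t 0 \<omega>)))\<^sup>2"
  have m0: "0 \<le> m" by simp
  have "(\<integral>\<omega>. (norm (g (w t (Suc 0) \<omega>)))\<^sup>2 \<partial>M) \<le> (\<integral>\<omega>. (norm (v t (Suc 0) \<omega>))\<^sup>2 \<partial>M)"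
  proof (rule batch_expectation_le(2)[OF t m0, where h = ?h])
    fix X assume X: "X \<in> minibatches n b"
    note [measurable] = adapted(1,2,4)[OF t m0] batch_grad_measurable[OF X]
    show "?h X \<in> borel_measurable (F t 0)" by measurable
  next
    show "integrable M (\<lambda>\<omega>. (norm (v t (Suc 0) \<omega>))\<^sup>2)"
      using process_bounded(5)[OF t m0] process_measurable(5)[OF t m0] by (rule integrable_norm_sq)
    show "integrable M (\<lambda>\<omega>. (norm (g (w t (Suc 0) \<omega>)))\<^sup>2)"
      using integrable_gradient[OF t, of "Suc 0"] m1 by simp
  next
    fix \<omega> assume \<omega>: "\<omega> \<in> space M"
    show "(norm (v t (Suc 0) \<omega>))\<^sup>2 = ?h (B t (Suc 0) \<omega>) \<omega>"
      using v_step[OF t m0 \<omega>] v_start[OF t \<omega>] by simp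
    let ?x = "\<lambda>i. gradient (f i) (w t (Suc 0) \<omega>) - gradient (f i) (w t 0 \<omega>)"
    let ?c = "real (card (minibatches n b))"
    have c: "0 < ?c" and mean: "(1 / ?c) *\<^sub>R (\<Sum>X\<in>minibatches n b. (1 / real b) *\<^sub>R (\<Sum>i\<in>X. ?x i)) = (1 / real n) *\<^sub>R (\<Sum>i\<in>{1..n}. ?x i)"
      using mean_over_subsets(1)[of "{1..n}" b] mean_over_subsets(2)[of "{1..n}" b, where g = ?x] b unfolding minibatches_def by simp_all
    have ne: "minibatches n b \<noteq> {}" using c by force
    have "(1 / ?c) *\<^sub>R (\<Sum>X\<in>minibatches n b. (batch_grad X (w t (Suc 0) \<omega>) - batch_grad X (w t 0 \<omega>)) + g (w t 0 \<omega>))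
      = (1 / ?c) *\<^sub>R (\<Sum>X\<in>minibatches n b. (1 / real b) *\<^sub>R (\<Sum>i\<in>X. ?x i)) + g (w t 0 \<omega>)"
      using c by (simp only: batch_grad_diff sum.distrib scaleR_add_right cong: sum.cong)
        (simp add: sum_constant_scaleR)
    also have "\<dots> = g (w t (Suc 0) \<omega>)" unfolding mean g_diff[symmetric] by simp
    finally show "(norm (g (w t (Suc 0) \<omega>)))\<^sup>2 \<le> 1 / ?c * (\<Sum>X\<in>minibatches n b. ?h X \<omega>)"
      using norm_mean_sq_le[OF minibatch(4) ne, of "\<lambda>X. (batch_grad X (w t (Suc 0) \<omega>) - batch_grad X (w t 0 \<omega>)) + g (w t 0 \<omega>)"] by simp
  qed simp_all
  then show ?thesis by simp
qed

lemma estimator_increment_le: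
  assumes t: "t \<in> {1..S}"
  shows "(\<integral>\<omega>. (norm (v t 1 \<omega> - v t 0 \<omega>))\<^sup>2 \<partial>M) \<le> L\<^sup>2 * \<gamma>\<^sup>2 * (\<integral>\<omega>. (norm (step t 0 \<omega>))\<^sup>2 \<partial>M)"
proof -
  let ?h = "\<lambda>X \<omega>. (norm (batch_grad X (w t (Suc 0) \<omega>) - batch_grad X (w t 0 \<omega>)))\<^sup>2"
  have m0: "0 \<le> m" by simp
  have "(\<integral>\<omega>. (norm (v t (Suc 0) \<omega> - v t 0 \<omega>))\<^sup>2 \<partial>M) \<le> (\<integral>\<omega>. L\<^sup>2 * \<gamma>\<^sup>2 * (norm (step t 0 \<omega>))\<^sup>2 \<partial>M)"
  proof (rule batch_expectation_le(1)[OF t m0, where h = ?h])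
    fix X assume X: "X \<in> minibatches n b"
    note [measurable] = adapted(1,2,4)[OF t m0] batch_grad_measurable[OF X]
    show "?h X \<in> borel_measurable (F t 0)" by measurable
  next
    note [measurable] = process_measurable(2,5)[OF t m0]
    have "(\<lambda>\<omega>. v t (Suc 0) \<omega> - v t 0 \<omega>) \<in> borel_measurable M" by measurable
    then show "integrable M (\<lambda>\<omega>. (norm (v t (Suc 0) \<omega> - v t 0 \<omega>))\<^sup>2)"
      using ae_bounded_minus[OF process_bounded(5,2)[OF t m0]] by (intro integrable_norm_sq)
    show "integrable M (\<lambda>\<omega>. L\<^sup>2 * \<gamma>\<^sup>2 * (norm (step t 0 \<omega>))\<^sup>2)"
      using integrable_step[OF t m0] by simp
  next
    fix \<omega> assume \<omega>: "\<omega> \<in> space M"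
    show "(norm (v t (Suc 0) \<omega> - v t 0 \<omega>))\<^sup>2 = ?h (B t (Suc 0) \<omega>) \<omega>"
      using v_step[OF t m0 \<omega>] by simp
    let ?x = "\<lambda>i. gradient (f i) (w t (Suc 0) \<omega>) - gradient (f i) (w t 0 \<omega>)"
    let ?c = "real (card (minibatches n b))"
    have mean: "(1 / ?c) *\<^sub>R (\<Sum>X\<in>minibatches n b. (1 / real b) *\<^sub>R (\<Sum>i\<in>X. (norm (?x i))\<^sup>2))
        = (1 / real n) *\<^sub>R (\<Sum>i\<in>{1..n}. (norm (?x i))\<^sup>2)"
      using mean_over_subsets(2)[of "{1..n}" b, where g = "\<lambda>i. (norm (?x i))\<^sup>2"] b unfolding minibatches_def by simp
    have "1 / ?c * (\<Sum>X\<in>minibatches n b. ?h X \<omega>) \<le> 1 / ?c * (\<Sum>X\<in>minibatches n b. (1 / real b) *\<^sub>R (\<Sum>i\<in>X. (norm (?x i))\<^sup>2))"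
    proof (intro mult_left_mono sum_mono)
      fix X assume X: "X \<in> minibatches n b"
      have fin: "finite X" using minibatch(1)[OF X] finite_subset by blast
      show "?h X \<omega> \<le> (1 / real b) *\<^sub>R (\<Sum>i\<in>X. (norm (?x i))\<^sup>2)"
        using norm_mean_sq_le[OF fin minibatch(2)[OF X], of ?x] minibatch(3)[OF X] batch_grad_diff[OF X] by simp
    qed simp
    also have "\<dots> = (1 / real n) * (\<Sum>i\<in>{1..n}. (norm (?x i))\<^sup>2)" using mean by simp
    also have "\<dots> \<le> L\<^sup>2 * \<gamma>\<^sup>2 * (norm (step t 0 \<omega>))\<^sup>2" using gradient_increments_le[OF t m0 \<omega>] .
    finally show "1 / ?c * (\<Sum>X\<in>minibatches n b. ?h X \<omega>) \<le> L\<^sup>2 * \<gamma>\<^sup>2 * (norm (step t 0 \<omega>))\<^sup>2" .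
  qed simp_all
  then show ?thesis using integrable_step[OF t m0] by simp
qed

abbreviation "gap_after j \<equiv> expected_gap M (objective n f \<phi>) (outer_iterate w0 m w j) wopt"

section \<open>One epoch in expectation\<close>

text \<open>The domain is the countable union of the closed sublevel sets.\<close>

lemma dom_borel: "dom \<in> sets borel"
proof -
  have "dom = (\<Union>k::nat. {x. (x, real k) \<in> ereal_epigraph \<phi>})"
    using real_arch_simple by (auto simp: mem_epigraph)
  moreover have "closed {x. (x, real k) \<in> ereal_epigraph \<phi>}" for k
    using closed_vimage[OF closed_epi, of "\<lambda>x. (x, real k)"]
    by (simp add: vimage_def continuous_on_Pair)
  ultimately show ?thesis by (simp add: borel_closed sets.countable_UN)
qed

text \<open>Outside the domain the gap is infinite, so a finite expected gap excludes this almost surely.\<close>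

lemma AE_start_dom:
  assumes t: "Suc j \<in> {1..S}" and fin: "gap_after j = ereal \<Gamma>"
  shows "AE \<omega> in M. w (Suc j) 0 \<omega> \<in> dom"
proof -
  define N where "N = {\<omega>\<in>space M. w (Suc j) 0 \<omega> \<notin> dom}"
  have [measurable]: "w (Suc j) 0 \<in> borel_measurable M" "dom \<in> sets borel"
    using process_measurable(1)[OF t, of 0] dom_borel by auto
  have N: "N \<in> sets M" unfolding N_def by measurable
  have "\<infinity> * emeasure M N = (\<integral>\<^sup>+\<omega>. \<infinity> * indicator N \<omega> \<partial>M)"
    using N by (simp add: nn_integral_cmult_indicator)
  also have "\<dots> \<le> (\<integral>\<^sup>+\<omega>. e2ennreal (objective n f \<phi> (outer_iterate w0 m w j \<omega>) - objective n f \<phi> wopt) \<partial>M)"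
  proof (rule nn_integral_mono)
    fix \<omega> assume \<omega>: "\<omega> \<in> space M"
    show "\<infinity> * indicator N \<omega> \<le> e2ennreal (objective n f \<phi> (outer_iterate w0 m w j \<omega>) - objective n f \<phi> wopt)"
    proof (cases "\<omega> \<in> N")
      case True
      then have "\<phi> (outer_iterate w0 m w j \<omega>) = \<infinity>"
        using not_dom w_0[OF t \<omega>] by (simp add: N_def)
      then show ?thesis unfolding objective_eq[OF wopt_dom] by (simp add: objective_def)
    qed simp
  qed
  also have "\<dots> < \<infinity>"
    using fin unfolding expected_gap_def
    by (cases "\<integral>\<^sup>+\<omega>. e2ennreal (objective n f \<phi> (outer_iterate w0 m w j \<omega>) - objective n f \<phi> wopt) \<partial>M") auto
  finally have "emeasure M N = 0" by (cases "emeasure M N = 0") (auto simp: ennreal_top_mult)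
  then show ?thesis using N by (intro AE_I[where N = N]) (auto simp: N_def)
qed

text \<open>The starting gap is not known to be integrable. It is compared as a nonnegative extended
  real with the positive part of the integrable minorant \<open>W\<close>.\<close>

lemma expectation_le:
  assumes t: "Suc j \<in> {1..S}" and fin: "gap_after j = ereal \<Gamma>" and W: "integrable M W"
    and le: "\<And>\<omega>. regular \<omega> \<Longrightarrow> w (Suc j) 0 \<omega> \<in> dom \<Longrightarrow> W \<omega> \<le> start_gap (Suc j) \<omega>"
  shows "(\<integral>\<omega>. W \<omega> \<partial>M) \<le> 2 / \<gamma> * \<Gamma>" and "0 \<le> \<Gamma>"
proof -
  let ?H = "\<lambda>\<omega>. e2ennreal (objective n f \<phi> (outer_iterate w0 m w j \<omega>) - objective n f \<phi> wopt)"
  have \<Gamma>: "(\<integral>\<^sup>+\<omega>. ?H \<omega> \<partial>M) = ennreal \<Gamma>" "0 \<le> \<Gamma>"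
    using fin unfolding expected_gap_def by (cases "\<integral>\<^sup>+\<omega>. ?H \<omega> \<partial>M"; auto simp: enn2ereal_ennreal)+
  then show "0 \<le> \<Gamma>" by simp
  have W': "integrable M (\<lambda>\<omega>. \<gamma> / 2 * max 0 (W \<omega>))" using W by (intro integrable_mult_right integrable_max) auto
  have "ennreal (\<integral>\<omega>. \<gamma> / 2 * max 0 (W \<omega>) \<partial>M) = (\<integral>\<^sup>+\<omega>. ennreal (\<gamma> / 2 * max 0 (W \<omega>)) \<partial>M)"
    using W' \<gamma> by (intro nn_integral_eq_integral[symmetric]) auto
  also have "\<dots> \<le> (\<integral>\<^sup>+\<omega>. ?H \<omega> \<partial>M)"
  proof (rule nn_integral_mono_AE)
    show "AE \<omega> in M. ennreal (\<gamma> / 2 * max 0 (W \<omega>)) \<le> ?H \<omega>"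
      using AE_regular AE_start_dom[OF t fin]
    proof eventually_elim
      case (elim \<omega>)
      then have \<omega>: "\<omega> \<in> space M" by (simp add: regular_def)
      let ?x = "w (Suc j) 0 \<omega>"
      have x: "outer_iterate w0 m w j \<omega> = ?x" using w_0[OF t \<omega>] by simp
      have gap: "\<gamma> / 2 * start_gap (Suc j) \<omega> = fbar ?x + val ?x - Pmin"
        using \<gamma> by (simp add: start_gap_def)
      have "0 \<le> start_gap (Suc j) \<omega>" using Pmin_le[OF elim(2)] \<gamma> by (simp add: start_gap_def)
      then have "max 0 (W \<omega>) \<le> start_gap (Suc j) \<omega>" using le[OF elim] by simp
      then have "\<gamma> / 2 * max 0 (W \<omega>) \<le> \<gamma> / 2 * start_gap (Suc j) \<omega>"
        using \<gamma> by (intro mult_left_mono) auto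
      then show ?case
        unfolding x gap objective_eq[OF elim(2)] objective_eq[OF wopt_dom] Pmin_def by (simp add: ennreal_leI)
    qed
  qed
  finally have "(\<integral>\<omega>. \<gamma> / 2 * max 0 (W \<omega>) \<partial>M) \<le> \<Gamma>"
    using \<Gamma> by (simp add: ennreal_le_iff)
  then have "\<gamma> / 2 * (\<integral>\<omega>. max 0 (W \<omega>) \<partial>M) \<le> \<Gamma>" by simp
  moreover have "(\<integral>\<omega>. W \<omega> \<partial>M) \<le> (\<integral>\<omega>. max 0 (W \<omega>) \<partial>M)"
    using W by (intro integral_mono integrable_max) auto
  ultimately have "\<gamma> / 2 * (\<integral>\<omega>. W \<omega> \<partial>M) \<le> \<Gamma>" using \<gamma> by (smt (verit) mult_left_mono divide_nonneg_nonneg)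
  then show "(\<integral>\<omega>. W \<omega> \<partial>M) \<le> 2 / \<gamma> * \<Gamma>" using \<gamma> by (simp add: field_simps)
qed

lemma integrable_residual: "t \<in> {1..S} \<Longrightarrow> integrable M (\<lambda>\<omega>. (norm (v t 0 \<omega> + d t 0 \<omega>))\<^sup>2)"
proof (rule integrable_norm_sq)
  assume t: "t \<in> {1..S}"
  have m0: "0 \<le> m" by simp
  note [measurable] = process_measurable(2,3)[OF t m0]
  show "ae_bounded M (\<lambda>\<omega>. v t 0 \<omega> + d t 0 \<omega>)" by (intro ae_bounded_add process_bounded(2,3) t) simp_all
  show "(\<lambda>\<omega>. v t 0 \<omega> + d t 0 \<omega>) \<in> borel_measurable M" by measurable
qed

lemma integrable_v: "t \<in> {1..S} \<Longrightarrow> k \<le> m \<Longrightarrow> integrable M (\<lambda>\<omega>. (norm (v t k \<omega>))\<^sup>2)"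
  using process_bounded(2) process_measurable(2) by (intro integrable_norm_sq)

lemma integrable_excess: "t \<in> {1..S} \<Longrightarrow> integrable M (excess t)"
  unfolding excess_def
  using integrable_v[of t 0] integrable_norm_sq[OF process_bounded(3) process_measurable(3), of t 0]
  by (intro integrable_max integrable_diff) auto

lemma integrable_epoch_budget: "t \<in> {1..S} \<Longrightarrow> integrable M (epoch_budget t)"
  unfolding epoch_budget_def
  using integrable_v[of t 0] integrable_residual[of t] integrable_excess[of t] by auto

lemma ratio_pos: "0 < ratio"
  using r_pos r1 by (simp add: ratio_def)

lemma \<alpha>_pos: "1 \<le> \<alpha>"
proof -
  have "1 \<le> (1 + c2) / (1 - c2)" using c2 by (simp add: field_simps)
  then show ?thesis using \<alpha> by linarith
qed

lemma eta2_le: "\<eta>2 \<le> 2/3"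
proof -
  have "0 < L * \<gamma>" using L \<gamma> by simp
  then have "3 \<le> 2 / \<eta>2" using slack_term_nonneg unfolding slack_term_def by linarith
  then show ?thesis using etas by (simp add: field_simps)
qed

lemma eta2_sq: "\<eta>2\<^sup>2 \<le> 4/9"
  using power_mono[OF eta2_le, of 2] etas by (simp add: power2_eq_square)

text \<open>Taking expectations in a pathwise bound, the error terms are absorbed by the squared steps.\<close>

lemma epoch_expectation:
  assumes t: "Suc j \<in> {1..S}" and fin: "gap_after j = ereal \<Gamma>" and U: "integrable M U"
    and c: "0 \<le> cE" "0 \<le> cL" "cE * (real m - 1) + cL \<le> real m * (2 + 4 * \<eta>2\<^sup>2)"
    and le: "\<And>\<omega>. regular \<omega> \<Longrightarrow> w (Suc j) 0 \<omega> \<in> dom \<Longrightarrow>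
      U \<omega> + slack_term * (\<Sum>k<m. (norm (step (Suc j) k \<omega>))\<^sup>2)
      \<le> start_gap (Suc j) \<omega> + cE * (\<Sum>k<m. (norm (err (Suc j) k \<omega>))\<^sup>2)
        + cL * (norm (err (Suc j) m \<omega>))\<^sup>2 + epoch_budget (Suc j) \<omega>"
  shows "(\<integral>\<omega>. U \<omega> \<partial>M) \<le> 2 / \<gamma> * \<Gamma> + (\<integral>\<omega>. epoch_budget (Suc j) \<omega> \<partial>M)"
proof -
  let ?W = "\<lambda>\<omega>. U \<omega> + slack_term * (\<Sum>k<m. (norm (step (Suc j) k \<omega>))\<^sup>2)
      - (cE * (\<Sum>k<m. (norm (err (Suc j) k \<omega>))\<^sup>2) + cL * (norm (err (Suc j) m \<omega>))\<^sup>2 + epoch_budget (Suc j) \<omega>)"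
  have i1: "integrable M (\<lambda>\<omega>. slack_term * (\<Sum>k<m. (norm (step (Suc j) k \<omega>))\<^sup>2))"
    using integrable_step[OF t] by (intro integrable_mult_right integrable_sum) auto
  have i2: "integrable M (\<lambda>\<omega>. cE * (\<Sum>k<m. (norm (err (Suc j) k \<omega>))\<^sup>2))"
    using integrable_err[OF t] by (intro integrable_mult_right integrable_sum) auto
  have i3: "integrable M (\<lambda>\<omega>. cL * (norm (err (Suc j) m \<omega>))\<^sup>2)"
    using integrable_err[OF t, of m] by (intro integrable_mult_right) auto
  note i4 = integrable_epoch_budget[OF t]
  have W: "integrable M ?W" using U i1 i2 i3 i4
    by (intro Bochner_Integration.integrable_add Bochner_Integration.integrable_diff)
  have "(\<integral>\<omega>. ?W \<omega> \<partial>M) \<le> 2 / \<gamma> * \<Gamma>"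
    by (rule expectation_le(1)[OF t fin W]) (use le in fastforce)
  moreover have "(\<integral>\<omega>. ?W \<omega> \<partial>M) = (\<integral>\<omega>. U \<omega> \<partial>M) + (\<integral>\<omega>. slack_term * (\<Sum>k<m. (norm (step (Suc j) k \<omega>))\<^sup>2) \<partial>M)
      - ((\<integral>\<omega>. cE * (\<Sum>k<m. (norm (err (Suc j) k \<omega>))\<^sup>2) \<partial>M) + (\<integral>\<omega>. cL * (norm (err (Suc j) m \<omega>))\<^sup>2 \<partial>M)
        + (\<integral>\<omega>. epoch_budget (Suc j) \<omega> \<partial>M))"
    using U i1 i2 i3 i4 by (simp add: Bochner_Integration.integral_add Bochner_Integration.integral_diff)
  moreover have "(\<integral>\<omega>. slack_term * (\<Sum>k<m. (norm (step (Suc j) k \<omega>))\<^sup>2) \<partial>M)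
      = slack_term * (\<Sum>k<m. \<integral>\<omega>. (norm (step (Suc j) k \<omega>))\<^sup>2 \<partial>M)"
    using integrable_step[OF t] by (subst Bochner_Integration.integral_mult_right) (auto simp: Bochner_Integration.integral_sum)
  moreover have "(\<integral>\<omega>. cE * (\<Sum>k<m. (norm (err (Suc j) k \<omega>))\<^sup>2) \<partial>M)
      = cE * (\<Sum>k<m. \<integral>\<omega>. (norm (err (Suc j) k \<omega>))\<^sup>2 \<partial>M)"
    using integrable_err[OF t] by (subst Bochner_Integration.integral_mult_right) (auto simp: Bochner_Integration.integral_sum)
  moreover have "(\<integral>\<omega>. cL * (norm (err (Suc j) m \<omega>))\<^sup>2 \<partial>M) = cL * (\<integral>\<omega>. (norm (err (Suc j) m \<omega>))\<^sup>2 \<partial>M)"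
    by simp
  ultimately show ?thesis using total_noise_le[OF t c] by linarith
qed

text \<open>The three pathwise regimes have different weights for the errors, all of which are admissible for
  \<open>epoch_expectation\<close> because \<open>\<eta>2\<^sup>2 \<le> 4/9\<close>.\<close>

lemma mapping_expectation:
  assumes t: "Suc j \<in> {1..S}" and fin: "gap_after j = ereal \<Gamma>" and long: "17/2 * ratio \<le> real m + 1"
  shows "(real m + 1) * \<eta>1\<^sup>2 * (\<integral>\<omega>. (norm (mapping (Suc j) \<omega>))\<^sup>2 \<partial>M) \<le> 2 / \<gamma> * \<Gamma> + (\<integral>\<omega>. epoch_budget (Suc j) \<omega> \<partial>M)"
proof -
  let ?U = "\<lambda>\<omega>. (real m + 1) * (\<eta>1 * norm (mapping (Suc j) \<omega>))\<^sup>2"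
  have U: "integrable M ?U" using integrable_mapping[OF t] by (simp add: power_mult_distrib)
  have mh: "real m * \<eta>2\<^sup>2 \<le> real m * (4/9)" using eta2_sq by (intro mult_left_mono) auto
  have cases: "m \<le> 2 \<or> (3 \<le> m \<and> r \<le> 2/3) \<or> (3 \<le> m \<and> 2/3 < r)" by linarith
  have "(\<integral>\<omega>. ?U \<omega> \<partial>M) \<le> 2 / \<gamma> * \<Gamma> + (\<integral>\<omega>. epoch_budget (Suc j) \<omega> \<partial>M)"
    using cases
  proof (elim disjE conjE)
    assume A: "m \<le> 2"
    show ?thesis
      by (rule epoch_expectation[OF t fin U, of 2 0])
        (use pathwise_facts(1)[OF t] A m1 in \<open>auto simp: algebra_simps\<close>)
  next
    assume A: "3 \<le> m" "r \<le> 2/3"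
    show ?thesis
      by (rule epoch_expectation[OF t fin U, of 2 "4 * (real m + 1) * \<eta>2\<^sup>2"])
        (use pathwise_facts(2)[OF t] A eta2_sq in \<open>auto simp: algebra_simps\<close>)
  next
    assume A: "3 \<le> m" "2/3 < r"
    have "10/7 * (M - 1) + 5 * P \<le> 2 * M + 4 * P" if "P \<le> M * (4/9)" "0 \<le> M" for M P :: real
      using that by argo
    from this[OF mh] have c: "10/7 * (real m - 1) + 5 * real m * \<eta>2\<^sup>2 \<le> real m * (2 + 4 * \<eta>2\<^sup>2)"
      by (simp add: distrib_left mult.assoc mult.left_commute mult.commute)
    show ?thesis
      by (rule epoch_expectation[OF t fin U _ _ c])
        (use pathwise_facts(3)[OF t _ _ A long] in \<open>auto simp: algebra_simps\<close>)
  qed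
  then show ?thesis by (simp add: power_mult_distrib mult.assoc)
qed

end
text \<open>With \<open>b = \<surd>x\<close> this is \<open>17 b ^ 4 - 3 b\<^sup>2 - 2 b + 1 \<ge> 0\<close>, written as a sum of squares.\<close>

lemma first_step_scalar:
  fixes x :: real
  assumes "0 \<le> x"
  shows "2 * x \<le> 17/2 * x\<^sup>2 + 1/2 * (1 - sqrt x)\<^sup>2"
proof -
  define b where "b = sqrt x"
  have x: "x = b\<^sup>2" using assms by (simp add: b_def)
  have "36 * (17 * (b\<^sup>2)\<^sup>2 + (1 - b)\<^sup>2 - 4 * b\<^sup>2) = 17 * (6 * b\<^sup>2 - 1)\<^sup>2 + 6 * (4 * b - 3/2)\<^sup>2 + 11/2"
    by (simp add: power2_eq_square algebra_simps)
  then have "36 * (17 * (b\<^sup>2)\<^sup>2 + (1 - b)\<^sup>2 - 4 * b\<^sup>2) \<ge> 36 * 0" by simp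
  then have "0 \<le> 17 * (b\<^sup>2)\<^sup>2 + (1 - b)\<^sup>2 - 4 * b\<^sup>2"
    by (rule mult_left_le_imp_le) simp
  then show ?thesis by (simp add: x[symmetric] b_def[symmetric])
qed

context prox_cg_analysis begin

lemma epoch_budget_expectation:
  assumes t: "t \<in> {1..S}"
  shows "(\<integral>\<omega>. epoch_budget t \<omega> \<partial>M) = (2 + 4 * \<eta>2\<^sup>2) * (ratio * (\<alpha> * (\<integral>\<omega>. (norm (v t 0 \<omega>))\<^sup>2 \<partial>M)))
    + (1 + 2 * \<eta>2\<^sup>2) * (\<integral>\<omega>. (norm (v t 0 \<omega> + d t 0 \<omega>))\<^sup>2 \<partial>M)
    + (2 + 4 * \<eta>2\<^sup>2) * (r\<^sup>2 / (1 - r\<^sup>2) * (\<integral>\<omega>. excess t \<omega> \<partial>M))"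
proof -
  have i: "integrable M (\<lambda>\<omega>. (norm (v t 0 \<omega>))\<^sup>2)" using integrable_v[OF t] by simp
  note j = integrable_residual[OF t] and l = integrable_excess[OF t]
  show ?thesis unfolding epoch_budget_def
    using i j l by (simp add: Bochner_Integration.integral_add)
qed

lemma one_minus_r_sq: "0 < 1 - r\<^sup>2" "(1 - r)\<^sup>2 * (1 + r) = (1 - r) * (1 - r\<^sup>2)"
proof -
  have "1 - r\<^sup>2 = (1 - r) * (1 + r)" by (simp add: power2_eq_square algebra_simps)
  then show "0 < 1 - r\<^sup>2" using r_pos r1 by simp
  show "(1 - r)\<^sup>2 * (1 + r) = (1 - r) * (1 - r\<^sup>2)" by (simp add: power2_eq_square algebra_simps)
qed

text \<open>The new gradient is bounded by \<open>r\<close> times the old one, in mean square. Moreover the estimator has moved by at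
  least \<open>(1 - \<surd>r) \<parallel>v 0\<parallel>\<close>, which by Lipschitz continuity needs a long step. If \<open>r\<close> is small, this step
  pays for the bound through the two units of \<open>first_step_bound\<close>; if \<open>r\<close> is large, the budget does.\<close>

lemma first_step_expectation:
  assumes m: "m = 1" and t: "Suc j \<in> {1..S}" and fin: "gap_after j = ereal \<Gamma>"
  shows "2 * \<eta>1\<^sup>2 * (\<integral>\<omega>. (norm (g (w (Suc j) 1 \<omega>)))\<^sup>2 \<partial>M) \<le> 2 / \<gamma> * \<Gamma> + (\<integral>\<omega>. epoch_budget (Suc j) \<omega> \<partial>M)"
proof -
  let ?t = "Suc j"
  define V where "V = (\<integral>\<omega>. (norm (v ?t 0 \<omega>))\<^sup>2 \<partial>M)"
  define Q where "Q = (\<integral>\<omega>. (norm (step ?t 0 \<omega>))\<^sup>2 \<partial>M)"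
  define R where "R = (\<integral>\<omega>. (norm (v ?t 0 \<omega> + d ?t 0 \<omega>))\<^sup>2 \<partial>M)"
  define I where "I = (\<integral>\<omega>. (norm (v ?t 1 \<omega> - v ?t 0 \<omega>))\<^sup>2 \<partial>M)"
  define X where "X = (\<integral>\<omega>. (norm (g (w ?t 1 \<omega>)))\<^sup>2 \<partial>M)"
  have nn: "0 \<le> V" "0 \<le> Q" "0 \<le> R" "0 \<le> X" "0 \<le> (\<integral>\<omega>. excess ?t \<omega> \<partial>M)"
    unfolding V_def Q_def R_def X_def excess_def by (auto intro!: integral_nonneg_AE AE_I2)
  have m0: "0 \<le> m" by simp
  note iv = integrable_v[OF t m0] and iq = integrable_step[OF t m0] and ir = integrable_residual[OF t]
  have descent: "2 * Q + slack_term * Q \<le> 2 / \<gamma> * \<Gamma> + R"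
  proof -
    let ?W = "\<lambda>\<omega>. 2 * (norm (step ?t 0 \<omega>))\<^sup>2 + slack_term * (norm (step ?t 0 \<omega>))\<^sup>2 - (norm (v ?t 0 \<omega> + d ?t 0 \<omega>))\<^sup>2"
    have W: "integrable M ?W" using iq ir by simp
    have "(\<integral>\<omega>. ?W \<omega> \<partial>M) \<le> 2 / \<gamma> * \<Gamma>"
    proof (rule expectation_le(1)[OF t fin W])
      fix \<omega> assume "regular \<omega>" "w ?t 0 \<omega> \<in> dom"
      from pathwise_facts(5)[OF t this m] show "?W \<omega> \<le> start_gap ?t \<omega>" by (simp add: m)
    qed
    moreover have "(\<integral>\<omega>. ?W \<omega> \<partial>M) = 2 * Q + slack_term * Q - R" using iq ir unfolding Q_def R_def by simp
    ultimately show ?thesis by simp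
  qed
  have "(\<integral>\<omega>. (norm (v ?t 1 \<omega>))\<^sup>2 \<partial>M) \<le> (\<integral>\<omega>. r * (norm (v ?t 0 \<omega>))\<^sup>2 \<partial>M)"
  proof (rule integral_mono_AE)
    show "integrable M (\<lambda>\<omega>. (norm (v ?t 1 \<omega>))\<^sup>2)" using integrable_v[OF t, of 1] m by simp
    show "integrable M (\<lambda>\<omega>. r * (norm (v ?t 0 \<omega>))\<^sup>2)" using iv by simp
    show "AE \<omega> in M. (norm (v ?t 1 \<omega>))\<^sup>2 \<le> r * (norm (v ?t 0 \<omega>))\<^sup>2"
      using AE_regular by eventually_elim (use t in \<open>auto simp: regular_def\<close>)
  qed
  then have grad: "X \<le> r * V" using gradient_le_estimator[OF t] iv unfolding X_def V_def by simp
  have "(\<integral>\<omega>. (1 - sqrt r)\<^sup>2 * (norm (v ?t 0 \<omega>))\<^sup>2 \<partial>M) \<le> I"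
    unfolding I_def
  proof (rule integral_mono_AE)
    note [measurable] = process_measurable(2,5)[OF t m0]
    have "(\<lambda>\<omega>. v ?t (Suc 0) \<omega> - v ?t 0 \<omega>) \<in> borel_measurable M" by measurable
    then show "integrable M (\<lambda>\<omega>. (norm (v ?t 1 \<omega> - v ?t 0 \<omega>))\<^sup>2)"
      using ae_bounded_minus[OF process_bounded(5,2)[OF t m0]] unfolding One_nat_def by (intro integrable_norm_sq)
    show "integrable M (\<lambda>\<omega>. (1 - sqrt r)\<^sup>2 * (norm (v ?t 0 \<omega>))\<^sup>2)" using iv by simp
    show "AE \<omega> in M. (1 - sqrt r)\<^sup>2 * (norm (v ?t 0 \<omega>))\<^sup>2 \<le> (norm (v ?t 1 \<omega> - v ?t 0 \<omega>))\<^sup>2"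
      using AE_regular
    proof eventually_elim
      case (elim \<omega>)
      have "(norm (v ?t 1 \<omega>))\<^sup>2 \<le> r * (norm (v ?t 0 \<omega>))\<^sup>2" using elim t by (auto simp: regular_def)
      also have "\<dots> = (sqrt r * norm (v ?t 0 \<omega>))\<^sup>2" using r_pos by (simp add: power_mult_distrib)
      finally have "norm (v ?t 1 \<omega>) \<le> sqrt r * norm (v ?t 0 \<omega>)"
        by (rule power2_le_imp_le) (use r_pos in simp)
      moreover have "norm (v ?t 0 \<omega>) - norm (v ?t 1 \<omega>) \<le> norm (v ?t 1 \<omega> - v ?t 0 \<omega>)"
        using norm_triangle_ineq2[of "v ?t 0 \<omega>" "v ?t 1 \<omega>"] by (simp add: norm_minus_commute)
      ultimately have "(1 - sqrt r) * norm (v ?t 0 \<omega>) \<le> norm (v ?t 1 \<omega> - v ?t 0 \<omega>)" by (simp add: algebra_simps)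
      then have "((1 - sqrt r) * norm (v ?t 0 \<omega>))\<^sup>2 \<le> (norm (v ?t 1 \<omega> - v ?t 0 \<omega>))\<^sup>2"
        using r1 by (intro power_mono) auto
      then show ?case by (simp add: power_mult_distrib)
    qed
  qed
  then have "(1 - sqrt r)\<^sup>2 * V \<le> L\<^sup>2 * \<gamma>\<^sup>2 * Q"
    using estimator_increment_le[OF t] iv unfolding I_def V_def Q_def by simp
  also have "\<dots> \<le> (2 / \<eta>2)\<^sup>2 * Q"
  proof (rule mult_right_mono[OF _ nn(2)])
    have "L * \<gamma> \<le> 2 / \<eta>2" using slack_term_nonneg by (simp add: slack_term_def)
    then have "(L * \<gamma>)\<^sup>2 \<le> (2 / \<eta>2)\<^sup>2" using L \<gamma> by (intro power_mono) auto
    then show "L\<^sup>2 * \<gamma>\<^sup>2 \<le> (2 / \<eta>2)\<^sup>2" by (simp add: power_mult_distrib)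
  qed
  finally have "\<eta>2\<^sup>2 * ((1 - sqrt r)\<^sup>2 * V) \<le> \<eta>2\<^sup>2 * ((2 / \<eta>2)\<^sup>2 * Q)" by (intro mult_left_mono) auto
  also have "\<dots> = 4 * Q" using etas by (simp add: power_divide)
  finally have incr: "\<eta>2\<^sup>2 * ((1 - sqrt r)\<^sup>2 * V) \<le> 4 * Q" .
  have rr: "r\<^sup>2 \<le> ratio"
  proof -
    have p: "0 < (1 - r)\<^sup>2 * (1 + r)" using r_pos r1 by simp
    have "(1 - r) * (1 - r\<^sup>2) \<le> 1 * 1" using r_pos r1 one_minus_r_sq(1) by (intro mult_mono) auto
    then have "r\<^sup>2 * ((1 - r)\<^sup>2 * (1 + r)) \<le> r\<^sup>2 * 1" unfolding one_minus_r_sq(2) by (intro mult_left_mono) auto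
    then show ?thesis using p by (simp add: ratio_def le_divide_eq)
  qed
  have "2 * \<eta>1\<^sup>2 * X \<le> 2 * \<eta>2\<^sup>2 * (r * V)"
    using grad etas nn by (intro mult_mono mult_left_mono power_mono) auto
  also have "\<dots> = \<eta>2\<^sup>2 * V * (2 * r)" by simp
  also have "\<dots> \<le> \<eta>2\<^sup>2 * V * (17/2 * r\<^sup>2 + 1/2 * (1 - sqrt r)\<^sup>2)"
    using first_step_scalar[of r] r_pos nn by (intro mult_left_mono) auto
  also have "\<dots> = 17/2 * \<eta>2\<^sup>2 * (r\<^sup>2 * V) + 1/2 * (\<eta>2\<^sup>2 * ((1 - sqrt r)\<^sup>2 * V))" by (simp add: algebra_simps)
  also have "\<dots> \<le> (2 + 4 * \<eta>2\<^sup>2) * (ratio * (\<alpha> * V)) + 2 * Q"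
  proof -
    have "ratio * (1 * V) \<le> ratio * (\<alpha> * V)" using \<alpha>_pos nn ratio_pos by (intro mult_left_mono mult_right_mono) auto
    then have le: "r\<^sup>2 * V \<le> ratio * (\<alpha> * V)" using mult_right_mono[OF rr nn(1)] by linarith
    have "17/2 * \<eta>2\<^sup>2 * (r\<^sup>2 * V) \<le> (2 + 4 * \<eta>2\<^sup>2) * (ratio * (\<alpha> * V))"
      by (rule mult_mono[OF _ le]) (use eta2_sq nn in auto)
    then show ?thesis using incr by linarith
  qed
  finally have "2 * \<eta>1\<^sup>2 * X \<le> (2 + 4 * \<eta>2\<^sup>2) * (ratio * (\<alpha> * V)) + 2 * Q" .
  moreover have "0 \<le> slack_term * Q" using slack_term_nonneg nn by simp
  moreover have "(2 + 4 * \<eta>2\<^sup>2) * (ratio * (\<alpha> * V)) + R \<le> (\<integral>\<omega>. epoch_budget ?t \<omega> \<partial>M)"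
  proof -
    have "1 * R \<le> (1 + 2 * \<eta>2\<^sup>2) * R" using nn by (intro mult_right_mono) auto
    moreover have "0 \<le> (2 + 4 * \<eta>2\<^sup>2) * (r\<^sup>2 / (1 - r\<^sup>2) * (\<integral>\<omega>. excess ?t \<omega> \<partial>M))"
      using nn one_minus_r_sq(1) by (intro mult_nonneg_nonneg divide_nonneg_nonneg) auto
    ultimately show ?thesis unfolding epoch_budget_expectation[OF t] V_def R_def by linarith
  qed
  ultimately show ?thesis using descent unfolding X_def by linarith
qed

lemma gradient_expectation:
  assumes t: "Suc j \<in> {1..S}" and fin: "gap_after j = ereal \<Gamma>"
  shows "(real m + 1) * \<eta>1\<^sup>2 * (\<integral>\<omega>. (norm (g (w (Suc j) m \<omega>)))\<^sup>2 \<partial>M) \<le> 2 / \<gamma> * \<Gamma> + (\<integral>\<omega>. epoch_budget (Suc j) \<omega> \<partial>M)"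
proof (cases "m = 1")
  case True
  then show ?thesis using first_step_expectation[OF True t fin] by simp
next
  case False
  then have m: "2 \<le> m" using m1 by simp
  let ?U = "\<lambda>\<omega>. (real m + 1) * (\<eta>1 * norm (g (w (Suc j) m \<omega>)))\<^sup>2"
  have U: "integrable M ?U" using integrable_gradient[OF t, of m] by (simp add: power_mult_distrib)
  have "(\<integral>\<omega>. ?U \<omega> \<partial>M) \<le> 2 / \<gamma> * \<Gamma> + (\<integral>\<omega>. epoch_budget (Suc j) \<omega> \<partial>M)"
    by (rule epoch_expectation[OF t fin U, of 2 "4 * (real m + 1) * \<eta>2\<^sup>2"])
      (use pathwise_facts(4)[OF t] m eta2_sq in \<open>auto simp: algebra_simps\<close>)
  then show ?thesis by (simp add: power_mult_distrib mult.assoc)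
qed

section \<open>The recursion over the epochs\<close>
definition "\<xi> = ((2 + 4 * \<eta>2\<^sup>2) * \<alpha> * r\<^sup>2) / ((real m + 1) * \<eta>1\<^sup>2 * (1 - r)\<^sup>2 * (1 + r))"
definition "weight = ((1 - r)\<^sup>2 * (1 + r)) / (\<gamma> * \<alpha> * (1 + 2 * \<eta>2\<^sup>2) * r\<^sup>2)"
definition "offset p q = (1 - r) / \<alpha> * q + ((1 - r)\<^sup>2 * (1 + r)) / (2 * \<alpha> * r\<^sup>2) * p"

lemma \<xi>_pos: "0 < \<xi>"
  unfolding \<xi>_def using \<alpha>_pos r_pos r1 etas
  by (intro divide_pos_pos mult_pos_pos) (auto simp: add_pos_nonneg)

lemma weight_pos: "0 < weight"
  unfolding weight_def using \<alpha>_pos r_pos r1 \<gamma>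
  by (intro divide_pos_pos mult_pos_pos) (auto simp: add_pos_nonneg)

lemma offset_nonneg: "0 \<le> p \<Longrightarrow> 0 \<le> q \<Longrightarrow> 0 \<le> offset p q"
  unfolding offset_def using \<alpha>_pos r_pos r1
  by (intro add_nonneg_nonneg mult_nonneg_nonneg divide_nonneg_nonneg) auto

lemma \<xi>_ratio: "(real m + 1) * \<eta>1\<^sup>2 * \<xi> = (2 + 4 * \<eta>2\<^sup>2) * (ratio * \<alpha>)"
proof -
  have "A * ((P * \<alpha> * R2) / (A * K1 * K2)) = P * (R2 / (K1 * K2) * \<alpha>)" if "A \<noteq> 0" for A P R2 K1 K2 :: real
    using that by simp
  from this[of "(real m + 1) * \<eta>1\<^sup>2" "2 + 4 * \<eta>2\<^sup>2" "r\<^sup>2" "(1 - r)\<^sup>2" "1 + r"] etas show ?thesis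
    unfolding \<xi>_def ratio_def by simp
qed

text \<open>The length condition for large ratios is a consequence of \<open>\<xi> < 1\<close>, as
  \<open>2 + 4 \<eta>2\<^sup>2 \<ge> 17/2 \<eta>2\<^sup>2\<close> and \<open>\<alpha> \<ge> 1\<close>.\<close>

lemma long_epoch:
  assumes "\<xi> < 1"
  shows "17/2 * ratio \<le> real m + 1"
proof -
  have e: "\<eta>1\<^sup>2 \<le> \<eta>2\<^sup>2" using etas by (intro power_mono) auto
  have A: "0 < (real m + 1) * \<eta>1\<^sup>2" using etas by simp
  have "ratio * 1 \<le> ratio * \<alpha>" using \<alpha>_pos ratio_pos by (intro mult_left_mono) auto
  then have "17/2 * \<eta>1\<^sup>2 * ratio \<le> (2 + 4 * \<eta>2\<^sup>2) * (ratio * \<alpha>)"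
    using eta2_sq e ratio_pos by (intro mult_mono) auto
  also have "\<dots> \<le> (real m + 1) * \<eta>1\<^sup>2 * 1"
    unfolding \<xi>_ratio[symmetric] using assms A by (intro mult_left_mono) auto
  finally have "\<eta>1\<^sup>2 * (17/2 * ratio) \<le> \<eta>1\<^sup>2 * (real m + 1)" by (simp add: mult_ac)
  then show ?thesis using etas by (simp add: mult_le_cancel_left_pos)
qed

text \<open>The constants \<open>\<xi>\<close>, \<open>\<delta>\<close> and \<open>C\<close> are made so that the right-hand side of the epoch bounds is exactly
  \<open>(m + 1) \<eta>1\<^sup>2 \<xi>\<close> times the sum of \<open>\<delta>\<close>, \<open>C\<close> and the squared initial gradient.\<close>

lemma budget_identity:
  "(real m + 1) * \<eta>1\<^sup>2 * (\<xi> * (weight * \<Gamma> + offset p q + V))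
    = 2 / \<gamma> * \<Gamma> + ((2 + 4 * \<eta>2\<^sup>2) * (ratio * (\<alpha> * V)) + (1 + 2 * \<eta>2\<^sup>2) * p + (2 + 4 * \<eta>2\<^sup>2) * (r\<^sup>2 / (1 - r\<^sup>2) * q))"
proof -
  define H where "H = 1 + 2 * \<eta>2\<^sup>2"
  define s where "s = 1 - r\<^sup>2"
  define u where "u = 1 - r"
  have H: "0 < H" "2 + 4 * \<eta>2\<^sup>2 = 2 * H" by (auto simp: H_def add_pos_nonneg)
  have s: "0 < s" "(1 - r)\<^sup>2 * (1 + r) = u * s" using one_minus_r_sq by (auto simp: s_def u_def)
  have u: "0 < u" using r1 by (simp add: u_def)
  have a: "0 < \<alpha>" using \<alpha>_pos by simp
  have parts: "weight = u * s / (\<gamma> * \<alpha> * H * r\<^sup>2)" "offset p q = u / \<alpha> * q + u * s / (2 * \<alpha> * r\<^sup>2) * p"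
    "ratio = r\<^sup>2 / (u * s)"
    unfolding weight_def offset_def ratio_def s(2) H_def unfolding u_def by simp_all
  have "(real m + 1) * \<eta>1\<^sup>2 * (\<xi> * (weight * \<Gamma> + offset p q + V))
      = ((real m + 1) * \<eta>1\<^sup>2 * \<xi>) * (weight * \<Gamma> + offset p q + V)" by (simp only: mult.assoc)
  also have "\<dots> = 2 * H * (r\<^sup>2 / (u * s) * \<alpha>) * (u * s / (\<gamma> * \<alpha> * H * r\<^sup>2) * \<Gamma> + (u / \<alpha> * q + u * s / (2 * \<alpha> * r\<^sup>2) * p) + V)"
    unfolding \<xi>_ratio H(2) parts ..
  also have "\<dots> = 2 / \<gamma> * \<Gamma> + (2 * H * (r\<^sup>2 / (u * s) * (\<alpha> * V)) + H * p + 2 * H * (r\<^sup>2 / s * q))"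
    using H(1) s(1) u a r_pos \<gamma>(1) by (simp add: field_simps)
  finally show ?thesis unfolding parts(3) H(2) H_def[symmetric] s_def[symmetric] .
qed

lemma recursion_step:
  assumes t: "Suc j \<in> {1..S}"
    and p: "(\<integral>\<omega>. (norm (v (Suc j) 0 \<omega> + d (Suc j) 0 \<omega>))\<^sup>2 \<partial>M) \<le> p" and q: "(\<integral>\<omega>. excess (Suc j) \<omega> \<partial>M) \<le> q"
    and X: "(real m + 1) * \<eta>1\<^sup>2 * X \<le> 2 / \<gamma> * \<Gamma> + (\<integral>\<omega>. epoch_budget (Suc j) \<omega> \<partial>M)"
  shows "X \<le> \<xi> * (weight * \<Gamma> + offset p q + (\<integral>\<omega>. (norm (v (Suc j) 0 \<omega>))\<^sup>2 \<partial>M))"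
proof -
  let ?V = "\<integral>\<omega>. (norm (v (Suc j) 0 \<omega>))\<^sup>2 \<partial>M"
  have A: "0 < (real m + 1) * \<eta>1\<^sup>2" using etas by simp
  have "(1 + 2 * \<eta>2\<^sup>2) * (\<integral>\<omega>. (norm (v (Suc j) 0 \<omega> + d (Suc j) 0 \<omega>))\<^sup>2 \<partial>M) \<le> (1 + 2 * \<eta>2\<^sup>2) * p"
    using p by (intro mult_left_mono) (auto simp: add_nonneg_nonneg)
  moreover have "(2 + 4 * \<eta>2\<^sup>2) * (r\<^sup>2 / (1 - r\<^sup>2) * (\<integral>\<omega>. excess (Suc j) \<omega> \<partial>M)) \<le> (2 + 4 * \<eta>2\<^sup>2) * (r\<^sup>2 / (1 - r\<^sup>2) * q)"
    using q one_minus_r_sq(1) by (intro mult_left_mono) (auto simp: add_nonneg_nonneg)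
  ultimately have "(real m + 1) * \<eta>1\<^sup>2 * X \<le> (real m + 1) * \<eta>1\<^sup>2 * (\<xi> * (weight * \<Gamma> + offset p q + ?V))"
    unfolding budget_identity using X unfolding epoch_budget_expectation[OF t] by linarith
  then show ?thesis using A by (simp only: mult_le_cancel_left_pos)
qed

definition "H j = (\<integral>\<omega>. (norm (g (outer_iterate w0 m w j \<omega>)))\<^sup>2 \<partial>M)"

lemma H_0: "H 0 = (norm (g w0))\<^sup>2"
  by (simp add: H_def outer_iterate_def prob_space)

lemma H_start: "Suc j \<in> {1..S} \<Longrightarrow> H j = (\<integral>\<omega>. (norm (v (Suc j) 0 \<omega>))\<^sup>2 \<partial>M)"
  unfolding H_def by (intro Bochner_Integration.integral_cong) (auto simp: v_start w_0)

text \<open>\<open>\<Delta>\<close> is the fixed point of \<open>h \<mapsto> \<xi> (\<delta> + offset p q + h)\<close>, so the distance to it contracts by \<open>\<xi>\<close> in each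
  epoch.\<close>

lemma linear_convergence:
  assumes s: "s \<in> {1..S}" and \<xi>1: "\<xi> < 1" and pq: "0 \<le> p" "0 \<le> q"
    and p: "\<And>t. t \<in> {1..S} \<Longrightarrow> (\<integral>\<omega>. (norm (v t 0 \<omega> + d t 0 \<omega>))\<^sup>2 \<partial>M) \<le> p"
    and q: "\<And>t. t \<in> {1..S} \<Longrightarrow> (\<integral>\<omega>. excess t \<omega> \<partial>M) \<le> q"
    and fin: "\<And>j. j < s \<Longrightarrow> gap_after j = ereal (\<Gamma> j)" and \<delta>: "\<And>j. j < s \<Longrightarrow> weight * \<Gamma> j \<le> \<delta>"
  defines "\<Delta> \<equiv> \<xi> * (\<delta> + offset p q) / (1 - \<xi>)"
  shows "(\<integral>\<omega>. (norm (mapping s \<omega>))\<^sup>2 \<partial>M) - \<Delta> \<le> \<xi> ^ s * ((norm (g w0))\<^sup>2 - \<Delta>)" and "0 \<le> \<Delta>"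
proof -
  have "0 \<le> \<Gamma> 0"
  proof (rule expectation_le(2)[of 0 "\<Gamma> 0" "\<lambda>_. 0"])
    show "0 \<le> start_gap (Suc 0) \<omega>" if "w (Suc 0) 0 \<omega> \<in> dom" for \<omega>
      unfolding start_gap_def using Pmin_le[OF that] \<gamma> by (intro mult_nonneg_nonneg) auto
  qed (use fin[of 0] s in auto)
  then have "0 \<le> weight * \<Gamma> 0" using weight_pos by simp
  then have "0 \<le> \<delta>" using \<delta>[of 0] s by simp
  then show "0 \<le> \<Delta>" unfolding \<Delta>_def using offset_nonneg[OF pq] \<xi>_pos \<xi>1
    by (intro divide_nonneg_nonneg mult_nonneg_nonneg) auto
  have D: "\<xi> * (\<delta> + offset p q) = (1 - \<xi>) * \<Delta>" using \<xi>1 by (simp add: \<Delta>_def)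
  have step: "X - \<Delta> \<le> \<xi> * (H j - \<Delta>)"
    if j: "j < s" and X: "(real m + 1) * \<eta>1\<^sup>2 * X \<le> 2 / \<gamma> * \<Gamma> j + (\<integral>\<omega>. epoch_budget (Suc j) \<omega> \<partial>M)" for j X
  proof -
    have t: "Suc j \<in> {1..S}" using j s by auto
    have "X \<le> \<xi> * (weight * \<Gamma> j + offset p q + H j)"
      unfolding H_start[OF t] by (rule recursion_step[OF t p[OF t] q[OF t] X])
    also have "\<dots> \<le> \<xi> * (\<delta> + offset p q + H j)" using \<delta>[OF j] \<xi>_pos by (intro mult_left_mono) auto
    also have "\<dots> = (1 - \<xi>) * \<Delta> + \<xi> * H j" unfolding D[symmetric] by (simp add: algebra_simps)
    finally show ?thesis by (simp add: algebra_simps)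
  qed
  have outer: "H j - \<Delta> \<le> \<xi> ^ j * (H 0 - \<Delta>)" if "j < s" for j
    using that
  proof (induction j)
    case (Suc j)
    then have j: "j < s" "Suc j \<in> {1..S}" using s by auto
    have "H (Suc j) = (\<integral>\<omega>. (norm (g (w (Suc j) m \<omega>)))\<^sup>2 \<partial>M)" by (simp add: H_def outer_iterate_def)
    then have "H (Suc j) - \<Delta> \<le> \<xi> * (H j - \<Delta>)"
      using step[OF j(1)] gradient_expectation[OF j(2) fin[OF j(1)]] by simp
    also have "\<dots> \<le> \<xi> * (\<xi> ^ j * (H 0 - \<Delta>))" using Suc.IH j(1) \<xi>_pos by (intro mult_left_mono) auto
    finally show ?case by simp
  qed simp
  obtain j where sj: "s = Suc j" using s by (cases s) auto
  have j: "j < s" "Suc j \<in> {1..S}" using s sj by auto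
  have "(\<integral>\<omega>. (norm (mapping s \<omega>))\<^sup>2 \<partial>M) - \<Delta> \<le> \<xi> * (H j - \<Delta>)"
    unfolding sj by (rule step[OF j(1)]) (rule mapping_expectation[OF j(2) fin[OF j(1)] long_epoch[OF \<xi>1]])
  also have "\<dots> \<le> \<xi> * (\<xi> ^ j * (H 0 - \<Delta>))" using outer[OF j(1)] \<xi>_pos by (intro mult_left_mono) auto
  finally show "(\<integral>\<omega>. (norm (mapping s \<omega>))\<^sup>2 \<partial>M) - \<Delta> \<le> \<xi> ^ s * ((norm (g w0))\<^sup>2 - \<Delta>)"
    unfolding H_0 sj by simp
qed

text \<open>If some expected gap is infinite, then so is \<open>\<Delta>\<close> and both claims are trivial.\<close>

lemma extended_linear_convergence:
  fixes \<delta> :: ereal and \<delta>seq :: "nat \<Rightarrow> ereal"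
  assumes s: "s \<in> {1..S}" and \<xi>1: "\<xi> < 1" and pq: "0 \<le> p" "0 \<le> q"
    and p: "\<And>t. t \<in> {1..S} \<Longrightarrow> (\<integral>\<omega>. (norm (v t 0 \<omega> + d t 0 \<omega>))\<^sup>2 \<partial>M) \<le> p"
    and q: "\<And>t. t \<in> {1..S} \<Longrightarrow> (\<integral>\<omega>. excess t \<omega> \<partial>M) \<le> q"
    and \<delta>seq: "\<And>k. \<delta>seq k = ereal weight * gap_after k" and \<delta>: "\<delta> = (MAX k\<in>{0..s - 1}. \<delta>seq k)"
    and EG: "EG = (\<integral>\<omega>. (norm (mapping s \<omega>))\<^sup>2 \<partial>M)"
    and \<Delta>: "\<Delta> = ereal \<xi> * (\<delta> + ereal (offset p q)) / ereal (1 - \<xi>)" and g0: "g0 = (norm (g w0))\<^sup>2"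
  shows "ereal EG - \<Delta> \<le> ereal (\<xi> ^ s) * (ereal g0 - \<Delta>) \<and> max 0 (ereal EG - \<Delta>) \<le> ereal (g0 * \<xi> ^ s)"
proof (cases "\<exists>k<s. gap_after k = \<infinity>")
  case True
  then obtain k where k: "k < s" "gap_after k = \<infinity>" by blast
  have "\<delta>seq k = \<infinity>" using k weight_pos by (simp add: \<delta>seq)
  moreover have "\<delta>seq k \<le> \<delta>" unfolding \<delta> using k by (intro Max_ge) auto
  ultimately have "\<delta> = \<infinity>" by simp
  then have "\<Delta> = \<infinity>" using \<Delta> \<xi>_pos \<xi>1 by simp
  then show ?thesis using \<xi>_pos by (simp add: g0)
next
  case False
  define \<Gamma> where "\<Gamma> k = real_of_ereal (gap_after k)" for k
  have fin: "gap_after k = ereal (\<Gamma> k)" if "k < s" for k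
  proof -
    have "0 \<le> gap_after k" by (simp add: expected_gap_def)
    then show ?thesis using False that unfolding \<Gamma>_def by (cases "gap_after k") auto
  qed
  have "\<delta> \<in> \<delta>seq ` {0..s - 1}" unfolding \<delta> by (rule Max_in) auto
  then obtain l where l: "l \<le> s - 1" "\<delta> = \<delta>seq l" by auto
  have ls: "l < s" using l s by auto
  have \<delta>r: "\<delta> = ereal (weight * \<Gamma> l)" using l fin[OF ls] by (simp add: \<delta>seq)
  have le: "weight * \<Gamma> j \<le> weight * \<Gamma> l" if j: "j < s" for j
  proof -
    have "\<delta>seq j \<le> \<delta>" unfolding \<delta> using j by (intro Max_ge) auto
    then show ?thesis unfolding \<delta>r \<delta>seq fin[OF j] by simp
  qed
  define D where "D = \<xi> * (weight * \<Gamma> l + offset p q) / (1 - \<xi>)"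
  have D: "\<Delta> = ereal D" using \<xi>1 unfolding \<Delta> \<delta>r D_def by simp
  note conv = linear_convergence[OF s \<xi>1 pq p q fin le, folded D_def EG]
  have "0 \<le> \<xi> ^ s * D" using conv(2) \<xi>_pos by simp
  then have "EG - D \<le> g0 * \<xi> ^ s" using conv(1) by (simp add: g0 algebra_simps)
  moreover have "0 \<le> g0 * \<xi> ^ s" using \<xi>_pos by (simp add: g0)
  ultimately show ?thesis using conv(1) unfolding D by (simp add: g0)
qed

text \<open>For \<open>d 0 = - h\<close> with the last estimator \<open>h\<close> of the previous epoch, the residual is the error of that
  estimator at the common point \<open>w m = w 0\<close>, and the excess compares the squares of the same two
  vectors. In the first epoch \<open>h\<close> is exact.\<close>

lemma stale_direction_residual:
  assumes d0: "\<And>t \<omega>. t \<in> {1..S} \<Longrightarrow> \<omega> \<in> space M \<Longrightarrow> d t 0 \<omega> = - last_estimator n f w0 m v (t - 1) \<omega>"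
    and nonneg: "0 \<le> p" "0 \<le> q"
    and p: "\<And>t. t \<in> {1..S} \<Longrightarrow> (\<integral>\<omega>. (norm (v t m \<omega> - g (w t m \<omega>)))\<^sup>2 \<partial>M) \<le> p"
    and q: "\<And>t. t \<in> {1..S} \<Longrightarrow> (\<integral>\<omega>. \<bar>(norm (v t m \<omega>))\<^sup>2 - (norm (g (w t m \<omega>)))\<^sup>2\<bar> \<partial>M) \<le> q"
    and t: "t \<in> {1..S}"
  shows "(\<integral>\<omega>. (norm (v t 0 \<omega> + d t 0 \<omega>))\<^sup>2 \<partial>M) \<le> p" and "(\<integral>\<omega>. excess t \<omega> \<partial>M) \<le> q"
proof -
  obtain j where tj: "t = Suc j" using t by (cases t) auto
  show "(\<integral>\<omega>. (norm (v t 0 \<omega> + d t 0 \<omega>))\<^sup>2 \<partial>M) \<le> p"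
  proof (cases "j = 0")
    case True
    then have t1: "t = Suc 0" using tj by simp
    note t' = t[unfolded t1]
    have "(\<integral>\<omega>. (norm (v t 0 \<omega> + d t 0 \<omega>))\<^sup>2 \<partial>M) = (\<integral>\<omega>. 0 \<partial>M)"
      unfolding t1 by (intro Bochner_Integration.integral_cong)
        (auto simp: v_start[OF t'] w_0[OF t'] d0[OF t'] last_estimator_def outer_iterate_def g_def fbar_def)
    then show ?thesis using nonneg by simp
  next
    case False
    note t' = t[unfolded tj]
    have j: "j \<in> {1..S}" using False t tj by auto
    have "(\<integral>\<omega>. (norm (v t 0 \<omega> + d t 0 \<omega>))\<^sup>2 \<partial>M) = (\<integral>\<omega>. (norm (v j m \<omega> - g (w j m \<omega>)))\<^sup>2 \<partial>M)"
      using False by (intro Bochner_Integration.integral_cong)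
        (auto simp: v_start[OF t'] w_0[OF t'] d0[OF t'] tj last_estimator_def outer_iterate_def norm_minus_commute)
    then show ?thesis using p[OF j] by simp
  qed
  show "(\<integral>\<omega>. excess t \<omega> \<partial>M) \<le> q"
  proof (cases "j = 0")
    case True
    then have t1: "t = Suc 0" using tj by simp
    note t' = t[unfolded t1]
    have "(\<integral>\<omega>. excess t \<omega> \<partial>M) = (\<integral>\<omega>. 0 \<partial>M)"
      unfolding t1 by (intro Bochner_Integration.integral_cong)
        (auto simp: excess_def v_start[OF t'] w_0[OF t'] d0[OF t'] last_estimator_def outer_iterate_def g_def fbar_def)
    then show ?thesis using nonneg by simp
  next
    case False
    note t' = t[unfolded tj]
    have j: "j \<in> {1..S}" using False t tj by auto
    have "(\<integral>\<omega>. excess t \<omega> \<partial>M) \<le> (\<integral>\<omega>. \<bar>(norm (v j m \<omega>))\<^sup>2 - (norm (g (w j m \<omega>)))\<^sup>2\<bar> \<partial>M)"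
    proof (rule integral_mono)
      show "integrable M (excess t)" by (rule integrable_excess[OF t])
      show "integrable M (\<lambda>\<omega>. \<bar>(norm (v j m \<omega>))\<^sup>2 - (norm (g (w j m \<omega>)))\<^sup>2\<bar>)"
        using integrable_v[OF j, of m] integrable_gradient[OF j, of m]
        by (intro integrable_abs Bochner_Integration.integrable_diff) auto
      show "excess t \<omega> \<le> \<bar>(norm (v j m \<omega>))\<^sup>2 - (norm (g (w j m \<omega>)))\<^sup>2\<bar>" if "\<omega> \<in> space M" for \<omega>
        using that False by (simp add: excess_def v_start[OF t'] w_0[OF t'] d0[OF t'] tj last_estimator_def outer_iterate_def)
    qed
    then show ?thesis using q[OF j] by linarith
  qed
qed

lemma fresh_direction_residual:
  assumes d0: "\<And>t \<omega>. t \<in> {1..S} \<Longrightarrow> \<omega> \<in> space M \<Longrightarrow> d t 0 \<omega> = - v t 0 \<omega>" and t: "t \<in> {1..S}"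
  shows "(\<integral>\<omega>. (norm (v t 0 \<omega> + d t 0 \<omega>))\<^sup>2 \<partial>M) \<le> 0" and "(\<integral>\<omega>. excess t \<omega> \<partial>M) \<le> 0"
proof -
  have "(\<integral>\<omega>. (norm (v t 0 \<omega> + d t 0 \<omega>))\<^sup>2 \<partial>M) = (\<integral>\<omega>. 0 \<partial>M)" "(\<integral>\<omega>. excess t \<omega> \<partial>M) = (\<integral>\<omega>. 0 \<partial>M)"
    by (intro Bochner_Integration.integral_cong; simp add: excess_def d0[OF t])+
  then show "(\<integral>\<omega>. (norm (v t 0 \<omega> + d t 0 \<omega>))\<^sup>2 \<partial>M) \<le> 0" "(\<integral>\<omega>. excess t \<omega> \<partial>M) \<le> 0" by simp_all
qed

end

theorem theorem2:
  fixes M :: "'w measure" and F :: "nat \<Rightarrow> nat \<Rightarrow> 'w measure"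
    and f :: "nat \<Rightarrow> 'a::euclidean_space \<Rightarrow> real" and \<phi> :: "'a \<Rightarrow> ereal"
    and w0 wopt :: 'a and n m b S s :: nat
    and \<gamma> \<eta>1 \<eta>2 c1 c2 L \<beta>hat \<alpha> \<sigma> \<tau> \<xi> C :: real
    and \<delta> :: ereal and \<delta>seq :: "nat \<Rightarrow> ereal" and EG :: real
    and B :: "nat \<Rightarrow> nat \<Rightarrow> 'w \<Rightarrow> nat set"
    and \<theta> \<beta> :: "nat \<Rightarrow> nat \<Rightarrow> 'w \<Rightarrow> real"
    and w v d :: "nat \<Rightarrow> nat \<Rightarrow> 'w \<Rightarrow> 'a"
  assumes "\<And>i x. i \<in> {1..n} \<Longrightarrow> f i differentiable (at x)"
    and "proper_fun \<phi>" and "closed (ereal_epigraph \<phi>)" and "convex (ereal_epigraph \<phi>)"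
    and "\<exists>l::real. \<forall>x. ereal l \<le> objective n f \<phi> x"
    and "\<And>x. is_arg_min (objective n f \<phi>) (\<lambda>_. True) x \<longleftrightarrow> x = wopt"
    and "2 \<le> n" and "1 \<le> b" and "b \<le> n" and "1 \<le> m" and "0 < \<gamma>" and "\<gamma> \<le> 1"
    and "0 < c1" and "c1 < c2" and "c2 < 1" and "0 < \<eta>1" and "\<eta>1 \<le> \<eta>2"
    and assumption1: "0 < L"
      "\<And>x y. (1 / real n) * (\<Sum>i\<in>{1..n}. (norm (gradient (f i) x - gradient (f i) y))\<^sup>2)
               \<le> L\<^sup>2 * (norm (x - y))\<^sup>2"
    and assumption2: "\<beta>hat < 1"
      "AE \<omega> in M. \<forall>t\<in>{1..S}. \<forall>k\<le>m.
         v t k \<omega> \<noteq> 0 \<and> (norm (v t (Suc k) \<omega>))\<^sup>2 / (norm (v t k \<omega>))\<^sup>2 \<le> \<beta>hat"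
    and "1 < \<alpha>" and "(1 + c2) / (1 - c2) \<le> \<alpha>"
    and "\<And>t k \<omega>. \<lbrakk>t \<in> {1..S}; k \<le> m; \<omega> \<in> space M\<rbrakk> \<Longrightarrow> \<theta> t k \<omega> \<in> {\<eta>1, \<eta>2}"
    and "(2 + 4 * \<eta>2\<^sup>2) * ((real n - real b) / (real b * (real n - 1))) * L\<^sup>2 * \<gamma>\<^sup>2 * real m
           - (2 / \<eta>2 - L * \<gamma> - 3) \<le> 0"
    and "\<xi> = ((2 + 4 * \<eta>2\<^sup>2) * \<alpha> * \<beta>hat\<^sup>2)
               / ((real m + 1) * \<eta>1\<^sup>2 * (1 - \<beta>hat)\<^sup>2 * (1 + \<beta>hat))"
    and "C = ((1 - \<beta>hat) / \<alpha> * \<tau> + ((1 - \<beta>hat)\<^sup>2 * (1 + \<beta>hat)) / (2 * \<alpha> * \<beta>hat\<^sup>2)) * \<sigma>\<^sup>2"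
    and "\<xi> < 1" and "s \<in> {1..S}"
    and "\<And>k. \<delta>seq k =
           ereal (((1 - \<beta>hat)\<^sup>2 * (1 + \<beta>hat)) / (\<gamma> * \<alpha> * (1 + 2 * \<eta>2\<^sup>2) * \<beta>hat\<^sup>2))
             * expected_gap M (objective n f \<phi>) (outer_iterate w0 m w k) wopt"
    and "\<delta> = (MAX k\<in>{0..s - 1}. \<delta>seq k)"
    and "EG = (\<integral>\<omega>. (norm (gradient_mapping n f \<phi> (min (\<theta> s m \<omega>) \<eta>2)
                              (outer_iterate w0 m w s \<omega>)))\<^sup>2 \<partial>M)"
  shows
    "(prox_cg_algorithm1 M F n f \<phi> w0 m b S \<gamma> \<eta>2 c1 c2 B \<theta> \<beta> w v d
        \<and> 0 < \<sigma>
        \<and> (\<forall>t\<in>{1..S}. \<forall>k\<le>Suc m.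
             (\<integral>\<omega>. (norm (v t k \<omega> - gradient (avg_fun f {1..n}) (w t k \<omega>)))\<^sup>2 \<partial>M) \<le> \<sigma>\<^sup>2)
        \<and> 0 < \<tau>
        \<and> (\<forall>t\<in>{1..S}. \<forall>k\<le>Suc m.
             (\<integral>\<omega>. \<bar>(norm (v t k \<omega>))\<^sup>2 - (norm (gradient (avg_fun f {1..n}) (w t k \<omega>)))\<^sup>2\<bar> \<partial>M)
               \<le> \<tau> * \<sigma>\<^sup>2)
      \<longrightarrow> (let \<Delta> = ereal \<xi> * (\<delta> + ereal C) / ereal (1 - \<xi>);
               g0 = (norm (gradient (avg_fun f {1..n}) w0))\<^sup>2
           in ereal EG - \<Delta> \<le> ereal (\<xi> ^ s) * (ereal g0 - \<Delta>)
              \<and> max 0 (ereal EG - \<Delta>) \<le> ereal (g0 * \<xi> ^ s)))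
   \<and> (prox_cg_algorithm2 M F n f \<phi> w0 m b S \<gamma> \<eta>2 c1 c2 B \<theta> \<beta> w v d
      \<longrightarrow> (let \<Delta> = ereal \<xi> * \<delta> / ereal (1 - \<xi>);
               g0 = (norm (gradient (avg_fun f {1..n}) w0))\<^sup>2
           in ereal EG - \<Delta> \<le> ereal (\<xi> ^ s) * (ereal g0 - \<Delta>)
              \<and> max 0 (ereal EG - \<Delta>) \<le> ereal (g0 * \<xi> ^ s)))"
proof (intro conjI impI)
  have analysis: "prox_cg_analysis M F n f \<phi> w0 m b S \<gamma> \<eta>2 c1 c2 B \<theta> \<beta> w v d wopt \<eta>1 L \<beta>hat \<alpha>"
    if "prox_cg M F n f \<phi> w0 m b S \<gamma> \<eta>2 c1 c2 B \<theta> \<beta> w v d"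
      and "\<And>t. t \<in> {1..S} \<Longrightarrow> (\<forall>\<omega>\<in>space M. d t 0 \<omega> = - v t 0 \<omega>)
        \<or> (\<forall>\<omega>\<in>space M. d t 0 \<omega> = - last_estimator n f w0 m v (t - 1) \<omega>)"
  proof (intro prox_cg_analysis.intro that(1) prox_cg_analysis_axioms.intro)
    show "is_arg_min (objective n f \<phi>) (\<lambda>_. True) wopt" using assms(6) by blast
    show "1 \<le> S" using assms(29) by auto
    show "0 < c2" using assms(13,14) by linarith
  qed (use that(2) assms in blast)+
  show "let \<Delta> = ereal \<xi> * (\<delta> + ereal C) / ereal (1 - \<xi>); g0 = (norm (gradient (avg_fun f {1..n}) w0))\<^sup>2
    in ereal EG - \<Delta> \<le> ereal (\<xi> ^ s) * (ereal g0 - \<Delta>) \<and> max 0 (ereal EG - \<Delta>) \<le> ereal (g0 * \<xi> ^ s)"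
    if alg: "prox_cg_algorithm1 M F n f \<phi> w0 m b S \<gamma> \<eta>2 c1 c2 B \<theta> \<beta> w v d
        \<and> 0 < \<sigma>
        \<and> (\<forall>t\<in>{1..S}. \<forall>k\<le>Suc m.
             (\<integral>\<omega>. (norm (v t k \<omega> - gradient (avg_fun f {1..n}) (w t k \<omega>)))\<^sup>2 \<partial>M) \<le> \<sigma>\<^sup>2)
        \<and> 0 < \<tau>
        \<and> (\<forall>t\<in>{1..S}. \<forall>k\<le>Suc m.
             (\<integral>\<omega>. \<bar>(norm (v t k \<omega>))\<^sup>2 - (norm (gradient (avg_fun f {1..n}) (w t k \<omega>)))\<^sup>2\<bar> \<partial>M)
               \<le> \<tau> * \<sigma>\<^sup>2)"
  proof -
    have loc: "prox_cg_algorithm1 M F n f \<phi> w0 m b S \<gamma> \<eta>2 c1 c2 B \<theta> \<beta> w v d" using alg by blast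
    note d0 = prox_cg_algorithm1.d_0[OF loc]
    interpret prox_cg_analysis M F n f \<phi> w0 m b S \<gamma> \<eta>2 c1 c2 B \<theta> \<beta> w v d wopt \<eta>1 L \<beta>hat \<alpha>
      by (rule analysis[OF prox_cg_algorithm1.axioms(1)[OF loc]]) (use d0 in blast)
    have nonneg: "0 \<le> \<sigma>\<^sup>2" "0 \<le> \<tau> * \<sigma>\<^sup>2" using alg by auto
    have p: "(\<integral>\<omega>. (norm (v t m \<omega> - g (w t m \<omega>)))\<^sup>2 \<partial>M) \<le> \<sigma>\<^sup>2"
      and q: "(\<integral>\<omega>. \<bar>(norm (v t m \<omega>))\<^sup>2 - (norm (g (w t m \<omega>)))\<^sup>2\<bar> \<partial>M) \<le> \<tau> * \<sigma>\<^sup>2" if "t \<in> {1..S}" for t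
      using alg that unfolding g_def fbar_def by auto
    have C: "C = offset (\<sigma>\<^sup>2) (\<tau> * \<sigma>\<^sup>2)" unfolding assms(27) offset_def by (simp add: algebra_simps)
    have EG: "EG = (\<integral>\<omega>. (norm (mapping s \<omega>))\<^sup>2 \<partial>M)"
      unfolding assms(32) using assms(29)
      by (simp add: mapping_def gradient_mapping_def eta_def outer_iterate_def g_def fbar_def)
    have \<xi>': "\<xi> = prox_cg_analysis.\<xi> m \<eta>2 \<eta>1 \<beta>hat \<alpha>" unfolding assms(26) \<xi>_def ..
    show ?thesis
      unfolding Let_def C \<xi>' fbar_def[symmetric] g_def[symmetric]
      using extended_linear_convergence[OF assms(29) _ nonneg stale_direction_residual(1)[OF d0 nonneg p q]
          stale_direction_residual(2)[OF d0 nonneg p q] assms(30)[folded weight_def] assms(31) EG refl refl]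
        assms(28)[unfolded \<xi>'] by blast
  qed
  show "let \<Delta> = ereal \<xi> * \<delta> / ereal (1 - \<xi>); g0 = (norm (gradient (avg_fun f {1..n}) w0))\<^sup>2
    in ereal EG - \<Delta> \<le> ereal (\<xi> ^ s) * (ereal g0 - \<Delta>) \<and> max 0 (ereal EG - \<Delta>) \<le> ereal (g0 * \<xi> ^ s)"
    if loc: "prox_cg_algorithm2 M F n f \<phi> w0 m b S \<gamma> \<eta>2 c1 c2 B \<theta> \<beta> w v d"
  proof -
    note d0 = prox_cg_algorithm2.d_0[OF loc]
    interpret prox_cg_analysis M F n f \<phi> w0 m b S \<gamma> \<eta>2 c1 c2 B \<theta> \<beta> w v d wopt \<eta>1 L \<beta>hat \<alpha>
      by (rule analysis[OF prox_cg_algorithm2.axioms(1)[OF loc]]) (use d0 in blast)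
    have zero: "offset 0 0 = 0" by (simp add: offset_def)
    have EG: "EG = (\<integral>\<omega>. (norm (mapping s \<omega>))\<^sup>2 \<partial>M)"
      unfolding assms(32) using assms(29)
      by (simp add: mapping_def gradient_mapping_def eta_def outer_iterate_def g_def fbar_def)
    have \<xi>': "\<xi> = prox_cg_analysis.\<xi> m \<eta>2 \<eta>1 \<beta>hat \<alpha>" unfolding assms(26) \<xi>_def ..
    have \<Delta>: "ereal (prox_cg_analysis.\<xi> m \<eta>2 \<eta>1 \<beta>hat \<alpha>) * \<delta> / ereal (1 - prox_cg_analysis.\<xi> m \<eta>2 \<eta>1 \<beta>hat \<alpha>)
      = ereal (prox_cg_analysis.\<xi> m \<eta>2 \<eta>1 \<beta>hat \<alpha>) * (\<delta> + ereal (offset 0 0)) / ereal (1 - prox_cg_analysis.\<xi> m \<eta>2 \<eta>1 \<beta>hat \<alpha>)"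
      by (simp add: zero zero_ereal_def[symmetric])
    show ?thesis
      unfolding Let_def \<xi>' fbar_def[symmetric] g_def[symmetric]
      using extended_linear_convergence[OF assms(29) _ order_refl order_refl fresh_direction_residual(1)[OF d0]
          fresh_direction_residual(2)[OF d0] assms(30)[folded weight_def] assms(31) EG \<Delta> refl]
        assms(28)[unfolded \<xi>'] by blast
  qed
qed

end
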